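(* Suppose that $\hat{\mathbf f}$ is an entropy stable directional numerical flux for $U$. Then every solution $\mathbf u(\cdot,t)\in(\mathbb V^k_d)^m$ of Scheme B'' satisfies the local semi-discrete entropy inequality $$\frac{d}{dt}\int_KU(\mathbf u)\,d\mathbf x+\int_{\partial K}\hat{\mathcal F}\big(\mathbf u(\mathbf x^{\mathrm{int}\,K}),\mathbf u(\mathbf x^{\mathrm{ext}\,K}),\mathbf n\big)\,ds(\mathbf x)\le0\qquad\text{for all }K\in\mathcal T_h,$$ where $$\hat{\mathcal F}(\mathbf u^{\mathrm{int}},\mathbf u^{\mathrm{ext}},\mathbf n):=\frac{\nabla U(\mathbf u^{\mathrm{int}})+\nabla U(\mathbf u^{\mathrm{ext}})}2\cdot\hat{\mathbf f}(\mathbf u^{\mathrm{int}},\mathbf u^{\mathrm{ext}},\mathbf n)-\sum_{i=1}^dn_i\frac{\psi^{(i)}(\mathbf u^{\mathrm{int}})+\psi^{(i)}(\mathbf u^{\mathrm{ext}})}2 .$$ Moreover $\hat{\mathcal F}$ is consistent, $\hat{\mathcal F}(\mathbf u,\mathbf u,\mathbf n)=\sum_{i=1}^dn_i\mathcal F^{(i)}(\mathbf u)$, and conservative, $\hat{\mathcal F}(\mathbf u^{\mathrm{ext}},\mathbf u^{\mathrm{int}},-\mathbf n)=-\hat{\mathcal F}(\mathbf u^{\mathrm{int}},\mathbf u^{\mathrm{ext}},\mathbf n)$.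
   Context: Consider an $m\times m$ system in $d$ space dimensions, $\mathbf u_t+\sum_{i=1}^d\partial_{x^{(i)}}\mathbf f^{(i)}(\mathbf u)=\mathbf 0$ on $\Omega\subset\mathbb R^d$, with $\mathbf f^{(i)}:\Omega'\to\mathbb R^m$ smooth on an open set $\Omega'\subset\mathbb R^m$. $U\in C^3(\Omega')$ is a strictly convex entropy ($\nabla^2U>0$) with entropy fluxes $\mathcal F^{(i)}$ satisfying $\nabla\mathcal F^{(i)}(\mathbf u)^T=\nabla U(\mathbf u)^T\nabla\mathbf f^{(i)}(\mathbf u)$, and $\psi^{(i)}(\mathbf u):=\nabla U(\mathbf u)^T\mathbf f^{(i)}(\mathbf u)-\mathcal F^{(i)}(\mathbf u)$. All states considered, including the convex hulls $\mathrm{co}(\mathbf u(K))$ of $\mathbf u(K)=\{\mathbf u(\mathbf x):\mathbf x\in K\}$, lie in $\Omega'$. $\mathcal T_h$ is a partition of $\Omega$ into convex elements $K$; $h_K=\operatorname{diam}K$, $\rho_K$ is the diameter of the largest sphere inscribed in $K$, $\gamma_K=h_K/\rho_K$, $|K|$ the volume. Fix $k\ge1$; $(\mathbb V^k_d)^m=\{\mathbf v\in(L^2(\Omega))^m:\mathbf v|_K\in(\mathbb P^k(K))^m\ \forall K\in\mathcal T_h\}$; $\pi_h$ is the ($L^2$) projection onto piecewise polynomials of degree $\le k$, acting componentwise; $\overline{\mathbf u}_K$ is the average on $K$. For $\mathbf x\in\partial K$, $\mathbf u(\mathbf x^{\mathrm{int}\,K})$, $\mathbf u(\mathbf x^{\mathrm{ext}\,K})$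 are the limits from inside and outside $K$ (exterior limits on $\partial\Omega$ being supplied by the boundary conditions), and $\mathbf n=(n_1,\dots,n_d)^T$ is the unit outward normal to $\partial K$. A directional numerical flux $\hat{\mathbf f}(\mathbf u^{\mathrm{int}},\mathbf u^{\mathrm{ext}},\mathbf n)$ is entropy stable for $U$ if it is consistent, $\hat{\mathbf f}(\mathbf u,\mathbf u,\mathbf n)=\sum_in_i\mathbf f^{(i)}(\mathbf u)$; conservative, $\hat{\mathbf f}(\mathbf u^{\mathrm{ext}},\mathbf u^{\mathrm{int}},-\mathbf n)=-\hat{\mathbf f}(\mathbf u^{\mathrm{int}},\mathbf u^{\mathrm{ext}},\mathbf n)$; and $$\hat{\mathbf f}(\mathbf u^{\mathrm{int}},\mathbf u^{\mathrm{ext}},\mathbf n)\cdot(\nabla U(\mathbf u^{\mathrm{ext}})-\nabla U(\mathbf u^{\mathrm{int}}))-\sum_{i=1}^dn_i(\psi^{(i)}(\mathbf u^{\mathrm{ext}})-\psi^{(i)}(\mathbf u^{\mathrm{int}}))\le0 .$$ Put $\mathbf H_K(\mathbf x,\mathbf n):=-\hat{\mathbf f}(\mathbf u(\mathbf x^{\mathrm{int}\,K}),\mathbf u(\mathbf x^{\mathrm{ext}\,K}),\mathbf n)+\sum_in_i\mathbf f^{(i)}(\mathbf u(\mathbf x^{\mathrm{int}\,K}))$, $\mathbf G:=\sum_i\partial_{x^{(i)}}\mathbf f^{(i)}(\mathbf u)$ (computed inside $K$), and let $M_K$ be the maximum over $\mathbf w\in\mathrm{co}(\mathbf u(K))$ and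 all $i_1,i_2,i_3$ of $|\partial^3U(\mathbf w)/\partial u_{i_1}\partial u_{i_2}\partial u_{i_3}|$. $\sigma_{\min}$ denotes the minimum eigenvalue. The constant $C(k,m,d,\gamma_K)>0$ is one depending only on $k,m,d,\gamma_K$ for which the following two estimates hold for all $K$ and all $\mathbf u\in(\mathbb V^k_d)^m$: for all $\mathbf x\in\partial K$, $$\big|\pi_h[\nabla U(\mathbf u)-\nabla U(\mathbf u(\mathbf x^{\mathrm{int}\,K}))](\mathbf x^{\mathrm{int}\,K})\big|\le\frac{C(k,m,d,\gamma_K)}{|K|}M_K\int_K|\mathbf u-\overline{\mathbf u}_K|^2d\mathbf x,$$ and $$\Big|\int_K\nabla U(\mathbf u)\cdot(\mathbf G-\pi_h[\mathbf G])\,d\mathbf x\Big|\le\frac{C(k,m,d,\gamma_K)}{\sqrt{|K|}}M_K\|\mathbf G-\pi_h[\mathbf G]\|_{L^2(K)}\int_K|\mathbf u-\overline{\mathbf u}_K|^2d\mathbf x.$$ Damping coefficient: $$B''_K[\mathbf u;U]:=C(k,m,d,\gamma_K)\frac{M_K}{\min_{\mathbf w\in\mathrm{co}(\mathbf u(K))}|\sigma_{\min}(\nabla^2U(\mathbf w))|}\Big\{\frac1{\sqrt{|K|}}\|\mathbf G-\pi_h[\mathbf G]\|_{L^2(K)}+\frac1{|K|}\int_{\partial K}|\mathbf H_K(\mathbf x,\mathbf n)|\,ds(\mathbf x)\Big\}.$$ Scheme B'': seek $\mathbf u(\cdot,t)\in(\mathbb V^k_d)^m$ such that for all $\mathbf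 v\in(\mathbb V^k_d)^m$ and all $K\in\mathcal T_h$, $$\int_K\mathbf u_t\cdot\mathbf v\,d\mathbf x=-\sum_{i=1}^d\int_K\frac{\partial\mathbf f^{(i)}(\mathbf u)}{\partial x^{(i)}}\cdot\mathbf v\,d\mathbf x+\int_{\partial K}\mathbf H_K(\mathbf x,\mathbf n)\cdot\mathbf v(\mathbf x^{\mathrm{int}\,K})\,ds(\mathbf x)-B''_K[\mathbf u;U]\int_K(\mathbf u-\overline{\mathbf u}_K)\cdot\mathbf v\,d\mathbf x.$$ *)

theory Defs
  imports "HOL-Analysis.Analysis"
begin

section \<open>Differential calculus\<close>

definition partial_deriv :: "'n::finite \<Rightarrow> (real^'n \<Rightarrow> 'b::real_normed_vector) \<Rightarrow> real^'n \<Rightarrow> 'b" where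
  "partial_deriv i f x = frechet_derivative f (at x) (axis i 1)"

text \<open>The class \<open>C\<^sup>r\<close>; intended for open sets.\<close>

primrec Ck_on :: "nat \<Rightarrow> (real^'n::finite) set \<Rightarrow> (real^'n \<Rightarrow> 'b::real_normed_vector) \<Rightarrow> bool" where
  "Ck_on 0 S f \<longleftrightarrow> continuous_on S f"
| "Ck_on (Suc r) S f \<longleftrightarrow>
     (\<forall>x\<in>S. f differentiable (at x)) \<and> (\<forall>i. Ck_on r S (partial_deriv i f))"

definition grad :: "(real^'n::finite \<Rightarrow> real) \<Rightarrow> real^'n \<Rightarrow> real^'n" where
  "grad U w = (\<chi> i. partial_deriv i U w)"

definition hessian :: "(real^'n::finite \<Rightarrow> real) \<Rightarrow> real^'n \<Rightarrow> real^'n^'n" where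
  "hessian U w = (\<chi> i j. partial_deriv i (partial_deriv j U) w)"

definition min_eigenvalue :: "real^'n^'n::finite \<Rightarrow> real" where
  "min_eigenvalue A = Min {l. \<exists>v. v \<noteq> 0 \<and> A *v v = l *\<^sub>R v}"


section \<open>Surface measure and outward normal\<close>

text \<open>Hausdorff outer measure of integer dimension \<open>s\<close>, without normalising constant. The empty
  set is given weight 0 separately because \<open>0 ^ 0 = 1\<close>; thus \<open>s = 0\<close> gives the counting measure.\<close>

definition hausdorff_pre :: "nat \<Rightarrow> real \<Rightarrow> 'a::metric_space set \<Rightarrow> ennreal" where
  "hausdorff_pre s \<delta> A =
     (INF C\<in>{C :: nat \<Rightarrow> 'a set. A \<subseteq> (\<Union>i. C i) \<and> (\<forall>i. bounded (C i) \<and> diameter (C i) \<le> \<delta>)}.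
        \<Sum>i. if C i = {} then 0 else ennreal (diameter (C i) ^ s))"

definition hausdorff_outer :: "nat \<Rightarrow> 'a::metric_space set \<Rightarrow> ennreal" where
  "hausdorff_outer s A = (SUP \<delta>\<in>{0<..}. hausdorff_pre s \<delta> A)"

text \<open>The surface measure \<open>ds\<close> in \<open>\<real>\<^sup>d\<close> is the \<open>(d - 1)\<close>-dimensional Hausdorff measure,
  normalised to agree with \<open>(d - 1)\<close>-dimensional volume on hyperplanes: the constant is fixed by the
  requirement that the boundary of the unit cube, which has \<open>2 d\<close> unit faces, has measure \<open>2 d\<close>.
  Its measurable sets are the Caratheodory-measurable ones, so it is complete.\<close>

definition surface_outer :: "(real^'d::finite) set \<Rightarrow> ennreal" where
  "surface_outer A = of_nat (2 * CARD('d)) * hausdorff_outer (CARD('d) - 1) A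
     / hausdorff_outer (CARD('d) - 1) (frontier (cbox 0 1 :: (real^'d) set))"

definition surface_measure :: "(real^'d::finite) measure" where
  "surface_measure = measure_of UNIV (lambda_system UNIV UNIV surface_outer) surface_outer"

text \<open>For a convex body \<open>K\<close> a unit outward normal exists at every boundary point and is unique at
  almost every one with respect to the surface measure.\<close>

definition outward_normal :: "(real^'d::finite) set \<Rightarrow> real^'d \<Rightarrow> real^'d" where
  "outward_normal K x = (SOME n. norm n = 1 \<and> (\<forall>y\<in>K. n \<bullet> (y - x) \<le> 0))"


section \<open>Meshes and discontinuous piecewise polynomials\<close>

text \<open>Elements are closed; they overlap only along their boundaries. A function on \<open>\<Omega>\<close> is
  described on the interiors of the elements, and its values on the skeleton are never used:
  one-sided values there are limits.\<close>

definition convex_mesh :: "(real^'d::finite) set \<Rightarrow> (real^'d) set set \<Rightarrow> bool" where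
  "convex_mesh \<Omega> T \<longleftrightarrow>
     open \<Omega> \<and>
     (\<forall>K\<in>T. compact K \<and> convex K \<and> interior K \<noteq> {} \<and> interior K \<subseteq> \<Omega>) \<and>
     pairwise (\<lambda>K L. interior K \<inter> interior L = {}) T \<and>
     \<Omega> \<subseteq> \<Union>T \<and>
     (\<forall>S. compact S \<longrightarrow> finite {K\<in>T. K \<inter> S \<noteq> {}})"

definition volume :: "(real^'d::finite) set \<Rightarrow> real" where
  "volume K = measure lebesgue K"

definition inscribed_diameter :: "(real^'d::finite) set \<Rightarrow> real" where
  "inscribed_diameter K = 2 * Sup {r. 0 \<le> r \<and> (\<exists>c. ball c r \<subseteq> K)}"

definition shape_ratio :: "(real^'d::finite) set \<Rightarrow> real" where
  "shape_ratio K = diameter K / inscribed_diameter K"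

definition Pk :: "nat \<Rightarrow> (real^'d::finite \<Rightarrow> real) set" where
  "Pk k = {p. \<exists>c :: ('d \<Rightarrow> nat) \<Rightarrow> real.
     \<forall>x. p x = (\<Sum>\<alpha> | sum \<alpha> UNIV \<le> k. c \<alpha> * (\<Prod>i\<in>UNIV. (x $ i) ^ \<alpha> i))}"

definition dg_space ::
  "nat \<Rightarrow> (real^'d::finite) set \<Rightarrow> (real^'d) set set \<Rightarrow> (real^'d \<Rightarrow> real^'m::finite) set" where
  "dg_space k \<Omega> T = {v.
     set_borel_measurable lebesgue \<Omega> v \<and>
     set_integrable lebesgue \<Omega> (\<lambda>x. (norm (v x))\<^sup>2) \<and>
     (\<forall>K\<in>T. \<forall>j. \<exists>p\<in>Pk k. \<forall>x\<in>interior K. v x $ j = p x)}"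

text \<open>The \<open>L\<^sup>2\<close> projection on one element. As \<open>dg_space\<close> imposes no continuity between elements,
  the projection onto it acts element by element. The result is a polynomial, regarded
  as a function on the whole space, so that its value at \<open>x \<in> frontier K\<close> is the limit from inside.\<close>

definition L2_proj :: "nat \<Rightarrow> (real^'d::finite) set \<Rightarrow> (real^'d \<Rightarrow> real) \<Rightarrow> real^'d \<Rightarrow> real" where
  "L2_proj k K g =
     (THE p. p \<in> Pk k \<and> (\<forall>q\<in>Pk k. (LINT x:K|lebesgue. (g x - p x) * q x) = 0))"

definition pi_h :: "nat \<Rightarrow> (real^'d::finite) set \<Rightarrow> (real^'d \<Rightarrow> real^'m::finite) \<Rightarrow> real^'d \<Rightarrow> real^'m" where
  "pi_h k K g x = (\<chi> j. L2_proj k K (\<lambda>y. g y $ j) x)"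

definition cell_average :: "(real^'d::finite) set \<Rightarrow> (real^'d \<Rightarrow> real^'m::finite) \<Rightarrow> real^'m" where
  "cell_average K u = (1 / volume K) *\<^sub>R (LINT x:K|lebesgue. u x)"

definition cell_variance :: "(real^'d::finite) set \<Rightarrow> (real^'d \<Rightarrow> real^'m::finite) \<Rightarrow> real" where
  "cell_variance K u = (LINT x:K|lebesgue. (norm (u x - cell_average K u))\<^sup>2)"

definition int_trace :: "(real^'d::finite) set \<Rightarrow> (real^'d \<Rightarrow> real^'m::finite) \<Rightarrow> real^'d \<Rightarrow> real^'m" where
  "int_trace K u x = Lim (at x within interior K) u"

text \<open>\<open>g K x\<close> is the exterior state that the boundary conditions supply at \<open>x \<in> frontier \<Omega>\<close>.
  The limit exists except at points shared by three or more elements, a null set for the surface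
  measure.\<close>

definition ext_trace ::
  "(real^'d::finite) set \<Rightarrow> (real^'d) set set \<Rightarrow> ((real^'d) set \<Rightarrow> real^'d \<Rightarrow> real^'m::finite)
   \<Rightarrow> (real^'d) set \<Rightarrow> (real^'d \<Rightarrow> real^'m) \<Rightarrow> real^'d \<Rightarrow> real^'m" where
  "ext_trace \<Omega> T g K u x =
     (if x \<in> frontier \<Omega> then g K x else Lim (at x within (\<Union>L\<in>T - {K}. interior L)) u)"

text \<open>\<open>co(u(K))\<close>, with \<open>u\<close> extended continuously from the interior to all of \<open>K\<close>.\<close>

definition state_hull :: "(real^'d::finite) set \<Rightarrow> (real^'d \<Rightarrow> real^'m::finite) \<Rightarrow> (real^'m) set" where
  "state_hull K u = convex hull (int_trace K u ` K)"


section \<open>Entropy pairs and numerical fluxes\<close>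

definition convex_entropy ::
  "(real^'m::finite) set \<Rightarrow> ('d::finite \<Rightarrow> real^'m \<Rightarrow> real^'m)
   \<Rightarrow> (real^'m \<Rightarrow> real) \<Rightarrow> ('d \<Rightarrow> real^'m \<Rightarrow> real) \<Rightarrow> bool" where
  "convex_entropy \<Omega>' f U F \<longleftrightarrow>
     Ck_on 3 \<Omega>' U \<and>
     (\<forall>w\<in>\<Omega>'. \<forall>z. z \<noteq> 0 \<longrightarrow> 0 < z \<bullet> (hessian U w *v z)) \<and>
     (\<forall>i. \<forall>w\<in>\<Omega>'. F i differentiable (at w) \<and> grad (F i) w = grad U w v* jacobian (f i) (at w))"

definition entropy_potential ::
  "('d::finite \<Rightarrow> real^'m::finite \<Rightarrow> real^'m) \<Rightarrow> (real^'m \<Rightarrow> real) \<Rightarrow> ('d \<Rightarrow> real^'m \<Rightarrow> real)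
   \<Rightarrow> 'd \<Rightarrow> real^'m \<Rightarrow> real" where
  "entropy_potential f U F i w = grad U w \<bullet> f i w - F i w"

definition normal_flux ::
  "('d::finite \<Rightarrow> real^'m::finite \<Rightarrow> real^'m) \<Rightarrow> real^'m \<Rightarrow> real^'d \<Rightarrow> real^'m" where
  "normal_flux f w n = (\<Sum>i\<in>UNIV. (n $ i) *\<^sub>R f i w)"

definition entropy_stable_flux ::
  "(real^'m::finite) set \<Rightarrow> ('d::finite \<Rightarrow> real^'m \<Rightarrow> real^'m) \<Rightarrow> (real^'m \<Rightarrow> real)
   \<Rightarrow> ('d \<Rightarrow> real^'m \<Rightarrow> real) \<Rightarrow> (real^'m \<Rightarrow> real^'m \<Rightarrow> real^'d \<Rightarrow> real^'m) \<Rightarrow> bool" where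
  "entropy_stable_flux \<Omega>' f U F fhat \<longleftrightarrow>
     (\<forall>a\<in>\<Omega>'. \<forall>n. norm n = 1 \<longrightarrow> fhat a a n = normal_flux f a n) \<and>
     (\<forall>a\<in>\<Omega>'. \<forall>b\<in>\<Omega>'. \<forall>n. norm n = 1 \<longrightarrow> fhat b a (- n) = - fhat a b n) \<and>
     (\<forall>a\<in>\<Omega>'. \<forall>b\<in>\<Omega>'. \<forall>n. norm n = 1 \<longrightarrow>
        fhat a b n \<bullet> (grad U b - grad U a)
        - (\<Sum>i\<in>UNIV. n $ i * (entropy_potential f U F i b - entropy_potential f U F i a)) \<le> 0)"

definition numerical_entropy_flux ::
  "('d::finite \<Rightarrow> real^'m::finite \<Rightarrow> real^'m) \<Rightarrow> (real^'m \<Rightarrow> real) \<Rightarrow> ('d \<Rightarrow> real^'m \<Rightarrow> real)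
   \<Rightarrow> (real^'m \<Rightarrow> real^'m \<Rightarrow> real^'d \<Rightarrow> real^'m) \<Rightarrow> real^'m \<Rightarrow> real^'m \<Rightarrow> real^'d \<Rightarrow> real" where
  "numerical_entropy_flux f U F fhat a b n =
     ((1/2) *\<^sub>R (grad U a + grad U b)) \<bullet> fhat a b n
     - (\<Sum>i\<in>UNIV. n $ i * ((entropy_potential f U F i a + entropy_potential f U F i b) / 2))"


section \<open>The damped scheme\<close>

text \<open>\<open>H_jump\<close> is \<open>H\<^sub>K(x, n)\<close> at the outward normal \<open>n\<close> of \<open>K\<close> at \<open>x\<close>; \<open>flux_div\<close> is
  \<open>G\<close>, meaningful in the interiors of the elements.\<close>

definition H_jump ::
  "(real^'d::finite) set \<Rightarrow> (real^'d) set set \<Rightarrow> ('d \<Rightarrow> real^'m::finite \<Rightarrow> real^'m)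
   \<Rightarrow> (real^'m \<Rightarrow> real^'m \<Rightarrow> real^'d \<Rightarrow> real^'m) \<Rightarrow> ((real^'d) set \<Rightarrow> real^'d \<Rightarrow> real^'m)
   \<Rightarrow> (real^'d) set \<Rightarrow> (real^'d \<Rightarrow> real^'m) \<Rightarrow> real^'d \<Rightarrow> real^'m" where
  "H_jump \<Omega> T f fhat g K u x =
     - fhat (int_trace K u x) (ext_trace \<Omega> T g K u x) (outward_normal K x)
     + normal_flux f (int_trace K u x) (outward_normal K x)"

definition flux_div ::
  "('d::finite \<Rightarrow> real^'m::finite \<Rightarrow> real^'m) \<Rightarrow> (real^'d \<Rightarrow> real^'m) \<Rightarrow> real^'d \<Rightarrow> real^'m" where
  "flux_div f u x = (\<Sum>i\<in>UNIV. partial_deriv i (\<lambda>y. f i (u y)) x)"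

definition proj_defect ::
  "nat \<Rightarrow> ('d::finite \<Rightarrow> real^'m::finite \<Rightarrow> real^'m) \<Rightarrow> (real^'d) set \<Rightarrow> (real^'d \<Rightarrow> real^'m) \<Rightarrow> real" where
  "proj_defect k f K u =
     sqrt (LINT x:K|lebesgue. (norm (flux_div f u x - pi_h k K (flux_div f u) x))\<^sup>2)"

definition third_deriv_max ::
  "(real^'m::finite \<Rightarrow> real) \<Rightarrow> (real^'d::finite) set \<Rightarrow> (real^'d \<Rightarrow> real^'m) \<Rightarrow> real" where
  "third_deriv_max U K u =
     Sup {\<bar>partial_deriv i1 (partial_deriv i2 (partial_deriv i3 U)) w\<bar> | i1 i2 i3 w. w \<in> state_hull K u}"

text \<open>The property characterising the constant \<open>C(k, m, d, \<gamma>\<^sub>K)\<close>.\<close>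

definition estimate_constant ::
  "(nat \<Rightarrow> nat \<Rightarrow> nat \<Rightarrow> real \<Rightarrow> real) \<Rightarrow> nat \<Rightarrow> (real^'d::finite) set \<Rightarrow> (real^'d) set set
   \<Rightarrow> (real^'m::finite) set \<Rightarrow> ('d \<Rightarrow> real^'m \<Rightarrow> real^'m) \<Rightarrow> (real^'m \<Rightarrow> real) \<Rightarrow> bool" where
  "estimate_constant C k \<Omega> T \<Omega>' f U \<longleftrightarrow>
     (\<forall>K\<in>T. 0 < C k CARD('m) CARD('d) (shape_ratio K)) \<and>
     (\<forall>K\<in>T. \<forall>u\<in>dg_space k \<Omega> T. state_hull K u \<subseteq> \<Omega>' \<longrightarrow>
        (\<forall>x\<in>frontier K.
           norm (pi_h k K (\<lambda>y. grad U (u y) - grad U (int_trace K u x)) x)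
           \<le> C k CARD('m) CARD('d) (shape_ratio K) / volume K
             * third_deriv_max U K u * cell_variance K u) \<and>
        \<bar>LINT x:K|lebesgue. grad U (u x) \<bullet> (flux_div f u x - pi_h k K (flux_div f u) x)\<bar>
        \<le> C k CARD('m) CARD('d) (shape_ratio K) / sqrt (volume K)
          * third_deriv_max U K u * proj_defect k f K u * cell_variance K u)"

definition damping_coeff ::
  "(nat \<Rightarrow> nat \<Rightarrow> nat \<Rightarrow> real \<Rightarrow> real) \<Rightarrow> nat \<Rightarrow> (real^'d::finite) set \<Rightarrow> (real^'d) set set
   \<Rightarrow> ('d \<Rightarrow> real^'m::finite \<Rightarrow> real^'m) \<Rightarrow> (real^'m \<Rightarrow> real)
   \<Rightarrow> (real^'m \<Rightarrow> real^'m \<Rightarrow> real^'d \<Rightarrow> real^'m) \<Rightarrow> ((real^'d) set \<Rightarrow> real^'d \<Rightarrow> real^'m)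
   \<Rightarrow> (real^'d) set \<Rightarrow> (real^'d \<Rightarrow> real^'m) \<Rightarrow> real" where
  "damping_coeff C k \<Omega> T f U fhat g K u =
     C k CARD('m) CARD('d) (shape_ratio K)
     * (third_deriv_max U K u / (INF w\<in>state_hull K u. \<bar>min_eigenvalue (hessian U w)\<bar>))
     * (1 / sqrt (volume K) * proj_defect k f K u
        + 1 / volume K * (LINT x:frontier K|surface_measure. norm (H_jump \<Omega> T f fhat g K u x)))"

text \<open>Solutions on a time interval \<open>I\<close>; the boundary conditions supply at time \<open>t\<close> the exterior
  states \<open>g t K x\<close>. Membership in \<open>\<Omega>'\<close> of the states involved and integrability of \<open>H\<^sub>K\<close> over the
  element boundaries express that the scheme is well-defined along the solution.\<close>

definition scheme_solution ::
  "(nat \<Rightarrow> nat \<Rightarrow> nat \<Rightarrow> real \<Rightarrow> real) \<Rightarrow> nat \<Rightarrow> (real^'d::finite) set \<Rightarrow> (real^'d) set set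
   \<Rightarrow> (real^'m::finite) set \<Rightarrow> ('d \<Rightarrow> real^'m \<Rightarrow> real^'m) \<Rightarrow> (real^'m \<Rightarrow> real)
   \<Rightarrow> (real^'m \<Rightarrow> real^'m \<Rightarrow> real^'d \<Rightarrow> real^'m)
   \<Rightarrow> (real \<Rightarrow> (real^'d) set \<Rightarrow> real^'d \<Rightarrow> real^'m)
   \<Rightarrow> real set \<Rightarrow> (real \<Rightarrow> real^'d \<Rightarrow> real^'m) \<Rightarrow> bool" where
  "scheme_solution C k \<Omega> T \<Omega>' f U fhat g I u \<longleftrightarrow>
     (\<forall>t\<in>I. u t \<in> dg_space k \<Omega> T \<and>
       (\<forall>K\<in>T.
          (\<forall>x\<in>interior K. (\<lambda>s. u s x) differentiable (at t within I)) \<and>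
          state_hull K (u t) \<subseteq> \<Omega>' \<and>
          (AE x in surface_measure. x \<in> frontier K \<longrightarrow> ext_trace \<Omega> T (g t) K (u t) x \<in> \<Omega>') \<and>
          set_integrable surface_measure (frontier K) (H_jump \<Omega> T f fhat (g t) K (u t)) \<and>
          (\<forall>v\<in>dg_space k \<Omega> T.
             (LINT x:K|lebesgue. vector_derivative (\<lambda>s. u s x) (at t within I) \<bullet> v x)
             = - (\<Sum>i\<in>UNIV. LINT x:K|lebesgue. partial_deriv i (\<lambda>y. f i (u t y)) x \<bullet> v x)
               + (LINT x:frontier K|surface_measure.
                    H_jump \<Omega> T f fhat (g t) K (u t) x \<bullet> int_trace K v x)
               - damping_coeff C k \<Omega> T f U fhat (g t) K (u t)
                 * (LINT x:K|lebesgue. (u t x - cell_average K (u t)) \<bullet> v x))))"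

end

theory Submission
  imports Defs
begin

text \<open>Fix an element \<open>K\<close> and a time, and let \<open>P\<close> be the vector of polynomials that the solution \<open>u\<close> agrees with on
the interior of \<open>K\<close>. As \<open>u\<^sub>t\<close> is a vector of polynomials too, \<open>d/dt \<integral>\<^sub>K U(u) = \<integral>\<^sub>K u\<^sub>t \<bullet> \<nabla>U(u) = \<integral>\<^sub>K u\<^sub>t \<bullet> v\<close> with
the projected entropy variables \<open>v = \<pi>\<^sub>h[\<nabla>U(u)]\<close>, and the scheme may be tested with \<open>v\<close>. Each of its three
terms is compared with the same term for \<open>\<nabla>U(u)\<close>.

\<^item> In the volume term the error of replacing \<open>v\<close> by \<open>\<nabla>U(u)\<close> is \<open>\<integral>\<^sub>K \<nabla>U(u) \<bullet> (G - \<pi>\<^sub>h[G])\<close>, because \<open>\<pi>\<^sub>h\<close> is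
  symmetric. The main part is the divergence of the entropy flux, since \<open>\<nabla>F\<^sub>i = \<nabla>U \<nabla>f\<^sub>i\<close>, and the divergence
  theorem turns it into \<open>- \<integral> n \<bullet> F(u)\<close> over the boundary (\<open>entropy_flux_divergence\<close>).

\<^item> In the boundary term the error is \<open>\<integral> H \<bullet> (\<pi>\<^sub>h[\<nabla>U(u)] - \<nabla>U(u))\<close>. Entropy stability of the numerical flux says
  exactly that \<open>H \<bullet> \<nabla>U(u)\<close> plus the numerical entropy flux is at most \<open>n \<bullet> F(u)\<close>
  (\<open>boundary_entropy_dissipation\<close>), which is what the volume term has left over.

\<^item> In the damping term no error arises, because \<open>u - avg u\<close> is polynomial. Uniform convexity of \<open>U\<close> on the compact
  convex set \<open>co(u(K))\<close> gives \<open>\<integral>\<^sub>K (u - avg u) \<bullet> \<nabla>U(u) \<ge> \<mu> \<integral>\<^sub>K |u - avg u|\<^sup>2\<close>, where \<open>\<mu>\<close> is the least eigenvalue of the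
  Hessian on that set (\<open>damping_coercive\<close>).

By the two estimates that characterise the constant, the errors are at most a multiple of \<open>\<integral>\<^sub>K |u - avg u|\<^sup>2\<close>, and
the damping coefficient is chosen so that the damping dominates their sum. This is
\<open>element_entropy_inequality\<close>; differentiation under the integral sign
(\<open>has_real_derivative_integral_state\<close>) completes the argument.

Most of the work lies in the divergence theorem for a convex body with respect to the Hausdorff measure
(\<open>divergence_component\<close>). For a unit vector \<open>e\<close>, Fubini's theorem and the fundamental theorem of calculus along
the lines parallel to \<open>e\<close> express \<open>\<integral>\<^sub>K \<partial>\<^sub>e \<phi>\<close> as an integral of the difference of \<open>\<phi>\<close> at the points where a line
leaves and enters \<open>K\<close>. It remains to see that the part of the boundary where \<open>n \<bullet> e > 0\<close>, weighted by \<open>n \<bullet> e\<close>,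
is carried by projection along \<open>e\<close> to Lebesgue measure (\<open>flux_measure_eq_exit_measure\<close>). On hyperplanes the
surface measure is Lebesgue measure, by uniqueness of Haar measure. On a piece of the boundary whose normals are
close to one vector \<open>\<nu>\<close>, convexity alone forces the chords to be almost orthogonal to \<open>\<nu>\<close>
(\<open>normal_slope\<close>); hence the projection to the hyperplane orthogonal to \<open>\<nu>\<close> changes distances, and so the
Hausdorff measure, by factors near 1. Summing over countably many such pieces gives the claim up to points
with several normals, and the same estimate, used for two different normals at once, shows that these form a
null set (\<open>surface_singular_null\<close>).\<close>


section \<open>Hausdorff measure and Caratheodory's criterion\<close>

lemma ennreal_less_add_pos: "x < top \<Longrightarrow> 0 < e \<Longrightarrow> x < x + ennreal e"
  by (metis add.right_neutral ennreal_add_left_cancel_less ennreal_less_zero_iff infinity_ennreal_def less_top)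

lemma hausdorff_pre_mono: "A \<subseteq> B \<Longrightarrow> hausdorff_pre s \<delta> A \<le> hausdorff_pre s \<delta> B"
  unfolding hausdorff_pre_def by (rule INF_superset_mono) auto

lemma hausdorff_pre_antimono: "\<delta> \<le> \<delta>' \<Longrightarrow> hausdorff_pre s \<delta>' A \<le> hausdorff_pre s \<delta> A"
  unfolding hausdorff_pre_def by (rule INF_superset_mono) (auto intro: order_trans)

lemma hausdorff_pre_le:
  assumes "A \<subseteq> (\<Union>i. C i)" "\<And>i. bounded (C i)" "\<And>i. diameter (C i) \<le> \<delta>"
  shows "hausdorff_pre s \<delta> A \<le> (\<Sum>i. if C i = {} then 0 else ennreal (diameter (C i) ^ s))"
  unfolding hausdorff_pre_def by (rule INF_lower) (use assms in auto)

lemma hausdorff_pre_empty: "0 \<le> \<delta> \<Longrightarrow> hausdorff_pre s \<delta> {} = 0"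
  using hausdorff_pre_le[of "{}" "\<lambda>_. {}" \<delta> s] by simp

lemma hausdorff_pre_countably_subadditive:
  fixes A :: "nat \<Rightarrow> 'a::metric_space set"
  shows "hausdorff_pre s \<delta> (\<Union>i. A i) \<le> (\<Sum>i. hausdorff_pre s \<delta> (A i))"
proof (rule ennreal_le_epsilon)
  fix e :: real assume fin: "(\<Sum>i. hausdorff_pre s \<delta> (A i)) < top" and e: "0 < e"
  let ?w = "\<lambda>C :: 'a set. if C = {} then 0 else ennreal (diameter C ^ s)"
  have ex: "\<exists>C. A i \<subseteq> (\<Union>j. C j) \<and> (\<forall>j. bounded (C j) \<and> diameter (C j) \<le> \<delta>) \<and>
      (\<Sum>j. ?w (C j)) \<le> hausdorff_pre s \<delta> (A i) + ennreal (e * (1/2)^Suc i)" for i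
  proof -
    have "hausdorff_pre s \<delta> (A i) < top"
      using fin ennreal_suminf_lessD[of "\<lambda>i. hausdorff_pre s \<delta> (A i)" top i] by simp
    then have "hausdorff_pre s \<delta> (A i) < hausdorff_pre s \<delta> (A i) + ennreal (e * (1/2)^Suc i)"
      using e by (intro ennreal_less_add_pos) auto
    then show ?thesis
      unfolding hausdorff_pre_def[of s \<delta> "A i"] INF_less_iff by (auto simp del: power_Suc intro: less_imp_le)
  qed
  from choice[OF allI[OF ex]] obtain C where CC: "\<forall>i. A i \<subseteq> (\<Union>j. C i j) \<and> (\<forall>j. bounded (C i j) \<and> diameter (C i j) \<le> \<delta>) \<and>
      (\<Sum>j. ?w (C i j)) \<le> hausdorff_pre s \<delta> (A i) + ennreal (e * (1/2)^Suc i)" ..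
  note C = CC[rule_format, THEN conjunct1] CC[rule_format, THEN conjunct2, THEN conjunct1, rule_format, THEN conjunct1]
    CC[rule_format, THEN conjunct2, THEN conjunct1, rule_format, THEN conjunct2]
    CC[rule_format, THEN conjunct2, THEN conjunct2]
  define B where "B n = case_prod C (prod_decode n)" for n
  have "(\<Union>i. A i) \<subseteq> (\<Union>n. B n)"
  proof
    fix x assume "x \<in> (\<Union>i. A i)"
    then obtain i j where "x \<in> C i j" using C(1) by blast
    then have "x \<in> B (prod_encode (i, j))" by (simp add: B_def)
    then show "x \<in> (\<Union>n. B n)" by blast
  qed
  then have "hausdorff_pre s \<delta> (\<Union>i. A i) \<le> (\<Sum>n. ?w (B n))"
    by (rule hausdorff_pre_le) (auto simp: B_def C split: prod.split)
  also have "\<dots> = (\<Sum>n. (\<lambda>p. ?w (case_prod C p)) (prod_decode n))" by (simp only: B_def)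
  also have "\<dots> = (\<Sum>i. \<Sum>j. ?w (C i j))"
    by (subst suminf_ennreal_2dimen[where f = "\<lambda>p. ?w (case_prod C p)", OF refl]) (simp only: prod.case)
  also have "\<dots> \<le> (\<Sum>i. hausdorff_pre s \<delta> (A i) + ennreal (e * (1/2)^Suc i))"
    by (rule suminf_le[OF C(4)]) auto
  also have "\<dots> = (\<Sum>i. hausdorff_pre s \<delta> (A i)) + (\<Sum>i. ennreal (e * (1/2)^Suc i))"
    by (rule suminf_add[symmetric]) auto
  also have "(\<Sum>i. ennreal (e * (1/2)^Suc i)) = ennreal e"
  proof (rule suminf_ennreal_eq)
    show "(\<lambda>i. e * (1/2)^Suc i) sums e" using sums_mult[OF power_half_series, of e] by (simp only: mult_1_right)
  qed (use e in simp)
  finally show "hausdorff_pre s \<delta> (\<Union>i. A i) \<le> (\<Sum>i. hausdorff_pre s \<delta> (A i)) + ennreal e" .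
qed

lemma hausdorff_outer_mono: "A \<subseteq> B \<Longrightarrow> hausdorff_outer s A \<le> hausdorff_outer s B"
  unfolding hausdorff_outer_def by (intro SUP_mono') (rule hausdorff_pre_mono)

lemma hausdorff_pre_le_outer: "0 < \<delta> \<Longrightarrow> hausdorff_pre s \<delta> A \<le> hausdorff_outer s A"
  unfolding hausdorff_outer_def by (rule SUP_upper) auto

lemma hausdorff_outer_empty: "hausdorff_outer s {} = 0"
  unfolding hausdorff_outer_def
  by (rule antisym) (auto intro!: SUP_least simp: hausdorff_pre_empty)

lemma hausdorff_outer_countably_subadditive:
  "hausdorff_outer s (\<Union>i. A i) \<le> (\<Sum>i. hausdorff_outer s (A i))"
  unfolding hausdorff_outer_def[of s "\<Union>i. A i"]
proof (rule SUP_least)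
  fix \<delta> :: real assume "\<delta> \<in> {0<..}"
  then have "(\<Sum>i. hausdorff_pre s \<delta> (A i)) \<le> (\<Sum>i. hausdorff_outer s (A i))"
    by (intro suminf_le hausdorff_pre_le_outer) auto
  with hausdorff_pre_countably_subadditive
  show "hausdorff_pre s \<delta> (\<Union>i. A i) \<le> (\<Sum>i. hausdorff_outer s (A i))" by (rule order_trans)
qed

text \<open>A set of diameter less than the gap between \<open>A\<close> and \<open>B\<close> meets only one of them, so every fine
cover of the union splits into a cover of \<open>A\<close> and one of \<open>B\<close>.\<close>

lemma hausdorff_outer_metric:
  fixes A B :: "'a::metric_space set"
  assumes \<eta>: "0 < \<eta>" and sep: "\<And>x y. x \<in> A \<Longrightarrow> y \<in> B \<Longrightarrow> \<eta> \<le> dist x y"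
  shows "hausdorff_outer s A + hausdorff_outer s B \<le> hausdorff_outer s (A \<union> B)"
proof -
  let ?w = "\<lambda>C :: 'a set. if C = {} then 0 else ennreal (diameter C ^ s)"
  have split: "hausdorff_pre s \<delta> A + hausdorff_pre s \<delta> B \<le> hausdorff_pre s \<delta> (A \<union> B)"
    if \<delta>: "\<delta> < \<eta>" for \<delta>
    unfolding hausdorff_pre_def[of s \<delta> "A \<union> B"]
  proof (rule INF_greatest, clarify)
    fix C :: "nat \<Rightarrow> 'a set"
    assume cov: "A \<union> B \<subseteq> (\<Union>i. C i)" and C: "\<forall>i. bounded (C i) \<and> diameter (C i) \<le> \<delta>"
    have dm: "diameter (C i \<inter> X) \<le> diameter (C i)" "bounded (C i \<inter> X)" for i X
      using C by (auto intro: diameter_subset bounded_subset)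
    have "hausdorff_pre s \<delta> A \<le> (\<Sum>i. ?w (C i \<inter> A))" "hausdorff_pre s \<delta> B \<le> (\<Sum>i. ?w (C i \<inter> B))"
      using cov C dm by (auto intro!: hausdorff_pre_le intro: order_trans[OF dm(1)])
    then have "hausdorff_pre s \<delta> A + hausdorff_pre s \<delta> B \<le> (\<Sum>i. ?w (C i \<inter> A)) + (\<Sum>i. ?w (C i \<inter> B))"
      by (rule add_mono)
    also have "\<dots> = (\<Sum>i. ?w (C i \<inter> A) + ?w (C i \<inter> B))" by (rule suminf_add) auto
    also have "\<dots> \<le> (\<Sum>i. ?w (C i))"
    proof (rule suminf_le)
      fix i
      have w: "?w (C i \<inter> X) \<le> ?w (C i)" for X
        using dm(1)[of i X] by (auto intro!: ennreal_leI power_mono diameter_ge_0 dm)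
      have "C i \<inter> A = {} \<or> C i \<inter> B = {}"
      proof (rule ccontr)
        assume "\<not> ?thesis"
        then obtain x y where "x \<in> C i" "x \<in> A" "y \<in> C i" "y \<in> B" by blast
        then have "\<eta> \<le> dist x y" "dist x y \<le> diameter (C i)"
          using sep C by (auto intro: diameter_bounded_bound)
        then show False using C \<delta> by (meson linorder_not_le order.trans)
      qed
      then show "?w (C i \<inter> A) + ?w (C i \<inter> B) \<le> ?w (C i)"
        using w[of A] w[of B] by (elim disjE) simp_all
    qed auto
    finally show "hausdorff_pre s \<delta> A + hausdorff_pre s \<delta> B \<le> (\<Sum>i. ?w (C i))" .
  qed
  have two: "hausdorff_pre s \<delta>1 A + hausdorff_pre s \<delta>2 B \<le> hausdorff_outer s (A \<union> B)"
    if "0 < \<delta>1" "0 < \<delta>2" for \<delta>1 \<delta>2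
  proof -
    define \<delta> where "\<delta> = min (\<eta>/2) (min \<delta>1 \<delta>2)"
    have "hausdorff_pre s \<delta>1 A + hausdorff_pre s \<delta>2 B \<le> hausdorff_pre s \<delta> A + hausdorff_pre s \<delta> B"
      by (intro add_mono hausdorff_pre_antimono) (auto simp: \<delta>_def)
    also have "\<dots> \<le> hausdorff_pre s \<delta> (A \<union> B)" using \<eta> by (intro split) (auto simp: \<delta>_def min_def)
    also have "\<dots> \<le> hausdorff_outer s (A \<union> B)" using \<eta> that by (intro hausdorff_pre_le_outer) (auto simp: \<delta>_def)
    finally show ?thesis .
  qed
  have ne: "{0::real<..} \<noteq> {}" by (rule greaterThan_non_empty)
  have "hausdorff_pre s \<delta>1 A + hausdorff_outer s B \<le> hausdorff_outer s (A \<union> B)" if "0 < \<delta>1" for \<delta>1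
    using two[OF that] unfolding hausdorff_outer_def[of s B]
    by (subst ennreal_SUP_add_right[OF ne]) (auto intro!: SUP_least)
  then show ?thesis
    unfolding hausdorff_outer_def[of s A]
    by (subst ennreal_SUP_add_left[OF ne, symmetric]) (auto intro!: SUP_least)
qed

text \<open>The last clause, additivity on sets at positive distance, is the hypothesis of Caratheodory's criterion.\<close>

definition metric_outer_measure :: "('a::metric_space set \<Rightarrow> ennreal) \<Rightarrow> bool" where
  "metric_outer_measure \<mu> \<longleftrightarrow> \<mu> {} = 0 \<and> (\<forall>A B. A \<subseteq> B \<longrightarrow> \<mu> A \<le> \<mu> B) \<and>
     (\<forall>A :: nat \<Rightarrow> 'a set. \<mu> (\<Union>i. A i) \<le> (\<Sum>i. \<mu> (A i))) \<and>
     (\<forall>A B \<eta>. 0 < \<eta> \<longrightarrow> (\<forall>x\<in>A. \<forall>y\<in>B. \<eta> \<le> dist x y) \<longrightarrow> \<mu> A + \<mu> B \<le> \<mu> (A \<union> B))"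

lemma metric_outer_measure_hausdorff: "metric_outer_measure (hausdorff_outer s)"
  unfolding metric_outer_measure_def
  by (intro conjI allI impI hausdorff_outer_empty hausdorff_outer_mono
    hausdorff_outer_countably_subadditive hausdorff_outer_metric) auto

lemma metric_outer_measure_scale:
  assumes "metric_outer_measure \<mu>" shows "metric_outer_measure (\<lambda>A. c * \<mu> A)"
  using assms unfolding metric_outer_measure_def
  by (auto simp: ennreal_suminf_cmult distrib_left[symmetric] intro!: mult_left_mono)

lemma metric_outer_measure_Un:
  assumes "metric_outer_measure \<mu>" shows "\<mu> (A \<union> B) \<le> \<mu> A + \<mu> B"
proof -
  have "\<mu> (\<Union>i. binaryset A B i) \<le> (\<Sum>i. \<mu> (binaryset A B i))"
    using assms unfolding metric_outer_measure_def by blast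
  then show ?thesis using assms
    by (simp add: UN_binaryset_eq suminf_binaryset_eq metric_outer_measure_def)
qed

lemma metric_outer_measure_space:
  "metric_outer_measure \<mu> \<Longrightarrow> outer_measure_space UNIV \<mu>"
  unfolding metric_outer_measure_def outer_measure_space_def positive_def increasing_def
    countably_subadditive_def by auto

text \<open>Caratheodory's criterion. The part \<open>B n\<close> of \<open>X\<close> at distance at least \<open>r n\<close> from \<open>F\<close> is at positive distance from
\<open>F\<close>, so additivity holds for it and \<open>F \<inter> X\<close>. What is left of \<open>X - F\<close> is the union of the shells \<open>R k\<close> with \<open>k \<ge> n\<close>.
Shells of the same parity are at positive distance from each other, so their measures are summable and the
tails vanish in the limit.\<close>

lemma closed_in_lambda_system:
  fixes F :: "'a::metric_space set"
  assumes \<mu>: "metric_outer_measure \<mu>" and F: "closed F"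
  shows "F \<in> lambda_system UNIV UNIV \<mu>"
proof (cases "F = {}")
  case True
  then show ?thesis using \<mu> by (simp add: lambda_system_def metric_outer_measure_def)
next
  case ne: False
  note mono = \<mu>[unfolded metric_outer_measure_def, THEN conjunct2, THEN conjunct1, rule_format]
  note sub = \<mu>[unfolded metric_outer_measure_def, THEN conjunct2, THEN conjunct2, THEN conjunct1, rule_format]
  note metr = \<mu>[unfolded metric_outer_measure_def, THEN conjunct2, THEN conjunct2, THEN conjunct2, rule_format]
  have "\<mu> (F \<inter> X) + \<mu> ((UNIV - F) \<inter> X) = \<mu> X" for X
  proof (rule antisym)
    have "\<mu> X \<le> \<mu> (F \<inter> X \<union> (UNIV - F) \<inter> X)" by (rule mono) auto
    then show "\<mu> X \<le> \<mu> (F \<inter> X) + \<mu> ((UNIV - F) \<inter> X)"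
      using metric_outer_measure_Un[OF \<mu>] order_trans by blast
  next
    show "\<mu> (F \<inter> X) + \<mu> ((UNIV - F) \<inter> X) \<le> \<mu> X"
    proof (cases "\<mu> X = \<infinity>")
      case False
      define r where "r k = 1 / (real k + 1)" for k
      have r: "0 < r k" "r (Suc k) < r k" for k by (auto simp: r_def field_simps)
      have r_anti: "r j \<le> r i" if "i \<le> j" for i j using that by (auto simp: r_def field_simps)
      define R where "R k = {x\<in>X. r (Suc k) \<le> infdist x F \<and> infdist x F < r k}" for k
      define B where "B n = {x\<in>X. r n \<le> infdist x F}" for n
      have gap: "\<mu> P + \<mu> Q \<le> \<mu> (P \<union> Q)"
        if "b < a" "\<And>x. x \<in> P \<Longrightarrow> a \<le> infdist x F" "\<And>x. x \<in> Q \<Longrightarrow> infdist x F \<le> b" for P Q a b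
      proof (rule metr[of "a - b"])
        show "0 < a - b" using that by simp
        fix x y assume "x \<in> P" "y \<in> Q"
        then have "a \<le> infdist x F" "infdist y F \<le> b" using that by auto
        then show "a - b \<le> dist x y" using infdist_triangle[of x F y] by linarith
      qed
      \<comment> \<open>Two shells whose indices differ by 2 are separated by the shell between them.\<close>
      have alt: "(\<Sum>k<N. \<mu> (R (2 * k + j))) \<le> \<mu> (\<Union>k<N. R (2*k + j))" for N j
      proof (induction N)
        case 0 then show ?case by simp
      next
        case (Suc N)
        have "(\<Sum>k<Suc N. \<mu> (R (2 * k + j))) \<le> \<mu> (\<Union>k<N. R (2*k + j)) + \<mu> (R (2 * N + j))"
          using Suc by (auto intro: add_right_mono)
        also have "\<dots> \<le> \<mu> ((\<Union>k<N. R (2*k + j)) \<union> R (2 * N + j))"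
        proof (cases N)
          case 0 then show ?thesis using \<mu> by (simp add: metric_outer_measure_def)
        next
          case (Suc M)
          show ?thesis
          proof (rule gap[where a = "r (2*M + j + 1)" and b = "r (2*N + j)"])
            show "r (2*N+j) < r (2*M+j+1)" by (auto simp: Suc r_def field_simps)
            fix x
            show "x \<in> R (2 * N + j) \<Longrightarrow> infdist x F \<le> r (2 * N + j)" by (simp add: R_def)
            assume "x \<in> (\<Union>k<N. R (2 * k + j))"
            then obtain k where "k \<le> M" "x \<in> R (2 * k + j)" using Suc by (auto simp: less_Suc_eq_le)
            moreover have "r (2*M+j+1) \<le> r (Suc (2*k+j))" by (rule r_anti) (use \<open>k \<le> M\<close> in simp)
            ultimately show "r (2*M+j+1) \<le> infdist x F" by (auto simp: R_def)
          qed
        qed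
        also have "(\<Union>k<N. R (2*k + j)) \<union> R (2 * N + j) = (\<Union>k<Suc N. R (2*k+j))"
          by (auto simp: less_Suc_eq)
        finally show ?case .
      qed
      have alt_le: "(\<Sum>k. \<mu> (R (2 * k + j))) \<le> \<mu> X" for j
        by (rule suminf_le_const[OF summableI]) (rule order_trans[OF alt], rule mono, auto simp: R_def)
      have fin: "(\<Sum>k. \<mu> (R k)) < \<infinity>"
      proof -
        have "(\<Sum>k<n. \<mu> (R k)) \<le> \<mu> X + \<mu> X" for n
        proof -
          have "(\<Sum>k<n. \<mu> (R k)) \<le> (\<Sum>k<2*n. \<mu> (R k))" by (rule sum_mono2) auto
          also have "\<dots> = (\<Sum>k<n. \<mu> (R (2*k+0))) + (\<Sum>k<n. \<mu> (R (2*k+1)))"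
            by (induction n) (auto simp: algebra_simps)
          also have "\<dots> \<le> \<mu> X + \<mu> X"
            by (intro add_mono order_trans[OF sum_le_suminf alt_le]) auto
          finally show ?thesis .
        qed
        then have "(\<Sum>k. \<mu> (R k)) \<le> \<mu> X + \<mu> X" by (intro suminf_le_const) auto
        then show ?thesis by (rule le_less_trans) (use False in \<open>simp add: less_top\<close>)
      qed
      have tail: "(\<lambda>n. \<Sum>k. \<mu> (R (k + n))) \<longlonglongrightarrow> 0"
      proof -
        have s: "summable (\<lambda>k. enn2real (\<mu> (R k)))" and f: "\<mu> (R k) < top" for k
        proof -
          show f: "\<mu> (R k) < top" for k
            using ennreal_suminf_lessD[of "\<lambda>k. \<mu> (R k)" top k] fin by simp
          have "(\<Sum>k. ennreal (enn2real (\<mu> (R k)))) \<noteq> top" using fin f by simp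
          then show "summable (\<lambda>k. enn2real (\<mu> (R k)))" by (rule summable_suminf_not_top[rotated]) auto
        qed
        have "(\<Sum>k. \<mu> (R (k + n))) = ennreal (\<Sum>k. enn2real (\<mu> (R (k + n))))" for n
          using s f summable_ignore_initial_segment[OF s, of n] by (subst suminf_ennreal2[symmetric]) auto
        then have "(\<lambda>n. \<Sum>k. \<mu> (R (k + n))) = (\<lambda>n. ennreal (\<Sum>k. enn2real (\<mu> (R (k + n)))))" by blast
        moreover have "(\<lambda>n. \<Sum>k. enn2real (\<mu> (R (k + n)))) \<longlonglongrightarrow> 0" by (rule suminf_exist_split2[OF s])
        ultimately show ?thesis using tendsto_ennrealI[of "\<lambda>n. \<Sum>k. enn2real (\<mu> (R (k + n)))" 0] by simp
      qed
      have "\<mu> (F \<inter> X) + \<mu> ((UNIV - F) \<inter> X) \<le> \<mu> X + (\<Sum>k. \<mu> (R (k + n)))" for n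
      proof -
        have "(UNIV - F) \<inter> X \<subseteq> B n \<union> (\<Union>k. R (k + n))"
        proof
          fix x assume x: "x \<in> (UNIV - F) \<inter> X"
          then have pos: "0 < infdist x F"
            using F ne by (metis Diff_iff IntE in_closed_iff_infdist_zero infdist_nonneg less_eq_real_def)
          show "x \<in> B n \<union> (\<Union>k. R (k + n))"
          proof (cases "r n \<le> infdist x F")
            case True then show ?thesis using x by (auto simp: B_def)
          next
            case False
            obtain N where "r N < infdist x F" using pos reals_Archimedean[OF pos]
              by (auto simp: r_def inverse_eq_divide add.commute)
            then have ex: "\<exists>m. r m \<le> infdist x F" by (auto intro: less_imp_le)
            define m where "m = (LEAST m. r m \<le> infdist x F)"
            have m: "r m \<le> infdist x F" unfolding m_def using LeastI_ex[OF ex] .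
            have "n < m" using m False r_anti[of m n] by (meson linorder_not_le order_trans)
            then obtain k where k: "m = Suc (k + n)" by (metis add.commute less_imp_Suc_add)
            have "infdist x F < r (k + n)" using not_less_Least[of "k+n" "\<lambda>m. r m \<le> infdist x F"] k
              by (auto simp: m_def[symmetric])
            then have "x \<in> R (k + n)" using m k x by (auto simp: R_def)
            then show ?thesis by blast
          qed
        qed
        then have "\<mu> ((UNIV - F) \<inter> X) \<le> \<mu> (B n) + \<mu> (\<Union>k. R (k + n))"
          using mono metric_outer_measure_Un[OF \<mu>] order_trans by blast
        also have "\<dots> \<le> \<mu> (B n) + (\<Sum>k. \<mu> (R (k + n)))" by (intro add_left_mono sub)
        finally have "\<mu> (F \<inter> X) + \<mu> ((UNIV - F) \<inter> X) \<le> (\<mu> (B n) + \<mu> (F \<inter> X)) + (\<Sum>k. \<mu> (R (k + n)))"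
          by (metis add.assoc add.commute add_left_mono)
        also have "\<mu> (B n) + \<mu> (F \<inter> X) \<le> \<mu> (B n \<union> F \<inter> X)"
          by (rule gap[of 0 "r n"]) (auto simp: r B_def)
        also have "\<dots> \<le> \<mu> X" by (rule mono) (auto simp: B_def)
        finally show ?thesis by (simp add: add_right_mono)
      qed
      moreover have "(\<lambda>n. \<mu> X + (\<Sum>k. \<mu> (R (k + n)))) \<longlonglongrightarrow> \<mu> X + 0"
        by (intro tendsto_add tendsto_const tail)
      ultimately show ?thesis using LIMSEQ_le_const by fastforce
    qed simp
  qed
  then show ?thesis by (simp add: lambda_system_def)
qed

definition outer_measure_measure :: "('a::metric_space set \<Rightarrow> ennreal) \<Rightarrow> 'a measure" where
  "outer_measure_measure \<mu> = measure_of UNIV (lambda_system UNIV UNIV \<mu>) \<mu>"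

text \<open>The \<open>\<sigma>\<close>-algebra of measurable sets comes from Caratheodory's construction; closed sets belong to it by the
criterion above, and null sets always do.\<close>

lemma outer_measure_measure:
  fixes \<mu> :: "'a::metric_space set \<Rightarrow> ennreal"
  assumes "metric_outer_measure \<mu>"
  shows sets_outer_measure_measure: "sets (outer_measure_measure \<mu>) = lambda_system UNIV UNIV \<mu>"
    and space_outer_measure_measure: "space (outer_measure_measure \<mu>) = UNIV"
    and emeasure_outer_measure_measure:
      "\<And>A. A \<in> sets (outer_measure_measure \<mu>) \<Longrightarrow> emeasure (outer_measure_measure \<mu>) A = \<mu> A"
    and borel_le_outer_measure_measure: "sets borel \<subseteq> sets (outer_measure_measure \<mu>)"
    and null_outer_measure_measure: "\<And>N. \<mu> N = 0 \<Longrightarrow> N \<in> null_sets (outer_measure_measure \<mu>)"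
proof -
  interpret sigma_algebra UNIV "UNIV :: 'a set set" using sigma_algebra_Pow[of UNIV] by simp
  have ms: "measure_space UNIV (lambda_system UNIV UNIV \<mu>) \<mu>"
    using caratheodory_lemma[OF metric_outer_measure_space[OF assms]] .
  then interpret L: sigma_algebra UNIV "lambda_system UNIV UNIV \<mu>" by (simp add: measure_space_def)
  show sets: "sets (outer_measure_measure \<mu>) = lambda_system UNIV UNIV \<mu>"
    unfolding outer_measure_measure_def by (rule L.sets_measure_of_eq)
  show "space (outer_measure_measure \<mu>) = UNIV"
    unfolding outer_measure_measure_def by (rule space_measure_of) auto
  show em: "emeasure (outer_measure_measure \<mu>) A = \<mu> A" if "A \<in> sets (outer_measure_measure \<mu>)" for A
    using ms that unfolding sets unfolding outer_measure_measure_def measure_space_def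
    by (intro emeasure_measure_of_sigma) auto
  have "sigma_sets UNIV (Collect closed) \<subseteq> lambda_system UNIV UNIV \<mu>"
    by (rule L.sigma_sets_subset) (auto intro: closed_in_lambda_system[OF assms])
  then show "sets borel \<subseteq> sets (outer_measure_measure \<mu>)" unfolding sets borel_eq_closed by simp
  show "N \<in> null_sets (outer_measure_measure \<mu>)" if N: "\<mu> N = 0" for N
  proof -
    note mono = assms[unfolded metric_outer_measure_def, THEN conjunct2, THEN conjunct1, rule_format]
    have "\<mu> (N \<inter> X) + \<mu> ((UNIV - N) \<inter> X) = \<mu> X" for X
    proof (rule antisym)
      have "\<mu> X \<le> \<mu> (N \<inter> X \<union> (UNIV - N) \<inter> X)" by (rule mono) auto
      then show "\<mu> X \<le> \<mu> (N \<inter> X) + \<mu> ((UNIV - N) \<inter> X)"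
        using metric_outer_measure_Un[OF assms] order_trans by blast
      have "\<mu> (N \<inter> X) \<le> \<mu> N" by (rule mono) auto
      moreover have "\<mu> ((UNIV - N) \<inter> X) \<le> \<mu> X" by (rule mono) auto
      ultimately show "\<mu> (N \<inter> X) + \<mu> ((UNIV - N) \<inter> X) \<le> \<mu> X" using N by simp
    qed
    then have "N \<in> sets (outer_measure_measure \<mu>)" unfolding sets by (simp add: lambda_system_def)
    then show ?thesis using em N by (simp add: null_sets_def)
  qed
qed

lemma surface_measure_eq: "surface_measure = outer_measure_measure surface_outer"
  by (simp add: surface_measure_def outer_measure_measure_def)

lemma surface_outer_scale:
  "surface_outer (A :: (real^'d::finite) set) =
    of_nat (2 * CARD('d)) / hausdorff_outer (CARD('d) - 1) (frontier (cbox 0 1 :: (real^'d) set))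
      * hausdorff_outer (CARD('d) - 1) A"
  unfolding surface_outer_def divide_ennreal_def by (simp add: mult_ac)

lemma metric_outer_measure_surface: "metric_outer_measure (surface_outer :: (real^'d::finite) set \<Rightarrow> ennreal)"
  unfolding surface_outer_scale[abs_def]
  by (intro metric_outer_measure_scale metric_outer_measure_hausdorff)

text \<open>The image of a cover is a cover, with diameters multiplied by at most \<open>L\<close>.\<close>

lemma hausdorff_outer_lipschitz_image:
  fixes f :: "'a::real_normed_vector \<Rightarrow> 'b::real_normed_vector"
  assumes L: "0 < L" and lip: "\<And>x y. x \<in> A \<Longrightarrow> y \<in> A \<Longrightarrow> dist (f x) (f y) \<le> L * dist x y"
  shows "hausdorff_outer s (f ` A) \<le> ennreal (L ^ s) * hausdorff_outer s A"
proof -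
  let ?wa = "\<lambda>C :: 'a set. if C = {} then 0 else ennreal (diameter C ^ s)"
  let ?wb = "\<lambda>C :: 'b set. if C = {} then 0 else ennreal (diameter C ^ s)"
  have Ls: "ennreal (L ^ s) * (ennreal (1 / L ^ s) * x) = x" "ennreal (1 / L ^ s) * (ennreal (L ^ s) * x) = x" for x
    using L by (simp_all add: mult.assoc[symmetric] ennreal_mult[symmetric])
  have "hausdorff_pre s \<delta> (f ` A) \<le> ennreal (L ^ s) * hausdorff_outer s A" if \<delta>: "0 < \<delta>" for \<delta>
  proof -
    have "ennreal (1 / L ^ s) * hausdorff_pre s \<delta> (f ` A) \<le> hausdorff_pre s (\<delta> / L) A"
      unfolding hausdorff_pre_def[of s "\<delta> / L" A]
    proof (rule INF_greatest, clarify)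
      fix C :: "nat \<Rightarrow> 'a set"
      assume cov: "A \<subseteq> (\<Union>i. C i)" and C: "\<forall>i. bounded (C i) \<and> diameter (C i) \<le> \<delta> / L"
      have nn: "0 \<le> diameter (C i)" for i using C by (simp add: diameter_ge_0)
      have d: "dist (f x) (f y) \<le> L * diameter (C i)" if "x \<in> C i \<inter> A" "y \<in> C i \<inter> A" for x y i
      proof -
        have "dist (f x) (f y) \<le> L * dist x y" using lip that by auto
        also have "dist x y \<le> diameter (C i)" using that C by (auto intro: diameter_bounded_bound)
        finally show ?thesis using L by simp
      qed
      have dm: "diameter (f ` (C i \<inter> A)) \<le> L * diameter (C i)" for i
        by (rule diameter_le) (use d[of _ i] nn[of i] L in \<open>auto simp: dist_norm\<close>)
      have bd: "bounded (f ` (C i \<inter> A))" for i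
      proof (cases "C i \<inter> A = {}")
        case False
        then obtain a where "a \<in> C i \<inter> A" by blast
        then show ?thesis using d[of a i] unfolding bounded_def by blast
      qed simp
      have "hausdorff_pre s \<delta> (f ` A) \<le> (\<Sum>i. ?wb (f ` (C i \<inter> A)))"
      proof (rule hausdorff_pre_le)
        show "f ` A \<subseteq> (\<Union>i. f ` (C i \<inter> A))" using cov by blast
        fix i show "bounded (f ` (C i \<inter> A))" by (rule bd)
        have "L * diameter (C i) \<le> \<delta>" using C L by (simp add: field_simps)
        then show "diameter (f ` (C i \<inter> A)) \<le> \<delta>" using dm[of i] by linarith
      qed
      also have "\<dots> \<le> (\<Sum>i. ennreal (L ^ s) * ?wa (C i))"
      proof (rule suminf_le)
        fix i
        have "diameter (f ` (C i \<inter> A)) ^ s \<le> L ^ s * diameter (C i) ^ s"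
          using power_mono[OF dm diameter_ge_0[OF bd], of i s] by (simp add: power_mult_distrib)
        then show "?wb (f ` (C i \<inter> A)) \<le> ennreal (L ^ s) * ?wa (C i)"
          using L nn[of i] by (auto simp: ennreal_mult[symmetric] intro!: ennreal_leI)
      qed auto
      also have "\<dots> = ennreal (L ^ s) * (\<Sum>i. ?wa (C i))" by (rule ennreal_suminf_cmult)
      finally have "ennreal (1 / L ^ s) * hausdorff_pre s \<delta> (f ` A)
          \<le> ennreal (1 / L ^ s) * (ennreal (L ^ s) * (\<Sum>i. ?wa (C i)))"
        by (rule mult_left_mono) auto
      then show "ennreal (1 / L ^ s) * hausdorff_pre s \<delta> (f ` A) \<le> (\<Sum>i. ?wa (C i))" by (simp only: Ls)
    qed
    also have "\<dots> \<le> hausdorff_outer s A" using L \<delta> by (intro hausdorff_pre_le_outer) auto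
    finally have "ennreal (L ^ s) * (ennreal (1 / L ^ s) * hausdorff_pre s \<delta> (f ` A)) \<le> ennreal (L ^ s) * hausdorff_outer s A"
      by (rule mult_left_mono) auto
    then show ?thesis by (simp only: Ls)
  qed
  then show ?thesis unfolding hausdorff_outer_def[of s "f ` A"] by (auto intro!: SUP_least)
qed

lemma hausdorff_outer_isometry_image:
  fixes f :: "'a::real_normed_vector \<Rightarrow> 'b::real_normed_vector"
  assumes "\<And>x y. dist (f x) (f y) = dist x y"
  shows "hausdorff_outer s (f ` A) = hausdorff_outer s A"
proof (rule antisym)
  show "hausdorff_outer s (f ` A) \<le> hausdorff_outer s A"
    using hausdorff_outer_lipschitz_image[of 1 A f s] assms by simp
  have inj: "inj f" by (rule injI) (metis assms dist_eq_0_iff)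
  have "hausdorff_outer s (inv f ` f ` A) \<le> hausdorff_outer s (f ` A)"
    using hausdorff_outer_lipschitz_image[of 1 "f ` A" "inv f" s] assms inj by (force simp: inv_f_f)
  then show "hausdorff_outer s A \<le> hausdorff_outer s (f ` A)"
    using inj by (simp add: image_comp inv_o_cancel)
qed

lemma hausdorff_pre_le_finite:
  assumes G: "finite G" "0 \<le> \<delta>" and "A \<subseteq> (\<Union>g\<in>G. C g)" "\<And>g. g \<in> G \<Longrightarrow> bounded (C g)" "\<And>g. g \<in> G \<Longrightarrow> diameter (C g) \<le> \<delta>"
  shows "hausdorff_pre s \<delta> A \<le> (\<Sum>g\<in>G. ennreal (diameter (C g) ^ s))"
proof -
  obtain h where h: "bij_betw h {0..<card G} G" using ex_bij_betw_nat_finite[OF G(1)] by blast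
  define B where "B i = (if i < card G then C (h i) else {})" for i
  have hG: "h i \<in> G" if "i < card G" for i using h that by (auto simp: bij_betw_def)
  have "(\<Union>g\<in>G. C g) = (\<Union>i. B i)"
    using h unfolding bij_betw_def B_def by (force split: if_splits)
  then have "hausdorff_pre s \<delta> A \<le> (\<Sum>i. if B i = {} then 0 else ennreal (diameter (B i) ^ s))"
    using assms hG by (intro hausdorff_pre_le) (auto simp: B_def)
  also have "\<dots> = (\<Sum>i<card G. if B i = {} then 0 else ennreal (diameter (B i) ^ s))"
    by (rule suminf_finite) (auto simp: B_def)
  also have "\<dots> \<le> (\<Sum>i<card G. ennreal (diameter (C (h i)) ^ s))"
    by (rule sum_mono) (auto simp: B_def)
  also have "\<dots> = (\<Sum>g\<in>G. ennreal (diameter (C g) ^ s))"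
    using sum.reindex_bij_betw[OF h, of "\<lambda>g. ennreal (diameter (C g) ^ s)"] by (simp add: atLeast0LessThan)
  finally show ?thesis .
qed

section \<open>Hausdorff measure on hyperplanes\<close>

definition coord_face :: "'d::finite \<Rightarrow> (real^'d) set" where
  "coord_face i = {x. x $ i = 0 \<and> (\<forall>j. 0 \<le> x $ j \<and> x $ j \<le> 1)}"

lemma diameter_le_coords:
  fixes S :: "(real^'d::finite) set"
  assumes "0 \<le> r" "\<And>x y i. x \<in> S \<Longrightarrow> y \<in> S \<Longrightarrow> \<bar>x $ i - y $ i\<bar> \<le> r"
  shows "bounded S" "diameter S \<le> real CARD('d) * r"
proof -
  have n: "norm (x - y) \<le> real CARD('d) * r" if "x \<in> S" "y \<in> S" for x y
  proof -
    have "norm (x - y) \<le> (\<Sum>i\<in>UNIV. \<bar>(x - y) $ i\<bar>)" by (rule norm_le_l1_cart)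
    also have "\<dots> \<le> (\<Sum>i\<in>(UNIV::'d set). r)" by (rule sum_mono) (use assms that in auto)
    finally show ?thesis by simp
  qed
  then show "diameter S \<le> real CARD('d) * r" using assms(1) by (intro diameter_le) auto
  show "bounded S"
  proof (cases "S = {}")
    case False then obtain a where "a \<in> S" by blast
    then show ?thesis using n[of a] unfolding bounded_def dist_norm by blast
  qed simp
qed

text \<open>Dividing the face into \<open>N\<^sup>d\<^sup>-\<^sup>1\<close> small cubes of side \<open>1 / N\<close> gives covers of bounded weight.\<close>

lemma hausdorff_coord_face_finite:
  "hausdorff_outer (CARD('d) - 1) (coord_face (i0::'d::finite)) < \<infinity>"
proof -
  let ?d = "CARD('d)"
  have "hausdorff_pre (?d - 1) \<delta> (coord_face i0) \<le> ennreal (real ?d ^ (?d - 1))" if \<delta>: "0 < \<delta>" for \<delta>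
  proof -
    obtain N :: nat where N0: "real ?d / \<delta> < real N" using reals_Archimedean2 by blast
    moreover have "0 < real ?d / \<delta>" using \<delta> by simp
    ultimately have "0 < real N" by linarith
    then have N: "real ?d / real N \<le> \<delta>" "0 < N"
      using N0 \<delta> by (auto simp: field_simps)
    define G where "G = (\<Pi>\<^sub>E i\<in>(UNIV::'d set). if i = i0 then {0} else {..<N})"
    define C where "C g = {x::real^'d. x $ i0 = 0 \<and> (\<forall>i. i \<noteq> i0 \<longrightarrow> real (g i) / N \<le> x $ i \<and> x $ i \<le> real (g i + 1) / N)}" for g
    have finG: "finite G" unfolding G_def by (rule finite_PiE) auto
    have cardG: "card G = N ^ (?d - 1)"
    proof -
      have "card G = (\<Prod>i\<in>(UNIV::'d set). card (if i = i0 then {0} else {..<N}))"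
        unfolding G_def by (rule card_PiE) simp
      also have "\<dots> = (\<Prod>i\<in>UNIV - {i0}. card (if i = i0 then {0} else {..<N}))"
        by (subst prod.remove[of _ i0]) auto
      also have "\<dots> = (\<Prod>i\<in>UNIV - {i0}. N)" by (rule prod.cong) auto
      also have "\<dots> = N ^ (?d - 1)" by (simp add: card_Diff_singleton)
      finally show ?thesis .
    qed
    have diamC: "bounded (C g)" "diameter (C g) \<le> real ?d * (1 / N)" for g
    proof -
      have *: "\<bar>x $ i - y $ i\<bar> \<le> 1 / N" if "x \<in> C g" "y \<in> C g" for x y i
      proof (cases "i = i0")
        case False
        then have "x $ i \<le> real (g i) / N + 1 / N" "y $ i \<le> real (g i) / N + 1 / N"
            "real (g i) / N \<le> x $ i" "real (g i) / N \<le> y $ i"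
          using that by (auto simp: C_def add_divide_distrib)
        then show ?thesis by linarith
      qed (use that in \<open>auto simp: C_def\<close>)
      show "bounded (C g)" "diameter (C g) \<le> real ?d * (1 / N)"
        by (rule diameter_le_coords[OF _ *]; simp)+
    qed
    have "coord_face i0 \<subseteq> (\<Union>g\<in>G. C g)"
    proof
      fix x :: "real^'d" assume x: "x \<in> coord_face i0"
      define g where "g i = (if i = i0 then 0 else if x $ i = 1 then N - 1 else nat \<lfloor>real N * x $ i\<rfloor>)" for i
      have "g \<in> G"
      proof -
        have "nat \<lfloor>real N * x $ i\<rfloor> < N" if "x $ i \<noteq> 1" for i
        proof -
          have "x $ i < 1" using x that by (auto simp: coord_face_def less_le)
          then have "real N * x $ i < real N" using N(2) by simp
          then have "\<lfloor>real N * x $ i\<rfloor> < int N" by (simp add: floor_less_iff)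
          then show ?thesis using N(2) by linarith
        qed
        then show ?thesis using N(2) by (auto simp: G_def g_def)
      qed
      moreover have "x \<in> C g"
      proof -
        have "real (g i) / N \<le> x $ i \<and> x $ i \<le> real (g i + 1) / N" if "i \<noteq> i0" for i
        proof (cases "x $ i = 1")
          case True then show ?thesis using N(2) that by (simp add: g_def of_nat_diff field_simps)
        next
          case False
          have "0 \<le> real N * x $ i" using x by (simp add: coord_face_def)
          then have "real (nat \<lfloor>real N * x $ i\<rfloor>) \<le> real N * x $ i" "real N * x $ i \<le> real (nat \<lfloor>real N * x $ i\<rfloor>) + 1"
            by linarith+
          then show ?thesis using False N(2) that by (simp add: g_def field_simps)
        qed
        then show ?thesis using x by (simp add: C_def coord_face_def)
      qed
      ultimately show "x \<in> (\<Union>g\<in>G. C g)" by blast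
    qed
    then have "hausdorff_pre (?d - 1) \<delta> (coord_face i0) \<le> (\<Sum>g\<in>G. ennreal (diameter (C g) ^ (?d - 1)))"
      using finG \<delta> diamC N(1) by (intro hausdorff_pre_le_finite) (auto intro: order_trans)
    also have "\<dots> \<le> (\<Sum>g\<in>G. ennreal ((real ?d * (1 / N)) ^ (?d - 1)))"
      by (intro sum_mono ennreal_leI power_mono diamC diameter_ge_0)
    also have "\<dots> = ennreal (real (card G) * (real ?d * (1 / N)) ^ (?d - 1))"
      by (simp add: ennreal_of_nat_eq_real_of_nat ennreal_mult)
    also have "real (card G) * (real ?d * (1 / N)) ^ (?d - 1) = real ?d ^ (?d - 1)"
      using N(2) by (simp add: cardG power_divide power_mult_distrib)
    finally show ?thesis .
  qed
  then have "hausdorff_outer (?d - 1) (coord_face i0) \<le> ennreal (real ?d ^ (?d - 1))"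
    unfolding hausdorff_outer_def by (auto intro!: SUP_least)
  then show ?thesis by (rule le_less_trans) simp
qed

lemma hausdorff_coord_hyperplane_finite:
  fixes A :: "(real^'d::finite) set"
  assumes "bounded A" "\<And>x. x \<in> A \<Longrightarrow> x $ i0 = 0"
  shows "hausdorff_outer (CARD('d) - 1) A < \<infinity>"
proof -
  obtain M where M: "0 < M" "\<And>x. x \<in> A \<Longrightarrow> norm x \<le> M" using assms(1) bounded_pos by blast
  define c :: "real^'d" where "c = (\<chi> i. if i = i0 then 0 else M)"
  define f where "f x = (2 * M) *\<^sub>R x - c" for x
  have "A \<subseteq> f ` coord_face i0"
  proof
    fix x assume x: "x \<in> A"
    define y where "y = (1 / (2 * M)) *\<^sub>R (x + c)"
    have "\<bar>x $ j\<bar> \<le> M" for j using M(2)[OF x] component_le_norm_cart order_trans by blast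
    then have "- M \<le> x $ j \<and> x $ j \<le> M" for j by (meson abs_le_iff minus_le_iff)
    then have "y \<in> coord_face i0" using assms(2)[OF x] M(1)
      by (auto simp: coord_face_def y_def c_def field_simps) (metis add_mono add.right_inverse order_refl)
    moreover have "x = f y" using M(1) by (simp add: f_def y_def)
    ultimately show "x \<in> f ` coord_face i0" by blast
  qed
  then have "hausdorff_outer (CARD('d) - 1) A \<le> hausdorff_outer (CARD('d) - 1) (f ` coord_face i0)"
    by (rule hausdorff_outer_mono)
  also have "\<dots> \<le> ennreal ((2 * M) ^ (CARD('d) - 1)) * hausdorff_outer (CARD('d) - 1) (coord_face i0)"
  proof (rule hausdorff_outer_lipschitz_image)
    fix x y :: "real^'d"
    have "f x - f y = (2 * M) *\<^sub>R (x - y)" by (simp add: f_def scaleR_diff_right)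
    then show "dist (f x) (f y) \<le> 2 * M * dist x y" using M(1) by (simp add: dist_norm)
  qed (use M in simp)
  also have "\<dots> < \<infinity>" using hausdorff_coord_face_finite[of i0] by (simp add: ennreal_mult_less_top)
  finally show ?thesis .
qed

text \<open>The volume of the cylinder of height 1 over a subset \<open>A\<close> of the hyperplane orthogonal to \<open>v\<close> serves as the
\<open>(d - 1)\<close>-dimensional Lebesgue measure of \<open>A\<close>.\<close>

definition cylinder :: "'a::real_inner \<Rightarrow> 'a set \<Rightarrow> 'a set" where
  "cylinder v A = {z. 0 \<le> z \<bullet> v \<and> z \<bullet> v \<le> 1 \<and> z - (z \<bullet> v) *\<^sub>R v \<in> A}"

lemma cylinder_borel:
  fixes v :: "'a::euclidean_space"
  assumes "A \<in> sets borel" shows "cylinder v A \<in> sets borel"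
proof -
  have "(\<lambda>z. z - (z \<bullet> v) *\<^sub>R v) -` A \<inter> space borel \<in> sets borel"
    by (rule measurable_sets[OF _ assms]) (intro borel_measurable_continuous_onI continuous_intros)
  moreover have "{z. 0 \<le> z \<bullet> v \<and> z \<bullet> v \<le> 1} \<in> sets borel"
    by (intro borel_closed closed_Collect_conj closed_Collect_le continuous_intros)
  ultimately have "{z. 0 \<le> z \<bullet> v \<and> z \<bullet> v \<le> 1} \<inter> ((\<lambda>z. z - (z \<bullet> v) *\<^sub>R v) -` A \<inter> space borel) \<in> sets borel"
    by (rule sets.Int[rotated])
  also have "{z. 0 \<le> z \<bullet> v \<and> z \<bullet> v \<le> 1} \<inter> ((\<lambda>z. z - (z \<bullet> v) *\<^sub>R v) -` A \<inter> space borel) = cylinder v A"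
    by (auto simp: cylinder_def)
  finally show ?thesis .
qed

text \<open>A set of diameter \<open>r\<close> lies under a box whose base is a cube of side \<open>2 r\<close>. So Hausdorff measure
bounds the volume of the cylinder over an arbitrary set, up to enclosure of the cylinder in a Borel set.\<close>

lemma cylinder_coord_outer:
  fixes A :: "(real^'d::finite) set"
  assumes "hausdorff_outer (CARD('d) - 1) A < c"
  obtains B where "B \<in> sets borel" "cylinder (axis i0 1) A \<subseteq> B" "emeasure lborel B \<le> 2 ^ (CARD('d) - 1) * c"
proof -
  let ?s = "CARD('d) - 1"
  let ?w = "\<lambda>C :: (real^'d) set. if C = {} then 0 else ennreal (diameter C ^ ?s)"
  have "hausdorff_pre ?s 1 A < c" using assms hausdorff_pre_le_outer[of 1 ?s A] by simp
  then obtain C where C: "A \<subseteq> (\<Union>i. C i)" "\<And>i. bounded (C i)" "(\<Sum>i. ?w (C i)) < c"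
    unfolding hausdorff_pre_def INF_less_iff by auto
  define p where "p i = (SOME x. x \<in> C i)" for i
  define lo where "lo i = (\<chi> j. if j = i0 then 0 else p i $ j - diameter (C i))" for i
  define hi where "hi i = (\<chi> j. if j = i0 then 1 else p i $ j + diameter (C i))" for i
  define B where "B i = (if C i = {} then {} else cbox (lo i) (hi i))" for i
  show thesis
  proof
    show "(\<Union>i. B i) \<in> sets borel" by (auto simp: B_def)
    show "cylinder (axis i0 1) A \<subseteq> (\<Union>i. B i)"
    proof
      fix z assume z: "z \<in> cylinder (axis i0 1) A"
      then obtain i where i: "z - (z $ i0) *\<^sub>R axis i0 1 \<in> C i" (is "?x \<in> _") using C(1)
        by (auto simp: cylinder_def inner_axis)
      have pi: "p i \<in> C i" unfolding p_def by (rule someI_ex) (use i in blast)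
      have "lo i $ j \<le> z $ j \<and> z $ j \<le> hi i $ j" for j
      proof (cases "j = i0")
        case True then show ?thesis using z by (auto simp: lo_def hi_def cylinder_def inner_axis)
      next
        case False
        have "\<bar>(?x - p i) $ j\<bar> \<le> norm (?x - p i)" by (rule component_le_norm_cart)
        also have "\<dots> \<le> diameter (C i)" using diameter_bounded_bound[OF C(2) i pi] by (simp add: dist_norm)
        finally show ?thesis using False by (simp add: lo_def hi_def axis_def abs_le_iff)
      qed
      then have "z \<in> B i" using i by (auto simp: B_def mem_box_cart)
      then show "z \<in> (\<Union>i. B i)" by blast
    qed
    have emB: "emeasure lborel (B i) \<le> 2 ^ ?s * ?w (C i)" for i
    proof (cases "C i = {}")
      case False
      have d0: "0 \<le> diameter (C i)" using C(2) by (rule diameter_ge_0)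
      have "lo i \<in> cbox (lo i) (hi i)" using d0 by (auto simp: mem_box_cart lo_def hi_def)
      then have ne: "cbox (lo i) (hi i) \<noteq> {}" by blast
      have "measure lborel (B i) = (\<Prod>j\<in>UNIV. hi i $ j - lo i $ j)"
        using False content_cbox_cart[OF ne] by (simp add: B_def)
      also have "\<dots> = (\<Prod>j\<in>UNIV - {i0}. hi i $ j - lo i $ j)"
        by (subst prod.remove[of _ i0]) (auto simp: hi_def lo_def)
      also have "\<dots> = (\<Prod>j\<in>UNIV - {i0}. 2 * diameter (C i))" by (rule prod.cong) (auto simp: hi_def lo_def)
      also have "\<dots> = (2 * diameter (C i)) ^ ?s" by (simp add: card_Diff_singleton)
      finally have m: "measure lborel (B i) = (2 * diameter (C i)) ^ ?s" .
      have "emeasure lborel (B i) = ennreal ((2 * diameter (C i)) ^ ?s)"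
        unfolding m[symmetric] using False
        by (intro emeasure_eq_ennreal_measure) (simp add: B_def emeasure_lborel_cbox_eq)
      also have "\<dots> = 2 ^ ?s * ?w (C i)" using False d0
        by (simp add: power_mult_distrib ennreal_mult ennreal_power[symmetric])
      finally show ?thesis by simp
    qed (simp add: B_def)
    have "emeasure lborel (\<Union>i. B i) \<le> (\<Sum>i. emeasure lborel (B i))"
      by (rule emeasure_subadditive_countably) (auto simp: B_def)
    also have "\<dots> \<le> (\<Sum>i. 2 ^ ?s * ?w (C i))" by (rule suminf_le[OF emB]) auto
    also have "\<dots> = 2 ^ ?s * (\<Sum>i. ?w (C i))" by (rule ennreal_suminf_cmult)
    also have "\<dots> \<le> 2 ^ ?s * c" using C(3) by (intro mult_left_mono) auto
    finally show "emeasure lborel (\<Union>i. B i) \<le> 2 ^ ?s * c" .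
  qed
qed

lemma borel_measurable_orthogonal:
  fixes f :: "real^'d::finite \<Rightarrow> real^'d"
  assumes "orthogonal_transformation f" shows "f \<in> borel_measurable borel"
proof (rule borel_measurable_continuous_onI)
  have "bounded_linear f"
    using orthogonal_transformation_linear[OF assms] by (simp add: linear_conv_bounded_linear)
  then show "continuous_on UNIV f" by (rule linear_continuous_on)
qed

lemma nn_integral_lborel_translate:
  fixes f :: "'a::euclidean_space \<Rightarrow> ennreal"
  assumes [measurable]: "f \<in> borel_measurable borel"
  shows "(\<integral>\<^sup>+z. f (x + z) \<partial>lborel) = (\<integral>\<^sup>+z. f z \<partial>lborel)"
proof -
  have "(\<integral>\<^sup>+z. f z \<partial>lborel) = (\<integral>\<^sup>+z. f z \<partial>distr lborel borel ((+) x))" by (simp add: lborel_distr_plus)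
  then show ?thesis by (simp add: nn_integral_distr)
qed

lemma nn_integral_lborel_reflect:
  fixes f :: "'a::euclidean_space \<Rightarrow> ennreal"
  assumes [measurable]: "f \<in> borel_measurable borel"
  shows "(\<integral>\<^sup>+z. f (x - z) \<partial>lborel) = (\<integral>\<^sup>+z. f z \<partial>lborel)"
proof -
  have "lborel = distr lborel borel (\<lambda>z. x - z)" using lborel_affine[of "-1" x] by (simp add: density_1)
  then have "(\<integral>\<^sup>+z. f z \<partial>lborel) = (\<integral>\<^sup>+z. f z \<partial>distr lborel borel (\<lambda>z. x - z))" by simp
  then show ?thesis by (simp add: nn_integral_distr)
qed

text \<open>Uniqueness of Haar measure, in its elementary form: for translation invariant \<open>\<mu>\<close>, evaluating
\<open>\<integral> \<integral> 1\<^sub>A(x) 1\<^sub>B(x + y) dy d\<mu>(x)\<close> in both orders gives \<open>\<mu>(A) \<lambda>(B) = \<mu>(B) \<lambda>(A)\<close>. With a ball for \<open>B\<close>, which the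
orthogonal map preserves, the constant is 1.\<close>

lemma distr_lborel_orthogonal:
  fixes f :: "real^'d::finite \<Rightarrow> real^'d"
  assumes f: "orthogonal_transformation f"
  shows "distr lborel borel f = lborel"
proof -
  define \<mu> where "\<mu> = distr lborel borel f"
  have fm[measurable]: "f \<in> borel_measurable borel" by (rule borel_measurable_orthogonal[OF f])
  have s\<mu>[measurable_cong]: "sets \<mu> = sets borel" and sp: "space \<mu> = UNIV" by (simp_all add: \<mu>_def)
  have ball: "emeasure \<mu> (cball 0 r) = emeasure lborel (cball 0 r :: (real^'d) set)" for r
  proof -
    have "f -` cball 0 r = cball 0 r"
      using f by (auto simp: orthogonal_transformation_norm)
    then show ?thesis by (simp add: \<mu>_def emeasure_distr)
  qed
  have fin: "emeasure lborel (cball 0 r :: (real^'d) set) < \<infinity>" for r :: real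
    by (rule emeasure_bounded_finite) simp
  interpret \<mu>: sigma_finite_measure \<mu>
  proof (rule sigma_finite_measure.intro, intro exI conjI)
    show "countable (range (\<lambda>n. cball 0 (real n) :: (real^'d) set))" by simp
    show "range (\<lambda>n. cball 0 (real n) :: (real^'d) set) \<subseteq> sets \<mu>" by (auto simp: s\<mu>)
    show "\<Union> (range (\<lambda>n. cball 0 (real n) :: (real^'d) set)) = space \<mu>"
      unfolding sp using real_arch_simple by (auto simp: dist_norm)
    show "\<forall>a\<in>range (\<lambda>n. cball 0 (real n) :: (real^'d) set). emeasure \<mu> a \<noteq> \<infinity>"
      using fin by (auto simp: ball less_top)
  qed
  interpret pair_sigma_finite \<mu> lborel ..
  have trans: "(\<integral>\<^sup>+x. g (x - w) \<partial>\<mu>) = (\<integral>\<^sup>+x. g x \<partial>\<mu>)"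
    if g[measurable]: "g \<in> borel_measurable borel" for g :: "real^'d \<Rightarrow> ennreal" and w
  proof -
    obtain v where v: "f v = - w" using orthogonal_transformation_surj[OF f] by (metis surjD)
    have "f (v + z) = f z - w" for z
      using orthogonal_transformation_linear[OF f] v by (simp add: linear_add)
    then have "(\<integral>\<^sup>+x. g (x - w) \<partial>\<mu>) = (\<integral>\<^sup>+z. g (f (v + z)) \<partial>lborel)"
      by (simp add: \<mu>_def nn_integral_distr)
    also have "\<dots> = (\<integral>\<^sup>+z. g (f z) \<partial>lborel)" by (rule nn_integral_lborel_translate) measurable
    finally show ?thesis by (simp add: \<mu>_def nn_integral_distr)
  qed
  have "\<mu> = lborel"
  proof (rule measure_eqI)
    fix A assume "A \<in> sets \<mu>"
    then have A[measurable]: "A \<in> sets borel" by (simp add: s\<mu>)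
    define B :: "(real^'d) set" where "B = cball 0 1"
    have B[measurable]: "B \<in> sets borel" by (simp add: B_def)
    have "emeasure \<mu> A * emeasure lborel B = (\<integral>\<^sup>+x. indicator A x * emeasure lborel B \<partial>\<mu>)"
      by (subst nn_integral_multc) (auto simp: s\<mu>)
    also have "\<dots> = (\<integral>\<^sup>+x. indicator A x * (\<integral>\<^sup>+y. indicator B (x + y) \<partial>lborel) \<partial>\<mu>)"
      by (subst nn_integral_lborel_translate) auto
    also have "\<dots> = (\<integral>\<^sup>+x. \<integral>\<^sup>+y. indicator A x * indicator B (x + y) \<partial>lborel \<partial>\<mu>)"
      by (subst nn_integral_cmult) auto
    also have "\<dots> = (\<integral>\<^sup>+y. \<integral>\<^sup>+x. indicator A x * indicator B (x + y) \<partial>\<mu> \<partial>lborel)"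
      by (rule Fubini'[symmetric]) measurable
    also have "\<dots> = (\<integral>\<^sup>+y. \<integral>\<^sup>+x. indicator A (x - y) * indicator B x \<partial>\<mu> \<partial>lborel)"
    proof (rule nn_integral_cong)
      fix y
      show "(\<integral>\<^sup>+x. indicator A x * indicator B (x + y) \<partial>\<mu>) = (\<integral>\<^sup>+x. indicator A (x - y) * indicator B x \<partial>\<mu>)"
        using trans[of "\<lambda>x. indicator A x * indicator B (x + y)" y] by simp
    qed
    also have "\<dots> = (\<integral>\<^sup>+x. \<integral>\<^sup>+y. indicator A (x - y) * indicator B x \<partial>lborel \<partial>\<mu>)"
      by (rule Fubini') measurable
    also have "\<dots> = (\<integral>\<^sup>+x. indicator B x * emeasure lborel A \<partial>\<mu>)"
      by (subst nn_integral_multc) (simp_all add: nn_integral_lborel_reflect mult.commute)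
    also have "\<dots> = emeasure \<mu> B * emeasure lborel A"
      by (subst nn_integral_multc) (auto simp: s\<mu>)
    finally have eq: "emeasure \<mu> A * emeasure lborel B = emeasure lborel A * emeasure lborel B"
      by (simp add: B_def ball mult.commute)
    have "emeasure lborel (ball 0 1 :: (real^'d) set) \<noteq> 0"
      using open_not_negligible[of "ball 0 (1::real) :: (real^'d) set"] negligible_iff_null_sets[of "ball 0 1 :: (real^'d) set"]
      by (auto simp: null_sets_def)
    moreover have "emeasure lborel (ball 0 1 :: (real^'d) set) \<le> emeasure lborel B"
      unfolding B_def by (rule emeasure_mono) auto
    ultimately have "emeasure lborel B \<noteq> 0" by auto
    moreover have "emeasure lborel B \<noteq> \<infinity>" using fin[of 1] by (simp add: B_def less_top)
    ultimately show "emeasure \<mu> A = emeasure lborel A"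
      using eq by (metis ennreal_mult_divide_eq infinity_ennreal_def mult_divide_eq_ennreal)
  qed (simp add: s\<mu>)
  then show ?thesis by (simp add: \<mu>_def)
qed

lemma emeasure_vimage_orthogonal:
  fixes f :: "real^'d::finite \<Rightarrow> real^'d"
  assumes f: "orthogonal_transformation f" and A: "A \<in> sets borel"
  shows "f -` A \<in> sets borel" "emeasure lborel (f -` A) = emeasure lborel A"
proof -
  have fm: "f \<in> borel_measurable borel" by (rule borel_measurable_orthogonal[OF f])
  show "f -` A \<in> sets borel" using measurable_sets_borel[OF fm A] .
  have "emeasure lborel A = emeasure (distr lborel borel f) A" by (simp add: distr_lborel_orthogonal[OF f])
  then show "emeasure lborel (f -` A) = emeasure lborel A" using fm A by (simp add: emeasure_distr)
qed

lemma cylinder_vimage_orthogonal: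
  assumes f: "orthogonal_transformation f"
  shows "f -` cylinder (f e) A = cylinder e (f -` A)"
proof -
  have "f (z - (z \<bullet> e) *\<^sub>R e) = f z - (z \<bullet> e) *\<^sub>R f e" for z
    using orthogonal_transformation_linear[OF f] by (simp add: linear_diff linear_scale)
  then show ?thesis using f by (auto simp: cylinder_def orthogonal_transformation_def)
qed

lemma hausdorff_outer_vimage_orthogonal:
  fixes f :: "real^'d::finite \<Rightarrow> real^'d"
  assumes f: "orthogonal_transformation f"
  shows "hausdorff_outer s (f -` A) = hausdorff_outer s A"
proof -
  have "f ` (f -` A) = A" using orthogonal_transformation_surj[OF f] by simp
  moreover have "hausdorff_outer s (f ` (f -` A)) = hausdorff_outer s (f -` A)"
    by (rule hausdorff_outer_isometry_image)
      (metis f orthogonal_transformation_isometry)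
  ultimately show ?thesis by simp
qed

lemma cylinder_coord_face: "cylinder (axis i 1) (coord_face i) = cbox 0 (1 :: real^'d::finite)"
proof -
  have "(x - (x $ i) *\<^sub>R axis i 1) $ j = (if j = i then 0 else x $ j)" for x :: "real^'d" and j
    by (simp add: axis_def)
  then show ?thesis
    by (simp add: cylinder_def coord_face_def mem_box_cart inner_axis set_eq_iff del: vector_minus_component) metis
qed

lemma emeasure_unit_cube: "emeasure lborel (cbox 0 (1 :: real^'d::finite)) = 1" "emeasure lborel (box 0 (1 :: real^'d)) = 1"
proof -
  have "(\<Prod>b\<in>Basis. (1 :: real^'d) \<bullet> b) = 1" by (rule prod.neutral) (auto simp: Basis_vec_def inner_axis)
  moreover have "\<forall>b\<in>Basis. 0 \<le> (1 :: real^'d) \<bullet> b" by (auto simp: Basis_vec_def inner_axis)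
  ultimately show "emeasure lborel (cbox 0 (1 :: real^'d)) = 1" "emeasure lborel (box 0 (1 :: real^'d)) = 1"
    by (simp_all add: emeasure_lborel_cbox_eq emeasure_lborel_box_eq)
qed

text \<open>The same Fubini argument as for Haar measure, with one factor replaced: \<open>N\<close> is Hausdorff measure restricted to
the hyperplane, which is invariant under translations along the hyperplane, while the other factor is
\<open>d\<close>-dimensional Lebesgue measure. Evaluating
\<open>\<integral> \<integral> 1\<^sub>A(x) 1\<^bsub>cyl Q\<^esub>(x + y) dy dN(x)\<close> in both orders, where \<open>Q\<close> is the unit face, compares \<open>A\<close> with \<open>Q\<close>. In
the second order \<open>y\<close> is split into its component along \<open>e\<close>, which only enters through the height of the cylinder,
and its projection \<open>pr y\<close>, which is absorbed by a translation.\<close>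

lemma hausdorff_coord_hyperplane:
  fixes A :: "(real^'d::finite) set"
  assumes A: "A \<in> sets borel" and AP: "\<And>x. x \<in> A \<Longrightarrow> x $ i0 = 0"
  shows "hausdorff_outer (CARD('d) - 1) A
    = hausdorff_outer (CARD('d) - 1) (coord_face i0) * emeasure lborel (cylinder (axis i0 1) A)"
proof -
  define H :: "(real^'d) set \<Rightarrow> ennreal" where "H = hausdorff_outer (CARD('d) - 1)"
  define e :: "real^'d" where "e = axis i0 1"
  define P where "P = {x :: real^'d. x \<bullet> e = 0}"
  define pr where "pr z = z - (z \<bullet> e) *\<^sub>R e" for z
  define Q :: "(real^'d) set" where "Q = coord_face i0"
  have ee: "e \<bullet> e = 1" by (simp add: e_def inner_axis)
  have xe: "x \<bullet> e = x $ i0" for x by (simp add: e_def inner_axis)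
  note mo = metric_outer_measure_hausdorff[of "CARD('d) - 1", where ?'a = "real^'d", folded H_def]
  define M where "M = distr (outer_measure_measure H) borel (\<lambda>x. x)"
  have idm: "(\<lambda>x. x) \<in> measurable (outer_measure_measure H) borel"
    using borel_le_outer_measure_measure[OF mo]
    by (auto intro!: measurableI simp: space_outer_measure_measure[OF mo])
  have emM: "emeasure M X = H X" if "X \<in> sets borel" for X
    using that idm borel_le_outer_measure_measure[OF mo]
    by (auto simp: M_def emeasure_distr space_outer_measure_measure[OF mo] intro!: emeasure_outer_measure_measure[OF mo])
  have P: "P \<in> sets borel" unfolding P_def by (intro borel_closed closed_Collect_eq continuous_intros)
  define N where "N = density M (indicator P)"
  have sN[measurable_cong]: "sets N = sets borel" by (simp add: N_def M_def)
  have spN: "space N = UNIV" by (simp add: N_def M_def)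
  have emN: "emeasure N X = H (P \<inter> X)" if "X \<in> sets borel" for X
    unfolding N_def using P that
    by (subst emeasure_restricted) (auto simp: M_def[symmetric] emM, simp_all add: M_def)
  interpret N: sigma_finite_measure N
  proof (rule sigma_finite_measure.intro, intro exI conjI)
    show "countable (range (\<lambda>n. cball 0 (real n) :: (real^'d) set))" by simp
    show "range (\<lambda>n. cball 0 (real n) :: (real^'d) set) \<subseteq> sets N" by (auto simp: sN)
    show "\<Union> (range (\<lambda>n. cball 0 (real n) :: (real^'d) set)) = space N"
      unfolding spN using real_arch_simple by (auto simp: dist_norm)
    show "\<forall>a\<in>range (\<lambda>n. cball 0 (real n) :: (real^'d) set). emeasure N a \<noteq> \<infinity>"
    proof clarify
      fix n :: nat assume "emeasure N (cball 0 (real n)) = \<infinity>"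
      moreover have "H (P \<inter> cball 0 (real n)) < \<infinity>" unfolding H_def
        by (rule hausdorff_coord_hyperplane_finite[of _ i0]) (auto simp: P_def xe intro: bounded_subset[OF bounded_cball])
      ultimately show False by (simp add: emN)
    qed
  qed
  interpret pair_sigma_finite N lborel ..
  \<comment> \<open>Outside the hyperplane \<open>N\<close> vanishes, so \<open>x \<bullet> e = 0\<close> may be used under the integral.\<close>
  have AEP: "AE x in N. x \<in> P"
  proof (rule AE_I[of _ _ "- P"])
    show "emeasure N (- P) = 0" using P hausdorff_outer_empty by (simp add: emN H_def)
  qed (use P in \<open>auto simp: sN\<close>)
  have trans: "(\<integral>\<^sup>+x. g (x + w) \<partial>N) = (\<integral>\<^sup>+x. g x \<partial>N)"
    if w: "w \<in> P" and g[measurable]: "g \<in> borel_measurable borel" for g :: "real^'d \<Rightarrow> ennreal" and w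
  proof -
    have "distr N borel (\<lambda>x. x + w) = N"
    proof (rule measure_eqI)
      fix X assume "X \<in> sets (distr N borel (\<lambda>x. x + w))"
      then have X: "X \<in> sets borel" by simp
      have m: "(\<lambda>x. x + w) \<in> borel_measurable borel" by simp
      have V: "(\<lambda>x. x + w) -` X \<in> sets borel" by (rule measurable_sets_borel[OF m X])
      have "emeasure (distr N borel (\<lambda>x. x + w)) X = H (P \<inter> (\<lambda>x. x + w) -` X)"
        using X V by (simp add: emeasure_distr spN emN)
      also have "\<dots> = H ((\<lambda>x. x + w) ` (P \<inter> (\<lambda>x. x + w) -` X))"
        unfolding H_def by (rule hausdorff_outer_isometry_image[symmetric]) (simp add: dist_norm)
      also have "(\<lambda>x. x + w) ` (P \<inter> (\<lambda>x. x + w) -` X) = P \<inter> X"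
      proof
        show "P \<inter> X \<subseteq> (\<lambda>x. x + w) ` (P \<inter> (\<lambda>x. x + w) -` X)"
        proof
          fix x assume "x \<in> P \<inter> X"
          then have "x = (x - w) + w" "x - w \<in> P \<inter> (\<lambda>x. x + w) -` X" using w by (auto simp: P_def inner_diff_left)
          then show "x \<in> (\<lambda>x. x + w) ` (P \<inter> (\<lambda>x. x + w) -` X)" by (rule image_eqI)
        qed
      qed (use w in \<open>auto simp: P_def inner_add_left\<close>)
      finally show "emeasure (distr N borel (\<lambda>x. x + w)) X = emeasure N X" using X by (simp add: emN)
    qed (simp add: sN)
    then have "(\<integral>\<^sup>+x. g x \<partial>N) = (\<integral>\<^sup>+x. g x \<partial>distr N borel (\<lambda>x. x + w))" by simp
    also have "\<dots> = (\<integral>\<^sup>+x. g (x + w) \<partial>N)" by (rule nn_integral_distr) measurable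
    finally show ?thesis by simp
  qed
  note [measurable] = A
  have Qm[measurable]: "Q \<in> sets borel"
  proof -
    have "Q = cbox 0 1 \<inter> P" by (auto simp: Q_def coord_face_def P_def xe mem_box_cart)
    then show ?thesis using P by simp
  qed
  have cyl[measurable]: "cylinder e A \<in> sets borel" "cylinder e Q \<in> sets borel"
    by (simp_all add: cylinder_borel)
  let ?I = "indicator {0..1::real} :: real \<Rightarrow> ennreal"
  have "emeasure N A * emeasure lborel (cylinder e Q)
      = (\<integral>\<^sup>+x. indicator A x * emeasure lborel (cylinder e Q) \<partial>N)"
    by (subst nn_integral_multc) (auto simp: sN)
  also have "\<dots> = (\<integral>\<^sup>+x. indicator A x * (\<integral>\<^sup>+y. indicator (cylinder e Q) (x + y) \<partial>lborel) \<partial>N)"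
    by (subst nn_integral_lborel_translate) auto
  also have "\<dots> = (\<integral>\<^sup>+x. \<integral>\<^sup>+y. indicator A x * indicator (cylinder e Q) (x + y) \<partial>lborel \<partial>N)"
    by (subst nn_integral_cmult) auto
  also have "\<dots> = (\<integral>\<^sup>+y. \<integral>\<^sup>+x. indicator A x * indicator (cylinder e Q) (x + y) \<partial>N \<partial>lborel)"
    by (rule Fubini'[symmetric]) measurable
  also have "\<dots> = (\<integral>\<^sup>+y. \<integral>\<^sup>+x. indicator A (x - pr y) * (indicator Q x * ?I (y \<bullet> e)) \<partial>N \<partial>lborel)"
  proof (rule nn_integral_cong)
    fix y
    have w: "- pr y \<in> P" by (simp add: P_def pr_def inner_diff_left ee)
    have "(\<integral>\<^sup>+x. indicator A x * indicator (cylinder e Q) (x + y) \<partial>N)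
        = (\<integral>\<^sup>+x. indicator A (x + - pr y) * indicator (cylinder e Q) (x + - pr y + y) \<partial>N)"
      by (rule trans[OF w, symmetric]) measurable
    also have "\<dots> = (\<integral>\<^sup>+x. indicator A (x - pr y) * (indicator Q x * ?I (y \<bullet> e)) \<partial>N)"
    proof (rule nn_integral_cong_AE, rule AE_mp[OF AEP], rule AE_I2, rule impI)
      fix x assume "x \<in> P"
      then have x: "x \<bullet> e = 0" by (simp add: P_def)
      have "x - pr y + y = x + (y \<bullet> e) *\<^sub>R e" by (simp add: pr_def)
      moreover have "indicator (cylinder e Q) (x + (y \<bullet> e) *\<^sub>R e) = indicator Q x * ?I (y \<bullet> e)"
        by (auto simp: cylinder_def inner_add_left x ee indicator_def)
      ultimately show "indicator A (x + - pr y) * indicator (cylinder e Q) (x + - pr y + y)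
          = indicator A (x - pr y) * (indicator Q x * ?I (y \<bullet> e))" by (simp only: add_uminus_conv_diff)
    qed
    finally show "(\<integral>\<^sup>+x. indicator A x * indicator (cylinder e Q) (x + y) \<partial>N)
        = (\<integral>\<^sup>+x. indicator A (x - pr y) * (indicator Q x * ?I (y \<bullet> e)) \<partial>N)" .
  qed
  also have "\<dots> = (\<integral>\<^sup>+x. \<integral>\<^sup>+y. indicator A (x - pr y) * (indicator Q x * ?I (y \<bullet> e)) \<partial>lborel \<partial>N)"
    by (rule Fubini') (unfold pr_def, measurable)
  also have "\<dots> = (\<integral>\<^sup>+x. indicator Q x * emeasure lborel (cylinder e A) \<partial>N)"
  proof (rule nn_integral_cong_AE, rule AE_mp[OF AEP], rule AE_I2, rule impI)
    fix x assume "x \<in> P"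
    then have x: "x \<bullet> e = 0" by (simp add: P_def)
    have "(\<integral>\<^sup>+y. indicator A (x - pr y) * (indicator Q x * ?I (y \<bullet> e)) \<partial>lborel)
        = indicator Q x * (\<integral>\<^sup>+y. indicator (cylinder e A) ((x + e) - y) \<partial>lborel)"
      (is "_ = _ * ?r")
    proof -
      have "indicator A (x - pr y) * (indicator Q x * ?I (y \<bullet> e)) = indicator Q x * indicator (cylinder e A) ((x + e) - y)" for y
      proof -
        have "(x + e - y) - ((x + e - y) \<bullet> e) *\<^sub>R e = x - pr y"
          by (simp add: pr_def x ee inner_diff_left inner_add_left scaleR_diff_left del: diff_add_eq add_diff_eq)
        moreover have "(x + e - y) \<bullet> e = 1 - y \<bullet> e" by (simp add: x ee inner_diff_left inner_add_left)
        ultimately have "x + e - y \<in> cylinder e A \<longleftrightarrow> 0 \<le> 1 - y \<bullet> e \<and> 1 - y \<bullet> e \<le> 1 \<and> x - pr y \<in> A"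
          unfolding cylinder_def mem_Collect_eq by (simp only:)
        then have "indicator (cylinder e A) ((x + e) - y) = indicator A (x - pr y) * ?I (y \<bullet> e)"
          by (auto simp: indicator_def)
        then show ?thesis by (simp add: mult_ac)
      qed
      then show ?thesis by (simp add: nn_integral_cmult)
    qed
    also have "?r = emeasure lborel (cylinder e A)" by (subst nn_integral_lborel_reflect) auto
    finally show "(\<integral>\<^sup>+y. indicator A (x - pr y) * (indicator Q x * ?I (y \<bullet> e)) \<partial>lborel)
        = indicator Q x * emeasure lborel (cylinder e A)" .
  qed
  also have "\<dots> = emeasure N Q * emeasure lborel (cylinder e A)"
    by (subst nn_integral_multc) (auto simp: sN)
  finally have "emeasure N A * emeasure lborel (cylinder e Q) = emeasure N Q * emeasure lborel (cylinder e A)" .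
  moreover have "emeasure lborel (cylinder e Q) = 1"
    unfolding e_def Q_def cylinder_coord_face by (rule emeasure_unit_cube)
  moreover have "P \<inter> A = A" "P \<inter> Q = Q" using AP by (auto simp: P_def xe Q_def coord_face_def)
  ultimately have "H A = H Q * emeasure lborel (cylinder e A)" using emN[OF A] emN[OF Qm] by simp
  then show ?thesis by (simp add: H_def Q_def e_def)
qed

text \<open>The unit cube is the cylinder over its face. If the face had measure less than \<open>2\<^sup>-\<^sup>d\<close>, the cylinder would be
covered by boxes of total volume at most \<open>1 / 2\<close>.\<close>

lemma hausdorff_coord_face_pos: "hausdorff_outer (CARD('d) - 1) (coord_face (i0::'d::finite)) \<noteq> 0"
proof
  let ?n = "CARD('d) - 1"
  have half: "2 ^ n * (1 / 2 ^ Suc n :: real) = 1 / 2" for n by simp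
  assume "hausdorff_outer ?n (coord_face i0) = 0"
  then have "hausdorff_outer ?n (coord_face i0) < ennreal (1 / 2 ^ Suc ?n)" by simp
  from cylinder_coord_outer[OF this, of i0] obtain B
    where B: "B \<in> sets borel" "cylinder (axis i0 1) (coord_face i0) \<subseteq> B"
      "emeasure lborel B \<le> 2 ^ ?n * ennreal (1 / 2 ^ Suc ?n)" by blast
  have "1 \<le> emeasure lborel B"
    using emeasure_mono[OF B(2), of lborel] B(1) by (simp add: cylinder_coord_face emeasure_unit_cube)
  also note B(3)
  also have "2 ^ ?n * ennreal (1 / 2 ^ Suc ?n) = ennreal (2 ^ ?n * (1 / 2 ^ Suc ?n))"
    using ennreal_mult'[of "1 / 2 ^ Suc ?n" "2 ^ ?n"] ennreal_power[of 2 ?n] by (simp add: mult.commute del: power_Suc)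
  also have "2 ^ ?n * (1 / 2 ^ Suc ?n :: real) = 1 / 2" by (rule half)
  finally have "ennreal 1 \<le> ennreal (1 / 2)" by (simp only: ennreal_1)
  then show False by (subst (asm) ennreal_le_iff) auto
qed

text \<open>Every hyperplane is the image of a coordinate hyperplane under an orthogonal map, which preserves both
sides; therefore the constant is the same for all directions.\<close>

lemma hausdorff_hyperplane:
  obtains c where "c \<noteq> 0" "c < \<infinity>"
    "\<And>\<nu> (A :: (real^'d::finite) set). norm \<nu> = 1 \<Longrightarrow> A \<in> sets borel \<Longrightarrow> (\<And>x. x \<in> A \<Longrightarrow> x \<bullet> \<nu> = 0) \<Longrightarrow>
       hausdorff_outer (CARD('d) - 1) A = c * emeasure lborel (cylinder \<nu> A)"
proof
  let ?i = "undefined :: 'd"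
  let ?c = "hausdorff_outer (CARD('d) - 1) (coord_face ?i)"
  show "?c \<noteq> 0" by (rule hausdorff_coord_face_pos)
  show "?c < \<infinity>" by (rule hausdorff_coord_face_finite)
  fix \<nu> and A :: "(real^'d) set"
  assume \<nu>: "norm \<nu> = 1" and A: "A \<in> sets borel" and perp: "\<And>x. x \<in> A \<Longrightarrow> x \<bullet> \<nu> = 0"
  obtain f :: "real^'d \<Rightarrow> real^'d" where f: "orthogonal_transformation f" and fe: "f (axis ?i 1) = \<nu>"
  proof (rule orthogonal_transformation_exists[of "axis ?i 1 :: real^'d" \<nu>])
    show "norm (axis ?i 1 :: real^'d) = norm \<nu>" using \<nu> by (simp add: norm_axis_1)
  qed blast
  have "hausdorff_outer (CARD('d) - 1) A = hausdorff_outer (CARD('d) - 1) (f -` A)"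
    by (simp add: hausdorff_outer_vimage_orthogonal[OF f])
  also have "\<dots> = ?c * emeasure lborel (cylinder (axis ?i 1) (f -` A))"
  proof (rule hausdorff_coord_hyperplane)
    show "f -` A \<in> sets borel" by (rule emeasure_vimage_orthogonal(1)[OF f A])
    fix x assume "x \<in> f -` A"
    then have "f x \<bullet> f (axis ?i 1) = 0" using perp fe by simp
    then show "x $ ?i = 0" using f by (simp add: orthogonal_transformation_def inner_axis)
  qed
  also have "cylinder (axis ?i 1) (f -` A) = f -` cylinder \<nu> A"
    using cylinder_vimage_orthogonal[OF f, of "axis ?i 1" A] fe by simp
  also have "emeasure lborel (f -` cylinder \<nu> A) = emeasure lborel (cylinder \<nu> A)"
    by (rule emeasure_vimage_orthogonal(2)[OF f cylinder_borel[OF A]])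
  finally show "hausdorff_outer (CARD('d) - 1) A = ?c * emeasure lborel (cylinder \<nu> A)" .
qed

text \<open>For a null set that need not be Borel, the cylinder is enclosed in Borel sets of arbitrarily small volume.\<close>

lemma hausdorff_null_cylinder:
  fixes A :: "(real^'d::finite) set"
  assumes \<nu>: "norm \<nu> = 1" and A: "hausdorff_outer (CARD('d) - 1) A = 0"
  obtains B where "B \<in> null_sets lborel" "cylinder \<nu> A \<subseteq> B"
proof -
  let ?n = "CARD('d) - 1"
  let ?i = "undefined :: 'd"
  obtain f :: "real^'d \<Rightarrow> real^'d" where f: "orthogonal_transformation f" and fe: "f \<nu> = axis ?i 1"
  proof (rule orthogonal_transformation_exists[of \<nu> "axis ?i 1 :: real^'d"])
    show "norm \<nu> = norm (axis ?i 1 :: real^'d)" using \<nu> by (simp add: norm_axis_1)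
  qed blast
  have g: "orthogonal_transformation (inv f)" by (rule orthogonal_transformation_inv[OF f])
  have "hausdorff_outer ?n (inv f -` A) = 0" using A hausdorff_outer_vimage_orthogonal[OF g] by simp
  then have lt: "hausdorff_outer ?n (inv f -` A) < ennreal (1 / real (Suc n))" for n by simp
  have ex: "\<exists>B. B \<in> sets borel \<and> cylinder (axis ?i 1) (inv f -` A) \<subseteq> B \<and>
      emeasure lborel B \<le> 2 ^ ?n * ennreal (1 / real (Suc n))" for n
    using cylinder_coord_outer[OF lt[of n], of ?i] by blast
  from choice[OF allI[OF ex]] obtain B where BB: "\<forall>n. B n \<in> sets borel \<and>
      cylinder (axis ?i 1) (inv f -` A) \<subseteq> B n \<and> emeasure lborel (B n) \<le> 2 ^ ?n * ennreal (1 / real (Suc n))" ..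
  note B = BB[rule_format, THEN conjunct1] BB[rule_format, THEN conjunct2, THEN conjunct1]
    BB[rule_format, THEN conjunct2, THEN conjunct2]
  define N where "N = (\<Inter>n. B n)"
  have Nb: "N \<in> sets borel" unfolding N_def using B(1) by auto
  have "emeasure lborel N \<le> 2 ^ ?n * ennreal (1 / real (Suc n))" for n
    by (rule order_trans[OF emeasure_mono B(3)]) (auto simp: N_def B(1))
  moreover have "(\<lambda>n. 2 ^ ?n * ennreal (1 / real (Suc n))) \<longlonglongrightarrow> 2 ^ ?n * ennreal 0"
    by (intro ennreal_tendsto_cmult tendsto_ennrealI LIMSEQ_Suc lim_1_over_n) (simp add: power_less_top_ennreal)
  ultimately have "emeasure lborel N \<le> 0" using LIMSEQ_le_const by (metis (no_types, lifting) ennreal_0 mult_zero_right)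
  then have N0: "N \<in> null_sets lborel" using Nb by (simp add: null_sets_def)
  show thesis
  proof
    show "f -` N \<in> null_sets lborel"
      using emeasure_vimage_orthogonal[OF f Nb] N0 by (simp add: null_sets_def)
    have "cylinder (axis ?i 1) (inv f -` A) \<subseteq> N" using B(2) by (auto simp: N_def)
    then have "f -` cylinder (f \<nu>) (inv f -` A) \<subseteq> f -` N" using fe by auto
    moreover have "f -` (inv f -` A) = A"
      using orthogonal_transformation_inj[OF f] by (auto simp: inv_f_f)
    ultimately show "cylinder \<nu> A \<subseteq> f -` N" using cylinder_vimage_orthogonal[OF f, of \<nu> "inv f -` A"] by simp
  qed
qed

text \<open>The boundary of the unit cube consists of \<open>2 d\<close> faces isometric to \<open>coord_face i\<close>. An open and a closed face
have the same measure, since the open and the closed unit cube have the same volume; so the overlaps of the closed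
faces do not matter, and the disjoint open faces give the lower bound.\<close>

lemma hausdorff_frontier_unit_cube:
  assumes c: "\<And>\<nu> (A :: (real^'d::finite) set). norm \<nu> = 1 \<Longrightarrow> A \<in> sets borel \<Longrightarrow> (\<And>x. x \<in> A \<Longrightarrow> x \<bullet> \<nu> = 0) \<Longrightarrow>
       hausdorff_outer (CARD('d) - 1) A = c * emeasure lborel (cylinder \<nu> A)"
  shows "hausdorff_outer (CARD('d) - 1) (frontier (cbox 0 1 :: (real^'d) set)) = of_nat (2 * CARD('d)) * c"
proof -
  define H :: "(real^'d) set \<Rightarrow> ennreal" where "H = hausdorff_outer (CARD('d) - 1)"
  note mo = metric_outer_measure_hausdorff[of "CARD('d) - 1", where ?'a = "real^'d", folded H_def]
  let ?M = "outer_measure_measure H"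
  define open_face :: "'d \<times> bool \<Rightarrow> (real^'d) set" where
    "open_face p = {x. x $ fst p = of_bool (snd p) \<and> (\<forall>j. j \<noteq> fst p \<longrightarrow> 0 < x $ j \<and> x $ j < 1)}" for p
  define face :: "'d \<times> bool \<Rightarrow> (real^'d) set" where
    "face p = {x. x $ fst p = of_bool (snd p) \<and> (\<forall>j. 0 \<le> x $ j \<and> x $ j \<le> 1)}" for p
  have bor: "open_face p \<in> sets borel" "face p \<in> sets borel" for p
  proof -
    have "open_face p = {x. x $ fst p = of_bool (snd p)} \<inter> (\<Inter>j\<in>UNIV - {fst p}. {x. 0 < x $ j} \<inter> {x. x $ j < 1})"
      by (auto simp: open_face_def)
    moreover have "{x::real^'d. x $ j = a} \<in> sets borel" "{x::real^'d. a < x $ j} \<in> sets borel" "{x::real^'d. x $ j < a} \<in> sets borel" for j a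
      by (auto intro!: borel_closed borel_open closed_Collect_eq open_Collect_less continuous_intros)
    ultimately show "open_face p \<in> sets borel"
      by (cases "UNIV - {fst p} = {}") (auto intro!: sets.Int sets.finite_INT)
    have "face p = {x. x $ fst p = of_bool (snd p)} \<inter> cbox 0 1" by (auto simp: face_def mem_box_cart)
    then show "face p \<in> sets borel"
      by (auto intro!: borel_closed closed_Int closed_Collect_eq continuous_intros)
  qed
  have zero: "H A = c" if A: "A \<in> sets borel" "open_face (i, False) \<subseteq> A" "A \<subseteq> face (i, False)" for A i
  proof -
    have co: "(x - (x $ i) *\<^sub>R axis i 1) $ j = (if j = i then 0 else x $ j)" for x :: "real^'d" and j
      by (simp add: axis_def)
    have "box 0 1 \<subseteq> cylinder (axis i 1) A"
    proof
      fix x :: "real^'d" assume x: "x \<in> box 0 1"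
      then have "x - (x $ i) *\<^sub>R axis i 1 \<in> open_face (i, False)"
        unfolding open_face_def mem_Collect_eq co by (simp add: mem_box_cart)
      then show "x \<in> cylinder (axis i 1) A" using x A(2) 
        by (auto simp: cylinder_def inner_axis mem_box_cart less_imp_le)
    qed
    then have "1 \<le> emeasure lborel (cylinder (axis i 1) A)"
      using emeasure_mono[of "box 0 1" "cylinder (axis i 1) A" lborel] cylinder_borel[OF A(1)]
      by (simp add: emeasure_unit_cube)
    moreover have "cylinder (axis i 1) A \<subseteq> cbox 0 1"
    proof
      fix x :: "real^'d" assume x: "x \<in> cylinder (axis i 1) A"
      then have "x - (x $ i) *\<^sub>R axis i 1 \<in> face (i, False)" and xi: "0 \<le> x $ i" "x $ i \<le> 1"
        using A(3) by (auto simp: cylinder_def inner_axis)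
      then have "\<forall>j. 0 \<le> (if j = i then 0 else x $ j) \<and> (if j = i then 0 else x $ j) \<le> 1"
        unfolding face_def mem_Collect_eq co by blast
      then show "x \<in> cbox 0 1" using xi by (auto simp: mem_box_cart split: if_splits)
    qed
    then have "emeasure lborel (cylinder (axis i 1) A) \<le> 1"
      using emeasure_mono[of "cylinder (axis i 1) A" "cbox 0 1" lborel] by (simp add: emeasure_unit_cube)
    ultimately have "emeasure lborel (cylinder (axis i 1) A) = 1" by (rule antisym[rotated])
    moreover have "H A = c * emeasure lborel (cylinder (axis i 1) A)"
      unfolding H_def by (rule c) (use A in \<open>auto simp: norm_axis_1 face_def inner_axis\<close>)
    ultimately show ?thesis by simp
  qed
  have shift: "open_face (i, True) = (\<lambda>x. axis i 1 + x) ` open_face (i, False)"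
      "face (i, True) = (\<lambda>x. axis i 1 + x) ` face (i, False)" for i
  proof -
    have co: "(axis i 1 + x) $ j = (if j = i then 1 + x $ j else x $ j)"
        "(x - axis i 1) $ j = (if j = i then x $ j - 1 else x $ j)" for x :: "real^'d" and j
      by (simp_all add: axis_def)
    have "x = axis i 1 + (x - axis i 1)" for x :: "real^'d" by simp
    moreover have "x - axis i 1 \<in> open_face (i, False)" if "x \<in> open_face (i, True)" for x
      using that unfolding open_face_def mem_Collect_eq co by simp
    moreover have "axis i 1 + x \<in> open_face (i, True)" if "x \<in> open_face (i, False)" for x
      using that unfolding open_face_def mem_Collect_eq co by simp
    ultimately show "open_face (i, True) = (\<lambda>x. axis i 1 + x) ` open_face (i, False)" by blast
    have "x = axis i 1 + (x - axis i 1)" for x :: "real^'d" by simp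
    moreover have "x - axis i 1 \<in> face (i, False)" if "x \<in> face (i, True)" for x
      using that unfolding face_def mem_Collect_eq co by auto
    moreover have "axis i 1 + x \<in> face (i, True)" if "x \<in> face (i, False)" for x
      using that unfolding face_def mem_Collect_eq co by auto
    ultimately show "face (i, True) = (\<lambda>x. axis i 1 + x) ` face (i, False)" by blast
  qed
  have sub: "open_face p \<subseteq> face p" for p
  proof
    fix x assume x: "x \<in> open_face p"
    have "0 \<le> x $ j \<and> x $ j \<le> 1" for j
    proof (cases "j = fst p")
      case True then show ?thesis using x by (simp add: open_face_def)
    next
      case False
      then have "0 < x $ j \<and> x $ j < 1" using x by (simp add: open_face_def)
      then show ?thesis by simp
    qed
    then show "x \<in> face p" using x by (simp add: open_face_def face_def)
  qed
  have Hf: "H (open_face p) = c \<and> H (face p) = c" for p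
  proof (cases p)
    case (Pair i b)
    have *: "H (open_face (i, False)) = c" "H (face (i, False)) = c" 
      by (rule zero[OF bor(1) order_refl sub], rule zero[OF bor(2) sub order_refl])
    have "H ((\<lambda>x. axis i 1 + x) ` A) = H A" for A
      unfolding H_def by (rule hausdorff_outer_isometry_image) (simp add: dist_norm)
    then show ?thesis using * shift[of i] Pair by (cases b) simp_all
  qed
  have card: "card (UNIV :: ('d \<times> bool) set) = 2 * CARD('d)" by (simp add: card_prod)
  have Msets: "A \<in> sets borel \<Longrightarrow> A \<in> sets ?M" for A using borel_le_outer_measure_measure[OF mo] by blast
  note em = emeasure_outer_measure_measure[OF mo Msets]
  have fr: "frontier (cbox 0 1 :: (real^'d) set) = cbox 0 1 - box 0 1" by (rule frontier_cbox)
  have up: "frontier (cbox 0 1) \<subseteq> (\<Union>p. face p)"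
  proof
    fix x :: "real^'d" assume "x \<in> frontier (cbox 0 1)"
    then have x: "\<forall>j. 0 \<le> x $ j \<and> x $ j \<le> 1" and "\<exists>i. \<not> (0 < x $ i \<and> x $ i < 1)"
      unfolding fr by (auto simp: mem_box_cart)
    then obtain i where "x $ i = 0 \<or> x $ i = 1" by (metis less_eq_real_def)
    then have "x \<in> face (i, x $ i = 1)" using x by (auto simp: face_def)
    then show "x \<in> (\<Union>p. face p)" by blast
  qed
  have lo: "(\<Union>p. open_face p) \<subseteq> frontier (cbox 0 1)"
  proof
    fix x assume "x \<in> (\<Union>p. open_face p)"
    then obtain i b where x: "x $ i = of_bool b" "\<And>j. j \<noteq> i \<Longrightarrow> 0 < x $ j \<and> x $ j < 1" by (auto simp: open_face_def)
    then have "\<forall>j. 0 \<le> x $ j \<and> x $ j \<le> 1" by (metis less_imp_le of_bool_eq zero_le_one order_refl of_bool_def)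
    moreover have "\<not> (0 < x $ i \<and> x $ i < 1)" using x(1) by simp
    ultimately show "x \<in> frontier (cbox 0 1)" unfolding fr by (auto simp: mem_box_cart)
  qed
  have "H (frontier (cbox 0 1)) \<le> H (\<Union>p. face p)"
    using up unfolding H_def by (rule hausdorff_outer_mono)
  also have "\<dots> = emeasure ?M (\<Union>p. face p)" by (rule em[symmetric]) (auto intro!: sets.finite_UN bor)
  also have "\<dots> \<le> (\<Sum>p\<in>UNIV. emeasure ?M (face p))"
    by (rule emeasure_subadditive_finite) (auto intro!: Msets bor)
  also have "\<dots> = (\<Sum>p\<in>(UNIV :: ('d \<times> bool) set). c)" using Hf by (simp add: em bor)
  also have "\<dots> = of_nat (2 * CARD('d)) * c" by (simp add: card mult.commute mult.left_commute)
  finally have le: "H (frontier (cbox 0 1)) \<le> of_nat (2 * CARD('d)) * c" .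
  have disj: "disjoint_family open_face"
  proof (unfold disjoint_family_on_def, intro ballI impI)
    fix p q :: "'d \<times> bool" assume pq: "p \<noteq> q"
    obtain i a where p: "p = (i, a)" by (cases p)
    obtain j b where q: "q = (j, b)" by (cases q)
    show "open_face p \<inter> open_face q = {}"
    proof (cases "i = j")
      case True then show ?thesis using pq p q by (auto simp: open_face_def)
    next
      case False
      have "x $ i = 0 \<or> x $ i = 1" if "x \<in> open_face p" for x using that p by (cases a) (auto simp: open_face_def)
      moreover have "0 < x $ i \<and> x $ i < 1" if "x \<in> open_face q" for x using that q False by (auto simp: open_face_def)
      ultimately show ?thesis by force
    qed
  qed
  have "of_nat (2 * CARD('d)) * c = (\<Sum>p\<in>(UNIV :: ('d \<times> bool) set). c)" by (simp add: card mult.commute mult.left_commute)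
  also have "\<dots> = (\<Sum>p\<in>UNIV. emeasure ?M (open_face p))" using Hf by (simp add: em bor)
  also have "\<dots> = emeasure ?M (\<Union>p. open_face p)"
    by (rule sum_emeasure) (use disj in \<open>auto intro!: Msets bor\<close>)
  also have "\<dots> = H (\<Union>p. open_face p)" by (rule em) (auto intro!: sets.finite_UN bor)
  also have "\<dots> \<le> H (frontier (cbox 0 1))"
    using lo unfolding H_def by (rule hausdorff_outer_mono)
  finally show ?thesis using le unfolding H_def by (rule antisym[rotated])
qed

section \<open>The normalised surface measure\<close>

text \<open>The normalising constant is \<open>2 d\<close> over the Hausdorff measure of the boundary of the cube, which is \<open>2 d\<close> times
the constant of the cylinder formula.\<close>

lemma surface_outer_hyperplane:
  fixes A :: "(real^'d::finite) set"
  assumes "norm \<nu> = 1" "A \<in> sets borel" "\<And>x. x \<in> A \<Longrightarrow> x \<bullet> \<nu> = 0"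
  shows "surface_outer A = emeasure lborel (cylinder \<nu> A)"
proof -
  obtain c where c0: "c \<noteq> 0" "c < \<infinity>"
    and c: "\<And>\<nu> (A :: (real^'d) set). norm \<nu> = 1 \<Longrightarrow> A \<in> sets borel \<Longrightarrow> (\<And>x. x \<in> A \<Longrightarrow> x \<bullet> \<nu> = 0) \<Longrightarrow>
       hausdorff_outer (CARD('d) - 1) A = c * emeasure lborel (cylinder \<nu> A)"
    using hausdorff_hyperplane by blast
  define N :: ennreal where "N = of_nat (2 * CARD('d))"
  have fr: "hausdorff_outer (CARD('d) - 1) (frontier (cbox 0 1 :: (real^'d) set)) = of_nat (2 * CARD('d)) * c"
    by (rule hausdorff_frontier_unit_cube) (rule c)
  have N: "N \<noteq> 0" "N \<noteq> top" using of_nat_less_top[of "2 * CARD('d)"] unfolding N_def by (simp, simp only: less_top)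
  have "N * c \<noteq> 0" "N * c \<noteq> top" using N c0 by (auto simp: ennreal_mult_eq_top_iff)
  moreover have "hausdorff_outer (CARD('d) - 1) A = c * emeasure lborel (cylinder \<nu> A)"
    by (rule c) (use assms in auto)
  then have "surface_outer A = (N * c * emeasure lborel (cylinder \<nu> A)) / (N * c)"
    unfolding surface_outer_def fr N_def by (simp only: mult.assoc)
  ultimately show ?thesis
    by (metis ennreal_mult_divide_eq mult.commute infinity_ennreal_def)
qed

lemma surface_outer_scale_pos:
  obtains \<kappa> where "\<kappa> \<noteq> 0" "\<kappa> < \<infinity>" "\<And>A :: (real^'d::finite) set. surface_outer A = \<kappa> * hausdorff_outer (CARD('d) - 1) A"
proof -
  obtain c where c0: "c \<noteq> 0" "c < \<infinity>"
    and c: "\<And>\<nu> (A :: (real^'d) set). norm \<nu> = 1 \<Longrightarrow> A \<in> sets borel \<Longrightarrow> (\<And>x. x \<in> A \<Longrightarrow> x \<bullet> \<nu> = 0) \<Longrightarrow>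
       hausdorff_outer (CARD('d) - 1) A = c * emeasure lborel (cylinder \<nu> A)"
    using hausdorff_hyperplane by blast
  define N :: ennreal where "N = of_nat (2 * CARD('d))"
  have fr: "hausdorff_outer (CARD('d) - 1) (frontier (cbox 0 1 :: (real^'d) set)) = of_nat (2 * CARD('d)) * c"
    by (rule hausdorff_frontier_unit_cube) (rule c)
  have N: "N \<noteq> 0" "N \<noteq> top" using of_nat_less_top[of "2 * CARD('d)"] unfolding N_def by (simp, simp only: less_top)
  have Nc: "N * c \<noteq> 0" "N * c \<noteq> top" using N c0 by (auto simp: ennreal_mult_eq_top_iff)
  show thesis
  proof
    have "inverse (N * c) < top" using Nc by (simp only: less_top[symmetric] ennreal_inverse_eq_top_iff not_False_eq_True)
    moreover have "N < top" using N by (simp only: less_top)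
    ultimately show "N / (N * c) < \<infinity>" by (simp only: divide_ennreal_def ennreal_mult_less_top infinity_ennreal_def simp_thms)
    show "N / (N * c) \<noteq> 0"
      using N Nc by (auto simp: ennreal_divide_eq_top_iff less_top divide_ennreal_def ennreal_mult_eq_top_iff)
    show "surface_outer A = N / (N * c) * hausdorff_outer (CARD('d) - 1) A" for A :: "(real^'d) set"
      unfolding surface_outer_scale fr N_def ..
  qed
qed

lemma surface_outer_mono: "A \<subseteq> B \<Longrightarrow> surface_outer A \<le> surface_outer B"
  using metric_outer_measure_surface unfolding metric_outer_measure_def by blast

lemma surface_outer_lipschitz_image:
  fixes f :: "real^'d::finite \<Rightarrow> real^'d"
  assumes L: "0 < L" and lip: "\<And>x y. x \<in> A \<Longrightarrow> y \<in> A \<Longrightarrow> dist (f x) (f y) \<le> L * dist x y"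
  shows "surface_outer (f ` A) \<le> ennreal (L ^ (CARD('d) - 1)) * surface_outer A"
proof -
  obtain \<kappa> where \<kappa>: "\<And>A :: (real^'d) set. surface_outer A = \<kappa> * hausdorff_outer (CARD('d) - 1) A"
    using surface_outer_scale_pos by blast
  have "\<kappa> * hausdorff_outer (CARD('d) - 1) (f ` A) \<le> \<kappa> * (ennreal (L ^ (CARD('d) - 1)) * hausdorff_outer (CARD('d) - 1) A)"
    by (rule mult_left_mono[OF hausdorff_outer_lipschitz_image[OF assms]]) auto
  then show ?thesis unfolding \<kappa> by (simp only: mult_ac)
qed

lemma surface_null_cylinder:
  fixes A :: "(real^'d::finite) set"
  assumes \<nu>: "norm \<nu> = 1" and A: "surface_outer A = 0"
  obtains B where "B \<in> null_sets lborel" "cylinder \<nu> A \<subseteq> B"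
proof -
  obtain \<kappa> where "\<kappa> \<noteq> 0" "\<kappa> < \<infinity>" "\<And>A :: (real^'d) set. surface_outer A = \<kappa> * hausdorff_outer (CARD('d) - 1) A"
    using surface_outer_scale_pos by blast
  then have "hausdorff_outer (CARD('d) - 1) A = 0" using A by simp
  then show thesis using hausdorff_null_cylinder[OF \<nu>] that by blast
qed

lemmas surface_measure_facts =
  outer_measure_measure[OF metric_outer_measure_surface, folded surface_measure_eq]

lemma space_surface_measure: "space surface_measure = UNIV"
  and emeasure_surface_measure: "A \<in> sets surface_measure \<Longrightarrow> emeasure surface_measure A = surface_outer A"
  and borel_sets_surface_measure: "A \<in> sets borel \<Longrightarrow> A \<in> sets surface_measure"
  and null_sets_surface_measure: "surface_outer N = 0 \<Longrightarrow> N \<in> null_sets surface_measure"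
  using surface_measure_facts(2) surface_measure_facts(3)[of A] surface_measure_facts(4) surface_measure_facts(5)[of N]
  by blast+

section \<open>Normals of a convex body\<close>

text \<open>A bounded set with infinitely many disjoint translates inside a bounded set has measure zero; the
translates by \<open>v / (n + 1)\<close> remain bounded.\<close>

lemma null_if_disjoint_translates:
  fixes X :: "'a::euclidean_space set"
  assumes X: "X \<in> sets borel" "bounded X"
    and disj: "\<And>s t x y. x \<in> X \<Longrightarrow> y \<in> X \<Longrightarrow> x + s *\<^sub>R v = y + t *\<^sub>R v \<Longrightarrow> s = t"
  shows "emeasure lborel X = 0"
proof (rule ccontr)
  assume pos: "emeasure lborel X \<noteq> 0"
  define s where "s n = 1 / real (Suc n)" for n
  define Y where "Y n = (\<lambda>x. x - s n *\<^sub>R v) -` X" for n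
  obtain r where r: "\<And>x. x \<in> X \<Longrightarrow> norm x \<le> r" using X(2) by (auto simp: bounded_iff)
  have Yb: "Y n \<in> sets borel" for n
    unfolding Y_def by (rule measurable_sets_borel[OF _ X(1)]) measurable
  have Ym: "emeasure lborel (Y n) = emeasure lborel X" for n
  proof -
    have "emeasure lborel X = emeasure (distr lborel borel ((+) (- (s n *\<^sub>R v)))) X"
      by (simp add: lborel_distr_plus)
    also have "\<dots> = emeasure lborel (Y n)"
      using X(1) by (subst emeasure_distr) (auto simp: Y_def vimage_def)
    finally show ?thesis ..
  qed
  have dj: "disjoint_family Y"
  proof (unfold disjoint_family_on_def, intro ballI impI)
    fix m n :: nat assume "m \<noteq> n"
    then have "s m \<noteq> s n" by (simp add: s_def)
    have False if "z \<in> Y m" "z \<in> Y n" for z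
      using disj[of "z - s m *\<^sub>R v" "z - s n *\<^sub>R v" "s m" "s n"] that \<open>s m \<noteq> s n\<close> by (auto simp: Y_def)
    then show "Y m \<inter> Y n = {}" by blast
  qed
  have "(\<Union>n. Y n) \<subseteq> cball 0 (r + norm v)"
  proof
    fix z assume "z \<in> (\<Union>n. Y n)"
    then obtain n where "z - s n *\<^sub>R v \<in> X" by (auto simp: Y_def)
    then have "norm (z - s n *\<^sub>R v) \<le> r" by (rule r)
    moreover have "norm (s n *\<^sub>R v) \<le> norm v"
      using mult_right_mono[of "s n" 1 "norm v"] by (simp add: s_def)
    moreover have "norm z \<le> norm (z - s n *\<^sub>R v) + norm (s n *\<^sub>R v)"
      using norm_triangle_sub[of z "s n *\<^sub>R v"] by (simp add: add.commute)
    ultimately show "z \<in> cball 0 (r + norm v)" by simp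
  qed
  then have "emeasure lborel (\<Union>n. Y n) \<le> emeasure lborel (cball 0 (r + norm v) :: 'a set)"
    by (rule emeasure_mono) simp
  also have "\<dots> < \<infinity>" by (rule emeasure_bounded_finite) simp
  also have "emeasure lborel (\<Union>n. Y n) = (\<Sum>n. emeasure lborel (Y n))"
    by (rule suminf_emeasure[symmetric]) (use Yb dj in auto)
  also have "\<dots> = top" 
    using pos unfolding Ym suminf_eq_SUP sum_constant card_lessThan
    by (simp add: SUP_mult_right_ennreal[symmetric] ennreal_SUP_of_nat_eq_top ennreal_top_mult)
  finally show False by simp
qed

locale convex_body =
  fixes K :: "(real^'d::finite) set"
  assumes compact_K: "compact K" and convex_K: "convex K" and interior_K: "interior K \<noteq> {}"
begin

lemma closed_K: "closed K" using compact_K by (rule compact_imp_closed)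

lemma frontier_subset_K: "frontier K \<subseteq> K" using closed_K by (rule frontier_subset_closed)

lemma compact_frontier_K: "compact (frontier K)" using compact_K by (rule compact_frontier)

lemma K_eq_closure_interior: "K = closure (interior K)"
  using convex_closure_interior[OF convex_K interior_K] closed_K by simp

definition unit_normal :: "real^'d \<Rightarrow> real^'d \<Rightarrow> bool" where
  "unit_normal x n \<longleftrightarrow> norm n = 1 \<and> (\<forall>y\<in>K. n \<bullet> (y - x) \<le> 0)"

lemma unit_normal_exists:
  assumes "x \<in> frontier K" shows "\<exists>n. unit_normal x n"
proof -
  have x: "x \<in> closure K" "x \<notin> rel_interior K"
    using assms rel_interior_nonempty_interior[OF interior_K] by (auto simp: frontier_def)
  obtain a where a: "a \<noteq> 0" "\<And>y. y \<in> closure K \<Longrightarrow> a \<bullet> x \<le> a \<bullet> y"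
    by (rule supporting_hyperplane_relative_frontier[OF convex_K x]) (rule that, simp_all)
  have "((- 1 / norm a) *\<^sub>R a) \<bullet> (y - x) \<le> 0" if "y \<in> K" for y
  proof -
    have "y \<in> closure K" by (rule subsetD[OF closure_subset that])
    then have "0 \<le> a \<bullet> (y - x)" using a(2)[of y] by (simp add: inner_diff_right)
    then have "0 \<le> (1 / norm a) * (a \<bullet> (y - x))" by (rule mult_nonneg_nonneg[rotated]) simp
    moreover have "((- 1 / norm a) *\<^sub>R a) \<bullet> (y - x) = - ((1 / norm a) * (a \<bullet> (y - x)))"
      unfolding inner_scaleR_left by simp
    ultimately show ?thesis by linarith
  qed
  moreover have "norm ((- 1 / norm a) *\<^sub>R a) = 1" using a(1) by simp
  ultimately show ?thesis unfolding unit_normal_def by blast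
qed

lemma unit_normal_outward_normal: "x \<in> frontier K \<Longrightarrow> unit_normal x (outward_normal K x)"
  unfolding outward_normal_def using someI_ex[OF unit_normal_exists] unfolding unit_normal_def by blast

text \<open>A small ball around \<open>p\<close> lies in \<open>K\<close>, so moving \<open>p\<close> in direction \<open>n\<close> still does not pass the supporting hyperplane.\<close>

lemma unit_normal_interior:
  assumes "unit_normal x n" "p \<in> interior K" shows "n \<bullet> (p - x) < 0"
proof -
  obtain r where r: "r > 0" "cball p r \<subseteq> K" using assms(2) by (meson mem_interior_cball)
  have "p + r *\<^sub>R n \<in> cball p r" using assms(1) r by (simp add: dist_norm unit_normal_def)
  then have "n \<bullet> (p + r *\<^sub>R n - x) \<le> 0" using assms(1) r by (auto simp: unit_normal_def)
  moreover have "n \<bullet> n = 1" using assms(1) by (simp add: unit_normal_def norm_eq_1)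
  ultimately have "n \<bullet> (p - x) + r \<le> 0" by (simp add: inner_diff_right inner_add_right)
  then show ?thesis using r by simp
qed

text \<open>Being a unit normal is a closed condition on the pair of point and vector, so the graph of the normal cone is
compact, and so is its projection. The two normals \<open>a\<close>, \<open>b\<close> serve two purposes: a condition \<open>a \<noteq> b\<close> describes
the singular points, and a condition on a single normal is one on pairs with \<open>a = b\<close>.\<close>

lemma compact_normal_pairs:
  assumes "closed C"
  shows "compact {x \<in> frontier K. \<exists>a b. (a, b) \<in> C \<and> unit_normal x a \<and> unit_normal x b}"
proof -
  define S where "S = {(x, a, b). x \<in> frontier K \<and> (a, b) \<in> C \<and> unit_normal x a \<and> unit_normal x b}"
  have "S = (frontier K \<times> sphere 0 1 \<times> sphere 0 1) \<inter> (snd -` C) \<inter>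
     (\<Inter>y\<in>K. {p. fst (snd p) \<bullet> (y - fst p) \<le> 0} \<inter> {p. snd (snd p) \<bullet> (y - fst p) \<le> 0})"
    by (auto simp: S_def unit_normal_def)
  moreover have "compact (frontier K \<times> sphere (0::real^'d) 1 \<times> sphere (0::real^'d) 1)"
    by (intro compact_Times compact_frontier_K) simp_all
  moreover have "closed (snd -` C :: ((real^'d) \<times> (real^'d) \<times> (real^'d)) set)"
    by (rule continuous_closed_vimage[OF assms]) (auto intro: continuous_intros)
  moreover have "closed (\<Inter>y\<in>K. {p :: (real^'d) \<times> (real^'d) \<times> (real^'d). fst (snd p) \<bullet> (y - fst p) \<le> 0} \<inter> {p. snd (snd p) \<bullet> (y - fst p) \<le> 0})"
    by (intro closed_INT ballI closed_Int closed_Collect_le continuous_intros)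
  ultimately have "compact S" by (simp add: compact_Int_closed)
  then have "compact (fst ` S)" by (rule compact_continuous_image[rotated]) (intro continuous_intros)
  moreover have "fst ` S = {x \<in> frontier K. \<exists>a b. (a, b) \<in> C \<and> unit_normal x a \<and> unit_normal x b}"
    by (force simp: S_def)
  ultimately show ?thesis by simp
qed

definition singular :: "(real^'d) set" where
  "singular = {x \<in> frontier K. \<exists>a b. unit_normal x a \<and> unit_normal x b \<and> a \<noteq> b}"

definition regular :: "(real^'d) set" where "regular = frontier K - singular"

lemma regular_normal: "x \<in> regular \<Longrightarrow> unit_normal x n \<longleftrightarrow> n = outward_normal K x"
  using unit_normal_outward_normal[of x] unfolding regular_def singular_def by blast

text \<open>Two normals are different iff they are at distance at least \<open>1 / (k + 1)\<close> for some \<open>k\<close>, so the singular points are a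
countable union of compact sets.\<close>

lemma singular_borel: "singular \<in> sets borel"
proof -
  have "singular = (\<Union>k. {x \<in> frontier K. \<exists>a b. (a, b) \<in> {p. 1 / real (Suc k) \<le> dist (fst p) (snd p)} \<and>
      unit_normal x a \<and> unit_normal x b})" (is "_ = (\<Union>k. ?S k)")
  proof (intro equalityI subsetI)
    fix x assume "x \<in> singular"
    then obtain a b where ab: "x \<in> frontier K" "unit_normal x a" "unit_normal x b" "a \<noteq> b" by (auto simp: singular_def)
    then obtain k where "1 / real (Suc k) < dist a b" using nat_approx_posE[of "dist a b"] by auto
    then have "x \<in> ?S k" using ab by force
    then show "x \<in> (\<Union>k. ?S k)" by blast
  next
    fix x assume "x \<in> (\<Union>k. ?S k)"
    then obtain k a b where k: "x \<in> frontier K" "1 / real (Suc k) \<le> dist a b" "unit_normal x a" "unit_normal x b" by auto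
    have "0 < 1 / real (Suc k)" by simp
    with k(2) have "0 < dist a b" by linarith
    then show "x \<in> singular" using k by (auto simp: singular_def)
  qed
  moreover have "?S k \<in> sets borel" for k
    by (intro borel_compact compact_normal_pairs closed_Collect_le continuous_intros)
  ultimately show ?thesis by auto
qed

lemma regular_borel: "regular \<in> sets borel"
  unfolding regular_def by (intro sets.Diff singular_borel borel_compact compact_frontier_K)

lemma normal_borel: "(\<lambda>x. if x \<in> regular then outward_normal K x else 0) \<in> borel_measurable borel"
  (is "?N \<in> _")
proof -
  have "?N -` C \<in> sets borel" if C: "closed C" for C
  proof -
    have "closed {p. fst p \<in> C \<and> snd p = fst p}"
    proof -
      have "closed ((fst -` C) \<inter> {p :: (real^'d) \<times> (real^'d). snd p = fst p})"
        by (intro closed_Int continuous_closed_vimage[OF C] closed_Collect_eq) (auto intro: continuous_intros)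
      then show ?thesis by (simp add: vimage_def Collect_conj_eq)
    qed
    then have "compact {x \<in> frontier K. \<exists>a b. (a, b) \<in> {p. fst p \<in> C \<and> snd p = fst p} \<and> unit_normal x a \<and> unit_normal x b}" (is "compact ?S")
      by (rule compact_normal_pairs)
    then have S: "?S \<in> sets borel" by (rule borel_compact)
    have "regular \<inter> ?S = {x \<in> regular. outward_normal K x \<in> C}"
      using regular_normal by (auto simp: regular_def)
    then have 1: "{x \<in> regular. outward_normal K x \<in> C} \<in> sets borel"
      using sets.Int[OF regular_borel S] by (simp only:)
    have "?N -` C = {x \<in> regular. outward_normal K x \<in> C} \<union> (if 0 \<in> C then - regular else {})"
      by (auto split: if_splits)
    then show ?thesis using 1 regular_borel by auto
  qed
  then show ?thesis
    unfolding borel_eq_closed[where 'a = "real^'d"]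
    by (intro measurable_measure_of) (auto simp: borel_eq_closed[symmetric])
qed

text \<open>Each of the two points lies on the inner side of the supporting hyperplane at the other one, which bounds
\<open>\<nu> \<bullet> (x - y)\<close> from both sides.\<close>

lemma normal_slope:
  assumes "unit_normal x a" "unit_normal y b" "x \<in> K" "y \<in> K" "norm (a - \<nu>) \<le> \<epsilon>" "norm (b - \<nu>) \<le> \<epsilon>"
  shows "\<bar>(x - y) \<bullet> \<nu>\<bar> \<le> \<epsilon> * norm (x - y)"
proof -
  have "a \<bullet> (y - x) \<le> 0" "b \<bullet> (x - y) \<le> 0" using assms by (auto simp: unit_normal_def)
  moreover have "(\<nu> - a) \<bullet> (y - x) \<le> \<epsilon> * norm (x - y)"
    using norm_cauchy_schwarz[of "\<nu> - a" "y - x"] assms(5) mult_right_mono[OF assms(5), of "norm (x - y)"]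
    by (simp add: norm_minus_commute)
  moreover have "(\<nu> - b) \<bullet> (x - y) \<le> \<epsilon> * norm (x - y)"
    using norm_cauchy_schwarz[of "\<nu> - b" "x - y"] assms(6) mult_right_mono[OF assms(6), of "norm (x - y)"]
    by (simp add: norm_minus_commute)
  ultimately show ?thesis by (simp add: abs_le_iff inner_diff_left inner_diff_right inner_commute algebra_simps)
qed

text \<open>By the first slope condition the projection \<open>P\<close> to the hyperplane orthogonal to \<open>\<nu>\<close> is bi-Lipschitz on \<open>A\<close>, so it
suffices that \<open>P ` A\<close> is null. By the second one, different points of \<open>P ` A\<close> never differ by a multiple of
\<open>\<tau>\<close>, so the translates along \<open>\<tau>\<close> of the cylinder over \<open>P ` A\<close> are disjoint.\<close>

lemma surface_two_slopes_null:
  fixes A :: "(real^'d) set"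
  assumes A: "compact A" and \<nu>: "norm \<nu> = 1" and perp: "\<tau> \<bullet> \<nu> = 0"
    and \<epsilon>: "0 < \<epsilon>" "4 * \<epsilon> \<le> norm \<tau>" "norm \<tau> \<le> 1"
    and slope: "\<And>x y. x \<in> A \<Longrightarrow> y \<in> A \<Longrightarrow> \<bar>(x - y) \<bullet> \<nu>\<bar> \<le> \<epsilon> * norm (x - y)"
      "\<And>x y. x \<in> A \<Longrightarrow> y \<in> A \<Longrightarrow> \<bar>(x - y) \<bullet> \<tau>\<bar> \<le> 2 * \<epsilon> * norm (x - y)"
  shows "surface_outer A = 0"
proof -
  define P where "P x = x - (x \<bullet> \<nu>) *\<^sub>R \<nu>" for x :: "real^'d"
  have \<nu>\<nu>: "\<nu> \<bullet> \<nu> = 1" using \<nu> by (simp add: norm_eq_1)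
  have \<epsilon>1: "\<epsilon> \<le> 1/4" using \<epsilon> by linarith
  have Pd: "P x - P y = (x - y) - ((x - y) \<bullet> \<nu>) *\<^sub>R \<nu>" for x y
    by (simp add: P_def inner_diff_left scaleR_diff_left)
  have low: "(1 - \<epsilon>) * norm (x - y) \<le> norm (P x - P y)" if "x \<in> A" "y \<in> A" for x y
  proof -
    have "norm (x - y) \<le> norm (P x - P y) + norm (((x - y) \<bullet> \<nu>) *\<^sub>R \<nu>)"
      unfolding Pd using norm_triangle_sub[of "x - y" "((x - y) \<bullet> \<nu>) *\<^sub>R \<nu>"] by (simp only: add.commute)
    also have "norm (((x - y) \<bullet> \<nu>) *\<^sub>R \<nu>) \<le> \<epsilon> * norm (x - y)" using slope(1)[OF that] \<nu> by simp
    finally show ?thesis by (simp add: algebra_simps)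
  qed
  have inj: "inj_on P A"
  proof (rule inj_onI)
    fix x y assume "x \<in> A" "y \<in> A" "P x = P y"
    then have "(1 - \<epsilon>) * norm (x - y) \<le> 0" using low[of x y] by simp
    then show "x = y" using \<epsilon>1 by (simp add: mult_le_0_iff)
  qed
  have cPA: "compact (P ` A)"
    by (rule compact_continuous_image[OF _ A]) (auto simp: P_def intro!: continuous_intros)
  have perpP: "P x \<bullet> \<nu> = 0" for x by (simp add: P_def inner_diff_left \<nu>\<nu>)
  have cyl: "cylinder \<nu> (P ` A) \<subseteq> (\<lambda>(x, t). x + t *\<^sub>R \<nu>) ` (P ` A \<times> {0..1})"
  proof
    fix z assume "z \<in> cylinder \<nu> (P ` A)"
    then have "z - (z \<bullet> \<nu>) *\<^sub>R \<nu> \<in> P ` A" "z \<bullet> \<nu> \<in> {0..1}" by (auto simp: cylinder_def)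
    then show "z \<in> (\<lambda>(x, t). x + t *\<^sub>R \<nu>) ` (P ` A \<times> {0..1})" by (intro image_eqI[of _ _ "(z - (z \<bullet> \<nu>) *\<^sub>R \<nu>, z \<bullet> \<nu>)"]) auto
  qed
  have "surface_outer (P ` A) = emeasure lborel (cylinder \<nu> (P ` A))"
    by (rule surface_outer_hyperplane[OF \<nu> borel_compact[OF cPA]]) (auto simp: perpP)
  also have "\<dots> = 0"
  proof (rule null_if_disjoint_translates)
    show "cylinder \<nu> (P ` A) \<in> sets borel" by (rule cylinder_borel[OF borel_compact[OF cPA]])
    have "compact ((\<lambda>(x, t). x + t *\<^sub>R \<nu>) ` (P ` A \<times> {0..1::real}))"
      by (rule compact_continuous_image) (auto simp: split_beta intro!: continuous_intros compact_Times cPA)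
    then show "bounded (cylinder \<nu> (P ` A))" using cyl bounded_subset compact_imp_bounded by blast
    fix s t x y assume "x \<in> cylinder \<nu> (P ` A)" "y \<in> cylinder \<nu> (P ` A)" and eq: "x + s *\<^sub>R \<tau> = y + t *\<^sub>R \<tau>"
    then obtain p q where p: "p \<in> A" "x - (x \<bullet> \<nu>) *\<^sub>R \<nu> = P p" and q: "q \<in> A" "y - (y \<bullet> \<nu>) *\<^sub>R \<nu> = P q"
      by (auto simp: cylinder_def)
    have "x \<bullet> \<nu> = y \<bullet> \<nu>" using arg_cong[OF eq, of "\<lambda>z. z \<bullet> \<nu>"] perp by (simp add: inner_add_left)
    then have "P p - P q = x - y" unfolding p(2)[symmetric] q(2)[symmetric] by simp
    moreover have "x - y = (t - s) *\<^sub>R \<tau>" using eq by (simp add: scaleR_diff_left algebra_simps)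
    ultimately have Ppq: "P p - P q = (t - s) *\<^sub>R \<tau>" by simp
    have "\<bar>t - s\<bar> * (norm \<tau>)\<^sup>2 = \<bar>(P p - P q) \<bullet> \<tau>\<bar>" by (simp add: Ppq abs_mult power2_norm_eq_inner)
    also have "(P p - P q) \<bullet> \<tau> = (p - q) \<bullet> \<tau>" unfolding Pd inner_diff_left[of "p - q"] by (simp add: perp inner_commute[of \<nu> \<tau>])
    also have "\<bar>(p - q) \<bullet> \<tau>\<bar> \<le> 2 * \<epsilon> * norm (p - q)" by (rule slope(2)[OF p(1) q(1)])
    also have "(3/4) * (2 * \<epsilon> * norm (p - q)) \<le> 2 * \<epsilon> * ((1 - \<epsilon>) * norm (p - q))"
      using \<epsilon> \<epsilon>1 mult_right_mono[of "3/4" "1 - \<epsilon>" "norm (p - q)"] by simp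
    also have "\<dots> \<le> 2 * \<epsilon> * norm (P p - P q)" using low[OF p(1) q(1)] \<epsilon> by simp
    also have "\<dots> = 2 * \<epsilon> * (\<bar>t - s\<bar> * norm \<tau>)" by (simp add: Ppq)
    finally have "3/4 * (\<bar>t - s\<bar> * (norm \<tau>)\<^sup>2) \<le> 2 * \<epsilon> * (\<bar>t - s\<bar> * norm \<tau>)" by simp
    also have "\<dots> \<le> 1/2 * norm \<tau> * (\<bar>t - s\<bar> * norm \<tau>)" using \<epsilon> by (intro mult_right_mono) auto
    finally have "\<bar>t - s\<bar> * (norm \<tau>)\<^sup>2 \<le> 0" by (simp add: power2_eq_square mult_ac)
    moreover have "0 < (norm \<tau>)\<^sup>2" using \<epsilon> by (intro zero_less_power) linarith
    ultimately show "s = t" by (simp add: mult_le_0_iff)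
  qed
  finally have 0: "surface_outer (P ` A) = 0" .
  have "surface_outer (inv_into A P ` P ` A) \<le> ennreal ((1 / (1 - \<epsilon>)) ^ (CARD('d) - 1)) * surface_outer (P ` A)"
  proof (rule surface_outer_lipschitz_image)
    show "0 < 1 / (1 - \<epsilon>)" using \<epsilon>1 by simp
    fix x y assume "x \<in> P ` A" "y \<in> P ` A"
    then show "dist (inv_into A P x) (inv_into A P y) \<le> 1 / (1 - \<epsilon>) * dist x y"
      using low \<epsilon>1 inj by (auto simp: dist_norm field_simps)
  qed
  moreover have "inv_into A P ` P ` A = A" using inj by simp
  ultimately show ?thesis using 0 by simp
qed

text \<open>At a singular point with normals \<open>a \<noteq> b\<close> the vectors \<open>a\<close> and \<open>b - (a \<bullet> b) a\<close> are orthogonal and nonzero. Countably many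
small balls cover all such pairs \<open>(a, b)\<close> by Lindelof's theorem, and over each ball \<open>normal_slope\<close>, applied to both
normals, provides the two slope conditions.\<close>

lemma surface_singular_null: "surface_outer singular = 0"
proof -
  define W :: "((real^'d) \<times> (real^'d)) set" where "W = {(a, b). norm a = 1 \<and> norm b = 1 \<and> b - (a \<bullet> b) *\<^sub>R a \<noteq> 0}"
  define \<epsilon> where "\<epsilon> p = norm (snd p - (fst p \<bullet> snd p) *\<^sub>R fst p) / 4" for p :: "(real^'d) \<times> (real^'d)"
  define piece where "piece p = {x \<in> frontier K. \<exists>a b. (a, b) \<in> cball p (\<epsilon> p) \<and> unit_normal x a \<and> unit_normal x b}" for p
  have null: "piece p \<in> null_sets surface_measure" if p: "p \<in> W" for p
  proof -
    obtain \<nu> \<mu> where p_eq: "p = (\<nu>, \<mu>)" by (cases p)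
    define \<tau> where "\<tau> = \<mu> - (\<nu> \<bullet> \<mu>) *\<^sub>R \<nu>"
    have n1: "norm \<nu> = 1" "norm \<mu> = 1" and t0: "\<tau> \<noteq> 0" using p by (auto simp: p_eq W_def \<tau>_def)
    have e: "\<epsilon> p = norm \<tau> / 4" by (simp add: \<epsilon>_def p_eq \<tau>_def)
    have nn: "\<nu> \<bullet> \<nu> = 1" "\<mu> \<bullet> \<mu> = 1" using n1 by (auto simp: norm_eq_1)
    have c1: "\<bar>\<nu> \<bullet> \<mu>\<bar> \<le> 1" using Cauchy_Schwarz_ineq2[of \<nu> \<mu>] n1 by simp
    have cmp: "compact (piece p)" unfolding piece_def by (rule compact_normal_pairs) simp
    have "surface_outer (piece p) = 0"
    proof (rule surface_two_slopes_null[OF cmp n1(1), of \<tau> "\<epsilon> p"])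
      show "\<tau> \<bullet> \<nu> = 0" unfolding \<tau>_def by (simp add: inner_diff_left nn inner_commute[of \<mu> \<nu>])
      show "0 < \<epsilon> p" "4 * \<epsilon> p \<le> norm \<tau>" using t0 by (auto simp: e)
      have "(norm \<tau>)\<^sup>2 = 1 - (\<nu> \<bullet> \<mu>)\<^sup>2"
        unfolding power2_norm_eq_inner by (simp add: \<tau>_def inner_diff_left inner_diff_right nn inner_commute power2_eq_square)
      then have "(norm \<tau>)\<^sup>2 \<le> 1\<^sup>2" by simp
      then show "norm \<tau> \<le> 1" by (rule power2_le_imp_le) simp
    next
      fix x y assume x: "x \<in> piece p" and y: "y \<in> piece p"
      obtain a b where ab: "x \<in> frontier K" "dist p (a, b) \<le> \<epsilon> p" "unit_normal x a" "unit_normal x b"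
        using x by (auto simp: piece_def)
      obtain a' b' where ab': "y \<in> frontier K" "dist p (a', b') \<le> \<epsilon> p" "unit_normal y a'" "unit_normal y b'"
        using y by (auto simp: piece_def)
      have d: "norm (a - \<nu>) \<le> \<epsilon> p" "norm (b - \<mu>) \<le> \<epsilon> p" "norm (a' - \<nu>) \<le> \<epsilon> p" "norm (b' - \<mu>) \<le> \<epsilon> p"
        using dist_fst_le[of p "(a, b)"] dist_snd_le[of p "(a, b)"] dist_fst_le[of p "(a', b')"] dist_snd_le[of p "(a', b')"] ab(2) ab'(2)
        by (auto simp: p_eq dist_norm norm_minus_commute)
      have K: "x \<in> K" "y \<in> K" using ab(1) ab'(1) frontier_subset_K by auto
      show 1: "\<bar>(x - y) \<bullet> \<nu>\<bar> \<le> \<epsilon> p * norm (x - y)" by (rule normal_slope[OF ab(3) ab'(3) K d(1,3)])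
      have 2: "\<bar>(x - y) \<bullet> \<mu>\<bar> \<le> \<epsilon> p * norm (x - y)" by (rule normal_slope[OF ab(4) ab'(4) K d(2,4)])
      have "(x - y) \<bullet> \<tau> = (x - y) \<bullet> \<mu> - (\<nu> \<bullet> \<mu>) * ((x - y) \<bullet> \<nu>)" by (simp add: \<tau>_def inner_diff_right)
      then have "\<bar>(x - y) \<bullet> \<tau>\<bar> \<le> \<bar>(x - y) \<bullet> \<mu>\<bar> + \<bar>\<nu> \<bullet> \<mu>\<bar> * \<bar>(x - y) \<bullet> \<nu>\<bar>" by (simp add: abs_mult[symmetric] abs_triangle_ineq4)
      also have "\<bar>\<nu> \<bullet> \<mu>\<bar> * \<bar>(x - y) \<bullet> \<nu>\<bar> \<le> 1 * \<bar>(x - y) \<bullet> \<nu>\<bar>" by (rule mult_right_mono[OF c1]) simp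
      finally show "\<bar>(x - y) \<bullet> \<tau>\<bar> \<le> 2 * \<epsilon> p * norm (x - y)" using 1 2 by simp
    qed
    then show ?thesis by (rule null_sets_surface_measure)
  qed
  obtain F where F: "F \<subseteq> (\<lambda>p. ball p (\<epsilon> p)) ` W" "countable F" "\<Union>F = (\<Union>p\<in>W. ball p (\<epsilon> p))"
    using Lindelof[of "(\<lambda>p. ball p (\<epsilon> p)) ` W"] by (metis (no_types, lifting) imageE open_ball)
  obtain C where C: "C \<subseteq> W" "countable C" "F = (\<lambda>p. ball p (\<epsilon> p)) ` C" using F(1,2) by (meson countable_image_eq_inj countable_subset_image)
  have "singular \<subseteq> (\<Union>p\<in>C. piece p)"
  proof
    fix x assume "x \<in> singular"
    then obtain a b where ab: "x \<in> frontier K" "unit_normal x a" "unit_normal x b" "a \<noteq> b" by (auto simp: singular_def)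
    have n: "norm a = 1" "norm b = 1" using ab by (auto simp: unit_normal_def)
    obtain p where p: "p \<in> interior K" using interior_K by blast
    \<comment> \<open>Two different unit normals at one point are not opposite, because \<open>K\<close> has interior points.\<close>
    have "b - (a \<bullet> b) *\<^sub>R a \<noteq> 0"
    proof
      assume "b - (a \<bullet> b) *\<^sub>R a = 0"
      then have b: "b = (a \<bullet> b) *\<^sub>R a" by simp
      then have "\<bar>a \<bullet> b\<bar> = 1" using n by (metis norm_scaleR mult.right_neutral)
      then have "b = - a" using b ab(4) by (metis abs_if scaleR_minus1_left scaleR_one minus_equation_iff)
      then show False using unit_normal_interior[OF ab(2) p] unit_normal_interior[OF ab(3) p] by simp
    qed
    then have "(a, b) \<in> W" using n by (simp add: W_def)
    moreover then have "(a, b) \<in> ball (a, b) (\<epsilon> (a, b))" by (auto simp: \<epsilon>_def W_def)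
    ultimately have "(a, b) \<in> \<Union>F" unfolding F(3) by blast
    then obtain q where "q \<in> C" "(a, b) \<in> ball q (\<epsilon> q)" unfolding C(3) by blast
    then have "x \<in> piece q" using ab unfolding piece_def by (auto intro: less_imp_le)
    then show "x \<in> (\<Union>p\<in>C. piece p)" using \<open>q \<in> C\<close> by blast
  qed
  moreover have "(\<Union>p\<in>C. piece p) \<in> null_sets surface_measure"
    by (rule null_sets_UN'[OF C(2)]) (use C(1) null in blast)
  ultimately have "singular \<in> null_sets surface_measure"
    using null_sets_subset borel_sets_surface_measure[OF singular_borel] by blast
  then show ?thesis using emeasure_surface_measure[of singular] by (auto simp: null_sets_def)
qed

end

section \<open>Volumes of oblique cylinders\<close>

lemma nn_integral_interval_affine:
  fixes a b :: real
  assumes "0 < b"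
  shows "(\<integral>\<^sup>+s. indicator {0..1} (a + s * b) \<partial>lborel) = ennreal (1 / b)"
proof -
  have "(\<lambda>s. indicator {0..1} (a + s * b) :: ennreal) = indicator {- a / b .. (1 - a) / b}"
    using assms by (auto simp: indicator_def field_simps fun_eq_iff)
  then have "(\<integral>\<^sup>+s. indicator {0..1} (a + s * b) \<partial>lborel) = emeasure lborel {- a / b .. (1 - a) / b}" by simp
  also have "\<dots> = ennreal ((1 - a) / b - (- a / b))"
    using assms by (intro emeasure_lborel_Icc divide_right_mono) auto
  also have "(1 - a) / b - (- a / b) = 1 / b" by (simp add: diff_divide_distrib)
  finally show ?thesis .
qed

text \<open>For a set \<open>Y\<close> that consists of full lines parallel to \<open>e\<close>, the slabs cut from these lines segments of length 1 and
\<open>1 / (e \<bullet> \<nu>)\<close>. Averaging over the translates by \<open>s e\<close> and exchanging the integrals makes this precise.\<close>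

lemma emeasure_slab_change:
  fixes Y :: "'a::euclidean_space set"
  assumes Y[measurable]: "Y \<in> sets borel" and inv: "\<And>z s. z + s *\<^sub>R e \<in> Y \<longleftrightarrow> z \<in> Y"
    and e: "norm e = 1" and \<nu>: "0 < e \<bullet> \<nu>"
  shows "emeasure lborel (Y \<inter> {z. 0 \<le> z \<bullet> e \<and> z \<bullet> e \<le> 1})
       = ennreal (e \<bullet> \<nu>) * emeasure lborel (Y \<inter> {z. 0 \<le> z \<bullet> \<nu> \<and> z \<bullet> \<nu> \<le> 1})"
proof -
  let ?I = "indicator {0..1::real} :: real \<Rightarrow> ennreal"
  have ee: "e \<bullet> e = 1" using e by (simp add: norm_eq_1)
  have slab: "emeasure lborel (Y \<inter> {z. 0 \<le> z \<bullet> v \<and> z \<bullet> v \<le> 1}) = (\<integral>\<^sup>+z. indicator Y z * ?I (z \<bullet> v) \<partial>lborel)" for v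
  proof -
    have "(\<lambda>z. indicator Y z * ?I (z \<bullet> v)) = indicator (Y \<inter> {z. 0 \<le> z \<bullet> v \<and> z \<bullet> v \<le> 1})"
      by (auto simp: indicator_def fun_eq_iff)
    then show ?thesis by simp
  qed
  have "(\<integral>\<^sup>+z. indicator Y z * ?I (z \<bullet> e) * ennreal (1 / (e \<bullet> \<nu>)) \<partial>lborel)
      = (\<integral>\<^sup>+z. \<integral>\<^sup>+s. indicator Y z * ?I (z \<bullet> e) * ?I (z \<bullet> \<nu> + s * (e \<bullet> \<nu>)) \<partial>lborel \<partial>lborel)"
    by (simp add: nn_integral_cmult nn_integral_interval_affine[OF \<nu>])
  also have "\<dots> = (\<integral>\<^sup>+s. \<integral>\<^sup>+z. indicator Y z * ?I (z \<bullet> e) * ?I (z \<bullet> \<nu> + s * (e \<bullet> \<nu>)) \<partial>lborel \<partial>lborel)"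
    by (rule lborel_pair.Fubini'[symmetric]) measurable
  also have "\<dots> = (\<integral>\<^sup>+s. \<integral>\<^sup>+z. indicator Y z * ?I (z \<bullet> \<nu>) * ?I (z \<bullet> e + s * (-1)) \<partial>lborel \<partial>lborel)"
  proof (rule nn_integral_cong)
    fix s :: real
    have "(\<integral>\<^sup>+z. indicator Y z * ?I (z \<bullet> e) * ?I (z \<bullet> \<nu> + s * (e \<bullet> \<nu>)) \<partial>lborel)
        = (\<integral>\<^sup>+z. indicator Y ((- s) *\<^sub>R e + z) * ?I (((- s) *\<^sub>R e + z) \<bullet> e) * ?I (((- s) *\<^sub>R e + z) \<bullet> \<nu> + s * (e \<bullet> \<nu>)) \<partial>lborel)"
      by (rule nn_integral_lborel_translate[symmetric]) measurable
    also have "\<dots> = (\<integral>\<^sup>+z. indicator Y z * ?I (z \<bullet> \<nu>) * ?I (z \<bullet> e + s * (-1)) \<partial>lborel)"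
    proof (rule nn_integral_cong)
      fix z
      have "(- s) *\<^sub>R e + z \<in> Y \<longleftrightarrow> z \<in> Y" using inv[of z "- s"] by (simp add: add.commute)
      then have "indicator Y ((- s) *\<^sub>R e + z) = (indicator Y z :: ennreal)" by (simp add: indicator_def)
      moreover have "((- s) *\<^sub>R e + z) \<bullet> e = z \<bullet> e + s * (-1)" "((- s) *\<^sub>R e + z) \<bullet> \<nu> + s * (e \<bullet> \<nu>) = z \<bullet> \<nu>"
        by (simp_all add: inner_add_left inner_diff_left ee)
      ultimately show "indicator Y ((- s) *\<^sub>R e + z) * ?I (((- s) *\<^sub>R e + z) \<bullet> e) * ?I (((- s) *\<^sub>R e + z) \<bullet> \<nu> + s * (e \<bullet> \<nu>))
          = indicator Y z * ?I (z \<bullet> \<nu>) * ?I (z \<bullet> e + s * (-1))" by (simp only: mult_ac)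
    qed
    finally show "(\<integral>\<^sup>+z. indicator Y z * ?I (z \<bullet> e) * ?I (z \<bullet> \<nu> + s * (e \<bullet> \<nu>)) \<partial>lborel)
        = (\<integral>\<^sup>+z. indicator Y z * ?I (z \<bullet> \<nu>) * ?I (z \<bullet> e + s * (-1)) \<partial>lborel)" .
  qed
  also have "\<dots> = (\<integral>\<^sup>+z. \<integral>\<^sup>+s. indicator Y z * ?I (z \<bullet> \<nu>) * ?I (z \<bullet> e + s * (-1)) \<partial>lborel \<partial>lborel)"
    by (rule lborel_pair.Fubini') measurable
  also have "\<dots> = (\<integral>\<^sup>+z. indicator Y z * ?I (z \<bullet> \<nu>) \<partial>lborel)"
  proof -
    have "(\<integral>\<^sup>+s. ?I (a + s * (-1)) \<partial>lborel) = 1" for a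
    proof -
      have "(\<lambda>s. ?I (a + s * (-1))) = indicator {a - 1 .. a}" by (auto simp: indicator_def fun_eq_iff)
      then show ?thesis by simp
    qed
    then show ?thesis by (simp add: nn_integral_cmult)
  qed
  finally have "emeasure lborel (Y \<inter> {z. 0 \<le> z \<bullet> e \<and> z \<bullet> e \<le> 1}) * ennreal (1 / (e \<bullet> \<nu>))
      = emeasure lborel (Y \<inter> {z. 0 \<le> z \<bullet> \<nu> \<and> z \<bullet> \<nu> \<le> 1})"
    by (simp add: slab nn_integral_multc)
  then have "ennreal (e \<bullet> \<nu>) * (emeasure lborel (Y \<inter> {z. 0 \<le> z \<bullet> e \<and> z \<bullet> e \<le> 1}) * ennreal (1 / (e \<bullet> \<nu>)))
      = ennreal (e \<bullet> \<nu>) * emeasure lborel (Y \<inter> {z. 0 \<le> z \<bullet> \<nu> \<and> z \<bullet> \<nu> \<le> 1})" by simp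
  moreover have "ennreal (e \<bullet> \<nu>) * (x * ennreal (1 / (e \<bullet> \<nu>))) = x" for x
    using \<nu> by (simp add: mult.left_commute[of _ x] ennreal_mult[symmetric])
  ultimately show ?thesis by simp
qed

text \<open>The inner integral is the integral of \<open>f\<close> over the hyperplane at height \<open>s\<close>, written as a volume integral over a slab
of thickness 1 on which the integrand is constant along \<open>\<nu>\<close>.\<close>

lemma nn_integral_hyperplane_fibration:
  fixes f :: "'a::euclidean_space \<Rightarrow> ennreal"
  assumes [measurable]: "f \<in> borel_measurable borel" and \<nu>: "norm \<nu> = 1"
  shows "(\<integral>\<^sup>+z. f z \<partial>lborel) = (\<integral>\<^sup>+s. \<integral>\<^sup>+z. indicator {0..1} (z \<bullet> \<nu>) * f (z + (s - z \<bullet> \<nu>) *\<^sub>R \<nu>) \<partial>lborel \<partial>lborel)"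
proof -
  let ?I = "indicator {0..1::real} :: real \<Rightarrow> ennreal"
  have \<nu>\<nu>: "\<nu> \<bullet> \<nu> = 1" using \<nu> by (simp add: norm_eq_1)
  have "(\<integral>\<^sup>+s. \<integral>\<^sup>+z. ?I (z \<bullet> \<nu>) * f (z + (s - z \<bullet> \<nu>) *\<^sub>R \<nu>) \<partial>lborel \<partial>lborel)
      = (\<integral>\<^sup>+z. \<integral>\<^sup>+s. ?I (z \<bullet> \<nu>) * f (z + (s - z \<bullet> \<nu>) *\<^sub>R \<nu>) \<partial>lborel \<partial>lborel)"
    by (rule lborel_pair.Fubini') measurable
  also have "\<dots> = (\<integral>\<^sup>+z. \<integral>\<^sup>+s. ?I (z \<bullet> \<nu>) * f (z + s *\<^sub>R \<nu>) \<partial>lborel \<partial>lborel)"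
  proof (rule nn_integral_cong)
    fix z
    show "(\<integral>\<^sup>+s. ?I (z \<bullet> \<nu>) * f (z + (s - z \<bullet> \<nu>) *\<^sub>R \<nu>) \<partial>lborel) = (\<integral>\<^sup>+s. ?I (z \<bullet> \<nu>) * f (z + s *\<^sub>R \<nu>) \<partial>lborel)"
      using nn_integral_lborel_translate[of "\<lambda>s::real. ?I (z \<bullet> \<nu>) * f (z + s *\<^sub>R \<nu>)" "- (z \<bullet> \<nu>)"] by simp
  qed
  also have "\<dots> = (\<integral>\<^sup>+s. \<integral>\<^sup>+z. ?I (z \<bullet> \<nu>) * f (z + s *\<^sub>R \<nu>) \<partial>lborel \<partial>lborel)"
    by (rule lborel_pair.Fubini'[symmetric]) measurable
  also have "\<dots> = (\<integral>\<^sup>+s. \<integral>\<^sup>+z. ?I (z \<bullet> \<nu> - s) * f z \<partial>lborel \<partial>lborel)"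
  proof (rule nn_integral_cong)
    fix s :: real
    show "(\<integral>\<^sup>+z. ?I (z \<bullet> \<nu>) * f (z + s *\<^sub>R \<nu>) \<partial>lborel) = (\<integral>\<^sup>+z. ?I (z \<bullet> \<nu> - s) * f z \<partial>lborel)"
      using nn_integral_lborel_translate[of "\<lambda>z. ?I (z \<bullet> \<nu> - s) * f z" "s *\<^sub>R \<nu>"]
      by (simp add: inner_add_left \<nu>\<nu> add.commute)
  qed
  also have "\<dots> = (\<integral>\<^sup>+z. \<integral>\<^sup>+s. ?I (z \<bullet> \<nu> - s) * f z \<partial>lborel \<partial>lborel)"
    by (rule lborel_pair.Fubini') measurable
  also have "\<dots> = (\<integral>\<^sup>+z. f z \<partial>lborel)"
  proof -
    have "(\<integral>\<^sup>+s. ?I (a - s) \<partial>lborel) = 1" for a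
    proof -
      have "(\<lambda>s. ?I (a - s)) = indicator {a - 1 .. a}" by (auto simp: indicator_def fun_eq_iff)
      then show ?thesis by simp
    qed
    then show ?thesis by (simp add: nn_integral_multc)
  qed
  finally show ?thesis ..
qed

text \<open>Cavalieri's principle: the slab of direction \<open>\<nu>\<close> cuts from \<open>Y\<close> an oblique cylinder over
\<open>Y \<inter> {z. z \<bullet> \<nu> = 0}\<close>; its section at height \<open>s\<close> is the base shifted by \<open>(s / (e \<bullet> \<nu>)) e\<close>, which is the vector \<open>w\<close> plus \<open>s \<nu>\<close>,
with \<open>w\<close> parallel to the hyperplane.\<close>

lemma emeasure_oblique_cylinder:
  fixes Y :: "'a::euclidean_space set"
  assumes Y[measurable]: "Y \<in> sets borel" and inv: "\<And>z s. z + s *\<^sub>R e \<in> Y \<longleftrightarrow> z \<in> Y"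
    and e: "norm e = 1" and \<nu>: "norm \<nu> = 1" "0 < e \<bullet> \<nu>"
  shows "emeasure lborel (Y \<inter> {z. 0 \<le> z \<bullet> e \<and> z \<bullet> e \<le> 1})
       = ennreal (e \<bullet> \<nu>) * emeasure lborel (cylinder \<nu> (Y \<inter> {z. z \<bullet> \<nu> = 0}))"
proof -
  let ?I = "indicator {0..1::real} :: real \<Rightarrow> ennreal"
  let ?S = "Y \<inter> {z. 0 \<le> z \<bullet> \<nu> \<and> z \<bullet> \<nu> \<le> 1}"
  let ?C = "cylinder \<nu> (Y \<inter> {z. z \<bullet> \<nu> = 0})"
  have \<nu>\<nu>: "\<nu> \<bullet> \<nu> = 1" using \<nu> by (simp add: norm_eq_1)
  have Sm[measurable]: "?S \<in> sets borel"
    by (intro sets.Int Y borel_closed closed_Collect_conj closed_Collect_le continuous_intros)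
  have Cm[measurable]: "?C \<in> sets borel"
    by (intro cylinder_borel sets.Int Y borel_closed closed_Collect_eq continuous_intros)
  have "emeasure lborel ?S = (\<integral>\<^sup>+z. indicator ?S z \<partial>lborel)" by simp
  also have "\<dots> = (\<integral>\<^sup>+s. \<integral>\<^sup>+z. ?I (z \<bullet> \<nu>) * indicator ?S (z + (s - z \<bullet> \<nu>) *\<^sub>R \<nu>) \<partial>lborel \<partial>lborel)"
    by (rule nn_integral_hyperplane_fibration) (auto simp: \<nu>)
  also have "\<dots> = (\<integral>\<^sup>+s. ?I s * emeasure lborel ?C \<partial>lborel)"
  proof (rule nn_integral_cong)
    fix s :: real
    define w where "w = s *\<^sub>R ((1 / (e \<bullet> \<nu>)) *\<^sub>R e - \<nu>)"
    have w\<nu>: "w \<bullet> \<nu> = 0" using \<nu> by (simp add: w_def inner_diff_left \<nu>\<nu>)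
    have "(\<integral>\<^sup>+z. ?I (z \<bullet> \<nu>) * indicator ?S (z + (s - z \<bullet> \<nu>) *\<^sub>R \<nu>) \<partial>lborel)
        = (\<integral>\<^sup>+z. ?I ((w + z) \<bullet> \<nu>) * indicator ?S ((w + z) + (s - (w + z) \<bullet> \<nu>) *\<^sub>R \<nu>) \<partial>lborel)"
      by (rule nn_integral_lborel_translate[symmetric]) measurable
    also have "\<dots> = (\<integral>\<^sup>+z. ?I s * indicator ?C z \<partial>lborel)"
    proof (rule nn_integral_cong)
      fix z
      define p where "p = z - (z \<bullet> \<nu>) *\<^sub>R \<nu>"
      have p\<nu>: "p \<bullet> \<nu> = 0" by (simp add: p_def inner_diff_left \<nu>\<nu>)
      have 1: "(w + z) \<bullet> \<nu> = z \<bullet> \<nu>" by (simp add: inner_add_left w\<nu>)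
      have 2: "(w + z) + (s - z \<bullet> \<nu>) *\<^sub>R \<nu> = p + (s / (e \<bullet> \<nu>)) *\<^sub>R e"
        by (simp add: w_def p_def scaleR_diff_right scaleR_diff_left)
      have 3: "(p + (s / (e \<bullet> \<nu>)) *\<^sub>R e) \<bullet> \<nu> = s" using \<nu> by (simp add: inner_add_left p\<nu>)
      have "indicator ?S (p + (s / (e \<bullet> \<nu>)) *\<^sub>R e) = indicator Y p * ?I s"
        using inv[of p "s / (e \<bullet> \<nu>)"] 3 by (auto simp: indicator_def)
      moreover have "z \<in> ?C \<longleftrightarrow> 0 \<le> z \<bullet> \<nu> \<and> z \<bullet> \<nu> \<le> 1 \<and> p \<in> Y"
        using p\<nu> by (simp add: cylinder_def p_def[symmetric])
      then have "indicator ?C z = ?I (z \<bullet> \<nu>) * indicator Y p" by (auto simp: indicator_def)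
      ultimately show "?I ((w + z) \<bullet> \<nu>) * indicator ?S ((w + z) + (s - (w + z) \<bullet> \<nu>) *\<^sub>R \<nu>) = ?I s * indicator ?C z"
        unfolding 1 2 by (simp only: mult_ac)
    qed
    also have "\<dots> = ?I s * emeasure lborel ?C" by (simp add: nn_integral_cmult)
    finally show "(\<integral>\<^sup>+z. ?I (z \<bullet> \<nu>) * indicator ?S (z + (s - z \<bullet> \<nu>) *\<^sub>R \<nu>) \<partial>lborel) = ?I s * emeasure lborel ?C" .
  qed
  also have "\<dots> = emeasure lborel ?C" by (simp add: nn_integral_multc)
  finally show ?thesis unfolding emeasure_slab_change[OF Y inv e \<nu>(2)] by simp
qed

section \<open>Projection of the boundary along a direction\<close>

lemma emeasure_le_of_pieces:
  assumes sets: "sets N = sets M" and P: "\<And>n :: nat. P n \<in> sets M" and A: "A \<in> sets M" "A \<subseteq> (\<Union>n. P n)"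
    and le: "\<And>n B. B \<in> sets M \<Longrightarrow> B \<subseteq> P n \<Longrightarrow> emeasure M B \<le> q * emeasure N B"
  shows "emeasure M A \<le> q * emeasure N A"
proof -
  define D where "D n = A \<inter> disjointed P n" for n
  have D: "D n \<in> sets M" "D n \<subseteq> P n" for n
  proof -
    have "range (disjointed P) \<subseteq> sets M" by (rule sets.range_disjointed_sets) (use P in blast)
    then show "D n \<in> sets M" unfolding D_def by (intro sets.Int A(1)) blast
    show "D n \<subseteq> P n" by (auto simp: D_def disjointed_def)
  qed
  have dj: "disjoint_family D" using disjoint_family_disjointed[of P] by (auto simp: disjoint_family_on_def D_def)
  have U: "(\<Union>n. D n) = A" using A(2) UN_disjointed_eq[of P] by (auto simp: D_def)
  have rD: "range D \<subseteq> sets M" "range D \<subseteq> sets N" using D(1) sets by auto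
  have "emeasure M A = (\<Sum>n. emeasure M (D n))"
    using suminf_emeasure[OF rD(1) dj] by (simp only: U)
  also have "\<dots> \<le> (\<Sum>n. q * emeasure N (D n))" by (intro suminf_le le[OF D]) auto
  also have "\<dots> = q * (\<Sum>n. emeasure N (D n))" by (rule ennreal_suminf_cmult)
  also have "(\<Sum>n. emeasure N (D n)) = emeasure N A"
    using suminf_emeasure[OF rD(2) dj] by (simp only: U)
  finally show ?thesis .
qed

definition slab :: "'a::real_inner \<Rightarrow> 'a set" where "slab e = {z. 0 \<le> z \<bullet> e \<and> z \<bullet> e \<le> 1}"

lemma closed_slab: "closed (slab (e :: 'a::real_inner))"
  unfolding slab_def by (intro closed_Collect_conj closed_Collect_le continuous_intros)

text \<open>The restriction to the Borel sets, on which uniqueness of measures and the transformation formula are used. Surface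
measure itself has more measurable sets, among them all null sets; the outward normal, whose values at singular points
are arbitrary, need not be Borel measurable.\<close>

definition borel_surface :: "(real^'d::finite) measure" where
  "borel_surface = distr surface_measure borel (\<lambda>x. x)"

lemma measurable_id_surface: "(\<lambda>x. x) \<in> measurable surface_measure borel"
  using borel_sets_surface_measure by (auto intro!: measurableI simp: space_surface_measure)

lemma sets_borel_surface: "sets borel_surface = sets borel" "space borel_surface = UNIV"
  by (simp_all add: borel_surface_def)

lemma emeasure_borel_surface: "A \<in> sets borel \<Longrightarrow> emeasure borel_surface A = surface_outer A"
  unfolding borel_surface_def using emeasure_surface_measure[of A] borel_sets_surface_measure[of A]
  by (subst emeasure_distr[OF measurable_id_surface]) (auto simp: space_surface_measure)

context convex_body
begin

text \<open>The union of the lines parallel to \<open>e\<close> through the interior of \<open>K\<close>. Each of them leaves \<open>K\<close> at the point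
\<open>exit_point e z\<close> and enters it at \<open>exit_point (- e) z\<close>.\<close>

definition shadow :: "real^'d \<Rightarrow> (real^'d) set" where
  "shadow e = {z. \<exists>t. z + t *\<^sub>R e \<in> interior K}"

definition height :: "real^'d \<Rightarrow> real^'d \<Rightarrow> real" where
  "height e z = Sup {t. z + t *\<^sub>R e \<in> K}"

definition exit_point :: "real^'d \<Rightarrow> real^'d \<Rightarrow> real^'d" where
  "exit_point e z = z + height e z *\<^sub>R e"

lemma bounded_chord:
  assumes "norm e = 1" obtains M where "\<And>z t. z + t *\<^sub>R e \<in> K \<Longrightarrow> \<bar>t + z \<bullet> e\<bar> \<le> M" "\<And>x. x \<in> K \<Longrightarrow> norm x \<le> M"
proof -
  obtain M where M: "\<And>x. x \<in> K \<Longrightarrow> norm x \<le> M" using compact_imp_bounded[OF compact_K] by (auto simp: bounded_iff)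
  have "e \<bullet> e = 1" using assms by (simp add: norm_eq_1)
  then have "\<bar>t + z \<bullet> e\<bar> = \<bar>(z + t *\<^sub>R e) \<bullet> e\<bar>" for z t by (simp add: inner_add_left add.commute)
  also have "\<dots> z t \<le> norm (z + t *\<^sub>R e)" for z t using Cauchy_Schwarz_ineq2[of "z + t *\<^sub>R e" e] assms by simp
  finally have *: "\<bar>t + z \<bullet> e\<bar> \<le> norm (z + t *\<^sub>R e)" for z t .
  show thesis by (rule that[OF order_trans[OF * M] M])
qed

lemma height_facts:
  assumes e: "norm e = 1" and z: "z + t *\<^sub>R e \<in> K"
  shows "exit_point e z \<in> K" "t \<le> height e z"
proof -
  let ?T = "{t. z + t *\<^sub>R e \<in> K}"
  obtain M where M: "\<And>z t. z + t *\<^sub>R e \<in> K \<Longrightarrow> \<bar>t + z \<bullet> e\<bar> \<le> M" using bounded_chord[OF e] by metis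
  have bd: "bdd_above ?T"
  proof (rule bdd_aboveI)
    fix s assume "s \<in> ?T" then show "s \<le> M - z \<bullet> e" using M[of z s] by simp
  qed
  have cl: "closed ?T"
    using continuous_closed_vimage[OF closed_K, of "\<lambda>t. z + t *\<^sub>R e"] by (simp add: vimage_def continuous_intros)
  have "Sup ?T \<in> ?T" by (rule closed_contains_Sup[OF _ bd cl]) (use z in auto)
  then show "exit_point e z \<in> K" by (simp add: exit_point_def height_def)
  show "t \<le> height e z" unfolding height_def by (rule cSup_upper[OF _ bd]) (use z in simp)
qed

lemma height_eqI:
  assumes "z + h *\<^sub>R e \<in> K" "\<And>t. z + t *\<^sub>R e \<in> K \<Longrightarrow> t \<le> h"
  shows "height e z = h"
  unfolding height_def by (rule cSup_eq_maximum) (use assms in auto)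

lemma shadow_translate: "z + s *\<^sub>R e \<in> shadow e \<longleftrightarrow> z \<in> shadow e"
proof -
  have "(z + s *\<^sub>R e) + t *\<^sub>R e = z + (s + t) *\<^sub>R e" for t by (simp add: scaleR_add_left add.assoc)
  then have "z + s *\<^sub>R e \<in> shadow e \<longleftrightarrow> (\<exists>t. z + (s + t) *\<^sub>R e \<in> interior K)" by (simp only: shadow_def mem_Collect_eq)
  also have "\<dots> \<longleftrightarrow> (\<exists>t. z + t *\<^sub>R e \<in> interior K)" by (metis add.commute diff_add_cancel)
  finally show ?thesis by (simp add: shadow_def)
qed

lemma exit_point_translate:
  assumes e: "norm e = 1" and z: "z + t *\<^sub>R e \<in> K"
  shows "exit_point e (z + s *\<^sub>R e) = exit_point e z"
proof -
  have "height e (z + s *\<^sub>R e) = height e z - s"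
  proof (rule height_eqI)
    show "z + s *\<^sub>R e + (height e z - s) *\<^sub>R e \<in> K"
      using height_facts(1)[OF e z] by (simp add: exit_point_def algebra_simps)
    fix r assume "z + s *\<^sub>R e + r *\<^sub>R e \<in> K"
    then have "z + (s + r) *\<^sub>R e \<in> K" by (simp add: scaleR_add_left algebra_simps)
    then show "r \<le> height e z - s" using height_facts(2)[OF e] by force
  qed
  then show ?thesis by (simp add: exit_point_def scaleR_diff_left)
qed

lemma shadow_chord: "z \<in> shadow e \<Longrightarrow> \<exists>t. z + t *\<^sub>R e \<in> K"
  using interior_subset by (auto simp: shadow_def)

lemma open_shadow: "open (shadow e)"
proof -
  have "shadow e = (\<Union>t. (\<lambda>z. z + t *\<^sub>R e) -` interior K)" by (auto simp: shadow_def)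
  moreover have "open ((\<lambda>z. z + t *\<^sub>R e) -` interior K)" for t
    by (rule open_vimage) (auto intro: continuous_intros)
  ultimately show ?thesis by auto
qed

lemma convex_shadow: "convex (shadow e)"
proof (rule convexI)
  fix x y u v assume xy: "x \<in> shadow e" "y \<in> shadow e" and uv: "0 \<le> u" "0 \<le> v" "u + v = (1::real)"
  then obtain s t where "x + s *\<^sub>R e \<in> interior K" "y + t *\<^sub>R e \<in> interior K" by (auto simp: shadow_def)
  then have "u *\<^sub>R (x + s *\<^sub>R e) + v *\<^sub>R (y + t *\<^sub>R e) \<in> interior K"
    using convex_interior[OF convex_K] uv by (simp add: convexD)
  moreover have "u *\<^sub>R (x + s *\<^sub>R e) + v *\<^sub>R (y + t *\<^sub>R e) = (u *\<^sub>R x + v *\<^sub>R y) + (u * s + v * t) *\<^sub>R e"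
    by (simp add: algebra_simps)
  ultimately show "u *\<^sub>R x + v *\<^sub>R y \<in> shadow e" by (auto simp: shadow_def)
qed

text \<open>The height is a concave function on an open convex set.\<close>

lemma continuous_exit_point:
  assumes e: "norm e = 1" shows "continuous_on (shadow e) (exit_point e)"
proof -
  have "convex_on (shadow e) (\<lambda>z. - height e z)"
  proof (rule convex_onI)
    fix t x y assume t: "0 < t" "t < (1::real)" and xy: "x \<in> shadow e" "y \<in> shadow e"
    have "exit_point e x \<in> K" "exit_point e y \<in> K" using xy height_facts(1)[OF e] shadow_chord by blast+
    then have "(1 - t) *\<^sub>R exit_point e x + t *\<^sub>R exit_point e y \<in> K"
      using convex_K t by (simp add: convexD)
    moreover have "(1 - t) *\<^sub>R exit_point e x + t *\<^sub>R exit_point e y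
        = ((1 - t) *\<^sub>R x + t *\<^sub>R y) + ((1 - t) * height e x + t * height e y) *\<^sub>R e"
      by (simp add: exit_point_def algebra_simps)
    ultimately have "(1 - t) * height e x + t * height e y \<le> height e ((1 - t) *\<^sub>R x + t *\<^sub>R y)"
      using height_facts(2)[OF e] by simp
    then show "- height e ((1 - t) *\<^sub>R x + t *\<^sub>R y) \<le> (1 - t) * - height e x + t * - height e y" by simp
  qed (rule convex_shadow)
  then have "continuous_on (shadow e) (\<lambda>z. - height e z)" by (rule convex_on_continuous[OF open_shadow])
  then have "continuous_on (shadow e) (height e)" using continuous_on_minus by fastforce
  then show ?thesis unfolding exit_point_def[abs_def] by (intro continuous_intros)
qed

lemma exit_point_frontier:
  assumes e: "norm e = 1" and z: "z + t *\<^sub>R e \<in> K"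
  shows "exit_point e z \<in> frontier K"
proof -
  have "exit_point e z \<notin> interior K"
  proof
    assume "exit_point e z \<in> interior K"
    then obtain r where r: "r > 0" "cball (exit_point e z) r \<subseteq> K" by (meson mem_interior_cball)
    have "exit_point e z + r *\<^sub>R e \<in> cball (exit_point e z) r" using r e by (simp add: dist_norm)
    then have "z + (height e z + r) *\<^sub>R e \<in> K" using r(2) by (auto simp: exit_point_def algebra_simps)
    then show False using height_facts(2)[OF e] r(1) by force
  qed
  then show ?thesis using height_facts(1)[OF e z] closure_subset by (auto simp: frontier_def)
qed

lemma exit_point_normal:
  assumes e: "norm e = 1" and z: "z \<in> shadow e" and n: "unit_normal (exit_point e z) n"
  shows "0 < n \<bullet> e"
proof -
  obtain t where t: "z + t *\<^sub>R e \<in> interior K" using z by (auto simp: shadow_def)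
  have "n \<bullet> (z + t *\<^sub>R e - exit_point e z) < 0" by (rule unit_normal_interior[OF n t])
  then have "0 < (height e z - t) * (n \<bullet> e)" by (simp add: exit_point_def inner_diff_right inner_add_right algebra_simps)
  moreover have "t \<le> height e z" using height_facts(2)[OF e] t interior_subset by blast
  ultimately show ?thesis by (simp add: zero_less_mult_iff)
qed

text \<open>The value 0 at singular points makes this field Borel measurable.\<close>

definition normal_field :: "real^'d \<Rightarrow> real^'d" where
  "normal_field x = (if x \<in> regular then outward_normal K x else 0)"

definition upper :: "real^'d \<Rightarrow> (real^'d) set" where
  "upper e = {x \<in> regular. 0 < outward_normal K x \<bullet> e}"

lemma normal_field_borel[measurable]: "normal_field \<in> borel_measurable borel"
  using normal_borel by (simp add: normal_field_def[abs_def])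

lemma upper_borel: "upper e \<in> sets borel"
proof -
  have "upper e = {x. 0 < normal_field x \<bullet> e}" by (auto simp: upper_def normal_field_def)
  also have "\<dots> \<in> sets borel" using borel_measurable_less[of "\<lambda>_. 0" borel "\<lambda>x. normal_field x \<bullet> e"] by simp
  finally show ?thesis .
qed

text \<open>If the line through \<open>x\<close> missed the interior, a hyperplane containing the line would support \<open>K\<close> at \<open>x\<close>; its normal is
orthogonal to \<open>e\<close>, in contradiction to uniqueness of the normal at \<open>x\<close>.\<close>

lemma upper_exit_point:
  assumes e: "norm e = 1" and x: "x \<in> upper e"
  shows "x \<in> shadow e" "exit_point e x = x"
proof -
  define n where "n = outward_normal K x"
  have x_reg: "x \<in> regular" and ne: "0 < n \<bullet> e" using x by (auto simp: upper_def n_def)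
  then have n: "unit_normal x n" using regular_normal by (simp add: n_def)
  have xK: "x \<in> K" using x_reg frontier_subset_K by (auto simp: regular_def)
  have "height e x = 0"
  proof (rule height_eqI)
    show "x + 0 *\<^sub>R e \<in> K" using xK by simp
    fix t assume "x + t *\<^sub>R e \<in> K"
    then have "n \<bullet> (x + t *\<^sub>R e - x) \<le> 0" using n by (auto simp: unit_normal_def)
    then show "t \<le> 0" using ne by (simp add: mult_le_0_iff)
  qed
  then show "exit_point e x = x" by (simp add: exit_point_def)
  show "x \<in> shadow e"
  proof (rule ccontr)
    assume "x \<notin> shadow e"
    then have disj: "interior K \<inter> range (\<lambda>t. x + t *\<^sub>R e) = {}" by (auto simp: shadow_def)
    have "convex (range (\<lambda>t. x + t *\<^sub>R e))"
    proof (rule convexI)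
      fix p q u v assume "p \<in> range (\<lambda>t. x + t *\<^sub>R e)" "q \<in> range (\<lambda>t. x + t *\<^sub>R e)" and uv: "u + v = (1::real)"
      then obtain s t where "p = x + s *\<^sub>R e" "q = x + t *\<^sub>R e" by blast
      then have "u *\<^sub>R p + v *\<^sub>R q = (u + v) *\<^sub>R x + (u * s + v * t) *\<^sub>R e" by (simp add: algebra_simps)
      then show "u *\<^sub>R p + v *\<^sub>R q \<in> range (\<lambda>t. x + t *\<^sub>R e)" using uv by auto
    qed
    then obtain a b where ab: "a \<noteq> 0" "\<And>y. y \<in> interior K \<Longrightarrow> a \<bullet> y \<le> b" "\<And>t. b \<le> a \<bullet> (x + t *\<^sub>R e)"
      using separating_hyperplane_sets[OF convex_interior[OF convex_K] _ interior_K _ disj] by auto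
    have "a \<bullet> e = 0"
    proof (rule ccontr)
      assume "a \<bullet> e \<noteq> 0"
      then have "a \<bullet> (x + ((b - 1 - a \<bullet> x) / (a \<bullet> e)) *\<^sub>R e) = b - 1" by (simp add: inner_add_right)
      then show False using ab(3)[of "(b - 1 - a \<bullet> x) / (a \<bullet> e)"] by simp
    qed
    have le: "a \<bullet> y \<le> a \<bullet> x" if "y \<in> K" for y
    proof -
      have "interior K \<subseteq> {y. a \<bullet> y \<le> a \<bullet> x}" using ab(2) ab(3)[of 0] by force
      then have "closure (interior K) \<subseteq> {y. a \<bullet> y \<le> a \<bullet> x}"
        by (rule closure_minimal) (rule closed_halfspace_le)
      then show ?thesis using that K_eq_closure_interior by auto
    qed
    have "unit_normal x ((1 / norm a) *\<^sub>R a)"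
    proof -
      have "((1 / norm a) *\<^sub>R a) \<bullet> (y - x) \<le> 0" if "y \<in> K" for y
      proof -
        have "a \<bullet> (y - x) \<le> 0" using le[OF that] by (simp add: inner_diff_right)
        then show ?thesis by (simp add: divide_nonpos_nonneg)
      qed
      then show ?thesis using ab(1) by (simp add: unit_normal_def)
    qed
    then have "(1 / norm a) *\<^sub>R a = n" using regular_normal[OF x_reg] by (simp add: n_def)
    moreover have "((1 / norm a) *\<^sub>R a) \<bullet> e = 0" using \<open>a \<bullet> e = 0\<close> by simp
    ultimately show False using ne by simp
  qed
qed

lemma shadow_slab_bounded:
  assumes e: "norm e = 1" shows "bounded (shadow e \<inter> slab e)"
proof -
  obtain M where M: "\<And>z t. z + t *\<^sub>R e \<in> K \<Longrightarrow> \<bar>t + z \<bullet> e\<bar> \<le> M" "\<And>x. x \<in> K \<Longrightarrow> norm x \<le> M"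
    using bounded_chord[OF e] by metis
  have "norm z \<le> M + (M + 1)" if z: "z \<in> shadow e \<inter> slab e" for z
  proof -
    obtain t where t: "z + t *\<^sub>R e \<in> K" using z shadow_chord by blast
    have "\<bar>t\<bar> \<le> M + 1" using M(1)[OF t] z by (auto simp: slab_def)
    moreover have "norm z \<le> norm (z + t *\<^sub>R e) + norm (t *\<^sub>R e)" using norm_triangle_ineq4[of "z + t *\<^sub>R e" "t *\<^sub>R e"] by simp
    ultimately show ?thesis using M(2)[OF t] e by simp
  qed
  then show ?thesis unfolding bounded_iff by blast
qed

text \<open>Each line of the shadow meets the slab in a segment of length 1, so this is the Lebesgue measure of the
set of lines parallel to \<open>e\<close>, transported to the points where these lines leave \<open>K\<close>.\<close>

definition exit_measure :: "real^'d \<Rightarrow> (real^'d) measure" where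
  "exit_measure e = distr (density lborel (indicator (shadow e \<inter> slab e))) borel
     (\<lambda>z. if z \<in> shadow e then exit_point e z else z)"

definition flux_measure :: "real^'d \<Rightarrow> (real^'d) measure" where
  "flux_measure e = density borel_surface (\<lambda>x. ennreal (max 0 (normal_field x \<bullet> e)))"

lemma shadow_slab_borel: "shadow e \<inter> slab e \<in> sets borel"
  by (intro sets.Int borel_open borel_closed open_shadow closed_slab)

lemma exit_borel: "norm e = 1 \<Longrightarrow> (\<lambda>z. if z \<in> shadow e then exit_point e z else z) \<in> borel_measurable borel"
  by (intro borel_measurable_continuous_on_if borel_open open_shadow continuous_exit_point continuous_intros)

lemma exit_preimage_borel:
  assumes e: "norm e = 1" and A: "A \<in> sets borel"
  shows "{z \<in> shadow e. exit_point e z \<in> A} \<in> sets borel"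
proof -
  have "{z \<in> shadow e. exit_point e z \<in> A} = shadow e \<inter> (\<lambda>z. if z \<in> shadow e then exit_point e z else z) -` A"
    by auto
  then show ?thesis using measurable_sets_borel[OF exit_borel[OF e] A] open_shadow by auto
qed

lemma emeasure_exit_measure:
  assumes e: "norm e = 1" and A: "A \<in> sets borel"
  shows "emeasure (exit_measure e) A = emeasure lborel ({z \<in> shadow e. exit_point e z \<in> A} \<inter> slab e)"
proof -
  let ?f = "\<lambda>z. if z \<in> shadow e then exit_point e z else z"
  have f: "?f \<in> measurable (density lborel (indicator (shadow e \<inter> slab e))) borel"
    using exit_borel[OF e] by simp
  have "emeasure (exit_measure e) A = emeasure (density lborel (indicator (shadow e \<inter> slab e))) (?f -` A)"
    unfolding exit_measure_def using f A by (subst emeasure_distr) auto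
  also have "\<dots> = emeasure lborel ((shadow e \<inter> slab e) \<inter> ?f -` A)"
    using shadow_slab_borel measurable_sets_borel[OF exit_borel[OF e] A] by (intro emeasure_restricted) auto
  also have "(shadow e \<inter> slab e) \<inter> ?f -` A = {z \<in> shadow e. exit_point e z \<in> A} \<inter> slab e" by auto
  finally show ?thesis .
qed

lemma sets_exit_measure: "sets (exit_measure e) = sets borel" and sets_flux_measure: "sets (flux_measure e) = sets borel"
  by (simp_all add: exit_measure_def flux_measure_def sets_borel_surface)

lemma emeasure_flux_measure:
  assumes "A \<in> sets borel"
  shows "emeasure (flux_measure e) A = (\<integral>\<^sup>+x. ennreal (max 0 (normal_field x \<bullet> e)) * indicator A x \<partial>borel_surface)"
  unfolding flux_measure_def
  by (rule emeasure_density) (use assms in \<open>auto simp: sets_borel_surface intro!: measurable_compose[OF _ measurable_ennreal] borel_measurable_max borel_measurable_inner simp: measurable_cong_sets[OF sets_borel_surface(1) refl]\<close>)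

lemma exit_measure_finite: "norm e = 1 \<Longrightarrow> A \<in> sets borel \<Longrightarrow> emeasure (exit_measure e) A < \<infinity>"
proof -
  assume e: "norm e = 1" and A: "A \<in> sets borel"
  have "emeasure (exit_measure e) A \<le> emeasure lborel (shadow e \<inter> slab e)"
    unfolding emeasure_exit_measure[OF e A] using shadow_slab_borel by (intro emeasure_mono) auto
  also have "\<dots> < \<infinity>" by (rule emeasure_bounded_finite[OF shadow_slab_bounded[OF e]])
  finally show ?thesis .
qed

text \<open>The projection \<open>\<theta>\<close> along \<open>e\<close> to the hyperplane orthogonal to \<open>\<nu>\<close> changes the difference \<open>x - y\<close> of
two points of \<open>A\<close> by \<open>((x - y) \<bullet> \<nu>) / (e \<bullet> \<nu>) e\<close>, whose norm \<open>normal_slope\<close> bounds by \<open>\<delta> |x - y|\<close>. Thus \<open>\<theta>\<close> changes surface measure by a factor between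
\<open>(1 - \<delta>)\<^sup>d\<^sup>-\<^sup>1\<close> and \<open>(1 + \<delta>)\<^sup>d\<^sup>-\<^sup>1\<close>. The exit measure of \<open>A\<close> is \<open>e \<bullet> \<nu>\<close> times the measure of \<open>\<theta> ` A\<close>, and on \<open>A\<close> the weight \<open>n \<bullet> e\<close>
of the flux measure agrees with \<open>e \<bullet> \<nu>\<close> up to a factor \<open>1 \<plusminus> \<delta>\<close>.\<close>

lemma exit_flux_piece:
  assumes e: "norm e = 1" and A: "A \<in> sets borel" "A \<subseteq> upper e" and \<nu>: "norm \<nu> = 1" "0 < e \<bullet> \<nu>"
    and \<delta>: "0 < \<delta>" "\<delta> < 1" and near: "\<And>x. x \<in> A \<Longrightarrow> norm (outward_normal K x - \<nu>) \<le> \<delta> * (e \<bullet> \<nu>)"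
  defines "q \<equiv> ((1 + \<delta>) / (1 - \<delta>)) ^ CARD('d)"
  shows "emeasure (flux_measure e) A \<le> ennreal q * emeasure (exit_measure e) A"
    and "emeasure (exit_measure e) A \<le> ennreal q * emeasure (flux_measure e) A"
proof -
  define c where "c = e \<bullet> \<nu>"
  have c: "0 < c" using \<nu> by (simp add: c_def)
  have \<nu>\<nu>: "\<nu> \<bullet> \<nu> = 1" using \<nu> by (simp add: norm_eq_1)
  define \<theta> where "\<theta> z = z - ((z \<bullet> \<nu>) / c) *\<^sub>R e" for z
  have \<theta>d: "\<theta> x - \<theta> y = (x - y) - (((x - y) \<bullet> \<nu>) / c) *\<^sub>R e" for x y
    by (simp add: \<theta>_def inner_diff_left scaleR_diff_left diff_divide_distrib)
  have AK: "x \<in> K" "unit_normal x (outward_normal K x)" "x \<in> shadow e" "exit_point e x = x" if "x \<in> A" for x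
    using that A(2) frontier_subset_K regular_normal upper_exit_point[OF e] unfolding upper_def regular_def by blast+
  have err: "norm ((((x - y) \<bullet> \<nu>) / c) *\<^sub>R e) \<le> \<delta> * norm (x - y)" if "x \<in> A" "y \<in> A" for x y
  proof -
    have "\<bar>(x - y) \<bullet> \<nu>\<bar> \<le> (\<delta> * c) * norm (x - y)"
      using normal_slope[OF AK(2)[OF that(1)] AK(2)[OF that(2)] AK(1)[OF that(1)] AK(1)[OF that(2)] near[OF that(1)] near[OF that(2)]]
      by (simp add: c_def)
    then show ?thesis using c e by (simp add: field_simps)
  qed
  have up: "norm (\<theta> x - \<theta> y) \<le> (1 + \<delta>) * norm (x - y)" if "x \<in> A" "y \<in> A" for x y
    using norm_triangle_ineq4[of "x - y" "(((x - y) \<bullet> \<nu>) / c) *\<^sub>R e"] err[OF that] unfolding \<theta>d by (simp add: algebra_simps)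
  have lo: "(1 - \<delta>) * norm (x - y) \<le> norm (\<theta> x - \<theta> y)" if "x \<in> A" "y \<in> A" for x y
    using norm_triangle_ineq2[of "x - y" "(((x - y) \<bullet> \<nu>) / c) *\<^sub>R e"] err[OF that] unfolding \<theta>d by (simp add: algebra_simps)
  have inj: "inj_on \<theta> A"
  proof (rule inj_onI)
    fix x y assume "x \<in> A" "y \<in> A" "\<theta> x = \<theta> y"
    then have "(1 - \<delta>) * norm (x - y) \<le> 0" using lo[of x y] by simp
    then show "x = y" using \<delta> by (simp add: mult_le_0_iff)
  qed
  define Y where "Y = {z \<in> shadow e. exit_point e z \<in> A}"
  have Y: "Y \<in> sets borel" unfolding Y_def by (rule exit_preimage_borel[OF e A(1)])
  have Yinv: "z + s *\<^sub>R e \<in> Y \<longleftrightarrow> z \<in> Y" for z s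
    using shadow_translate[of z s e] exit_point_translate[OF e] shadow_chord by (metis (mono_tags, lifting) Y_def mem_Collect_eq)
  have \<theta>A: "\<theta> ` A = Y \<inter> {z. z \<bullet> \<nu> = 0}"
  proof (intro equalityI subsetI)
    fix z assume "z \<in> \<theta> ` A"
    then obtain x where x: "x \<in> A" "z = x + (- ((x \<bullet> \<nu>) / c)) *\<^sub>R e" by (auto simp: \<theta>_def)
    have "x \<in> Y" using x(1) AK by (simp add: Y_def)
    then have "z \<in> Y" unfolding x(2) Yinv .
    moreover have "z \<bullet> \<nu> = 0" using c unfolding x(2) by (simp add: inner_diff_left c_def[symmetric])
    ultimately show "z \<in> Y \<inter> {z. z \<bullet> \<nu> = 0}" by simp
  next
    fix z assume z: "z \<in> Y \<inter> {z. z \<bullet> \<nu> = 0}"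
    have "\<theta> (exit_point e z) = z"
      using z c by (simp add: \<theta>_def exit_point_def inner_add_left c_def[symmetric])
    moreover have "exit_point e z \<in> A" using z by (simp add: Y_def)
    ultimately show "z \<in> \<theta> ` A" by (metis image_eqI)
  qed
  have \<theta>Ab: "\<theta> ` A \<in> sets borel"
    unfolding \<theta>A by (intro sets.Int Y borel_closed closed_Collect_eq continuous_intros)
  have "surface_outer (\<theta> ` A) = emeasure lborel (cylinder \<nu> (\<theta> ` A))"
    by (rule surface_outer_hyperplane[OF \<nu>(1) \<theta>Ab]) (auto simp: \<theta>A)
  then have exit_eq: "emeasure (exit_measure e) A = ennreal c * surface_outer (\<theta> ` A)"
    unfolding emeasure_exit_measure[OF e A(1)] Y_def[symmetric] slab_def
    by (simp add: emeasure_oblique_cylinder[OF Y Yinv e \<nu>] \<theta>A c_def)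
  have S1: "surface_outer (\<theta> ` A) \<le> ennreal ((1 + \<delta>) ^ (CARD('d) - 1)) * surface_outer A"
    by (rule surface_outer_lipschitz_image) (use \<delta> up in \<open>auto simp: dist_norm\<close>)
  have S2: "surface_outer A \<le> ennreal ((1 / (1 - \<delta>)) ^ (CARD('d) - 1)) * surface_outer (\<theta> ` A)"
  proof -
    have "surface_outer (inv_into A \<theta> ` \<theta> ` A) \<le> ennreal ((1 / (1 - \<delta>)) ^ (CARD('d) - 1)) * surface_outer (\<theta> ` A)"
    proof (rule surface_outer_lipschitz_image)
      show "0 < 1 / (1 - \<delta>)" using \<delta> by simp
      fix x y assume "x \<in> \<theta> ` A" "y \<in> \<theta> ` A"
      then show "dist (inv_into A \<theta> x) (inv_into A \<theta> y) \<le> 1 / (1 - \<delta>) * dist x y"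
        using lo \<delta> inj by (auto simp: dist_norm field_simps)
    qed
    then show ?thesis using inj by simp
  qed
  have nb: "c * (1 - \<delta>) \<le> max 0 (normal_field x \<bullet> e)" "max 0 (normal_field x \<bullet> e) \<le> c * (1 + \<delta>)" if "x \<in> A" for x
  proof -
    have nf: "normal_field x = outward_normal K x" using that A(2) by (auto simp: normal_field_def upper_def)
    have "\<bar>(normal_field x - \<nu>) \<bullet> e\<bar> \<le> norm (normal_field x - \<nu>) * norm e" by (rule Cauchy_Schwarz_ineq2)
    also have "\<dots> \<le> \<delta> * c" using near[OF that] e by (simp add: nf c_def)
    finally have "\<bar>normal_field x \<bullet> e - c\<bar> \<le> \<delta> * c" by (simp only: inner_diff_left c_def inner_commute[of e \<nu>])
    then have "c * (1 - \<delta>) \<le> normal_field x \<bullet> e" "normal_field x \<bullet> e \<le> c * (1 + \<delta>)" by (auto simp: algebra_simps)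
    moreover have "0 \<le> c * (1 + \<delta>)" using c \<delta> by simp
    ultimately show "c * (1 - \<delta>) \<le> max 0 (normal_field x \<bullet> e)" "max 0 (normal_field x \<bullet> e) \<le> c * (1 + \<delta>)" by auto
  qed
  have const: "(\<integral>\<^sup>+x. ennreal r * indicator A x \<partial>borel_surface) = ennreal r * surface_outer A" for r
    using A(1) by (simp add: nn_integral_cmult_indicator sets_borel_surface emeasure_borel_surface)
  have F1: "emeasure (flux_measure e) A \<le> ennreal (c * (1 + \<delta>)) * surface_outer A"
    unfolding emeasure_flux_measure[OF A(1)] const[symmetric]
    by (rule nn_integral_mono) (use nb(2) in \<open>auto simp: indicator_def intro: ennreal_leI\<close>)
  have F2: "ennreal (c * (1 - \<delta>)) * surface_outer A \<le> emeasure (flux_measure e) A"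
    unfolding emeasure_flux_measure[OF A(1)] const[symmetric]
    by (rule nn_integral_mono) (use nb(1) in \<open>auto simp: indicator_def intro: ennreal_leI\<close>)
  define m where "m = CARD('d) - 1"
  have m: "CARD('d) = Suc m" by (simp add: m_def)
  have d0: "0 < 1 - \<delta>" using \<delta> by simp
  have q1: "(1 + \<delta>) * (1 / (1 - \<delta>)) ^ m \<le> q"
  proof -
    have "(1 + \<delta>) * (1 / (1 - \<delta>)) ^ m \<le> ((1 + \<delta>) / (1 - \<delta>)) * ((1 + \<delta>) / (1 - \<delta>)) ^ m"
      using \<delta> by (intro mult_mono power_mono divide_right_mono) (auto simp: le_divide_eq mult_le_cancel_left1)
    then show ?thesis by (simp add: q_def m)
  qed
  have q2: "(1 / (1 - \<delta>)) * (1 + \<delta>) ^ m \<le> q"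
  proof -
    have "(1 / (1 - \<delta>)) * (1 + \<delta>) ^ m \<le> ((1 + \<delta>) / (1 - \<delta>)) * ((1 + \<delta>) / (1 - \<delta>)) ^ m"
      using \<delta> by (intro mult_mono power_mono divide_right_mono) (auto simp: le_divide_eq mult_le_cancel_left1)
    then show ?thesis by (simp add: q_def m)
  qed
  have "emeasure (flux_measure e) A \<le> ennreal (c * (1 + \<delta>)) * (ennreal ((1 / (1 - \<delta>)) ^ m) * surface_outer (\<theta> ` A))"
    by (rule order_trans[OF F1 mult_left_mono]) (use S2 in \<open>auto simp: m_def\<close>)
  also have "\<dots> = ennreal ((1 + \<delta>) * (1 / (1 - \<delta>)) ^ m) * (ennreal c * surface_outer (\<theta> ` A))"
    using c \<delta> by (simp add: ennreal_mult mult_ac)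
  also have "\<dots> \<le> ennreal q * emeasure (exit_measure e) A"
    unfolding exit_eq by (intro mult_right_mono ennreal_leI q1) auto
  finally show "emeasure (flux_measure e) A \<le> ennreal q * emeasure (exit_measure e) A" .
  have "emeasure (exit_measure e) A \<le> ennreal c * (ennreal ((1 + \<delta>) ^ m) * surface_outer A)"
    unfolding exit_eq by (rule mult_left_mono) (use S1 in \<open>auto simp: m_def\<close>)
  also have "\<dots> = ennreal ((1 / (1 - \<delta>)) * (1 + \<delta>) ^ m) * (ennreal (c * (1 - \<delta>)) * surface_outer A)"
  proof -
    have "c * (1 + \<delta>) ^ m = ((1 / (1 - \<delta>)) * (1 + \<delta>) ^ m) * (c * (1 - \<delta>))" using d0 by simp
    then have "ennreal c * ennreal ((1 + \<delta>) ^ m) = ennreal ((1 / (1 - \<delta>)) * (1 + \<delta>) ^ m) * ennreal (c * (1 - \<delta>))"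
      using c \<delta> by (simp add: ennreal_mult[symmetric] del: times_divide_eq_left times_divide_eq_right)
    then show ?thesis by (simp add: mult.assoc[symmetric])
  qed
  also have "\<dots> \<le> ennreal q * emeasure (flux_measure e) A"
    by (intro mult_mono ennreal_leI q2 F2) auto
  finally show "emeasure (exit_measure e) A \<le> ennreal q * emeasure (flux_measure e) A" .
qed

text \<open>Countably many of the sets in \<open>exit_flux_piece\<close> cover the upper part of the boundary, so the estimate holds for \<open>A\<close>
itself with the factor \<open>q n\<close>, which tends to 1.\<close>

lemma flux_eq_exit_upper:
  assumes e: "norm e = 1" and A: "A \<in> sets borel" "A \<subseteq> upper e"
  shows "emeasure (flux_measure e) A = emeasure (exit_measure e) A"
proof -
  define q where "q n = ((1 + 1 / real (n + 2)) / (1 - 1 / real (n + 2))) ^ CARD('d)" for n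
  have le: "emeasure (flux_measure e) A \<le> ennreal (q n) * emeasure (exit_measure e) A \<and>
      emeasure (exit_measure e) A \<le> ennreal (q n) * emeasure (flux_measure e) A" for n
  proof -
    define \<delta> where "\<delta> = 1 / real (n + 2)"
    have \<delta>: "0 < \<delta>" "\<delta> < 1" by (auto simp: \<delta>_def)
    define W where "W = {\<nu>. norm \<nu> = 1 \<and> 0 < e \<bullet> \<nu>}"
    obtain F where F: "F \<subseteq> (\<lambda>\<nu>. ball \<nu> (\<delta> * (e \<bullet> \<nu>))) ` W" "countable F" "\<Union>F = (\<Union>\<nu>\<in>W. ball \<nu> (\<delta> * (e \<bullet> \<nu>)))"
      using Lindelof[of "(\<lambda>\<nu>. ball \<nu> (\<delta> * (e \<bullet> \<nu>))) ` W"] by (metis (no_types, lifting) imageE open_ball)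
    obtain C where C: "C \<subseteq> W" "countable C" "F = (\<lambda>\<nu>. ball \<nu> (\<delta> * (e \<bullet> \<nu>))) ` C"
      using F(1,2) by (meson countable_image_eq_inj countable_subset_image)
    have "e \<in> W" using e by (simp add: W_def norm_eq_1)
    then have "e \<in> \<Union>F" unfolding F(3) using e \<delta> by (intro UN_I[of e]) (auto simp: norm_eq_1)
    then have "C \<noteq> {}" unfolding C(3) by blast
    define \<nu> where "\<nu> = from_nat_into C"
    have \<nu>: "\<nu> n \<in> W" for n using from_nat_into[OF \<open>C \<noteq> {}\<close>] C(1) by (auto simp: \<nu>_def)
    have \<nu>C: "range \<nu> = C" unfolding \<nu>_def by (rule range_from_nat_into[OF \<open>C \<noteq> {}\<close> C(2)])
    define P where "P n = upper e \<inter> normal_field -` ball (\<nu> n) (\<delta> * (e \<bullet> \<nu> n))" for n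
    have P: "P n \<in> sets borel" for n
      unfolding P_def by (intro sets.Int upper_borel measurable_sets_borel[OF normal_field_borel] borel_open open_ball)
    have cov: "A \<subseteq> (\<Union>n. P n)"
    proof
      fix x assume "x \<in> A"
      then have x: "x \<in> upper e" using A(2) by blast
      then have nx: "normal_field x = outward_normal K x" "x \<in> regular" "0 < outward_normal K x \<bullet> e"
        by (auto simp: upper_def normal_field_def)
      then have "unit_normal x (normal_field x)" using regular_normal by simp
      then have W: "normal_field x \<in> W" using nx by (simp add: W_def unit_normal_def inner_commute)
      then have "normal_field x \<in> \<Union>F" unfolding F(3) using \<delta> by (intro UN_I[of "normal_field x"]) (auto simp: W_def)
      then obtain \<mu> where "\<mu> \<in> C" "normal_field x \<in> ball \<mu> (\<delta> * (e \<bullet> \<mu>))" unfolding C(3) by blast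
      then show "x \<in> (\<Union>n. P n)" using x \<nu>C unfolding P_def by blast
    qed
    have piece: "emeasure (flux_measure e) B \<le> ennreal (q n) * emeasure (exit_measure e) B"
        "emeasure (exit_measure e) B \<le> ennreal (q n) * emeasure (flux_measure e) B"
      if B: "B \<in> sets borel" "B \<subseteq> P k" for B k
    proof -
      have Bu: "B \<subseteq> upper e" using B(2) by (auto simp: P_def)
      have nr: "norm (outward_normal K x - \<nu> k) \<le> \<delta> * (e \<bullet> \<nu> k)" if "x \<in> B" for x
      proof -
        have "x \<in> upper e" "dist (\<nu> k) (normal_field x) < \<delta> * (e \<bullet> \<nu> k)" using that B(2) by (auto simp: P_def)
        then show ?thesis by (simp add: upper_def normal_field_def dist_norm norm_minus_commute)
      qed
      have n1: "norm (\<nu> k) = 1" "0 < e \<bullet> \<nu> k" using \<nu>[of k] by (auto simp: W_def)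
      show "emeasure (flux_measure e) B \<le> ennreal (q n) * emeasure (exit_measure e) B"
        "emeasure (exit_measure e) B \<le> ennreal (q n) * emeasure (flux_measure e) B"
        using exit_flux_piece[OF e B(1) Bu n1 \<delta> nr] unfolding q_def \<delta>_def by blast+
    qed
    show ?thesis
      by (intro conjI; rule emeasure_le_of_pieces[where P = P])
        (use piece P A(1) cov in \<open>auto simp: sets_exit_measure sets_flux_measure\<close>)
  qed
  have "q \<longlonglongrightarrow> ((1 + 0) / (1 - 0)) ^ CARD('d)"
    unfolding q_def by (intro tendsto_intros LIMSEQ_ignore_initial_segment lim_1_over_n) simp
  then have qe: "(\<lambda>n. ennreal (q n)) \<longlonglongrightarrow> 1" using tendsto_ennrealI by fastforce
  have fin: "emeasure (exit_measure e) A < top" using exit_measure_finite[OF e A(1)] by simp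
  have "(\<lambda>n. emeasure (exit_measure e) A * ennreal (q n)) \<longlonglongrightarrow> emeasure (exit_measure e) A * 1"
    by (rule ennreal_tendsto_cmult[OF fin qe])
  then have 1: "emeasure (flux_measure e) A \<le> emeasure (exit_measure e) A"
    using le by (intro LIMSEQ_le_const[of "\<lambda>n. emeasure (exit_measure e) A * ennreal (q n)"]) (auto simp: mult.commute)
  then have "emeasure (flux_measure e) A < top" using fin by simp
  then have "(\<lambda>n. emeasure (flux_measure e) A * ennreal (q n)) \<longlonglongrightarrow> emeasure (flux_measure e) A * 1"
    by (rule ennreal_tendsto_cmult[OF _ qe])
  then have "emeasure (exit_measure e) A \<le> emeasure (flux_measure e) A"
    using le by (intro LIMSEQ_le_const[of "\<lambda>n. emeasure (flux_measure e) A * ennreal (q n)"]) (auto simp: mult.commute)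
  with 1 show ?thesis by (rule antisym)
qed

text \<open>Orthogonal projection does not increase surface measure, so the lines through singular points form a cylinder over a
null set.\<close>

lemma exit_measure_singular_null: "norm e = 1 \<Longrightarrow> emeasure (exit_measure e) singular = 0"
proof -
  assume e: "norm e = 1"
  have ee: "e \<bullet> e = 1" using e by (simp add: norm_eq_1)
  define P where "P z = z - (z \<bullet> e) *\<^sub>R e" for z :: "real^'d"
  have "surface_outer (P ` singular) \<le> ennreal (1 ^ (CARD('d) - 1)) * surface_outer singular"
  proof (rule surface_outer_lipschitz_image)
    fix x y :: "real^'d"
    have "P x - P y = (x - y) - ((x - y) \<bullet> e) *\<^sub>R e" by (simp add: P_def inner_diff_left scaleR_diff_left)
    note Pxy = this
    have "(norm (P x - P y))\<^sup>2 = (norm (x - y))\<^sup>2 - ((x - y) \<bullet> e)\<^sup>2"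
    proof -
      have "(w - (w \<bullet> e) *\<^sub>R e) \<bullet> (w - (w \<bullet> e) *\<^sub>R e) = w \<bullet> w - (w \<bullet> e)\<^sup>2" for w
        by (simp add: inner_diff_left inner_diff_right ee power2_eq_square inner_commute[of e w])
      then show ?thesis unfolding Pxy power2_norm_eq_inner .
    qed
    then have "(norm (P x - P y))\<^sup>2 \<le> (norm (x - y))\<^sup>2" by simp
    then show "dist (P x) (P y) \<le> 1 * dist x y" using power2_le_imp_le[of "norm (P x - P y)" "norm (x - y)"] by (simp only: dist_norm mult_1 norm_ge_zero)
  qed simp
  then have "surface_outer (P ` singular) = 0" using surface_singular_null by simp
  then obtain B where B: "B \<in> null_sets lborel" "cylinder e (P ` singular) \<subseteq> B"
    using surface_null_cylinder[OF e] by blast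
  have "{z \<in> shadow e. exit_point e z \<in> singular} \<inter> slab e \<subseteq> cylinder e (P ` singular)"
  proof
    fix z assume z: "z \<in> {z \<in> shadow e. exit_point e z \<in> singular} \<inter> slab e"
    have "P (exit_point e z) = z - (z \<bullet> e) *\<^sub>R e"
      by (simp add: P_def exit_point_def inner_add_left ee algebra_simps)
    then have "z - (z \<bullet> e) *\<^sub>R e \<in> P ` singular" using z by (metis (mono_tags, lifting) IntD1 image_eqI mem_Collect_eq)
    then show "z \<in> cylinder e (P ` singular)" using z by (auto simp: cylinder_def slab_def)
  qed
  then have "emeasure lborel ({z \<in> shadow e. exit_point e z \<in> singular} \<inter> slab e) \<le> emeasure lborel B"
    using B by (intro emeasure_mono) auto
  then show ?thesis using B(1) by (simp add: emeasure_exit_measure[OF e singular_borel] null_sets_def)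
qed

text \<open>A line of the shadow leaves \<open>K\<close> at a point where every normal satisfies \<open>n \<bullet> e > 0\<close>, so both measures are concentrated
on \<open>upper e\<close> and the singular points.\<close>

lemma flux_measure_eq_exit_measure:
  assumes e: "norm e = 1" shows "flux_measure e = exit_measure e"
proof (rule measure_eqI)
  show "sets (flux_measure e) = sets (exit_measure e)" by (simp add: sets_exit_measure sets_flux_measure)
  fix A assume "A \<in> sets (flux_measure e)"
  then have A: "A \<in> sets borel" by (simp add: sets_flux_measure)
  have Au: "A \<inter> upper e \<in> sets borel" using A upper_borel by (rule sets.Int)
  have "emeasure (flux_measure e) A = emeasure (flux_measure e) (A \<inter> upper e)"
    unfolding emeasure_flux_measure[OF A] emeasure_flux_measure[OF Au]
    by (rule nn_integral_cong) (auto simp: indicator_def upper_def normal_field_def max_def)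
  also have "\<dots> = emeasure (exit_measure e) (A \<inter> upper e)" by (rule flux_eq_exit_upper[OF e Au]) simp
  also have "\<dots> = emeasure (exit_measure e) A"
  proof (rule antisym)
    show "emeasure (exit_measure e) (A \<inter> upper e) \<le> emeasure (exit_measure e) A"
      by (rule emeasure_mono) (use A in \<open>auto simp: sets_exit_measure\<close>)
    have "emeasure (exit_measure e) A \<le> emeasure (exit_measure e) ((A \<inter> upper e) \<union> singular)"
      unfolding emeasure_exit_measure[OF e A] emeasure_exit_measure[OF e sets.Un[OF Au singular_borel]]
    proof (rule emeasure_mono)
      show "{z \<in> shadow e. exit_point e z \<in> A \<inter> upper e \<union> singular} \<inter> slab e \<in> sets lborel"
        using exit_preimage_borel[OF e sets.Un[OF Au singular_borel]] closed_slab[of e] by auto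
      show "{z \<in> shadow e. exit_point e z \<in> A} \<inter> slab e \<subseteq> {z \<in> shadow e. exit_point e z \<in> A \<inter> upper e \<union> singular} \<inter> slab e"
      proof
        fix z assume z: "z \<in> {z \<in> shadow e. exit_point e z \<in> A} \<inter> slab e"
        then obtain t where "z + t *\<^sub>R e \<in> K" using shadow_chord by blast
        then have fr: "exit_point e z \<in> frontier K" by (rule exit_point_frontier[OF e])
        have "0 < outward_normal K (exit_point e z) \<bullet> e"
          using exit_point_normal[OF e _ unit_normal_outward_normal[OF fr]] z by simp
        then show "z \<in> {z \<in> shadow e. exit_point e z \<in> A \<inter> upper e \<union> singular} \<inter> slab e"
          using z fr by (auto simp: upper_def regular_def)
      qed
    qed
    also have "\<dots> \<le> emeasure (exit_measure e) (A \<inter> upper e) + emeasure (exit_measure e) singular"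
      by (rule emeasure_subadditive) (use Au singular_borel in \<open>auto simp: sets_exit_measure\<close>)
    finally show "emeasure (exit_measure e) A \<le> emeasure (exit_measure e) (A \<inter> upper e)"
      using exit_measure_singular_null[OF e] by simp
  qed
  finally show "emeasure (flux_measure e) A = emeasure (exit_measure e) A" .
qed

lemma flux_integral_upper:
  fixes f :: "real^'d \<Rightarrow> real"
  assumes e: "norm e = 1" and f[measurable]: "f \<in> borel_measurable borel" and bd: "\<And>x. x \<in> frontier K \<Longrightarrow> \<bar>f x\<bar> \<le> B"
  shows "integrable borel_surface (\<lambda>x. max 0 (normal_field x \<bullet> e) * f x)"
    and "integrable lborel (\<lambda>z. indicator (shadow e \<inter> slab e) z * f (exit_point e z))"
    and "(\<integral>x. max 0 (normal_field x \<bullet> e) * f x \<partial>borel_surface)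
       = (\<integral>z. indicator (shadow e \<inter> slab e) z * f (exit_point e z) \<partial>lborel)"
proof -
  let ?T = "\<lambda>z. if z \<in> shadow e then exit_point e z else z"
  note exb[measurable] = exit_borel[OF e]
  have ind[measurable]: "indicator (shadow e \<inter> slab e) \<in> borel_measurable borel" for e
    using shadow_slab_borel by simp
  have cong: "indicator (shadow e \<inter> slab e) z * f (?T z) = indicator (shadow e \<inter> slab e) z * f (exit_point e z)" for z
    by (auto simp: indicator_def)
  have fr: "exit_point e z \<in> frontier K" if "z \<in> shadow e" for z
    using that shadow_chord exit_point_frontier[OF e] by blast
  have bd': "\<bar>f (exit_point e z)\<bar> \<le> B" if "z \<in> shadow e" for z by (rule bd[OF fr[OF that]])
  have m: "(\<lambda>z. indicator (shadow e \<inter> slab e) z * f (exit_point e z)) \<in> borel_measurable borel"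
    unfolding cong[symmetric] using shadow_slab_borel by measurable
  show int2: "integrable lborel (\<lambda>z. indicator (shadow e \<inter> slab e) z * f (exit_point e z))"
  proof (rule integrableI_bounded_set[where A = "shadow e \<inter> slab e" and B = B])
    show "emeasure lborel (shadow e \<inter> slab e) < \<infinity>" by (rule emeasure_bounded_finite[OF shadow_slab_bounded[OF e]])
  qed (use m shadow_slab_borel bd' in \<open>auto simp: indicator_def\<close>)
  have mN: "(\<lambda>x. max 0 (normal_field x \<bullet> e)) \<in> borel_measurable borel_surface"
    unfolding measurable_cong_sets[OF sets_borel_surface(1) refl] by measurable
  have f': "f \<in> borel_measurable borel_surface"
    unfolding measurable_cong_sets[OF sets_borel_surface(1) refl] by (rule f)
  let ?D = "density lborel (\<lambda>z. ennreal (indicator (shadow e \<inter> slab e) z))"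
  have D: "density lborel (indicator (shadow e \<inter> slab e)) = ?D" by (simp add: ennreal_indicator)
  have mT: "?T \<in> measurable ?D borel" by simp
  have mI: "(\<lambda>z. indicator (shadow e \<inter> slab e) z :: real) \<in> borel_measurable lborel" using shadow_slab_borel by simp
  have mfT: "(\<lambda>z. f (?T z)) \<in> borel_measurable lborel" by simp
  have int_exit: "integrable (exit_measure e) f"
    unfolding exit_measure_def D integrable_distr_eq[OF mT f]
    by (subst integrable_density[OF mfT mI]) (use int2 in \<open>simp_all add: cong\<close>)
  have eq_exit: "integral\<^sup>L (exit_measure e) f = (\<integral>z. indicator (shadow e \<inter> slab e) z * f (exit_point e z) \<partial>lborel)"
    unfolding exit_measure_def D integral_distr[OF mT f]
    by (subst integral_density[OF mfT mI]) (simp_all add: cong)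
  show "integrable borel_surface (\<lambda>x. max 0 (normal_field x \<bullet> e) * f x)"
    using int_exit unfolding flux_measure_eq_exit_measure[OF e, symmetric] flux_measure_def
    by (subst (asm) integrable_density) (use mN f' in auto)
  show "(\<integral>x. max 0 (normal_field x \<bullet> e) * f x \<partial>borel_surface)
       = (\<integral>z. indicator (shadow e \<inter> slab e) z * f (exit_point e z) \<partial>lborel)"
    unfolding eq_exit[symmetric] flux_measure_eq_exit_measure[OF e, symmetric] flux_measure_def
    by (subst integral_density) (use mN f' in auto)
qed

end

section \<open>The divergence theorem on a convex body\<close>

lemma integral_lborel_translate:
  fixes f :: "'a::euclidean_space \<Rightarrow> real"
  assumes [measurable]: "f \<in> borel_measurable borel"
  shows "(\<integral>z. f (x + z) \<partial>lborel) = (\<integral>z. f z \<partial>lborel)"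
proof -
  have "(\<integral>z. f z \<partial>lborel) = (\<integral>z. f z \<partial>distr lborel borel ((+) x))" by (simp add: lborel_distr_plus)
  also have "\<dots> = (\<integral>z. f (x + z) \<partial>lborel)" by (rule integral_distr) simp_all
  finally show ?thesis by simp
qed

lemma integrable_lborel_bounded:
  fixes f :: "'a::euclidean_space \<Rightarrow> real"
  assumes "f \<in> borel_measurable borel" "\<And>x. \<bar>f x\<bar> \<le> B" "\<And>x. f x \<noteq> 0 \<Longrightarrow> norm x \<le> R"
  shows "integrable lborel f"
proof (rule integrableI_bounded_set[where A = "cball 0 R" and B = B])
  show "emeasure lborel (cball 0 R :: 'a set) < \<infinity>" by (rule emeasure_bounded_finite) simp
  show "AE x in lborel. x \<in> cball 0 R \<longrightarrow> norm (f x) \<le> B" using assms(2) by simp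
  show "AE x in lborel. x \<notin> cball 0 R \<longrightarrow> f x = 0" using assms(3) by (intro AE_I2) force
qed (use assms(1) in simp_all)

lemma integrable_lborel_pair_bounded:
  fixes F :: "'a::euclidean_space \<Rightarrow> real \<Rightarrow> real"
  assumes "case_prod F \<in> borel_measurable (borel \<Otimes>\<^sub>M borel)" "\<And>z s. \<bar>F z s\<bar> \<le> B"
    "\<And>z s. F z s \<noteq> 0 \<Longrightarrow> norm z \<le> R \<and> \<bar>s\<bar> \<le> R"
  shows "integrable (lborel \<Otimes>\<^sub>M lborel) (case_prod F)"
  unfolding lborel_prod
proof (rule integrable_lborel_bounded[where B = B and R = "R + R"])
  show "case_prod F \<in> borel_measurable borel" using assms(1) by (simp add: borel_prod)
  fix p :: "'a \<times> real"
  show "\<bar>case_prod F p\<bar> \<le> B" using assms(2) by (simp add: split_beta)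
  assume "case_prod F p \<noteq> 0"
  then have "norm (fst p) \<le> R" "norm (snd p) \<le> R" using assms(3)[of "fst p" "snd p"] by (auto simp: split_beta)
  then show "norm p \<le> R + R" using norm_Pair_le[of "fst p" "snd p"] by simp
qed

text \<open>Every line parallel to \<open>e\<close> is represented by the points of the slab on it, a segment of length 1.\<close>

lemma integral_lines:
  fixes G :: "'a::euclidean_space \<Rightarrow> real"
  assumes [measurable]: "G \<in> borel_measurable borel" and B: "\<And>x. \<bar>G x\<bar> \<le> B" and R: "\<And>x. G x \<noteq> 0 \<Longrightarrow> norm x \<le> R"
    and e: "norm e = 1"
  shows "(\<integral>x. G x \<partial>lborel) = (\<integral>z. indicator (slab e) z * (\<integral>s. G (z + s *\<^sub>R e) \<partial>lborel) \<partial>lborel)"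
proof -
  have ee: "e \<bullet> e = 1" using e by (simp add: norm_eq_1)
  have B0: "0 \<le> B" using B[of undefined] by linarith
  let ?J = "indicator {0..1::real} :: real \<Rightarrow> real"
  have sl: "indicator (slab e) z = ?J (z \<bullet> e)" for z by (simp add: slab_def indicator_def)
  have le: "\<bar>w \<bullet> e\<bar> \<le> norm w" for w using Cauchy_Schwarz_ineq2[of w e] e by simp
  define F where "F z s = ?J (z \<bullet> e) * G (z + s *\<^sub>R e)" for z and s :: real
  define F' where "F' z s = ?J (z \<bullet> e - s) * G z" for z and s :: real
  have iF: "integrable (lborel \<Otimes>\<^sub>M lborel) (case_prod F)"
  proof (rule integrable_lborel_pair_bounded[where B = B and R = "\<bar>R\<bar> + \<bar>R\<bar> + 1"])
    show "case_prod F \<in> borel_measurable (borel \<Otimes>\<^sub>M borel)" unfolding F_def by measurable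
    fix z s show "\<bar>F z s\<bar> \<le> B" using B B0 by (auto simp: F_def indicator_def)
    assume "F z s \<noteq> 0"
    then have z: "0 \<le> z \<bullet> e" "z \<bullet> e \<le> 1" and n: "norm (z + s *\<^sub>R e) \<le> R" using R by (auto simp: F_def indicator_def split: if_splits)
    have "(z + s *\<^sub>R e) \<bullet> e = z \<bullet> e + s" by (simp add: inner_add_left ee)
    then have s: "\<bar>s\<bar> \<le> R + 1" using z n le[of "z + s *\<^sub>R e"] by linarith
    have "norm z \<le> norm (z + s *\<^sub>R e) + norm (s *\<^sub>R e)" using norm_triangle_ineq4[of "z + s *\<^sub>R e" "s *\<^sub>R e"] by simp
    then show "norm z \<le> \<bar>R\<bar> + \<bar>R\<bar> + 1 \<and> \<bar>s\<bar> \<le> \<bar>R\<bar> + \<bar>R\<bar> + 1"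
      using s n e by (simp add: abs_le_iff) linarith
  qed
  have iF': "integrable (lborel \<Otimes>\<^sub>M lborel) (case_prod F')"
  proof (rule integrable_lborel_pair_bounded[where B = B and R = "\<bar>R\<bar> + \<bar>R\<bar> + 1"])
    show "case_prod F' \<in> borel_measurable (borel \<Otimes>\<^sub>M borel)" unfolding F'_def by measurable
    fix z s show "\<bar>F' z s\<bar> \<le> B" using B B0 by (auto simp: F'_def indicator_def)
    assume "F' z s \<noteq> 0"
    then have "0 \<le> z \<bullet> e - s" "z \<bullet> e - s \<le> 1" "norm z \<le> R" using R by (auto simp: F'_def indicator_def split: if_splits)
    then show "norm z \<le> \<bar>R\<bar> + \<bar>R\<bar> + 1 \<and> \<bar>s\<bar> \<le> \<bar>R\<bar> + \<bar>R\<bar> + 1" using le[of z] by linarith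
  qed
  have "(\<integral>z. indicator (slab e) z * (\<integral>s. G (z + s *\<^sub>R e) \<partial>lborel) \<partial>lborel) = (\<integral>z. \<integral>s. F z s \<partial>lborel \<partial>lborel)"
    by (simp add: F_def sl)
  also have "\<dots> = (\<integral>s. \<integral>z. F z s \<partial>lborel \<partial>lborel)" by (rule lborel_pair.Fubini_integral[OF iF, symmetric])
  also have "\<dots> = (\<integral>s. \<integral>z. F' z s \<partial>lborel \<partial>lborel)"
  proof (rule Bochner_Integration.integral_cong[OF refl])
    fix s :: real
    have m: "(\<lambda>z. F' z s) \<in> borel_measurable borel" unfolding F'_def by measurable
    have "F z s = F' (s *\<^sub>R e + z) s" for z
      by (simp add: F_def F'_def inner_add_left ee add.commute)
    then show "(\<integral>z. F z s \<partial>lborel) = (\<integral>z. F' z s \<partial>lborel)" using integral_lborel_translate[OF m, of "s *\<^sub>R e"] by simp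
  qed
  also have "\<dots> = (\<integral>z. \<integral>s. F' z s \<partial>lborel \<partial>lborel)" by (rule lborel_pair.Fubini_integral[OF iF'])
  also have "\<dots> = (\<integral>z. G z \<partial>lborel)"
  proof (rule Bochner_Integration.integral_cong[OF refl])
    fix z
    have "(\<lambda>s. ?J (z \<bullet> e - s)) = indicator {z \<bullet> e - 1 .. z \<bullet> e}" by (auto simp: indicator_def fun_eq_iff)
    then have "(\<integral>s. ?J (z \<bullet> e - s) \<partial>lborel) = 1" by simp
    then show "(\<integral>s. F' z s \<partial>lborel) = G z" by (simp add: F'_def)
  qed
  finally show ?thesis ..
qed

context convex_body
begin

lemma shadow_minus: "shadow (- e) = shadow e"
proof -
  have "(\<exists>t. z + t *\<^sub>R (- e) \<in> interior K) \<longleftrightarrow> (\<exists>t. z + t *\<^sub>R e \<in> interior K)" for z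
  proof -
    have "t *\<^sub>R (- e) = (- t) *\<^sub>R e" "t *\<^sub>R e = (- t) *\<^sub>R (- e)" for t :: real by simp_all
    then show ?thesis by (intro iffI; elim exE; metis)
  qed
  then show ?thesis by (simp add: shadow_def)
qed

text \<open>The positive and the negative part of \<open>n \<bullet> e\<close> belong to the exit measures of \<open>e\<close> and \<open>- e\<close>. A translation by \<open>e\<close> moves
the slab of \<open>- e\<close> to that of \<open>e\<close>.\<close>

lemma flux_integral_exit:
  fixes f :: "real^'d \<Rightarrow> real"
  assumes e: "norm e = 1" and f: "f \<in> borel_measurable borel" and bd: "\<And>x. x \<in> frontier K \<Longrightarrow> \<bar>f x\<bar> \<le> B"
  shows "integrable borel_surface (\<lambda>x. (normal_field x \<bullet> e) * f x)"
    and "(\<integral>x. (normal_field x \<bullet> e) * f x \<partial>borel_surface)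
       = (\<integral>z. indicator (slab e) z * (indicator (shadow e) z * (f (exit_point e z) - f (exit_point (- e) z))) \<partial>lborel)"
proof -
  have e': "norm (- e) = 1" using e by simp
  note up = flux_integral_upper[OF e f bd] and dn = flux_integral_upper[OF e' f bd, unfolded shadow_minus]
  have split: "(normal_field x \<bullet> e) * f x = max 0 (normal_field x \<bullet> e) * f x - max 0 (normal_field x \<bullet> (- e)) * f x" for x
    by (simp add: max_def)
  show "integrable borel_surface (\<lambda>x. (normal_field x \<bullet> e) * f x)"
    unfolding split by (intro Bochner_Integration.integrable_diff up dn)
  have m: "(\<lambda>z. indicator (shadow e \<inter> slab (- e)) z * f (exit_point (- e) z)) \<in> borel_measurable borel"
    using borel_measurable_integrable[OF dn(2)] by simp
  have shift: "indicator (shadow e \<inter> slab (- e)) (- e + z) * f (exit_point (- e) (- e + z))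
      = indicator (shadow e \<inter> slab e) z * f (exit_point (- e) z)" for z
  proof (cases "z \<in> shadow e")
    case True
    then have "- e + z \<in> shadow e" using shadow_translate[of z "-1" e] by (simp add: add.commute)
    moreover obtain t where "z + t *\<^sub>R (- e) \<in> K" using True shadow_chord[of z "- e"] shadow_minus by blast
    then have "exit_point (- e) (- e + z) = exit_point (- e) z"
      using exit_point_translate[OF e', of z t 1] by (simp add: add.commute)
    moreover have "- e + z \<in> slab (- e) \<longleftrightarrow> z \<in> slab e" using e by (auto simp: slab_def inner_diff_left norm_eq_1 inner_add_left)
    ultimately show ?thesis using True by (simp add: indicator_def)
  next
    case False
    then have "- e + z \<notin> shadow e" using shadow_translate[of z "-1" e] by (simp add: add.commute)
    then show ?thesis using False by simp
  qed
  have dn_eq: "(\<integral>z. indicator (shadow e \<inter> slab (- e)) z * f (exit_point (- e) z) \<partial>lborel)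
      = (\<integral>z. indicator (shadow e \<inter> slab e) z * f (exit_point (- e) z) \<partial>lborel)"
    using integral_lborel_translate[OF m, of "- e"] unfolding shift by simp
  have dn_int: "integrable lborel (\<lambda>z. indicator (shadow e \<inter> slab e) z * f (exit_point (- e) z))"
  proof -
    have "integrable (distr lborel borel ((+) (- e))) (\<lambda>z. indicator (shadow e \<inter> slab (- e)) z * f (exit_point (- e) z))"
      using dn(2) by (simp add: lborel_distr_plus)
    then have "integrable lborel (\<lambda>z. indicator (shadow e \<inter> slab (- e)) (- e + z) * f (exit_point (- e) (- e + z)))"
      by (subst (asm) integrable_distr_eq) (use m in simp_all)
    then show ?thesis unfolding shift .
  qed
  have "(\<integral>x. (normal_field x \<bullet> e) * f x \<partial>borel_surface)
      = (\<integral>z. indicator (shadow e \<inter> slab e) z * f (exit_point e z) \<partial>lborel)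
        - (\<integral>z. indicator (shadow e \<inter> slab e) z * f (exit_point (- e) z) \<partial>lborel)"
    unfolding split using up dn dn_eq by (simp add: Bochner_Integration.integral_diff)
  also have "\<dots> = (\<integral>z. indicator (shadow e \<inter> slab e) z * f (exit_point e z) - indicator (shadow e \<inter> slab e) z * f (exit_point (- e) z) \<partial>lborel)"
    by (rule Bochner_Integration.integral_diff[symmetric]) (use up dn_int in auto)
  also have "\<dots> = (\<integral>z. indicator (slab e) z * (indicator (shadow e) z * (f (exit_point e z) - f (exit_point (- e) z))) \<partial>lborel)"
    by (rule Bochner_Integration.integral_cong) (auto simp: indicator_def)
  finally show "(\<integral>x. (normal_field x \<bullet> e) * f x \<partial>borel_surface)
       = (\<integral>z. indicator (slab e) z * (indicator (shadow e) z * (f (exit_point e z) - f (exit_point (- e) z))) \<partial>lborel)" .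
qed

text \<open>An open segment from an interior point to a point of the closure stays in the interior, so a line through
the interior meets it in exactly the open interval between the two end points.\<close>

lemma interior_chord:
  assumes e: "norm e = 1" and z: "z \<in> shadow e"
  shows "{s. z + s *\<^sub>R e \<in> interior K} = {- height (- e) z <..< height e z}" (is "?I = _")
    and "- height (- e) z < height e z"
    and "\<And>s. s \<in> {- height (- e) z .. height e z} \<Longrightarrow> z + s *\<^sub>R e \<in> K"
    and "exit_point (- e) z = z + (- height (- e) z) *\<^sub>R e"
proof -
  have e': "norm (- e) = 1" using e by simp
  define b h where "b = - height (- e) z" and "h = height e z"
  obtain t where t: "z + t *\<^sub>R e \<in> interior K" using z by (auto simp: shadow_def)
  then have tK: "z + t *\<^sub>R e \<in> K" "z + (- t) *\<^sub>R (- e) \<in> K" using interior_subset by auto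
  show be: "exit_point (- e) z = z + (- height (- e) z) *\<^sub>R e" by (simp add: exit_point_def)
  have ends: "z + h *\<^sub>R e \<in> frontier K" "z + b *\<^sub>R e \<in> frontier K"
    using exit_point_frontier[OF e tK(1)] exit_point_frontier[OF e' tK(2)] unfolding be
    by (simp_all add: exit_point_def b_def h_def)
  have range: "b \<le> s" "s \<le> h" if "z + s *\<^sub>R e \<in> K" for s
    using height_facts(2)[OF e that] height_facts(2)[OF e', of z "- s"] that by (simp_all add: b_def h_def)
  have not_end: "z + h *\<^sub>R e \<notin> interior K" "z + b *\<^sub>R e \<notin> interior K" using ends by (auto simp: frontier_def)
  have sub: "b < s \<and> s < h" if "z + s *\<^sub>R e \<in> interior K" for s
  proof -
    have "z + s *\<^sub>R e \<in> K" using that interior_subset by blast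
    then have "b \<le> s" "s \<le> h" by (rule range)+
    moreover have "s \<noteq> h" "s \<noteq> b" using that not_end by auto
    ultimately show ?thesis by simp
  qed
  have cl: "z + h *\<^sub>R e \<in> closure K" "z + b *\<^sub>R e \<in> closure K" using ends by (auto simp: frontier_def)
  have toward: "z + s *\<^sub>R e \<in> interior K" if "z + r *\<^sub>R e \<in> closure K" "0 < u" "u < 1" "s = t + u * (r - t)" for s r u
  proof -
    have "z + s *\<^sub>R e = (1 - u) *\<^sub>R (z + t *\<^sub>R e) + u *\<^sub>R (z + r *\<^sub>R e)" by (simp add: that(4) algebra_simps)
    moreover have "z + t *\<^sub>R e \<noteq> z + r *\<^sub>R e \<Longrightarrow> (1 - u) *\<^sub>R (z + t *\<^sub>R e) + u *\<^sub>R (z + r *\<^sub>R e) \<in> open_segment (z + t *\<^sub>R e) (z + r *\<^sub>R e)"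
      using that by (auto simp: in_segment)
    moreover have "z + t *\<^sub>R e = z + r *\<^sub>R e \<Longrightarrow> (1 - u) *\<^sub>R (z + t *\<^sub>R e) + u *\<^sub>R (z + r *\<^sub>R e) = z + t *\<^sub>R e"
      by (metis scaleR_collapse)
    ultimately show ?thesis using in_interior_closure_convex_segment[OF convex_K t that(1)] t by (cases "z + t *\<^sub>R e = z + r *\<^sub>R e") auto
  qed
  have bth: "b < t" "t < h" using sub[OF t] by auto
  have sup: "z + s *\<^sub>R e \<in> interior K" if s: "b < s" "s < h" for s
  proof -
    consider "s = t" | "t < s" | "s < t" by linarith
    then show ?thesis
    proof cases
      case 1 then show ?thesis using t by simp
    next
      case 2
      have "0 < h - t" using bth by simp
      then show ?thesis using s 2
        by (intro toward[OF cl(1), of "(s - t) / (h - t)"]) auto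
    next
      case 3
      have tb: "0 < t - b" using bth by simp
      have "(t - s) / (t - b) * (b - t) = - ((t - s) / (t - b) * (t - b))" by (simp only: minus_diff_eq[of t b, symmetric] mult_minus_right)
      then have "s = t + (t - s) / (t - b) * (b - t)" using tb by simp
      then show ?thesis using s 3 tb
        by (intro toward[OF cl(2), of "(t - s) / (t - b)"]) auto
    qed
  qed
  show "?I = {- height (- e) z <..< height e z}" using sub sup by (auto simp: b_def h_def)
  show "- height (- e) z < height e z" using bth by (simp add: b_def h_def)
  fix s assume "s \<in> {- height (- e) z .. height e z}"
  then have "b \<le> s" "s \<le> h" by (auto simp: b_def h_def)
  then consider "s = b" | "s = h" | "b < s \<and> s < h" by linarith
  then show "z + s *\<^sub>R e \<in> K"
    using ends frontier_subset_K sup interior_subset by cases blast+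
qed

text \<open>Integration along the lines parallel to \<open>e\<close> and the fundamental theorem of calculus on each chord.\<close>

lemma integral_directional_derivative:
  fixes \<phi> :: "real^'d \<Rightarrow> real"
  assumes e: "norm e = 1" and W: "open W" "K \<subseteq> W"
    and diff: "\<And>x. x \<in> W \<Longrightarrow> (\<phi> has_derivative \<phi>' x) (at x)" and cont: "continuous_on W (\<lambda>x. \<phi>' x e)"
  shows "(\<integral>x. indicator (interior K) x * \<phi>' x e \<partial>lborel)
       = (\<integral>z. indicator (slab e) z * (indicator (shadow e) z * (\<phi> (exit_point e z) - \<phi> (exit_point (- e) z))) \<partial>lborel)"
proof -
  define G where "G x = indicator (interior K) x * \<phi>' x e" for x
  have cK: "continuous_on K (\<lambda>x. \<phi>' x e)" using cont W(2) by (rule continuous_on_subset)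
  have Gm: "G \<in> borel_measurable borel"
    using borel_measurable_continuous_on_indicator[OF borel_open[OF open_interior] continuous_on_subset[OF cK interior_subset]]
    by (simp add: G_def[abs_def])
  have "compact ((\<lambda>x. \<phi>' x e) ` K)" by (rule compact_continuous_image[OF cK compact_K])
  from compact_imp_bounded[OF this] obtain B where B: "\<And>x. x \<in> K \<Longrightarrow> \<bar>\<phi>' x e\<bar> \<le> B" by (auto simp: bounded_iff)
  obtain p where "p \<in> interior K" using interior_K by blast
  then have "p \<in> K" using interior_subset by blast
  then have B0: "0 \<le> B" using B[of p] by linarith
  have GB: "\<bar>G x\<bar> \<le> B" for x using B[of x] B0 interior_subset by (auto simp: G_def indicator_def)
  obtain R where R: "\<And>x. x \<in> K \<Longrightarrow> norm x \<le> R" using compact_imp_bounded[OF compact_K] by (auto simp: bounded_iff)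
  have GR: "norm x \<le> R" if "G x \<noteq> 0" for x using that R interior_subset by (auto simp: G_def indicator_def split: if_splits)
  have inner: "(\<integral>s. G (z + s *\<^sub>R e) \<partial>lborel) = indicator (shadow e) z * (\<phi> (exit_point e z) - \<phi> (exit_point (- e) z))" for z
  proof (cases "z \<in> shadow e")
    case False
    then have "G (z + s *\<^sub>R e) = 0" for s by (auto simp: G_def shadow_def)
    then show ?thesis using False by simp
  next
    case True
    define b h where "b = - height (- e) z" and "h = height e z"
    note ch = interior_chord[OF e True, folded b_def h_def]
    have zK: "z + s *\<^sub>R e \<in> K" if "s \<in> {b..h}" for s using ch(3) that .
    have "(\<integral>s. G (z + s *\<^sub>R e) \<partial>lborel) = (\<integral>s. indicator {b..h} s *\<^sub>R \<phi>' (z + s *\<^sub>R e) e \<partial>lborel)"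
    proof (rule integral_cong_AE)
      show "(\<lambda>s. G (z + s *\<^sub>R e)) \<in> borel_measurable lborel" using Gm by measurable
      have "continuous_on {b..h} (\<lambda>s. \<phi>' (z + s *\<^sub>R e) e)"
        by (rule continuous_on_compose2[OF cK]) (use zK in \<open>auto intro!: continuous_intros\<close>)
      then show "(\<lambda>s. indicator {b..h} s *\<^sub>R \<phi>' (z + s *\<^sub>R e) e) \<in> borel_measurable lborel"
        using borel_measurable_continuous_on_indicator[of "{b..h}" "\<lambda>s. \<phi>' (z + s *\<^sub>R e) e"] by simp
      have "AE s in lborel. s \<noteq> b" "AE s in lborel. s \<noteq> h" by (rule AE_lborel_singleton)+
      then show "AE s in lborel. G (z + s *\<^sub>R e) = indicator {b..h} s *\<^sub>R \<phi>' (z + s *\<^sub>R e) e"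
      proof eventually_elim
        case (elim s)
        have "s \<in> {s. z + s *\<^sub>R e \<in> interior K} \<longleftrightarrow> s \<in> {b<..<h}" by (simp only: ch(1))
        then have "indicator (interior K) (z + s *\<^sub>R e) = (indicator {b..h} s :: real)"
          using elim by (simp add: indicator_def less_le)
        then show ?case by (simp add: G_def)
      qed
    qed
    also have "\<dots> = \<phi> (z + h *\<^sub>R e) - \<phi> (z + b *\<^sub>R e)"
    proof (rule integral_FTC_atLeastAtMost)
      show "b \<le> h" using ch(2) by simp
      show "continuous_on {b..h} (\<lambda>s. \<phi>' (z + s *\<^sub>R e) e)"
        by (rule continuous_on_compose2[OF cK]) (use zK in \<open>auto intro!: continuous_intros\<close>)
      fix s assume "b \<le> s" "s \<le> h"
      then have "z + s *\<^sub>R e \<in> K" by (intro zK) simp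
      then have zW: "z + s *\<^sub>R e \<in> W" by (rule subsetD[OF W(2)])
      have 1: "((\<lambda>s. z + s *\<^sub>R e) has_vector_derivative e) (at s within {b..h})"
        unfolding has_vector_derivative_def
        by (rule has_derivative_eq_rhs, rule has_derivative_add[OF has_derivative_const has_derivative_scaleR_left[OF has_derivative_ident]]) simp
      have 2: "(\<phi> has_derivative \<phi>' (z + s *\<^sub>R e)) (at (z + s *\<^sub>R e) within (\<lambda>s. z + s *\<^sub>R e) ` {b..h})"
        by (rule has_derivative_at_withinI[OF diff[OF zW]])
      show "((\<lambda>s. \<phi> (z + s *\<^sub>R e)) has_vector_derivative \<phi>' (z + s *\<^sub>R e) e) (at s within {b..h})"
        using vector_derivative_diff_chain_within[OF 1 2] unfolding o_def .
    qed
    finally show ?thesis using True ch(4) by (simp add: exit_point_def h_def)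
  qed
  show ?thesis using integral_lines[OF Gm GB GR e] unfolding inner by (simp add: G_def)
qed

text \<open>Surface measure is complete, so a modification on a null set keeps measurability; it is used for the normal at
singular points.\<close>

lemma borel_measurable_surface_modify:
  fixes g :: "real^'d \<Rightarrow> real"
  assumes g: "g \<in> borel_measurable surface_measure" and N: "surface_outer N = 0" and eq: "\<And>x. x \<notin> N \<Longrightarrow> f x = g x"
  shows "f \<in> borel_measurable surface_measure"
proof (rule measurableI)
  fix A :: "real set" assume A: "A \<in> sets borel"
  have sub: "X \<in> sets surface_measure" if "X \<subseteq> N" for X
  proof -
    have "surface_outer X = 0" using surface_outer_mono[OF that] N by simp
    then show ?thesis using null_sets_surface_measure by blast
  qed
  have "f -` A \<inter> space surface_measure = ((g -` A \<inter> space surface_measure) - N) \<union> (f -` A \<inter> N)"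
    using eq by (auto simp: space_surface_measure)
  also have "\<dots> \<in> sets surface_measure"
    by (intro sets.Un sets.Diff measurable_sets[OF g A] sub) auto
  finally show "f -` A \<inter> space surface_measure \<in> sets surface_measure" .
qed simp

text \<open>Gauss's theorem for one coordinate direction: both sides are equal to the same integral over the lines in this direction.\<close>

theorem divergence_component:
  fixes \<phi> :: "real^'d \<Rightarrow> real"
  assumes W: "open W" "K \<subseteq> W" and diff: "\<And>x. x \<in> W \<Longrightarrow> \<phi> differentiable (at x)"
    and cont: "continuous_on W (partial_deriv i \<phi>)"
  shows "set_integrable surface_measure (frontier K) (\<lambda>x. outward_normal K x $ i * \<phi> x)"
    and "(LINT x:K|lebesgue. partial_deriv i \<phi> x) = (LINT x:frontier K|surface_measure. outward_normal K x $ i * \<phi> x)"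
proof -
  define e :: "real^'d" where "e = axis i 1"
  have e: "norm e = 1" by (simp add: e_def norm_axis_1)
  define f where "f x = indicator (frontier K) x * \<phi> x" for x
  have c\<phi>: "continuous_on W \<phi>" using diff by (meson continuous_at_imp_continuous_on differentiable_imp_continuous_within)
  have c\<phi>K: "continuous_on (frontier K) \<phi>" by (rule continuous_on_subset[OF c\<phi>]) (use W(2) frontier_subset_K in blast)
  have fm: "f \<in> borel_measurable borel"
    using borel_measurable_continuous_on_indicator[OF borel_compact[OF compact_frontier_K] c\<phi>K] by (simp add: f_def[abs_def])
  have "compact (\<phi> ` frontier K)" by (rule compact_continuous_image[OF c\<phi>K compact_frontier_K])
  from compact_imp_bounded[OF this] obtain B where "\<And>x. x \<in> frontier K \<Longrightarrow> \<bar>\<phi> x\<bar> \<le> B" by (auto simp: bounded_iff)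
  then have B: "\<bar>f x\<bar> \<le> B" if "x \<in> frontier K" for x using that by (simp add: f_def)
  have fl: "integrable borel_surface (\<lambda>x. (normal_field x \<bullet> e) * f x)"
      "(\<integral>x. (normal_field x \<bullet> e) * f x \<partial>borel_surface)
        = (\<integral>z. indicator (slab e) z * (indicator (shadow e) z * (f (exit_point e z) - f (exit_point (- e) z))) \<partial>lborel)"
    by (rule flux_integral_exit[OF e fm], erule B)+
  define h where "h x = (normal_field x \<bullet> e) * f x" for x
  have hm: "h \<in> borel_measurable borel" unfolding h_def using fm by measurable
  have hms: "h \<in> borel_measurable surface_measure"
    using measurable_compose[OF measurable_id_surface hm] by simp
  have hint: "integrable surface_measure h"
    using fl(1) unfolding borel_surface_def h_def[symmetric]
    by (subst (asm) integrable_distr_eq[OF measurable_id_surface hm]) simp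
  have hval: "integral\<^sup>L borel_surface h = integral\<^sup>L surface_measure h"
    unfolding borel_surface_def by (rule integral_distr[OF measurable_id_surface hm])
  define H where "H x = indicator (frontier K) x *\<^sub>R (outward_normal K x $ i * \<phi> x)" for x
  have eq: "H x = h x" if "x \<notin> singular" for x
    using that by (auto simp: H_def h_def f_def normal_field_def regular_def e_def inner_axis indicator_def)
  have Hm: "H \<in> borel_measurable surface_measure"
    by (rule borel_measurable_surface_modify[OF hms surface_singular_null eq])
  have AE: "AE x in surface_measure. H x = h x"
    by (rule AE_I'[OF null_sets_surface_measure[OF surface_singular_null]]) (use eq in auto)
  show "set_integrable surface_measure (frontier K) (\<lambda>x. outward_normal K x $ i * \<phi> x)"
    unfolding set_integrable_def H_def[symmetric] using integrable_cong_AE[OF Hm hms AE] hint by blast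
  have "(LINT x:frontier K|surface_measure. outward_normal K x $ i * \<phi> x) = integral\<^sup>L surface_measure h"
    unfolding set_lebesgue_integral_def H_def[symmetric] by (rule integral_cong_AE[OF Hm hms AE])
  also have "\<dots> = (\<integral>z. indicator (slab e) z * (indicator (shadow e) z * (f (exit_point e z) - f (exit_point (- e) z))) \<partial>lborel)"
    using fl(2) unfolding hval[symmetric] h_def .
  also have "\<dots> = (\<integral>z. indicator (slab e) z * (indicator (shadow e) z * (\<phi> (exit_point e z) - \<phi> (exit_point (- e) z))) \<partial>lborel)"
  proof (rule Bochner_Integration.integral_cong[OF refl])
    fix z
    have "f (exit_point e z) = \<phi> (exit_point e z)" "f (exit_point (- e) z) = \<phi> (exit_point (- e) z)" if "z \<in> shadow e"
    proof -
      have "exit_point e z \<in> frontier K" "exit_point (- e) z \<in> frontier K"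
        using that shadow_minus[of e] shadow_chord exit_point_frontier e by (metis norm_minus_cancel)+
      then show "f (exit_point e z) = \<phi> (exit_point e z)" "f (exit_point (- e) z) = \<phi> (exit_point (- e) z)" by (simp_all add: f_def)
    qed
    then show "indicator (slab e) z * (indicator (shadow e) z * (f (exit_point e z) - f (exit_point (- e) z)))
        = indicator (slab e) z * (indicator (shadow e) z * (\<phi> (exit_point e z) - \<phi> (exit_point (- e) z)))"
      by (auto simp: indicator_def)
  qed
  also have "\<dots> = (\<integral>x. indicator (interior K) x * partial_deriv i \<phi> x \<partial>lborel)"
    unfolding partial_deriv_def e_def[symmetric]
  proof (rule integral_directional_derivative[OF e W, symmetric])
    show "\<And>x. x \<in> W \<Longrightarrow> (\<phi> has_derivative frechet_derivative \<phi> (at x)) (at x)"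
      using diff frechet_derivative_works by blast
    show "continuous_on W (\<lambda>x. frechet_derivative \<phi> (at x) e)" using cont by (simp add: partial_deriv_def[abs_def] e_def)
  qed
  also have "\<dots> = (\<integral>x. indicator (interior K) x * partial_deriv i \<phi> x \<partial>lebesgue)"
  proof (rule integral_completion[symmetric])
    have "continuous_on (interior K) (partial_deriv i \<phi>)"
      by (rule continuous_on_subset[OF cont]) (use W(2) interior_subset in blast)
    then show "(\<lambda>x. indicator (interior K) x * partial_deriv i \<phi> x) \<in> borel_measurable lborel"
      using borel_measurable_continuous_on_indicator[of "interior K" "partial_deriv i \<phi>"] by simp
  qed
  also have "\<dots> = (\<integral>x. indicator K x *\<^sub>R partial_deriv i \<phi> x \<partial>lebesgue)"
  proof (rule integral_cong_AE)
    have cK: "continuous_on K (partial_deriv i \<phi>)" by (rule continuous_on_subset[OF cont W(2)])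
    have "continuous_on (interior K) (partial_deriv i \<phi>)" by (rule continuous_on_subset[OF cK interior_subset])
    then show "(\<lambda>x. indicator (interior K) x * partial_deriv i \<phi> x) \<in> borel_measurable lebesgue"
      using borel_measurable_continuous_on_indicator[of "interior K" "partial_deriv i \<phi>"]
      by (intro measurable_completion) simp
    show "(\<lambda>x. indicator K x *\<^sub>R partial_deriv i \<phi> x) \<in> borel_measurable lebesgue"
      using borel_measurable_continuous_on_indicator[OF borel_compact[OF compact_K] cK]
      by (intro measurable_completion) simp
    have "frontier K \<in> null_sets lebesgue"
      using negligible_convex_frontier[OF convex_K] negligible_iff_null_sets by blast
    then show "AE x in lebesgue. indicator (interior K) x * partial_deriv i \<phi> x = indicator K x *\<^sub>R partial_deriv i \<phi> x"
      by (rule AE_I') (use closure_subset[of K] interior_subset[of K] in \<open>auto simp: indicator_def frontier_def\<close>)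
  qed
  finally show "(LINT x:K|lebesgue. partial_deriv i \<phi> x) = (LINT x:frontier K|surface_measure. outward_normal K x $ i * \<phi> x)"
    by (simp add: set_lebesgue_integral_def)
qed

end

section \<open>Finite-dimensional spaces of functions\<close>

definition fspan :: "'i set \<Rightarrow> ('i \<Rightarrow> 'a \<Rightarrow> real) \<Rightarrow> ('a \<Rightarrow> real) set" where
  "fspan S m = {p. \<exists>c. \<forall>x. p x = (\<Sum>i\<in>S. c i * m i x)}"

lemma fspan_combine:
  assumes "p \<in> fspan S m" "q \<in> fspan S m" shows "(\<lambda>x. p x + a * q x) \<in> fspan S m"
proof -
  obtain c d where "\<And>x. p x = (\<Sum>i\<in>S. c i * m i x)" "\<And>x. q x = (\<Sum>i\<in>S. d i * m i x)"
    using assms by (auto simp: fspan_def)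
  then have "p x + a * q x = (\<Sum>i\<in>S. (c i + a * d i) * m i x)" for x
    by (simp add: sum.distrib sum_distrib_left algebra_simps)
  then show ?thesis by (auto simp: fspan_def)
qed

lemma fspan_zero: "(\<lambda>x. 0) \<in> fspan S m"
  by (auto simp: fspan_def intro!: exI[of _ "\<lambda>_. 0"])

lemma fspan_scale: "p \<in> fspan S m \<Longrightarrow> (\<lambda>x. a * p x) \<in> fspan S m"
  using fspan_combine[OF fspan_zero, of p S m a] by simp

lemma fspan_sum:
  "(\<And>j. j \<in> J \<Longrightarrow> l j \<in> fspan S m) \<Longrightarrow> (\<lambda>x. \<Sum>j\<in>J. a j * l j x) \<in> fspan S m"
proof (induction J rule: infinite_finite_induct)
  case (insert j J)
  then have "(\<lambda>x. (\<Sum>j\<in>J. a j * l j x) + a j * l j x) \<in> fspan S m" by (intro fspan_combine) auto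
  then show ?case using insert by (simp add: add.commute)
qed (simp_all add: fspan_zero)

lemma fspan_generator: "finite S \<Longrightarrow> i \<in> S \<Longrightarrow> m i \<in> fspan S m"
  by (auto simp: fspan_def if_distrib[of "\<lambda>c. c * _"] intro!: exI[of _ "\<lambda>j. if j = i then 1 else 0"] cong: if_cong)

lemma fspan_insertE:
  assumes "p \<in> fspan (insert b S) m" "finite S" "b \<notin> S"
  obtains q c where "q \<in> fspan S m" "p = (\<lambda>x. q x + c * m b x)"
proof -
  obtain c where c: "\<And>x. p x = (\<Sum>i\<in>insert b S. c i * m i x)" using assms(1) by (auto simp: fspan_def)
  show thesis
  proof
    show "(\<lambda>x. \<Sum>i\<in>S. c i * m i x) \<in> fspan S m" by (auto simp: fspan_def)
    show "p = (\<lambda>x. (\<Sum>i\<in>S. c i * m i x) + c b * m b x)" using assms(2,3) by (simp add: c fun_eq_iff)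
  qed
qed

lemma fspan_mono: "finite S \<Longrightarrow> S' \<subseteq> S \<Longrightarrow> fspan S' m \<subseteq> fspan S m"
proof
  fix p assume fin: "finite S" and sub: "S' \<subseteq> S" and "p \<in> fspan S' m"
  then obtain c where c: "\<And>x. p x = (\<Sum>i\<in>S'. c i * m i x)" by (auto simp: fspan_def)
  have "p x = (\<Sum>i\<in>S. (if i \<in> S' then c i else 0) * m i x)" for x
    unfolding c using fin sub by (intro sum.mono_neutral_cong_left) auto
  then show "p \<in> fspan S m" by (auto simp: fspan_def)
qed

text \<open>Newton interpolation. One more generator \<open>m b\<close> enlarges the span by its remainder \<open>r\<close> after interpolation at the nodes
found so far. If \<open>r\<close> vanishes on \<open>X\<close>, nothing has to be changed; otherwise a point where it does not vanish is a new node. The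
nodes lie in \<open>X\<close>, so that a time-dependent polynomial is differentiable in time as soon as its values in \<open>X\<close> are.\<close>

lemma fspan_interpolation:
  assumes "finite S"
  shows "\<exists>(n::nat) y l. (\<forall>j<n. y j \<in> X \<and> l j \<in> fspan S m) \<and>
    (\<forall>p\<in>fspan S m. \<forall>x\<in>X. p x = (\<Sum>j<n. p (y j) * l j x))"
  using assms
proof (induction S rule: finite_induct)
  case empty
  have "p \<in> fspan {} m \<Longrightarrow> p x = 0" for p x by (auto simp: fspan_def)
  then show ?case by (intro exI[of _ 0]) auto
next
  case (insert b S)
  then obtain n y l where IH: "\<And>j. j < n \<Longrightarrow> y j \<in> X" "\<And>j. j < (n::nat) \<Longrightarrow> l j \<in> fspan S m"
      "\<And>p x. p \<in> fspan S m \<Longrightarrow> x \<in> X \<Longrightarrow> p x = (\<Sum>j<n. p (y j) * l j x)" by blast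
  have fin: "finite (insert b S)" using insert by simp
  have l: "l j \<in> fspan (insert b S) m" if "j < n" for j
    using IH(2)[OF that] fspan_mono[OF fin, of S m] by blast
  have mb: "m b \<in> fspan (insert b S) m" by (rule fspan_generator[OF fin]) simp
  define r where "r x = m b x - (\<Sum>j<n. m b (y j) * l j x)" for x
  have "(\<lambda>x. m b x + (-1) * (\<Sum>j<n. m b (y j) * l j x)) \<in> fspan (insert b S) m"
    by (rule fspan_combine[OF mb fspan_sum]) (use l in auto)
  then have r: "r \<in> fspan (insert b S) m" by (simp add: r_def[abs_def])
  have key: "p x - (\<Sum>j<n. p (y j) * l j x) = c * r x"
    if "q \<in> fspan S m" "p = (\<lambda>x. q x + c * m b x)" "x \<in> X" for p q c x
    unfolding that(2) using IH(3)[OF that(1) that(3)]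
    by (simp add: r_def algebra_simps sum.distrib sum_distrib_left)
  show ?case
  proof (cases "\<forall>x\<in>X. r x = 0")
    case True
    have "p x = (\<Sum>j<n. p (y j) * l j x)" if p: "p \<in> fspan (insert b S) m" and x: "x \<in> X" for p x
    proof -
      obtain q c where "q \<in> fspan S m" "p = (\<lambda>x. q x + c * m b x)" using fspan_insertE[OF p insert(1,2)] by metis
      from key[OF this x] show ?thesis using True x by simp
    qed
    then show ?thesis using IH(1) l by (intro exI[of _ n] exI[of _ y] exI[of _ l]) blast
  next
    case False
    then obtain z where z: "z \<in> X" "r z \<noteq> 0" by blast
    define y' where "y' j = (if j < n then y j else z)" for j
    define l' where "l' j = (if j < n then (\<lambda>x. l j x + (- l j z / r z) * r x) else (\<lambda>x. (1 / r z) * r x))" for j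
    have "p x = (\<Sum>j<Suc n. p (y' j) * l' j x)" if p: "p \<in> fspan (insert b S) m" and x: "x \<in> X" for p x
    proof -
      obtain q c where qc: "q \<in> fspan S m" "p = (\<lambda>x. q x + c * m b x)" using fspan_insertE[OF p insert(1,2)] by metis
      have 1: "p x = (\<Sum>j<n. p (y j) * l j x) + c * r x" using key[OF qc x] by simp
      have 2: "c = (p z - (\<Sum>j<n. p (y j) * l j z)) / r z" using key[OF qc z(1)] z(2) by (simp add: field_simps)
      have "(\<Sum>j<Suc n. p (y' j) * l' j x) = (\<Sum>j<n. p (y j) * (l j x + (- l j z / r z) * r x)) + p z * ((1 / r z) * r x)"
        by (simp add: y'_def l'_def)
      also have "(\<Sum>j<n. p (y j) * (l j x + (- l j z / r z) * r x)) = (\<Sum>j<n. p (y j) * l j x) - (\<Sum>j<n. p (y j) * l j z) * (r x / r z)"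
        unfolding sum_distrib_right sum_subtractf[symmetric] by (rule sum.cong) (auto simp: algebra_simps)
      also have "\<dots> + p z * ((1 / r z) * r x) = (\<Sum>j<n. p (y j) * l j x) + c * r x"
        unfolding 2 by (simp add: diff_divide_distrib left_diff_distrib)
      finally show ?thesis using 1 by simp
    qed
    moreover have "l' j \<in> fspan (insert b S) m" if "j < Suc n" for j
    proof (cases "j < n")
      case True
      then have "l' j = (\<lambda>x. l j x + (- l j z / r z) * r x)" by (simp add: l'_def)
      then show ?thesis using fspan_combine[OF l[OF True] r] by (simp only:)
    next
      case False
      then have "l' j = (\<lambda>x. (1 / r z) * r x)" by (simp add: l'_def)
      then show ?thesis using fspan_scale[OF r] by (simp only:)
    qed
    moreover have "\<forall>j<Suc n. y' j \<in> X" using IH(1) z(1) by (auto simp: y'_def less_Suc_eq)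
    ultimately show ?thesis by (intro exI[of _ "Suc n"] exI[of _ y'] exI[of _ l']) blast
  qed
qed

text \<open>Gram-Schmidt: \<open>r\<close> is the new generator minus its representation \<open>r0\<close> in the old span, hence orthogonal to the old
span, and the representing function gets the additional term \<open>(L r / B r r) r\<close>.\<close>

lemma fspan_riesz:
  fixes B :: "('a \<Rightarrow> real) \<Rightarrow> ('a \<Rightarrow> real) \<Rightarrow> real"
  assumes fin: "finite S"
    and lin: "\<And>p q r c. p \<in> fspan S m \<Longrightarrow> q \<in> fspan S m \<Longrightarrow> r \<in> fspan S m \<Longrightarrow> B (\<lambda>x. p x + c * q x) r = B p r + c * B q r"
    and sym: "\<And>p q. B p q = B q p"
    and definite: "\<And>p. p \<in> fspan S m \<Longrightarrow> B p p = 0 \<Longrightarrow> p = (\<lambda>x. 0)"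
    and L: "\<And>p q c. p \<in> fspan S m \<Longrightarrow> q \<in> fspan S m \<Longrightarrow> L (\<lambda>x. p x + c * q x) = L p + c * L q"
  shows "\<exists>p\<in>fspan S m. \<forall>q\<in>fspan S m. L q = B p q"
proof -
  have lin2: "B r (\<lambda>x. p x + c * q x) = B r p + c * B r q" if "p \<in> fspan S m" "q \<in> fspan S m" "r \<in> fspan S m" for p q r c
    using lin[OF that] by (simp add: sym)
  have "\<exists>p\<in>fspan S' m. \<forall>q\<in>fspan S' m. L q = B p q"
    if "S' \<subseteq> S" and L: "\<And>p q c. p \<in> fspan S m \<Longrightarrow> q \<in> fspan S m \<Longrightarrow> L (\<lambda>x. p x + c * q x) = L p + c * L q" for S' L
    using finite_subset[OF that(1) fin] that
  proof (induction S' arbitrary: L rule: finite_induct)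
    case (empty L)
    have "q = (\<lambda>x. 0)" if "q \<in> fspan {} m" for q using that by (auto simp: fspan_def)
    moreover have z: "(\<lambda>x. 0) \<in> fspan S m" by (rule fspan_zero)
    have "L (\<lambda>x. 0) = 0" using empty(2)[OF z z, of 1] by simp
    moreover have "B (\<lambda>x. 0) (\<lambda>x. 0) = 0" using lin[OF z z z, of 1] by simp
    ultimately have "L q = B (\<lambda>x. 0) q" if "q \<in> fspan {} m" for q using that by metis
    then have "\<forall>q\<in>fspan {} m. L q = B (\<lambda>x. 0) q" ..
    then show ?case using fspan_zero by (rule bexI)
  next
    case (insert b S' L)
    have sub: "fspan S' m \<subseteq> fspan S m" "fspan (insert b S') m \<subseteq> fspan S m" "fspan S' m \<subseteq> fspan (insert b S') m"
      using insert.prems(1) insert.hyps(1) fin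
      by (intro fspan_mono; (blast | simp))+
    have mb: "m b \<in> fspan (insert b S') m" by (rule fspan_generator) (use insert in auto)
    then have mbS: "m b \<in> fspan S m" using sub by blast
    obtain p0 where p0: "p0 \<in> fspan S' m" "\<And>q. q \<in> fspan S' m \<Longrightarrow> L q = B p0 q"
      using insert.IH[of L] insert.prems by auto
    obtain r0 where r0: "r0 \<in> fspan S' m" "\<And>q. q \<in> fspan S' m \<Longrightarrow> B (m b) q = B r0 q"
      using insert.IH[of "\<lambda>q. B (m b) q"] lin2[OF _ _ mbS] insert.prems by auto
    define r where "r x = m b x + (-1) * r0 x" for x
    have rin: "r \<in> fspan (insert b S') m" unfolding r_def[abs_def] using mb r0(1) sub by (intro fspan_combine) auto
    have orth: "B r q = 0" if "q \<in> fspan S' m" for q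
      using lin[OF mbS, of r0 q "-1"] r0 that sub by (auto simp: r_def[abs_def])
    have decomp: "\<exists>q' c. q' \<in> fspan S' m \<and> q = (\<lambda>x. q' x + c * r x)" if qin: "q \<in> fspan (insert b S') m" for q
    proof -
      obtain q0 c where q: "q0 \<in> fspan S' m" "q = (\<lambda>x. q0 x + c * m b x)" using fspan_insertE[OF qin insert(1,2)] by metis
      have "(\<lambda>x. q0 x + c * r0 x) \<in> fspan S' m" by (rule fspan_combine[OF q(1) r0(1)])
      moreover have "q = (\<lambda>x. (q0 x + c * r0 x) + c * r x)" by (simp add: q(2) r_def algebra_simps)
      ultimately show ?thesis by blast
    qed
    define a where "a = (if B r r = 0 then 0 else L r / B r r)"
    have Lr: "L r = a * B r r"
    proof (cases "B r r = 0")
      case True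
      then have "r = (\<lambda>x. 0)" using definite rin sub by blast
      moreover have z: "(\<lambda>x. 0) \<in> fspan S m" by (rule fspan_zero)
      have "L (\<lambda>x. 0) = 0" using insert.prems(2)[OF z z, of 1] by simp
      ultimately have "L r = 0" by simp
      then show ?thesis unfolding True by simp
    qed (simp add: a_def)
    have S: "p0 \<in> fspan S m" "r \<in> fspan S m" using p0(1) rin sub by auto
    show ?case
    proof (intro bexI ballI)
      show pin: "(\<lambda>x. p0 x + a * r x) \<in> fspan (insert b S') m" using p0(1) rin sub by (intro fspan_combine) auto
      fix q assume "q \<in> fspan (insert b S') m"
      then obtain q' c where q: "q' \<in> fspan S' m" "q = (\<lambda>x. q' x + c * r x)" using decomp by blast
      have q'S: "q' \<in> fspan S m" using q(1) sub by blast
      have "L q = B p0 q' + c * (a * B r r)" unfolding q(2) using insert.prems(2)[OF q'S S(2)] p0(2)[OF q(1)] Lr by simp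
      moreover have "B (\<lambda>x. p0 x + a * r x) q = (B p0 q' + c * B p0 r) + a * (B r q' + c * B r r)"
        unfolding q(2) using lin[OF S, of "\<lambda>x. q' x + c * r x" a] lin2[OF q'S S(2) S(1)] lin2[OF q'S S(2) S(2)] fspan_combine[OF q'S S(2)] by simp
      moreover have "B p0 r = 0" using orth[OF p0(1)] sym by metis
      moreover have "B r q' = 0" by (rule orth[OF q(1)])
      ultimately show "L q = B (\<lambda>x. p0 x + a * r x) q" by simp
    qed
  qed
  from this[OF order_refl L] show ?thesis .
qed

section \<open>Polynomials\<close>

abbreviation multi_indices :: "nat \<Rightarrow> ('d::finite \<Rightarrow> nat) set" where
  "multi_indices k \<equiv> {\<alpha>. sum \<alpha> UNIV \<le> k}"

definition monomial :: "('d::finite \<Rightarrow> nat) \<Rightarrow> real^'d \<Rightarrow> real" where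
  "monomial \<alpha> x = (\<Prod>i\<in>UNIV. (x $ i) ^ \<alpha> i)"

lemma finite_multi_indices: "finite (multi_indices k :: ('d::finite \<Rightarrow> nat) set)"
proof (rule finite_subset)
  show "finite (\<Pi>\<^sub>E i\<in>(UNIV::'d set). {..k})" by (rule finite_PiE) auto
  show "multi_indices k \<subseteq> (\<Pi>\<^sub>E i\<in>(UNIV::'d set). {..k})"
  proof
    fix \<alpha> :: "'d \<Rightarrow> nat" assume "\<alpha> \<in> multi_indices k"
    moreover have "\<alpha> i \<le> sum \<alpha> UNIV" for i by (rule member_le_sum) auto
    ultimately show "\<alpha> \<in> (\<Pi>\<^sub>E i\<in>(UNIV::'d set). {..k})" by (force intro: order_trans)
  qed
qed

lemma Pk_fspan: "Pk k = fspan (multi_indices k) monomial"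
  by (simp add: Pk_def fspan_def monomial_def)

lemma Pk_const: "(\<lambda>x. c) \<in> Pk k"
proof -
  have "monomial (\<lambda>_. 0) \<in> Pk k" unfolding Pk_fspan by (rule fspan_generator[OF finite_multi_indices]) simp
  then have "(\<lambda>x. c * monomial (\<lambda>_. 0) x) \<in> Pk k" unfolding Pk_fspan by (rule fspan_scale)
  then show ?thesis by (simp add: monomial_def[abs_def])
qed

lemma real_polynomial_function_Pk:
  fixes p :: "real^'d::finite \<Rightarrow> real"
  assumes "p \<in> Pk k" shows "real_polynomial_function p"
proof -
  obtain c where p: "p = (\<lambda>x. \<Sum>\<alpha>\<in>multi_indices k. c \<alpha> * (\<Prod>i\<in>UNIV. (x $ i) ^ \<alpha> i))"
    using assms by (auto simp: Pk_def fun_eq_iff)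
  have "real_polynomial_function (\<lambda>x :: real^'d. x $ i)" for i
    by (rule real_polynomial_function.intros(1)) (rule bounded_linear_vec_nth)
  then show ?thesis unfolding p
    by (intro real_polynomial_function_sum real_polynomial_function_prod real_polynomial_function.intros(4)
        real_polynomial_function.intros(2) real_polynomial_function_power finite_multi_indices) auto
qed

lemma real_polynomial_function_derivative:
  fixes p :: "'a::euclidean_space \<Rightarrow> real"
  assumes "real_polynomial_function p"
  shows "\<exists>p'. (\<forall>x. (p has_derivative p' x) (at x)) \<and> (\<forall>v. continuous_on UNIV (\<lambda>x. p' x v))"
  using assms
proof (induction rule: real_polynomial_function.induct)
  case (linear f)
  then show ?case by (intro exI[of _ "\<lambda>x. f"]) (auto intro: bounded_linear_imp_has_derivative)
next
  case (const c)
  then show ?case by (intro exI[of _ "\<lambda>x v. 0"]) auto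
next
  case (add f g)
  then obtain f' g' where "\<forall>x. (f has_derivative f' x) (at x)" "\<forall>v. continuous_on UNIV (\<lambda>x. f' x v)"
    "\<forall>x. (g has_derivative g' x) (at x)" "\<forall>v. continuous_on UNIV (\<lambda>x. g' x v)" by blast
  then show ?case by (intro exI[of _ "\<lambda>x v. f' x v + g' x v"]) (auto intro!: has_derivative_add continuous_intros)
next
  case (mult f g)
  then obtain f' g' where *: "\<forall>x. (f has_derivative f' x) (at x)" "\<forall>v. continuous_on UNIV (\<lambda>x. f' x v)"
    "\<forall>x. (g has_derivative g' x) (at x)" "\<forall>v. continuous_on UNIV (\<lambda>x. g' x v)" by blast
  then have "continuous_on UNIV f" "continuous_on UNIV g"
    by (meson continuous_at_imp_continuous_on has_derivative_continuous)+
  with * show ?case by (intro exI[of _ "\<lambda>x v. f x * g' x v + f' x v * g x"]) (auto intro!: has_derivative_mult continuous_intros)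
qed

text \<open>Restricted to the line through \<open>a\<close> and \<open>x\<close> the polynomial has infinitely many zeros near \<open>a\<close>.\<close>

lemma real_polynomial_function_zero:
  fixes p :: "'a::euclidean_space \<Rightarrow> real"
  assumes p: "real_polynomial_function p" and S: "open S" "a \<in> S" and zero: "\<And>x. x \<in> S \<Longrightarrow> p x = 0"
  shows "p x = 0"
proof -
  have "polynomial_function (\<lambda>t::real. a + t *\<^sub>R (x - a))" by (simp add: polynomial_function_add polynomial_function_const polynomial_function_mult polynomial_function_id)
  then have "real_polynomial_function (p \<circ> (\<lambda>t::real. a + t *\<^sub>R (x - a)))"
    by (rule real_polynomial_function_compose) (rule p)
  then obtain c n where cn: "\<And>t. p (a + t *\<^sub>R (x - a)) = (\<Sum>i\<le>n. c i * t ^ i)"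
    unfolding real_polynomial_function_iff_sum by (auto simp: o_def fun_eq_iff)
  obtain r where r: "0 < r" "ball a r \<subseteq> S" using S openE by blast
  define \<delta> where "\<delta> = r / (norm (x - a) + 1)"
  have \<delta>: "0 < \<delta>" using r by (simp add: \<delta>_def add_nonneg_pos)
  have "(\<Sum>i\<le>n. c i * t ^ i) = 0" if t: "t \<in> {0<..<\<delta>}" for t
  proof -
    have "t * norm (x - a) < r"
    proof -
      have "t * (norm (x - a) + 1) < r" using t by (simp add: \<delta>_def pos_less_divide_eq add_nonneg_pos)
      then show ?thesis using t by (simp add: algebra_simps)
    qed
    then have "a + t *\<^sub>R (x - a) \<in> ball a r" using t by (simp add: dist_norm)
    then show ?thesis using zero r(2) cn by (metis subsetD)
  qed
  then have sub: "{0<..<\<delta>} \<subseteq> {t. (\<Sum>i\<le>n. c i * t ^ i) = 0}" by blast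
  have "infinite {0<..<\<delta>}" using \<delta> by simp
  then have "\<not> finite {t. (\<Sum>i\<le>n. c i * t ^ i) = 0}" using sub finite_subset by blast
  then have "\<forall>i\<le>n. c i = 0" using polyfun_finite_roots[of c n] by auto
  then show ?thesis using cn[of 1] by simp
qed

lemma trivial_limit_interior: "K \<noteq> {} \<Longrightarrow> K = closure (interior K) \<Longrightarrow> x \<in> K \<Longrightarrow> at x within interior K \<noteq> bot"
  for K :: "(real^'d::finite) set"
proof -
  assume x: "x \<in> K" and K: "K = closure (interior K)"
  have "x islimpt interior K"
  proof (cases "x \<in> interior K")
    case True
    then have "x \<in> interior (interior K)" by simp
    then show ?thesis by (rule interior_limit_point)
  next
    case False
    then show ?thesis using x K unfolding closure_def by blast
  qed
  then show ?thesis by (simp add: trivial_limit_within)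
qed

context convex_body
begin

lemma int_trace_eq:
  assumes "\<And>x. x \<in> interior K \<Longrightarrow> u x = P x" "continuous_on UNIV P" "x \<in> K"
  shows "int_trace K u x = P x"
  unfolding int_trace_def
proof (rule tendsto_Lim)
  have "K \<noteq> {}" using interior_K interior_subset by blast
  then show "at x within interior K \<noteq> bot" using trivial_limit_interior K_eq_closure_interior assms(3) by blast
  have "(P \<longlongrightarrow> P x) (at x within interior K)" using assms(2) by (auto simp: continuous_on_def intro: tendsto_within_subset)
  then show "(u \<longlongrightarrow> P x) (at x within interior K)"
    by (rule Lim_transform_eventually) (auto simp: eventually_at_filter assms(1))
qed

lemma frontier_null: "frontier K \<in> null_sets lebesgue"
  using negligible_convex_frontier[OF convex_K] negligible_iff_null_sets by blast

lemma K_lmeasurable: "K \<in> lmeasurable" using compact_K by (rule lmeasurable_compact)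

text \<open>The boundary of a convex set is a Lebesgue null set, so the unspecified values of the solution there do not
influence integrals.\<close>

lemma integrable_K_cong:
  fixes f g :: "real^'d \<Rightarrow> 'b::euclidean_space"
  assumes eq: "\<And>x. x \<in> interior K \<Longrightarrow> f x = g x" and g: "continuous_on K g"
  shows "set_integrable lebesgue K f" "set_integrable lebesgue K g" "(LINT x:K|lebesgue. f x) = (LINT x:K|lebesgue. g x)"
proof -
  have gb: "set_integrable lborel K g"
    unfolding set_integrable_def using compact_K g by (rule borel_integrable_compact)
  then have gm: "(\<lambda>x. indicator K x *\<^sub>R g x) \<in> borel_measurable lborel" unfolding set_integrable_def by (rule borel_measurable_integrable)
  show gi: "set_integrable lebesgue K g"
    using gb unfolding set_integrable_def by (simp add: integrable_completion[OF gm])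
  have AE: "AE x in lebesgue. indicator K x *\<^sub>R f x = indicator K x *\<^sub>R g x"
    by (rule AE_I'[OF frontier_null]) (use eq closure_subset[of K] in \<open>auto simp: frontier_def indicator_def\<close>)
  have gml: "(\<lambda>x. indicator K x *\<^sub>R g x) \<in> borel_measurable lebesgue" using gm by (rule measurable_completion)
  have gml': "(\<lambda>x. indicator K x *\<^sub>R f x) \<in> borel_measurable lebesgue"
  proof (rule borel_measurable_AE[OF gml])
    show "AE x in lebesgue. indicator K x *\<^sub>R g x = indicator K x *\<^sub>R f x" using AE by eventually_elim (rule sym)
  qed
  show "set_integrable lebesgue K f"
    using gi integrable_cong_AE[OF gml' gml AE] unfolding set_integrable_def by blast
  show "(LINT x:K|lebesgue. f x) = (LINT x:K|lebesgue. g x)"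
    unfolding set_lebesgue_integral_def by (rule integral_cong_AE[OF gml' gml AE])
qed

lemma Pk_continuous: "p \<in> Pk k \<Longrightarrow> continuous_on S (p :: real^'d \<Rightarrow> real)"
  using real_polynomial_function_Pk continuous_real_polymonial_function
  by (meson continuous_at_imp_continuous_on)

lemma Pk_eqI:
  assumes "p \<in> Pk k" "q \<in> Pk k" "\<And>x. x \<in> interior K \<Longrightarrow> p x = q x"
  shows "p = q"
proof
  fix x
  obtain a where "a \<in> interior K" using interior_K by blast
  have "real_polynomial_function (\<lambda>x. p x - q x)" using assms real_polynomial_function_Pk by blast
  from real_polynomial_function_zero[OF this open_interior \<open>a \<in> interior K\<close>, of x]
  show "p x = q x" using assms(3) by simp
qed

text \<open>The \<open>L\<^sup>2\<close> form is definite on polynomials because \<open>K\<close> has interior points.\<close>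

lemma LINT_Pk_definite:
  assumes p: "p \<in> Pk k" and zero: "(LINT x:K|lebesgue. p x * p x) = 0"
  shows "p = (\<lambda>x. 0)"
proof (rule Pk_eqI[OF p Pk_const])
  fix a assume a: "a \<in> interior K"
  have c: "continuous_on S (\<lambda>x. p x * p x)" for S by (intro continuous_intros Pk_continuous[OF p])
  have int: "integrable lebesgue (\<lambda>x. indicator K x *\<^sub>R (p x * p x))"
    using integrable_K_cong(1)[OF _ c, of "\<lambda>x. p x * p x"] unfolding set_integrable_def by simp
  have "AE x in lebesgue. indicator K x *\<^sub>R (p x * p x) = 0"
    using integral_nonneg_eq_0_iff_AE[OF int] zero unfolding set_lebesgue_integral_def by (simp add: indicator_def)
  then have ae: "AE x in lebesgue. \<not> (x \<in> K \<and> p x \<noteq> 0)" by eventually_elim (auto simp: indicator_def split: if_splits)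
  show "p a = 0"
  proof (rule ccontr)
    assume "p a \<noteq> 0"
    have op: "open (interior K \<inter> p -` (- {0}))"
      using continuous_open_preimage[OF Pk_continuous[OF p], of "interior K" "- {0}"] by auto
    have "a \<in> interior K \<inter> p -` (- {0})" using a \<open>p a \<noteq> 0\<close> by simp
    then have "\<not> negligible (interior K \<inter> p -` (- {0}))" using open_not_negligible[OF op] by blast
    moreover have "interior K \<inter> p -` (- {0}) \<subseteq> {x. x \<in> K \<and> p x \<noteq> 0}" using interior_subset by auto
    moreover have "{x. x \<in> K \<and> p x \<noteq> 0} \<in> null_sets lebesgue"
    proof -
      have "{x. x \<in> K \<and> p x \<noteq> 0} \<in> sets lebesgue"
      proof -
        have "{x. x \<in> K \<and> p x \<noteq> 0} = K \<inter> p -` (- {0})" by auto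
        moreover have "p \<in> borel_measurable borel" by (rule borel_measurable_continuous_onI[OF Pk_continuous[OF p]])
        then have "p -` (- {0}) \<in> sets borel" by (rule measurable_sets_borel) simp
        ultimately show ?thesis using borel_compact[OF compact_K] by (metis sets.Int sets_completionI_sets sets_lborel)
      qed
      then show ?thesis using AE_iff_null_sets ae by fastforce
    qed
    then have "negligible {x. x \<in> K \<and> p x \<noteq> 0}" by (simp add: negligible_iff_null_sets)
    ultimately show False using negligible_subset by blast
  qed
qed

section \<open>The projection onto polynomials\<close>

text \<open>The class of functions that are projected: \<open>\<nabla>U(u)\<close> and the flux divergence are continuous up to their unspecified values
on the boundary of \<open>K\<close>.\<close>

definition almost_continuous :: "(real^'d \<Rightarrow> real) \<Rightarrow> bool" where
  "almost_continuous g \<longleftrightarrow> (\<exists>g'. continuous_on K g' \<and> (\<forall>x\<in>interior K. g x = g' x))"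

lemma almost_continuous_Pk: "p \<in> Pk k \<Longrightarrow> almost_continuous p"
  unfolding almost_continuous_def using Pk_continuous by blast

lemma almost_continuous_arith:
  assumes "almost_continuous f" "almost_continuous g"
  shows "almost_continuous (\<lambda>x. f x * g x)" "almost_continuous (\<lambda>x. f x - g x)"
proof -
  obtain f' g' where *: "continuous_on K f'" "continuous_on K g'" "\<forall>x\<in>interior K. f x = f' x" "\<forall>x\<in>interior K. g x = g' x"
    using assms unfolding almost_continuous_def by blast
  show "almost_continuous (\<lambda>x. f x * g x)" unfolding almost_continuous_def
    by (rule exI[of _ "\<lambda>x. f' x * g' x"]) (use * in \<open>auto intro!: continuous_intros\<close>)
  show "almost_continuous (\<lambda>x. f x - g x)" unfolding almost_continuous_def
    by (rule exI[of _ "\<lambda>x. f' x - g' x"]) (use * in \<open>auto intro!: continuous_intros\<close>)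
qed

lemma almost_continuous_integrable: "almost_continuous g \<Longrightarrow> set_integrable lebesgue K g"
  unfolding almost_continuous_def using integrable_K_cong(1)[of g] by blast

lemma L2_proj:
  assumes g: "almost_continuous g"
  shows "L2_proj k K g \<in> Pk k" (is ?A)
    and "\<And>q. q \<in> Pk k \<Longrightarrow> (LINT x:K|lebesgue. (g x - L2_proj k K g x) * q x) = 0"
    and "\<And>p. p \<in> Pk k \<Longrightarrow> (\<And>q. q \<in> Pk k \<Longrightarrow> (LINT x:K|lebesgue. (g x - p x) * q x) = 0) \<Longrightarrow> L2_proj k K g = p"
proof -
  let ?P = "\<lambda>p. p \<in> Pk k \<and> (\<forall>q\<in>Pk k. (LINT x:K|lebesgue. (g x - p x) * q x) = 0)"
  define B where "B p q = (LINT x:K|lebesgue. p x * q x)" for p q :: "real^'d \<Rightarrow> real"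
  have int: "set_integrable lebesgue K (\<lambda>x. f x * q x)" if "almost_continuous f" "q \<in> Pk k" for f q
    using almost_continuous_integrable almost_continuous_arith(1) almost_continuous_Pk that by blast
  have split: "(LINT x:K|lebesgue. (g x - p x) * q x) = B g q - B p q" if "p \<in> Pk k" "q \<in> Pk k" for p q
  proof -
    have "(LINT x:K|lebesgue. (g x - p x) * q x) = (LINT x:K|lebesgue. g x * q x - p x * q x)" by (simp add: left_diff_distrib)
    also have "\<dots> = B g q - B p q" unfolding B_def
      by (rule set_integral_diff(2)) (use int g almost_continuous_Pk that in auto)
    finally show ?thesis .
  qed
  have lin: "B (\<lambda>x. p x + c * q x) r = B p r + c * B q r" if "p \<in> Pk k" "q \<in> Pk k" "r \<in> Pk k" for p q r c
  proof -
    have i: "set_integrable lebesgue K (\<lambda>x. p x * r x)" "set_integrable lebesgue K (\<lambda>x. c * (q x * r x))"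
      using int almost_continuous_Pk that by auto
    have "B (\<lambda>x. p x + c * q x) r = (LINT x:K|lebesgue. p x * r x + c * (q x * r x))"
      by (simp add: B_def distrib_right mult.assoc)
    also have "\<dots> = B p r + (LINT x:K|lebesgue. c * (q x * r x))" unfolding B_def by (rule set_integral_add(2)[OF i])
    finally show ?thesis by (simp add: B_def)
  qed
  have sym: "B p q = B q p" for p q by (simp add: B_def mult.commute)
  have Lg: "B g (\<lambda>x. p x + c * q x) = B g p + c * B g q" if "p \<in> Pk k" "q \<in> Pk k" for p q c
  proof -
    have i: "set_integrable lebesgue K (\<lambda>x. g x * p x)" "set_integrable lebesgue K (\<lambda>x. c * (g x * q x))"
      using int[OF g] that by auto
    have "B g (\<lambda>x. p x + c * q x) = (LINT x:K|lebesgue. g x * p x + c * (g x * q x))"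
      by (simp add: B_def distrib_left mult.left_commute)
    also have "\<dots> = B g p + (LINT x:K|lebesgue. c * (g x * q x))" unfolding B_def by (rule set_integral_add(2)[OF i])
    finally show ?thesis by (simp add: B_def)
  qed
  have def0: "p = (\<lambda>x. 0)" if "p \<in> Pk k" "B p p = 0" for p using LINT_Pk_definite that unfolding B_def by blast
  have "\<exists>p\<in>Pk k. \<forall>q\<in>Pk k. B g q = B p q"
    unfolding Pk_fspan
    by (rule fspan_riesz[OF finite_multi_indices]) (use lin sym def0 Lg in \<open>auto simp: Pk_fspan\<close>)
  then obtain p where p: "p \<in> Pk k" "\<And>q. q \<in> Pk k \<Longrightarrow> B g q = B p q" by blast
  have Pp: "?P p" using p split by simp
  have uniq: "p1 = p2" if "?P p1" "?P p2" for p1 p2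
  proof -
    have eq: "B p1 q = B p2 q" if "q \<in> Pk k" for q using \<open>?P p1\<close> \<open>?P p2\<close> split[of p1 q] split[of p2 q] that by auto
    have d: "(\<lambda>x. p1 x + (-1) * p2 x) \<in> Pk k" using that fspan_combine unfolding Pk_fspan by blast
    have "B (\<lambda>x. p1 x + (-1) * p2 x) (\<lambda>x. p1 x + (-1) * p2 x) = 0"
      using lin[of p1 p2 _ "-1"] d that eq[OF d] by simp
    from def0[OF d this] have "p1 x + (-1) * p2 x = 0" for x by (rule fun_cong)
    then show ?thesis by (simp add: fun_eq_iff)
  qed
  have L: "L2_proj k K g = p" unfolding L2_proj_def using the_equality[of ?P p] Pp uniq by blast
  show ?A using L p by simp
  show "\<And>q. q \<in> Pk k \<Longrightarrow> (LINT x:K|lebesgue. (g x - L2_proj k K g x) * q x) = 0" using L Pp by simp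
  show "L2_proj k K g = p'" if "p' \<in> Pk k" "\<And>q. q \<in> Pk k \<Longrightarrow> (LINT x:K|lebesgue. (g x - p' x) * q x) = 0" for p'
    using uniq[of p p'] Pp that L by blast
qed

lemma L2_proj_diff_const:
  assumes g: "almost_continuous g"
  shows "L2_proj k K (\<lambda>y. g y - c) x = L2_proj k K g x - c"
proof -
  have "L2_proj k K (\<lambda>y. g y - c) = (\<lambda>y. L2_proj k K g y - c)"
  proof (rule L2_proj(3))
    show "almost_continuous (\<lambda>y. g y - c)" by (rule almost_continuous_arith(2)[OF g almost_continuous_Pk[OF Pk_const]])
    have "(\<lambda>y. L2_proj k K g y + (-1) * c) \<in> Pk k"
      using fspan_combine[of "L2_proj k K g" _ monomial "\<lambda>_. c"] L2_proj(1)[OF g] Pk_const unfolding Pk_fspan by blast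
    then show "(\<lambda>y. L2_proj k K g y - c) \<in> Pk k" by simp
    fix q :: "real^'d \<Rightarrow> real" assume "q \<in> Pk k"
    then show "(LINT x:K|lebesgue. (g x - c - (L2_proj k K g x - c)) * q x) = 0" using L2_proj(2)[OF g] by simp
  qed
  then show ?thesis by simp
qed

lemma pi_h_orthogonal:
  fixes g q :: "real^'d \<Rightarrow> real^'m::finite"
  assumes g: "\<And>j. almost_continuous (\<lambda>y. g y $ j)" and q: "\<And>j. (\<lambda>y. q y $ j) \<in> Pk k"
  shows "(LINT x:K|lebesgue. g x \<bullet> q x) = (LINT x:K|lebesgue. pi_h k K g x \<bullet> q x)"
proof -
  have P: "(\<lambda>x. pi_h k K g x $ j) \<in> Pk k" for j using L2_proj(1)[OF g] by (simp add: pi_h_def)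
  have "(LINT x:K|lebesgue. g x $ j * q x $ j) = (LINT x:K|lebesgue. pi_h k K g x $ j * q x $ j)" for j
  proof -
    have i: "set_integrable lebesgue K (\<lambda>x. g x $ j * q x $ j)" "set_integrable lebesgue K (\<lambda>x. pi_h k K g x $ j * q x $ j)"
      using almost_continuous_integrable almost_continuous_arith(1) almost_continuous_Pk g q P by blast+
    have "(LINT x:K|lebesgue. g x $ j * q x $ j) - (LINT x:K|lebesgue. pi_h k K g x $ j * q x $ j)
        = (LINT x:K|lebesgue. (g x $ j - pi_h k K g x $ j) * q x $ j)"
      unfolding set_integral_diff(2)[OF i, symmetric] by (simp add: left_diff_distrib)
    also have "\<dots> = 0" using L2_proj(2)[OF g q] by (simp add: pi_h_def)
    finally show ?thesis by simp
  qed
  note comp = this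
  have sum: "(LINT x:K|lebesgue. f x \<bullet> q x) = (\<Sum>j\<in>UNIV. LINT x:K|lebesgue. f x $ j * q x $ j)"
    if f: "\<And>j. almost_continuous (\<lambda>y. f y $ j)" for f :: "real^'d \<Rightarrow> real^'m"
  proof -
    have "set_integrable lebesgue K (\<lambda>x. f x $ j * q x $ j)" for j
      by (intro almost_continuous_integrable almost_continuous_arith(1) f almost_continuous_Pk[OF q])
    then show ?thesis
      unfolding set_lebesgue_integral_def set_integrable_def inner_vec_def inner_real_def scaleR_sum_right
      by (intro Bochner_Integration.integral_sum) auto
  qed
  have "(LINT x:K|lebesgue. g x \<bullet> q x) = (\<Sum>j\<in>UNIV. LINT x:K|lebesgue. g x $ j * q x $ j)"
    by (rule sum) (rule g)
  also have "\<dots> = (\<Sum>j\<in>UNIV. LINT x:K|lebesgue. pi_h k K g x $ j * q x $ j)" by (simp only: comp)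
  also have "\<dots> = (LINT x:K|lebesgue. pi_h k K g x \<bullet> q x)"
    by (rule sum[symmetric]) (rule almost_continuous_Pk[OF P])
  finally show ?thesis .
qed

end

text \<open>A polynomial on \<open>K\<close>, extended by zero, is an admissible test function; this is what makes the scheme local.\<close>

lemma dg_space_element:
  fixes p :: "real^'d::finite \<Rightarrow> real^'m::finite"
  assumes mesh: "convex_mesh \<Omega> T" and K: "K \<in> T" and p: "\<And>j. (\<lambda>x. p x $ j) \<in> Pk k"
  shows "(\<lambda>x. if x \<in> interior K then p x else 0) \<in> dg_space k \<Omega> T"
proof -
  let ?v = "\<lambda>x. if x \<in> interior K then p x else 0"
  have cp: "continuous_on UNIV p"
  proof (rule continuous_on_vec_lambda[of UNIV "\<lambda>j x. p x $ j", simplified])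
    show "continuous_on UNIV (\<lambda>x. p x $ j)" for j
      using real_polynomial_function_Pk[OF p] continuous_real_polymonial_function by (meson continuous_at_imp_continuous_on)
  qed
  have Kc: "compact K" and sub: "interior K \<subseteq> \<Omega>" and op: "open \<Omega>" using mesh K by (auto simp: convex_mesh_def)
  have vb: "?v \<in> borel_measurable borel"
    by (rule borel_measurable_continuous_on_if) (auto intro: continuous_on_subset[OF cp])
  have v\<Omega>: "indicator \<Omega> x *\<^sub>R ?v x = ?v x" for x using sub by (auto simp: indicator_def)
  have n\<Omega>: "indicator \<Omega> x *\<^sub>R (norm (?v x))\<^sup>2 = (norm (?v x))\<^sup>2" for x using sub by (auto simp: indicator_def)
  have "continuous_on K (\<lambda>x. (norm (p x))\<^sup>2)" by (intro continuous_intros continuous_on_subset[OF cp]) auto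
  from compact_imp_bounded[OF compact_continuous_image[OF this Kc]]
  obtain B where B: "\<And>x. x \<in> K \<Longrightarrow> (norm (p x))\<^sup>2 \<le> B" by (auto simp: bounded_iff)
  have int: "integrable lborel (\<lambda>x. (norm (?v x))\<^sup>2)"
  proof (rule integrableI_bounded_set[where A = "interior K" and B = B])
    show "emeasure lborel (interior K) < \<infinity>"
      by (rule emeasure_bounded_finite) (use Kc compact_imp_bounded bounded_subset interior_subset in blast)
    show "AE x in lborel. x \<in> interior K \<longrightarrow> norm ((norm (?v x))\<^sup>2) \<le> B" using B interior_subset by (intro AE_I2) auto
  qed (use vb in auto)
  have "(\<lambda>x. (norm (?v x))\<^sup>2) \<in> borel_measurable lborel" using vb by simp
  then have "integrable lebesgue (\<lambda>x. (norm (?v x))\<^sup>2)" using int by (simp add: integrable_completion)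
  moreover have "?v \<in> borel_measurable lebesgue" using vb by (intro measurable_completion) simp
  moreover have "\<exists>q\<in>Pk k. \<forall>x\<in>interior L. ?v x $ j = q x" if L: "L \<in> T" for L j
  proof (cases "L = K")
    case True then show ?thesis using p by auto
  next
    case False
    then have "interior L \<inter> interior K = {}" using mesh L K by (auto simp: convex_mesh_def pairwise_def)
    then show ?thesis by (intro bexI[of _ "\<lambda>_. 0"] Pk_const) auto
  qed
  moreover have "(\<lambda>x. indicator \<Omega> x *\<^sub>R ?v x) = ?v" "(\<lambda>x. indicator \<Omega> x *\<^sub>R (norm (?v x))\<^sup>2) = (\<lambda>x. (norm (?v x))\<^sup>2)"
    by (rule ext, rule v\<Omega>) (rule ext, rule n\<Omega>)
  ultimately show ?thesis unfolding dg_space_def set_borel_measurable_def set_integrable_def mem_Collect_eq by simp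
qed

section \<open>Symmetric matrices and second derivatives\<close>

lemma inner_matrix_symmetric:
  fixes A :: "real^'n^'n::finite"
  assumes "\<And>i j. A $ i $ j = A $ j $ i" shows "x \<bullet> (A *v y) = (A *v x) \<bullet> y"
proof -
  have "transpose A = A" using assms by (simp add: transpose_def vec_eq_iff)
  then show ?thesis by (metis dot_lmul_matrix vector_transpose_matrix)
qed

text \<open>Eigenvectors of different eigenvalues are orthogonal, hence there are finitely many eigenvalues and the minimum
exists. A minimiser of the quadratic form on the sphere is an eigenvector: otherwise moving it in the direction
\<open>- r\<close> of its residual would decrease the form.\<close>

lemma min_eigenvalue_le_quadratic_form:
  fixes A :: "real^'n^'n::finite"
  assumes sym: "\<And>i j. A $ i $ j = A $ j $ i"
  shows "min_eigenvalue A * (norm z)\<^sup>2 \<le> z \<bullet> (A *v z)"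
    and "\<exists>v. norm v = 1 \<and> min_eigenvalue A = v \<bullet> (A *v v)"
proof -
  let ?E = "{l. \<exists>v. v \<noteq> 0 \<and> A *v v = l *\<^sub>R v}"
  note symA = inner_matrix_symmetric[of A, OF sym]
  have fin: "finite ?E"
  proof -
    define w where "w l = (SOME v. v \<noteq> 0 \<and> A *v v = l *\<^sub>R v)" for l
    have w: "w l \<noteq> 0" "A *v w l = l *\<^sub>R w l" if "l \<in> ?E" for l
      using someI_ex[of "\<lambda>v. v \<noteq> 0 \<and> A *v v = l *\<^sub>R v"] that unfolding w_def by auto
    have orth: "w l \<bullet> w k = 0" if "l \<in> ?E" "k \<in> ?E" "l \<noteq> k" for l k
    proof -
      have "k * (w l \<bullet> w k) = l * (w l \<bullet> w k)" using symA[of "w l" "w k"] w that by simp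
      then show ?thesis using that(3) by simp
    qed
    have inj: "inj_on w ?E"
    proof (rule inj_onI, rule ccontr)
      fix l k assume "l \<in> ?E" "k \<in> ?E" "w l = w k" "l \<noteq> k"
      then show False using orth[of l k] w(1)[of k] by simp
    qed
    have "pairwise orthogonal (w ` ?E)"
      using orth by (auto simp: pairwise_def orthogonal_def)
    moreover have "0 \<notin> w ` ?E"
    proof
      assume "0 \<in> w ` ?E"
      then obtain l where l: "0 = w l" "l \<in> ?E" by (rule imageE)
      show False using w(1)[OF l(2)] l(1) by simp
    qed
    ultimately have "independent (w ` ?E)" by (rule pairwise_orthogonal_independent)
    then have "finite (w ` ?E)" by (rule independent_imp_finite)
    then show ?thesis using inj finite_image_iff by blast
  qed
  have "compact (sphere (0 :: real^'n) 1)" "sphere (0 :: real^'n) 1 \<noteq> {}" by simp_all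
  moreover have "continuous_on (sphere 0 1) (\<lambda>v. v \<bullet> (A *v v))"
    by (intro continuous_intros matrix_vector_mult_linear_continuous_on)
  ultimately have "\<exists>v\<in>sphere 0 1. \<forall>y\<in>sphere 0 1. v \<bullet> (A *v v) \<le> y \<bullet> (A *v y)"
    by (rule continuous_attains_inf)
  then obtain v where v: "v \<in> sphere 0 1" "\<And>y. y \<in> sphere 0 1 \<Longrightarrow> v \<bullet> (A *v v) \<le> y \<bullet> (A *v y)"
    by blast
  define l where "l = v \<bullet> (A *v v)"
  have n: "norm v = 1" using v by simp
  have form: "l * (norm y)\<^sup>2 \<le> y \<bullet> (A *v y)" for y
  proof (cases "y = 0")
    case False
    have "l \<le> ((1 / norm y) *\<^sub>R y) \<bullet> (A *v ((1 / norm y) *\<^sub>R y))"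
      unfolding l_def by (rule v(2)) (use False in simp)
    also have "\<dots> = (y \<bullet> (A *v y)) / (norm y)\<^sup>2" by (simp add: matrix_vector_mult_scaleR power2_eq_square)
    finally show ?thesis using False by (simp add: pos_le_divide_eq)
  qed simp
  have "A *v v = l *\<^sub>R v"
  proof -
    define r where "r = A *v v - l *\<^sub>R v"
    have vv: "v \<bullet> v = 1" using n by (simp add: norm_eq_1)
    have rv: "r \<bullet> v = 0" by (simp add: r_def inner_diff_left vv l_def inner_commute[of "A *v v" v])
    have Avr: "(A *v v) \<bullet> r = r \<bullet> r"
      using rv by (simp add: r_def inner_diff_left inner_diff_right inner_commute)
    \<comment> \<open>Minimality along the line \<open>v + t r\<close>: the linear term in \<open>t\<close> has to vanish.\<close>
    have quad: "0 \<le> t * 2 * (r \<bullet> r) + t\<^sup>2 * (r \<bullet> (A *v r) - l * (r \<bullet> r))" for t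
    proof -
      have "l * (norm (v + t *\<^sub>R r))\<^sup>2 \<le> (v + t *\<^sub>R r) \<bullet> (A *v (v + t *\<^sub>R r))" by (rule form)
      moreover have "(norm (v + t *\<^sub>R r))\<^sup>2 = 1 + t\<^sup>2 * (r \<bullet> r)"
        unfolding power2_norm_eq_inner using rv by (simp add: inner_add_left inner_add_right vv inner_commute power2_eq_square)
      moreover have "(v + t *\<^sub>R r) \<bullet> (A *v (v + t *\<^sub>R r)) = l + t * 2 * (r \<bullet> r) + t\<^sup>2 * (r \<bullet> (A *v r))"
        using symA[of v r] Avr
        by (simp add: matrix_vector_right_distrib matrix_vector_mult_scaleR inner_add_left inner_add_right l_def power2_eq_square inner_commute algebra_simps)
      ultimately show ?thesis by (simp add: algebra_simps)
    qed
    have "r \<bullet> r = 0"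
    proof (rule ccontr)
      assume "r \<bullet> r \<noteq> 0"
      then have rr: "0 < r \<bullet> r" by simp
      define b where "b = \<bar>r \<bullet> (A *v r) - l * (r \<bullet> r)\<bar> + 1"
      define t where "t = - (r \<bullet> r) / b"
      have b: "0 < b" "r \<bullet> (A *v r) - l * (r \<bullet> r) \<le> b" by (auto simp: b_def)
      have "0 \<le> t * 2 * (r \<bullet> r) + t\<^sup>2 * b"
        by (rule order_trans[OF quad[of t]]) (use b in \<open>auto intro: mult_left_mono\<close>)
      also have "\<dots> = - ((r \<bullet> r)\<^sup>2 / b)" using b(1) by (simp add: t_def power2_eq_square field_simps)
      finally have "(r \<bullet> r)\<^sup>2 / b \<le> 0" by simp
      moreover have "0 < (r \<bullet> r)\<^sup>2 / b" using rr b(1) by simp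
      ultimately show False by simp
    qed
    then show ?thesis by (simp add: r_def)
  qed
  then have lE: "l \<in> ?E" using n by (auto intro!: exI[of _ v])
  have "min_eigenvalue A \<le> l" unfolding min_eigenvalue_def by (rule Min_le[OF fin lE])
  then show "min_eigenvalue A * (norm z)\<^sup>2 \<le> z \<bullet> (A *v z)"
    using form[of z] mult_right_mono[of "min_eigenvalue A" l "(norm z)\<^sup>2"] by simp
  have "min_eigenvalue A \<in> ?E" unfolding min_eigenvalue_def by (rule Min_in[OF fin]) (use lE in blast)
  then obtain y where y: "y \<noteq> 0" "A *v y = min_eigenvalue A *\<^sub>R y" by blast
  have "norm ((1 / norm y) *\<^sub>R y) = 1" using y(1) by simp
  moreover have "((1 / norm y) *\<^sub>R y) \<bullet> (A *v ((1 / norm y) *\<^sub>R y)) = min_eigenvalue A"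
    using y(1) by (simp add: matrix_vector_mult_scaleR y(2) dot_square_norm power2_eq_square)
  ultimately show "\<exists>v. norm v = 1 \<and> min_eigenvalue A = v \<bullet> (A *v v)" by metis
qed

lemma partial_deriv_line:
  fixes f :: "real^'n::finite \<Rightarrow> real"
  assumes "f differentiable (at (x + t *\<^sub>R axis i 1))"
  shows "((\<lambda>s. f (x + s *\<^sub>R axis i 1)) has_real_derivative partial_deriv i f (x + t *\<^sub>R axis i 1)) (at t)"
proof -
  have "(f has_derivative frechet_derivative f (at (x + t *\<^sub>R axis i 1))) (at (x + t *\<^sub>R axis i 1))"
    using assms frechet_derivative_works by blast
  moreover have "((\<lambda>s. x + s *\<^sub>R axis i 1) has_derivative (\<lambda>s. s *\<^sub>R axis i 1)) (at t)"
    by (auto intro!: derivative_eq_intros)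
  ultimately have "((\<lambda>s. f (x + s *\<^sub>R axis i 1)) has_derivative (\<lambda>s. frechet_derivative f (at (x + t *\<^sub>R axis i 1)) (s *\<^sub>R axis i 1))) (at t)"
    by (rule has_derivative_compose[rotated])
  moreover have "frechet_derivative f (at (x + t *\<^sub>R axis i 1)) (s *\<^sub>R axis i 1) = partial_deriv i f (x + t *\<^sub>R axis i 1) * s" for s
    using linear_frechet_derivative[OF assms] by (simp add: partial_deriv_def linear_scale mult.commute)
  ultimately show ?thesis by (simp add: has_field_derivative_def)
qed

text \<open>The mean value theorem is applied in direction \<open>i\<close> and then in direction \<open>j\<close>. The left-hand side is symmetric in \<open>i\<close> and \<open>j\<close>,
which is the reason for Schwarz's theorem on mixed derivatives.\<close>

lemma second_difference:
  fixes f :: "real^'n::finite \<Rightarrow> real"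
  assumes h: "0 < h" and d1: "\<And>x. x \<in> ball a r \<Longrightarrow> f differentiable (at x)"
    and d2: "\<And>x. x \<in> ball a r \<Longrightarrow> partial_deriv i f differentiable (at x)" and hr: "2 * h < r"
  shows "\<exists>x. dist x a \<le> 2 * h \<and>
    f (a + h *\<^sub>R axis i 1 + h *\<^sub>R axis j 1) - f (a + h *\<^sub>R axis i 1) - f (a + h *\<^sub>R axis j 1) + f a
    = h * h * partial_deriv j (partial_deriv i f) x"
proof -
  have inb: "dist (a + s *\<^sub>R axis i 1 + t *\<^sub>R axis j 1) a \<le> 2 * h" if "0 \<le> s" "s \<le> h" "0 \<le> t" "t \<le> h" for s t
  proof -
    have "norm (s *\<^sub>R axis i 1 + t *\<^sub>R axis j 1 :: real^'n) \<le> norm (s *\<^sub>R axis i 1 :: real^'n) + norm (t *\<^sub>R axis j 1 :: real^'n)"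
      by (rule norm_triangle_ineq)
    also have "\<dots> \<le> 2 * h" using that by (simp add: norm_axis_1)
    finally show ?thesis by (simp add: dist_norm add.assoc)
  qed
  have ball: "a + s *\<^sub>R axis i 1 + t *\<^sub>R axis j 1 \<in> ball a r" if "0 \<le> s" "s \<le> h" "0 \<le> t" "t \<le> h" for s t
    using inb[OF that] hr by (simp add: dist_commute)
  define \<phi> where "\<phi> s = f (a + h *\<^sub>R axis j 1 + s *\<^sub>R axis i 1) - f (a + s *\<^sub>R axis i 1)" for s
  have "\<exists>s. 0 < s \<and> s < h \<and> \<phi> h - \<phi> 0 = (h - 0) * (partial_deriv i f (a + h *\<^sub>R axis j 1 + s *\<^sub>R axis i 1) - partial_deriv i f (a + s *\<^sub>R axis i 1))"
  proof (rule MVT2)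
    fix s assume s: "0 \<le> s" "s \<le> h"
    show "DERIV \<phi> s :> partial_deriv i f (a + h *\<^sub>R axis j 1 + s *\<^sub>R axis i 1) - partial_deriv i f (a + s *\<^sub>R axis i 1)"
      unfolding \<phi>_def
      by (intro DERIV_diff partial_deriv_line d1)
        (use ball[of s h] ball[of s 0] s h in \<open>simp_all add: add.commute add.left_commute\<close>)
  qed (rule h)
  then obtain s where s: "0 < s" "s < h" "\<phi> h - \<phi> 0 = h * (partial_deriv i f (a + h *\<^sub>R axis j 1 + s *\<^sub>R axis i 1) - partial_deriv i f (a + s *\<^sub>R axis i 1))"
    by auto
  define \<psi> where "\<psi> t = partial_deriv i f (a + s *\<^sub>R axis i 1 + t *\<^sub>R axis j 1)" for t
  have "\<exists>t. 0 < t \<and> t < h \<and> \<psi> h - \<psi> 0 = (h - 0) * partial_deriv j (partial_deriv i f) (a + s *\<^sub>R axis i 1 + t *\<^sub>R axis j 1)"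
  proof (rule MVT2)
    fix t assume t: "0 \<le> t" "t \<le> h"
    show "DERIV \<psi> t :> partial_deriv j (partial_deriv i f) (a + s *\<^sub>R axis i 1 + t *\<^sub>R axis j 1)"
      unfolding \<psi>_def by (intro partial_deriv_line d2 ball) (use s t in auto)
  qed (rule h)
  then obtain t where t: "0 < t" "t < h" "\<psi> h - \<psi> 0 = h * partial_deriv j (partial_deriv i f) (a + s *\<^sub>R axis i 1 + t *\<^sub>R axis j 1)"
    by auto
  have "\<psi> h - \<psi> 0 = partial_deriv i f (a + h *\<^sub>R axis j 1 + s *\<^sub>R axis i 1) - partial_deriv i f (a + s *\<^sub>R axis i 1)"
    by (simp add: \<psi>_def add.commute add.left_commute)
  then have "\<phi> h - \<phi> 0 = h * h * partial_deriv j (partial_deriv i f) (a + s *\<^sub>R axis i 1 + t *\<^sub>R axis j 1)"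
    using s(3) t(3) by simp
  moreover have "\<phi> h - \<phi> 0 = f (a + h *\<^sub>R axis i 1 + h *\<^sub>R axis j 1) - f (a + h *\<^sub>R axis i 1) - f (a + h *\<^sub>R axis j 1) + f a"
    by (simp add: \<phi>_def add.commute add.left_commute)
  ultimately show ?thesis using inb[of s t] s t by (intro exI[of _ "a + s *\<^sub>R axis i 1 + t *\<^sub>R axis j 1"]) auto
qed

lemma partial_deriv_commute:
  fixes f :: "real^'n::finite \<Rightarrow> real"
  assumes S: "open S" "a \<in> S" and d1: "\<And>x. x \<in> S \<Longrightarrow> f differentiable (at x)"
    and d2: "\<And>x i. x \<in> S \<Longrightarrow> partial_deriv i f differentiable (at x)"
    and c: "\<And>i j. continuous_on S (partial_deriv i (partial_deriv j f))"
  shows "partial_deriv i (partial_deriv j f) a = partial_deriv j (partial_deriv i f) a"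
proof -
  obtain r where r: "0 < r" "ball a r \<subseteq> S" using S openE by blast
  define h where "h n = r / (3 * real (Suc n))" for n
  have h: "0 < h n" "2 * h n < r" for n
  proof -
    show "0 < h n" using r by (simp add: h_def)
    have "2 * h n \<le> 2 * (r / 3)" using r unfolding h_def by (intro mult_left_mono divide_left_mono) auto
    then show "2 * h n < r" using r by simp
  qed
  have "h \<longlonglongrightarrow> 0"
  proof -
    have "(\<lambda>n. (r / 3) * (1 / real (Suc n))) \<longlonglongrightarrow> (r / 3) * 0" by (intro tendsto_intros LIMSEQ_Suc lim_1_over_n)
    then show ?thesis by (simp add: h_def[abs_def] field_simps)
  qed
  have lim: "X \<longlonglongrightarrow> a" if "\<And>n. dist (X n) a \<le> 2 * h n" for X :: "nat \<Rightarrow> real^'n"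
  proof (rule metric_tendsto_imp_tendsto[of "\<lambda>n. 2 * h n" 0])
    show "(\<lambda>n. 2 * h n) \<longlonglongrightarrow> 0" using tendsto_mult_right_zero[OF \<open>h \<longlonglongrightarrow> 0\<close>, of 2] .
    show "\<forall>\<^sub>F n in sequentially. dist (X n) a \<le> dist (2 * h n) 0"
    proof (intro always_eventually allI)
      fix n show "dist (X n) a \<le> dist (2 * h n) 0" using that[of n] h(1)[of n] by (simp add: dist_real_def)
    qed
  qed
  have "\<exists>x y. dist x a \<le> 2 * h n \<and> dist y a \<le> 2 * h n \<and> partial_deriv i (partial_deriv j f) x = partial_deriv j (partial_deriv i f) y" for n
  proof -
    obtain y where y: "dist y a \<le> 2 * h n"
      "f (a + h n *\<^sub>R axis i 1 + h n *\<^sub>R axis j 1) - f (a + h n *\<^sub>R axis i 1) - f (a + h n *\<^sub>R axis j 1) + f a = h n * h n * partial_deriv j (partial_deriv i f) y"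
      using second_difference[of "h n" a r f i j] h r d1 d2 by blast
    obtain x where x: "dist x a \<le> 2 * h n"
      "f (a + h n *\<^sub>R axis j 1 + h n *\<^sub>R axis i 1) - f (a + h n *\<^sub>R axis j 1) - f (a + h n *\<^sub>R axis i 1) + f a = h n * h n * partial_deriv i (partial_deriv j f) x"
      using second_difference[of "h n" a r f j i] h r d1 d2 by blast
    have "a + h n *\<^sub>R axis j 1 + h n *\<^sub>R axis i 1 = a + h n *\<^sub>R axis i 1 + h n *\<^sub>R (axis j 1 :: real^'n)" by (simp add: algebra_simps)
    note pe = this
    have "h n * h n * partial_deriv i (partial_deriv j f) x = h n * h n * partial_deriv j (partial_deriv i f) y"
      using x(2) y(2) unfolding pe by linarith
    then have "partial_deriv i (partial_deriv j f) x = partial_deriv j (partial_deriv i f) y" using h(1)[of n] by simp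
    then show ?thesis using x(1) y(1) by blast
  qed
  then obtain X Y where XY: "\<And>n. dist (X n) a \<le> 2 * h n" "\<And>n. dist (Y n) a \<le> 2 * h n"
      "\<And>n. partial_deriv i (partial_deriv j f) (X n) = partial_deriv j (partial_deriv i f) (Y n)" by metis
  have cont: "isCont (partial_deriv i (partial_deriv j f)) a" for i j
    using c S by (simp add: continuous_on_eq_continuous_at)
  have "(\<lambda>n. partial_deriv i (partial_deriv j f) (X n)) \<longlonglongrightarrow> partial_deriv i (partial_deriv j f) a"
    by (rule isCont_tendsto_compose[OF cont lim[OF XY(1)]])
  moreover have "(\<lambda>n. partial_deriv i (partial_deriv j f) (X n)) \<longlonglongrightarrow> partial_deriv j (partial_deriv i f) a"
    unfolding XY(3) by (rule isCont_tendsto_compose[OF cont lim[OF XY(2)]])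
  ultimately show ?thesis by (rule LIMSEQ_unique)
qed

section \<open>Strictly convex entropies\<close>

lemma frechet_derivative_grad:
  fixes U :: "real^'n::finite \<Rightarrow> real"
  assumes "U differentiable (at x)"
  shows "frechet_derivative U (at x) v = grad U x \<bullet> v"
proof -
  have lin: "linear (frechet_derivative U (at x))" using linear_frechet_derivative[OF assms] .
  have "v = (\<Sum>i\<in>UNIV. v $ i *\<^sub>R axis i 1)" using basis_expansion[of v] by (simp add: scalar_mult_eq_scaleR)
  then have "frechet_derivative U (at x) v = frechet_derivative U (at x) (\<Sum>i\<in>UNIV. v $ i *\<^sub>R axis i 1)"
    by (rule arg_cong)
  also have "\<dots> = (\<Sum>i\<in>UNIV. v $ i *\<^sub>R frechet_derivative U (at x) (axis i 1))"
    by (simp add: linear_sum[OF lin] linear_scale[OF lin])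
  also have "\<dots> = grad U x \<bullet> v" by (simp add: grad_def inner_vec_def partial_deriv_def mult.commute)
  finally show ?thesis .
qed

lemma has_derivative_grad:
  fixes U :: "real^'n::finite \<Rightarrow> real"
  assumes "U differentiable (at x)"
  shows "(U has_derivative (\<lambda>v. grad U x \<bullet> v)) (at x)"
proof -
  have "frechet_derivative U (at x) = (\<lambda>v. grad U x \<bullet> v)" using frechet_derivative_grad[OF assms] by blast
  then show ?thesis using assms frechet_derivative_works by metis
qed

locale strict_entropy =
  fixes \<Omega>' :: "(real^'m::finite) set" and U :: "real^'m \<Rightarrow> real"
  assumes open_states: "open \<Omega>'" and smooth: "Ck_on 3 \<Omega>' U"
    and convex: "\<And>w z. w \<in> \<Omega>' \<Longrightarrow> z \<noteq> 0 \<Longrightarrow> 0 < z \<bullet> (hessian U w *v z)"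
begin

lemma regularity:
  shows "\<And>w. w \<in> \<Omega>' \<Longrightarrow> U differentiable (at w)"
    and "\<And>i w. w \<in> \<Omega>' \<Longrightarrow> partial_deriv i U differentiable (at w)"
    and "\<And>i j w. w \<in> \<Omega>' \<Longrightarrow> partial_deriv i (partial_deriv j U) differentiable (at w)"
    and "\<And>i j l. continuous_on \<Omega>' (partial_deriv i (partial_deriv j (partial_deriv l U)))"
  using smooth by (auto simp: numeral_3_eq_3)

lemma continuous_hessian_entry: "continuous_on \<Omega>' (partial_deriv i (partial_deriv j U))"
  using regularity(3) by (meson continuous_at_imp_continuous_on differentiable_imp_continuous_within)

lemma continuous_grad: "continuous_on \<Omega>' (grad U)"
proof -
  have "continuous_on \<Omega>' (partial_deriv i U)" for i
    using regularity(2) by (meson continuous_at_imp_continuous_on differentiable_imp_continuous_within)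
  then show ?thesis unfolding grad_def[abs_def] by (intro continuous_on_vec_lambda)
qed

lemma hessian_symmetric: "w \<in> \<Omega>' \<Longrightarrow> hessian U w $ i $ j = hessian U w $ j $ i"
  unfolding hessian_def by (simp add: partial_deriv_commute[OF open_states _ regularity(1,2) continuous_hessian_entry])

lemma min_eigenvalue_pos:
  assumes "w \<in> \<Omega>'" shows "0 < min_eigenvalue (hessian U w)"
proof -
  obtain v where "norm v = 1" "min_eigenvalue (hessian U w) = v \<bullet> (hessian U w *v v)"
    using min_eigenvalue_le_quadratic_form(2)[of "hessian U w", OF hessian_symmetric[OF assms]] by blast
  moreover have "v \<noteq> 0" using \<open>norm v = 1\<close> by auto
  ultimately show ?thesis using convex[OF assms] by simp
qed

lemma hessian_quadratic_form:
  "z \<bullet> (hessian U w *v z) = (\<Sum>i\<in>UNIV. \<Sum>j\<in>UNIV. z $ i * (partial_deriv i (partial_deriv j U) w * z $ j))"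
  by (simp add: inner_vec_def matrix_vector_mult_def hessian_def sum_distrib_left)

text \<open>The quadratic form of the Hessian attains a positive minimum on the product of \<open>S\<close> and the unit sphere, which
bounds all eigenvalues from below.\<close>

lemma inf_min_eigenvalue:
  assumes S: "compact S" "S \<noteq> {}" "S \<subseteq> \<Omega>'"
  defines "\<mu> \<equiv> (INF w\<in>S. \<bar>min_eigenvalue (hessian U w)\<bar>)"
  shows "0 < \<mu>" and "\<And>w z. w \<in> S \<Longrightarrow> \<mu> * (norm z)\<^sup>2 \<le> z \<bullet> (hessian U w *v z)"
proof -
  let ?q = "\<lambda>p. snd p \<bullet> (hessian U (fst p) *v snd p)"
  have "continuous_on (S \<times> sphere 0 1) (\<lambda>p. partial_deriv i (partial_deriv j U) (fst p))" for i j
    by (rule continuous_on_compose2[OF continuous_hessian_entry]) (use S in \<open>auto intro: continuous_intros\<close>)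
  then have "continuous_on (S \<times> sphere 0 1) ?q"
    unfolding hessian_quadratic_form by (intro continuous_intros)
  moreover have "compact (S \<times> sphere (0 :: real^'m) 1)" using S by (intro compact_Times) auto
  moreover have "S \<times> sphere (0 :: real^'m) 1 \<noteq> {}" using S by simp
  ultimately obtain p where p: "p \<in> S \<times> sphere 0 1" "\<And>y. y \<in> S \<times> sphere 0 1 \<Longrightarrow> ?q p \<le> ?q y"
    using continuous_attains_inf[of "S \<times> sphere 0 1" ?q] by blast
  have "snd p \<noteq> 0" using p(1) by auto
  then have pos: "0 < ?q p" using p(1) S(3) by (intro convex) auto
  have le: "?q p \<le> min_eigenvalue (hessian U w)" if w: "w \<in> S" for w
  proof -
    obtain v where v: "norm v = 1" "min_eigenvalue (hessian U w) = v \<bullet> (hessian U w *v v)"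
      using min_eigenvalue_le_quadratic_form(2)[of "hessian U w", OF hessian_symmetric] w S(3) by blast
    show ?thesis using p(2)[of "(w, v)"] v w by simp
  qed
  have "?q p \<le> \<mu>" unfolding \<mu>_def
  proof (rule cINF_greatest[OF S(2)])
    fix w assume "w \<in> S"
    then show "?q p \<le> \<bar>min_eigenvalue (hessian U w)\<bar>" using le[of w] by linarith
  qed
  then show "0 < \<mu>" using pos by linarith
  fix w z :: "real^'m" assume w: "w \<in> S"
  have "bdd_below ((\<lambda>w. \<bar>min_eigenvalue (hessian U w)\<bar>) ` S)" by (rule bdd_belowI[of _ 0]) auto
  then have "\<mu> \<le> \<bar>min_eigenvalue (hessian U w)\<bar>" unfolding \<mu>_def by (rule cINF_lower[OF _ w])
  then have "\<mu> \<le> min_eigenvalue (hessian U w)" using min_eigenvalue_pos[of w] w S(3) by auto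
  then have "\<mu> * (norm z)\<^sup>2 \<le> min_eigenvalue (hessian U w) * (norm z)\<^sup>2" by (rule mult_right_mono) simp
  also have "\<dots> \<le> z \<bullet> (hessian U w *v z)"
    using min_eigenvalue_le_quadratic_form(1)[of "hessian U w", OF hessian_symmetric] w S(3) by blast
  finally show "\<mu> * (norm z)\<^sup>2 \<le> z \<bullet> (hessian U w *v z)" .
qed

text \<open>The mean value theorem along the segment from \<open>a\<close> to \<open>b\<close>, which stays in the convex set \<open>S\<close>.\<close>

lemma grad_monotone:
  assumes S: "compact S" "convex S" "S \<subseteq> \<Omega>'" and a: "a \<in> S" and b: "b \<in> S"
  shows "(INF w\<in>S. \<bar>min_eigenvalue (hessian U w)\<bar>) * (norm (b - a))\<^sup>2 \<le> (b - a) \<bullet> (grad U b - grad U a)"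
proof -
  define z where "z = b - a"
  define g where "g t = z \<bullet> grad U (a + t *\<^sub>R z)" for t
  have seg: "a + t *\<^sub>R z \<in> S" if "0 \<le> t" "t \<le> 1" for t
  proof -
    have "(1 - t) *\<^sub>R a + t *\<^sub>R b \<in> S" using S(2) a b that by (simp add: convexD)
    then show ?thesis by (simp add: z_def algebra_simps)
  qed
  have "\<exists>t. 0 < t \<and> t < 1 \<and> g 1 - g 0 = (1 - 0) * (z \<bullet> (hessian U (a + t *\<^sub>R z) *v z))"
  proof (rule MVT2)
    fix t :: real assume t: "0 \<le> t" "t \<le> 1"
    then have w: "a + t *\<^sub>R z \<in> \<Omega>'" using seg S(3) by blast
    have "((\<lambda>s. partial_deriv i U (a + s *\<^sub>R z)) has_real_derivative (\<Sum>j\<in>UNIV. partial_deriv j (partial_deriv i U) (a + t *\<^sub>R z) * z $ j)) (at t)" for i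
    proof -
      have "(partial_deriv i U has_derivative (\<lambda>v. grad (partial_deriv i U) (a + t *\<^sub>R z) \<bullet> v)) (at (a + t *\<^sub>R z))"
        by (rule has_derivative_grad[OF regularity(2)[OF w]])
      moreover have "((\<lambda>s. a + s *\<^sub>R z) has_derivative (\<lambda>s. s *\<^sub>R z)) (at t)" by (auto intro!: derivative_eq_intros)
      ultimately have "((\<lambda>s. partial_deriv i U (a + s *\<^sub>R z)) has_derivative (\<lambda>s. grad (partial_deriv i U) (a + t *\<^sub>R z) \<bullet> (s *\<^sub>R z))) (at t)"
        by (rule has_derivative_compose[rotated])
      moreover have "(\<lambda>s. grad (partial_deriv i U) (a + t *\<^sub>R z) \<bullet> (s *\<^sub>R z)) = (*) (\<Sum>j\<in>UNIV. partial_deriv j (partial_deriv i U) (a + t *\<^sub>R z) * z $ j)"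
        by (simp add: fun_eq_iff grad_def inner_vec_def sum_distrib_left sum_distrib_right mult_ac)
      ultimately show ?thesis by (simp add: has_field_derivative_def)
    qed
    then have "(g has_real_derivative (\<Sum>i\<in>UNIV. z $ i * (\<Sum>j\<in>UNIV. partial_deriv j (partial_deriv i U) (a + t *\<^sub>R z) * z $ j))) (at t)"
      unfolding g_def inner_vec_def grad_def inner_real_def vec_lambda_beta by (intro DERIV_sum DERIV_cmult)
    moreover have "(\<Sum>i\<in>UNIV. z $ i * (\<Sum>j\<in>UNIV. partial_deriv j (partial_deriv i U) (a + t *\<^sub>R z) * z $ j)) = z \<bullet> (hessian U (a + t *\<^sub>R z) *v z)"
      using hessian_symmetric[OF w] unfolding hessian_quadratic_form by (simp add: sum_distrib_left hessian_def)
    ultimately show "DERIV g t :> z \<bullet> (hessian U (a + t *\<^sub>R z) *v z)" by simp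
  qed simp
  then obtain t where t: "0 < t" "t < 1" "g 1 - g 0 = z \<bullet> (hessian U (a + t *\<^sub>R z) *v z)" by auto
  have "(INF w\<in>S. \<bar>min_eigenvalue (hessian U w)\<bar>) * (norm z)\<^sup>2 \<le> z \<bullet> (hessian U (a + t *\<^sub>R z) *v z)"
    using t a by (intro inf_min_eigenvalue(2) S seg) auto
  also have "\<dots> = z \<bullet> (grad U b - grad U a)" using t(3) by (simp add: g_def inner_diff_right z_def)
  finally show ?thesis by (simp add: z_def)
qed

text \<open>The supremum is nonnegative because the set is nonempty and, by compactness of \<open>S\<close>, bounded.\<close>

lemma third_deriv_nonneg:
  assumes "compact S" "S \<noteq> {}" "S \<subseteq> \<Omega>'"
  shows "0 \<le> Sup {\<bar>partial_deriv i1 (partial_deriv i2 (partial_deriv i3 U)) w\<bar> | i1 i2 i3 w. w \<in> S}" (is "0 \<le> Sup ?A")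
proof -
  define V where "V p = (\<lambda>w. \<bar>partial_deriv (fst p) (partial_deriv (fst (snd p)) (partial_deriv (snd (snd p)) U)) w\<bar>)" for p :: "'m \<times> 'm \<times> 'm"
  have eq: "?A = (\<Union>p. V p ` S)" by (force simp: V_def)
  have "bounded (V p ` S)" for p
  proof -
    have "continuous_on S (V p)" unfolding V_def
      by (intro continuous_intros continuous_on_subset[OF regularity(4) assms(3)])
    then show ?thesis using assms(1) compact_continuous_image compact_imp_bounded by blast
  qed
  then have "bounded ?A" unfolding eq by (intro bounded_UN) auto
  then have bdd: "bdd_above ?A" by (rule bounded_imp_bdd_above)
  obtain w where "w \<in> S" using assms(2) by blast
  then have "\<bar>partial_deriv undefined (partial_deriv undefined (partial_deriv undefined U)) w\<bar> \<in> ?A" by blast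
  then have "\<bar>partial_deriv undefined (partial_deriv undefined (partial_deriv undefined U)) w\<bar> \<le> Sup ?A" by (rule cSup_upper[OF _ bdd])
  then show ?thesis by linarith
qed

end

section \<open>Numerical entropy flux\<close>

lemma numerical_entropy_flux_consistent:
  assumes "entropy_stable_flux \<Omega>' f U F fhat" "a \<in> \<Omega>'" "norm n = 1"
  shows "numerical_entropy_flux f U F fhat a a n = (\<Sum>i\<in>UNIV. n $ i * F i a)"
proof -
  have "fhat a a n = normal_flux f a n" using assms by (simp add: entropy_stable_flux_def)
  moreover have "grad U a \<bullet> normal_flux f a n = (\<Sum>i\<in>UNIV. n $ i * (grad U a \<bullet> f i a))"
    by (simp add: normal_flux_def inner_sum_right)
  moreover have "numerical_entropy_flux f U F fhat a a n
      = grad U a \<bullet> fhat a a n - (\<Sum>i\<in>UNIV. n $ i * entropy_potential f U F i a)"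
  proof -
    have "(1/2) *\<^sub>R (grad U a + grad U a) = grad U a" by (simp add: scaleR_2[symmetric])
    then show ?thesis unfolding numerical_entropy_flux_def by simp
  qed
  ultimately show ?thesis
    by (simp add: entropy_potential_def right_diff_distrib sum_subtractf)
qed

lemma numerical_entropy_flux_conservative:
  assumes "entropy_stable_flux \<Omega>' f U F fhat" "a \<in> \<Omega>'" "b \<in> \<Omega>'" "norm n = 1"
  shows "numerical_entropy_flux f U F fhat b a (- n) = - numerical_entropy_flux f U F fhat a b n"
proof -
  have "fhat b a (- n) = - fhat a b n" using assms by (simp add: entropy_stable_flux_def)
  then show ?thesis by (simp add: numerical_entropy_flux_def add.commute sum_negf)
qed

text \<open>With the definitions of the potential \<open>\<psi>\<close> and of the numerical entropy flux inserted, the difference of the two sides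
is half of the expression in the definition of entropy stability.\<close>

lemma boundary_entropy_dissipation:
  assumes "entropy_stable_flux \<Omega>' f U F fhat" "a \<in> \<Omega>'" "b \<in> \<Omega>'" "norm n = 1"
  shows "(- fhat a b n + normal_flux f a n) \<bullet> grad U a + numerical_entropy_flux f U F fhat a b n
    \<le> (\<Sum>i\<in>UNIV. n $ i * F i a)"
proof -
  let ?\<psi> = "entropy_potential f U F"
  have st: "fhat a b n \<bullet> (grad U b - grad U a) - (\<Sum>i\<in>UNIV. n $ i * (?\<psi> i b - ?\<psi> i a)) \<le> 0"
    using assms by (simp add: entropy_stable_flux_def)
  have 1: "normal_flux f a n \<bullet> grad U a = (\<Sum>i\<in>UNIV. n $ i * ?\<psi> i a) + (\<Sum>i\<in>UNIV. n $ i * F i a)"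
    unfolding sum.distrib[symmetric] by (simp add: normal_flux_def inner_sum_left inner_sum_right entropy_potential_def inner_commute algebra_simps)
  have 2: "(\<Sum>i\<in>UNIV. n $ i * ((?\<psi> i a + ?\<psi> i b) / 2)) = ((\<Sum>i\<in>UNIV. n $ i * ?\<psi> i a) + (\<Sum>i\<in>UNIV. n $ i * ?\<psi> i b)) / 2"
    unfolding sum.distrib[symmetric] sum_divide_distrib by (rule sum.cong) (auto simp: algebra_simps)
  have 3: "(\<Sum>i\<in>UNIV. n $ i * (?\<psi> i b - ?\<psi> i a)) = (\<Sum>i\<in>UNIV. n $ i * ?\<psi> i b) - (\<Sum>i\<in>UNIV. n $ i * ?\<psi> i a)"
    by (simp add: right_diff_distrib sum_subtractf)
  show ?thesis using st
    unfolding numerical_entropy_flux_def 2 3 inner_add_left 1 inner_diff_right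
    by (simp add: inner_add_left inner_add_right inner_commute[of "grad U a"] inner_commute[of "grad U b"] field_simps)
qed

section \<open>Integrals over an element\<close>

lemma partial_deriv_cong:
  assumes "open S" "x \<in> S" "\<And>y. y \<in> S \<Longrightarrow> f y = g y"
  shows "partial_deriv i f x = partial_deriv i g x"
proof -
  have "(f has_derivative D) (at x) \<longleftrightarrow> (g has_derivative D) (at x)" for D
    using has_derivative_transform_within_open[OF _ assms(1,2)] assms(3) by metis
  then show ?thesis by (simp add: partial_deriv_def frechet_derivative_def)
qed

lemma set_integrable_inner_continuous:
  fixes H :: "real^'d::finite \<Rightarrow> real^'m::finite"
  assumes S: "compact S" and H: "set_integrable surface_measure S H" and w: "continuous_on S w"
  shows "set_integrable surface_measure S (\<lambda>x. H x \<bullet> w x)"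
proof -
  from compact_imp_bounded[OF compact_continuous_image[OF w S]]
  obtain B where B: "\<And>x. x \<in> S \<Longrightarrow> norm (w x) \<le> B" by (auto simp: bounded_iff)
  have wm: "(\<lambda>x. indicator S x *\<^sub>R w x) \<in> borel_measurable surface_measure"
    using measurable_compose[OF measurable_id_surface borel_measurable_continuous_on_indicator[OF borel_compact[OF S] w]] .
  have Hm: "(\<lambda>x. indicator S x *\<^sub>R H x) \<in> borel_measurable surface_measure"
    using H unfolding set_integrable_def by (rule borel_measurable_integrable)
  have eq: "indicator S x *\<^sub>R (H x \<bullet> w x) = (indicator S x *\<^sub>R H x) \<bullet> (indicator S x *\<^sub>R w x)" for x
    by (simp add: indicator_def)
  have nH: "integrable surface_measure (\<lambda>x. B * norm (indicator S x *\<^sub>R H x))"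
    using H unfolding set_integrable_def by (intro integrable_mult_right integrable_norm)
  show ?thesis unfolding set_integrable_def
  proof (rule Bochner_Integration.integrable_bound[OF nH])
    show "(\<lambda>x. indicator S x *\<^sub>R (H x \<bullet> w x)) \<in> borel_measurable surface_measure"
      unfolding eq by (intro borel_measurable_inner Hm wm)
    show "AE x in surface_measure. norm (indicator S x *\<^sub>R (H x \<bullet> w x)) \<le> norm (B * norm (indicator S x *\<^sub>R H x))"
    proof (rule AE_I2)
      fix x
      have "\<bar>H x \<bullet> w x\<bar> \<le> \<bar>B * norm (H x)\<bar>" if "x \<in> S"
      proof -
        have "\<bar>H x \<bullet> w x\<bar> \<le> norm (H x) * norm (w x)" by (rule Cauchy_Schwarz_ineq2)
        also have "\<dots> \<le> norm (H x) * B" using B[OF that] by (rule mult_left_mono) simp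
        also have "\<dots> \<le> \<bar>B * norm (H x)\<bar>" by (simp add: mult.commute)
        finally show ?thesis .
      qed
      then show "norm (indicator S x *\<^sub>R (H x \<bullet> w x)) \<le> norm (B * norm (indicator S x *\<^sub>R H x))"
        by (simp add: indicator_def)
    qed
  qed
qed

context convex_body
begin

lemma volume_pos: "0 < volume K"
proof -
  have "\<not> negligible K" using interior_K by (meson interior_subset negligible_subset open_interior open_not_negligible)
  then have "measure lebesgue K \<noteq> 0" using K_lmeasurable by (simp add: negligible_iff_measure)
  then show ?thesis by (simp add: volume_def zero_less_measure_iff)
qed

lemma LINT_const: "(LINT x:K|lebesgue. c) = volume K *\<^sub>R c" for c :: "'b::euclidean_space"
proof -
  have "(LINT x:K|lebesgue. c) = measure lebesgue K *\<^sub>R c"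
    by (rule set_integral_const[OF fmeasurableD[OF K_lmeasurable]])
      (use fmeasurableD2[OF K_lmeasurable] in \<open>simp only: infinity_ennreal_def not_False_eq_True\<close>)
  then show ?thesis by (simp only: volume_def)
qed

text \<open>A hyperplane that separates the average from \<open>S\<close> would also separate it from all values.\<close>

lemma cell_average_hull:
  fixes P :: "real^'d \<Rightarrow> real^'m::finite"
  assumes P: "continuous_on K P" and S: "closed S" "convex S" "P ` K \<subseteq> S"
  shows "cell_average K P \<in> S"
proof (rule ccontr)
  assume "cell_average K P \<notin> S"
  then obtain a b where ab: "a \<bullet> cell_average K P < b" "\<And>x. x \<in> S \<Longrightarrow> b < a \<bullet> x"
    using separating_hyperplane_closed_point[OF S(2,1)] by blast
  have i: "set_integrable lebesgue K P" by (rule integrable_K_cong(2)[OF _ P, of P]) simp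
  have c: "continuous_on K (\<lambda>x. a \<bullet> P x)" by (intro continuous_intros P)
  have "volume K * b = (LINT x:K|lebesgue. b)" by (simp add: LINT_const)
  also have "\<dots> \<le> (LINT x:K|lebesgue. a \<bullet> P x)"
  proof (rule set_integral_mono)
    show "set_integrable lebesgue K (\<lambda>x. b)" by (rule integrable_K_cong(2)[of "\<lambda>_. b"]) auto
    show "set_integrable lebesgue K (\<lambda>x. a \<bullet> P x)" by (rule integrable_K_cong(2)[OF _ c, of "\<lambda>x. a \<bullet> P x"]) simp
    show "\<And>x. x \<in> K \<Longrightarrow> b \<le> a \<bullet> P x" using ab(2) S(3) by (force intro: less_imp_le)
  qed
  also have "\<dots> = a \<bullet> (LINT x:K|lebesgue. P x)"
  proof -
    have "integral\<^sup>L lebesgue (\<lambda>x. a \<bullet> (indicator K x *\<^sub>R P x)) = a \<bullet> (LINT x:K|lebesgue. P x)"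
      unfolding set_lebesgue_integral_def
      by (rule Bochner_Integration.integral_inner_right) (use i in \<open>simp add: set_integrable_def\<close>)
    then show ?thesis by (simp add: set_lebesgue_integral_def)
  qed
  also have "\<dots> = volume K * (a \<bullet> cell_average K P)" using volume_pos by (simp add: cell_average_def)
  finally have "b \<le> a \<bullet> cell_average K P" using volume_pos by simp
  then show False using ab(1) by simp
qed

lemma LINT_minus_average:
  fixes P :: "real^'d \<Rightarrow> real^'m::finite"
  assumes P: "continuous_on K P" shows "(LINT x:K|lebesgue. P x - cell_average K P) = 0"
proof -
  have "(LINT x:K|lebesgue. P x - cell_average K P) = (LINT x:K|lebesgue. P x) - (LINT x:K|lebesgue. cell_average K P)"
    by (rule set_integral_diff(2); rule integrable_K_cong(2)[of P P, OF _ P] integrable_K_cong(2)[of "\<lambda>_. cell_average K P"]) auto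
  then show ?thesis using volume_pos by (simp add: LINT_const cell_average_def)
qed

lemma cell_average_cong:
  assumes "\<And>x. x \<in> interior K \<Longrightarrow> u x = P x" "continuous_on K P"
  shows "cell_average K u = cell_average K P"
proof -
  have "(LINT x:K|lebesgue. u x) = (LINT x:K|lebesgue. P x)"
    by (rule integrable_K_cong(3)[OF _ assms(2)]) (rule assms(1))
  then show ?thesis by (simp only: cell_average_def)
qed

text \<open>The average \<open>m\<close> of \<open>P\<close> lies in \<open>S\<close>, so \<open>(P - m) \<bullet> (\<nabla>U(P) - \<nabla>U(m)) \<ge> \<mu> |P - m|\<^sup>2\<close> at every point, and the term with the
constant vector \<open>\<nabla>U(m)\<close> integrates to zero.\<close>

lemma damping_coercive:
  fixes P :: "real^'d \<Rightarrow> real^'m::finite"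
  assumes U: "strict_entropy \<Omega>' U" and P: "continuous_on K P" and S: "compact S" "convex S" "P ` K \<subseteq> S" "S \<subseteq> \<Omega>'"
  shows "(INF w\<in>S. \<bar>min_eigenvalue (hessian U w)\<bar>) * (LINT x:K|lebesgue. (norm (P x - cell_average K P))\<^sup>2)
    \<le> (LINT x:K|lebesgue. grad U (P x) \<bullet> (P x - cell_average K P))"
proof -
  interpret strict_entropy \<Omega>' U by (rule U)
  define m where "m = cell_average K P"
  define \<mu> where "\<mu> = (INF w\<in>S. \<bar>min_eigenvalue (hessian U w)\<bar>)"
  have mS: "m \<in> S" unfolding m_def by (rule cell_average_hull[OF P compact_imp_closed[OF S(1)] S(2,3)])
  have gP: "continuous_on K (\<lambda>x. grad U (P x))"
    by (rule continuous_on_compose2[OF continuous_grad P]) (use S in blast)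
  have int: "set_integrable lebesgue K h" if "continuous_on K h" for h :: "real^'d \<Rightarrow> real"
    by (rule integrable_K_cong(2)[OF _ that, of h]) simp
  have "\<mu> * (LINT x:K|lebesgue. (norm (P x - m))\<^sup>2) = (LINT x:K|lebesgue. \<mu> * (norm (P x - m))\<^sup>2)"
    by (rule set_integral_mult_right[symmetric])
  also have "\<dots> \<le> (LINT x:K|lebesgue. grad U (P x) \<bullet> (P x - m) - grad U m \<bullet> (P x - m))"
  proof (rule set_integral_mono)
    show "set_integrable lebesgue K (\<lambda>x. \<mu> * (norm (P x - m))\<^sup>2)" by (intro int continuous_intros P)
    show "set_integrable lebesgue K (\<lambda>x. grad U (P x) \<bullet> (P x - m) - grad U m \<bullet> (P x - m))" by (intro int continuous_intros P gP)
    fix x assume "x \<in> K"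
    then have "P x \<in> S" using S(3) by blast
    from grad_monotone[OF S(1,2,4) mS this]
    show "\<mu> * (norm (P x - m))\<^sup>2 \<le> grad U (P x) \<bullet> (P x - m) - grad U m \<bullet> (P x - m)"
      by (simp add: \<mu>_def inner_diff_right inner_diff_left inner_commute)
  qed
  also have "\<dots> = (LINT x:K|lebesgue. grad U (P x) \<bullet> (P x - m)) - (LINT x:K|lebesgue. grad U m \<bullet> (P x - m))"
    by (rule set_integral_diff(2)) (intro int continuous_intros P gP)+
  also have "(LINT x:K|lebesgue. grad U m \<bullet> (P x - m)) = grad U m \<bullet> (LINT x:K|lebesgue. P x - m)"
  proof -
    have "set_integrable lebesgue K (\<lambda>x. P x - m)"
      by (rule integrable_K_cong(2)[of "\<lambda>x. P x - m"]) (auto intro!: continuous_intros P)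
    then have "integral\<^sup>L lebesgue (\<lambda>x. grad U m \<bullet> (indicator K x *\<^sub>R (P x - m))) = grad U m \<bullet> (LINT x:K|lebesgue. P x - m)"
      unfolding set_lebesgue_integral_def set_integrable_def by (rule Bochner_Integration.integral_inner_right)
    then show ?thesis by (simp add: set_lebesgue_integral_def)
  qed
  also have "(LINT x:K|lebesgue. P x - m) = 0" unfolding m_def by (rule LINT_minus_average[OF P])
  finally show ?thesis by (simp add: \<mu>_def m_def)
qed

text \<open>By the chain rule and the compatibility condition on the entropy fluxes, \<open>\<nabla>U(P) \<bullet> \<partial>\<^sub>i f\<^sub>i(P) = \<partial>\<^sub>i F\<^sub>i(P)\<close>.\<close>

lemma entropy_flux_divergence:
  fixes P :: "real^'d \<Rightarrow> real^'m::finite" and f :: "'d \<Rightarrow> real^'m \<Rightarrow> real^'m"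
  assumes \<Omega>': "open \<Omega>'" and smooth: "\<And>i. Ck_on 1 \<Omega>' (f i)"
    and F: "\<And>i w. w \<in> \<Omega>' \<Longrightarrow> F i differentiable (at w) \<and> grad (F i) w = grad U w v* jacobian (f i) (at w)"
    and gU: "continuous_on \<Omega>' (grad U)"
    and P: "\<And>x. (P has_derivative P' x) (at x)" "\<And>v. continuous_on UNIV (\<lambda>x. P' x v)" and PK: "P ` K \<subseteq> \<Omega>'"
  shows "continuous_on K (\<lambda>x. partial_deriv i (\<lambda>y. f i (P y)) x)"
    and "set_integrable surface_measure (frontier K) (\<lambda>x. outward_normal K x $ i * F i (P x))"
    and "(LINT x:K|lebesgue. grad U (P x) \<bullet> (\<Sum>i\<in>UNIV. partial_deriv i (\<lambda>y. f i (P y)) x))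
       = (LINT x:frontier K|surface_measure. \<Sum>i\<in>UNIV. outward_normal K x $ i * F i (P x))"
proof -
  define W where "W = P -` \<Omega>'"
  have cP: "continuous_on S P" for S using P(1) by (meson continuous_at_imp_continuous_on has_derivative_continuous)
  have W: "open W" "K \<subseteq> W" using open_vimage[OF \<Omega>' cP] PK by (auto simp: W_def)
  have fd: "f i differentiable (at w)" "continuous_on \<Omega>' (partial_deriv j (f i))" if "w \<in> \<Omega>'" for i j w
    using smooth[of i] that by auto
  have comp: "partial_deriv i (\<lambda>y. f i (P y)) x = jacobian (f i) (at (P x)) *v P' x (axis i 1)" if "x \<in> W" for i x
  proof -
    have "(f i has_derivative (\<lambda>h. jacobian (f i) (at (P x)) *v h)) (at (P x))"
      using fd(1)[of "P x" i] that jacobian_works by (auto simp: W_def)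
    from has_derivative_compose[OF P(1) this]
    have "((\<lambda>y. f i (P y)) has_derivative (\<lambda>h. jacobian (f i) (at (P x)) *v P' x h)) (at x)" .
    from frechet_derivative_at[OF this, symmetric] show ?thesis by (simp add: partial_deriv_def)
  qed
  have jac: "jacobian (f i) (at w) *v h = (\<Sum>j\<in>UNIV. h $ j *\<^sub>R partial_deriv j (f i) w)" if "w \<in> \<Omega>'" for i w h
  proof -
    have "(f i has_derivative (\<lambda>h. jacobian (f i) (at w) *v h)) (at w)"
      using fd(1)[OF that] jacobian_works by blast
    from frechet_derivative_at[OF this] have eq: "frechet_derivative (f i) (at w) = (\<lambda>h. jacobian (f i) (at w) *v h)" by simp
    have lin: "linear (frechet_derivative (f i) (at w))" using linear_frechet_derivative[OF fd(1)[OF that]] .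
    have "h = (\<Sum>j\<in>UNIV. h $ j *\<^sub>R axis j 1)" using basis_expansion[of h] by (simp add: scalar_mult_eq_scaleR)
    then have "frechet_derivative (f i) (at w) h = frechet_derivative (f i) (at w) (\<Sum>j\<in>UNIV. h $ j *\<^sub>R axis j 1)" by (rule arg_cong)
    also have "\<dots> = (\<Sum>j\<in>UNIV. h $ j *\<^sub>R partial_deriv j (f i) w)"
      by (simp add: linear_sum[OF lin] linear_scale[OF lin] partial_deriv_def)
    finally show ?thesis by (simp add: eq)
  qed
  have c0: "continuous_on W (\<lambda>x. \<Sum>j\<in>UNIV. P' x (axis i 1) $ j *\<^sub>R partial_deriv j (f i) (P x))" for i
  proof (intro continuous_on_sum continuous_on_scaleR)
    fix j
    show "continuous_on W (\<lambda>x. P' x (axis i 1) $ j)"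
      by (intro continuous_intros continuous_on_subset[OF P(2)]) simp
    show "continuous_on W (\<lambda>x. partial_deriv j (f i) (P x))"
    proof (rule continuous_on_compose2[OF _ cP])
      have "Ck_on 0 \<Omega>' (partial_deriv j (f i))" using smooth[of i] by simp
      then show "continuous_on \<Omega>' (partial_deriv j (f i))" by simp
    qed (auto simp: W_def)
  qed
  have cf: "continuous_on W (\<lambda>x. partial_deriv i (\<lambda>y. f i (P y)) x)" for i
    using c0[of i] by (rule continuous_on_cong[THEN iffD1, rotated -1]) (auto simp: comp jac W_def)
  show "continuous_on K (\<lambda>x. partial_deriv i (\<lambda>y. f i (P y)) x)" by (rule continuous_on_subset[OF cf W(2)])
  have FP: "(\<lambda>y. F i (P y)) differentiable (at x)" "partial_deriv i (\<lambda>y. F i (P y)) x = grad U (P x) \<bullet> partial_deriv i (\<lambda>y. f i (P y)) x"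
    if x: "x \<in> W" for i x
  proof -
    have w: "P x \<in> \<Omega>'" using x by (simp add: W_def)
    have "(F i has_derivative (\<lambda>v. grad (F i) (P x) \<bullet> v)) (at (P x))" using F[OF w] by (intro has_derivative_grad) blast
    from has_derivative_compose[OF P(1) this]
    have d: "((\<lambda>y. F i (P y)) has_derivative (\<lambda>h. grad (F i) (P x) \<bullet> P' x h)) (at x)" .
    then show "(\<lambda>y. F i (P y)) differentiable (at x)" by (auto simp: differentiable_def)
    have "partial_deriv i (\<lambda>y. F i (P y)) x = grad (F i) (P x) \<bullet> P' x (axis i 1)"
      using frechet_derivative_at[OF d, symmetric] by (simp add: partial_deriv_def)
    also have "\<dots> = grad U (P x) \<bullet> (jacobian (f i) (at (P x)) *v P' x (axis i 1))"
      using F[OF w, of i] by (simp add: dot_lmul_matrix)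
    finally show "partial_deriv i (\<lambda>y. F i (P y)) x = grad U (P x) \<bullet> partial_deriv i (\<lambda>y. f i (P y)) x" using comp[OF x] by simp
  qed
  have gUP: "continuous_on W (\<lambda>x. grad U (P x))"
    by (rule continuous_on_compose2[OF gU cP]) (auto simp: W_def)
  have cF: "continuous_on W (\<lambda>x. grad U (P x) \<bullet> partial_deriv i (\<lambda>y. f i (P y)) x)" for i
    by (intro continuous_intros gUP cf)
  have cF': "continuous_on W (partial_deriv i (\<lambda>y. F i (P y)))" for i
    using cF[of i] by (rule continuous_on_cong[THEN iffD1, rotated -1]) (auto simp: FP)
  note div = divergence_component[OF W FP(1) cF']
  show "set_integrable surface_measure (frontier K) (\<lambda>x. outward_normal K x $ i * F i (P x))" by (rule div(1))
  have si: "set_integrable lebesgue K (\<lambda>x. grad U (P x) \<bullet> partial_deriv i (\<lambda>y. f i (P y)) x)" for i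
    using integrable_K_cong(2)[OF _ continuous_on_subset[OF cF W(2)], of "\<lambda>x. grad U (P x) \<bullet> partial_deriv i (\<lambda>y. f i (P y)) x"] by simp
  have "(LINT x:K|lebesgue. grad U (P x) \<bullet> (\<Sum>i\<in>UNIV. partial_deriv i (\<lambda>y. f i (P y)) x))
      = (\<Sum>i\<in>UNIV. LINT x:K|lebesgue. grad U (P x) \<bullet> partial_deriv i (\<lambda>y. f i (P y)) x)"
    using si unfolding set_lebesgue_integral_def set_integrable_def inner_sum_right scaleR_sum_right
    by (intro Bochner_Integration.integral_sum) auto
  also have "\<dots> = (\<Sum>i\<in>UNIV. LINT x:K|lebesgue. partial_deriv i (\<lambda>y. F i (P y)) x)"
  proof (rule sum.cong[OF refl])
    fix i
    have "indicator K x *\<^sub>R (grad U (P x) \<bullet> partial_deriv i (\<lambda>y. f i (P y)) x) = indicator K x *\<^sub>R partial_deriv i (\<lambda>y. F i (P y)) x" for x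
      using FP(2)[of x i] W(2) by (auto simp: indicator_def)
    then show "(LINT x:K|lebesgue. grad U (P x) \<bullet> partial_deriv i (\<lambda>y. f i (P y)) x) = (LINT x:K|lebesgue. partial_deriv i (\<lambda>y. F i (P y)) x)"
      unfolding set_lebesgue_integral_def by (intro Bochner_Integration.integral_cong refl)
  qed
  also have "\<dots> = (\<Sum>i\<in>UNIV. LINT x:frontier K|surface_measure. outward_normal K x $ i * F i (P x))" by (simp only: div(2))
  also have "\<dots> = (LINT x:frontier K|surface_measure. \<Sum>i\<in>UNIV. outward_normal K x $ i * F i (P x))"
    using div(1) unfolding set_lebesgue_integral_def set_integrable_def scaleR_sum_right
    by (intro Bochner_Integration.integral_sum[symmetric]) auto
  finally show "(LINT x:K|lebesgue. grad U (P x) \<bullet> (\<Sum>i\<in>UNIV. partial_deriv i (\<lambda>y. f i (P y)) x))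
       = (LINT x:frontier K|surface_measure. \<Sum>i\<in>UNIV. outward_normal K x $ i * F i (P x))" .
qed

end

section \<open>The time derivative of the total entropy\<close>

lemma at_within_interval_nontrivial:
  fixes I :: "real set"
  assumes "is_interval I" "interior I \<noteq> {}" "t \<in> I"
  shows "at t within I \<noteq> bot"
proof -
  have "\<nexists>a. I = {a}" using assms(2) by auto
  then have "t islimpt I" using assms connected_imp_perfect is_interval_connected by blast
  then show ?thesis by (simp add: trivial_limit_within)
qed

text \<open>The solution at any time is a fixed linear combination of its values at finitely many points, with coefficients in
\<open>Pk k\<close>; it is used to deduce properties of \<open>u\<^sub>t\<close> and uniformity in space from pointwise differentiability.\<close>

lemma vector_interpolation:
  fixes K :: "(real^'d::finite) set"
  shows "\<exists>(n::nat) y l. (\<forall>j<n. y j \<in> interior K \<and> l j \<in> Pk k) \<and>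
    (\<forall>v :: real^'d \<Rightarrow> real^'m::finite. (\<forall>i. \<exists>p\<in>Pk k. \<forall>x\<in>interior K. v x $ i = p x) \<longrightarrow>
       (\<forall>x\<in>interior K. v x = (\<Sum>j<n. l j x *\<^sub>R v (y j))))"
proof -
  obtain n :: nat and y and l :: "nat \<Rightarrow> real^'d \<Rightarrow> real" where nyl: "\<forall>j<n. y j \<in> interior K \<and> l j \<in> Pk k"
      "\<forall>p\<in>Pk k. \<forall>x\<in>interior K. p x = (\<Sum>j<n. p (y j) * l j x)"
    using fspan_interpolation[OF finite_multi_indices, of "interior K" k monomial] unfolding Pk_fspan by blast
  have "v x = (\<Sum>j<n. l j x *\<^sub>R v (y j))"
    if v: "\<forall>i. \<exists>p\<in>Pk k. \<forall>x\<in>interior K. v x $ i = p x" and x: "x \<in> interior K" for v :: "real^'d \<Rightarrow> real^'m" and x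
  proof -
    have "v x $ i = (\<Sum>j<n. l j x *\<^sub>R v (y j)) $ i" for i
    proof -
      obtain p where p: "p \<in> Pk k" "\<forall>x\<in>interior K. v x $ i = p x" using v by blast
      have "p x = (\<Sum>j<n. p (y j) * l j x)" using nyl(2) p(1) x by blast
      then show ?thesis using p(2) x nyl(1) by (simp add: mult.commute)
    qed
    then show ?thesis by (simp add: vec_eq_iff)
  qed
  then show ?thesis using nyl(1) by (intro exI[of _ n] exI[of _ y] exI[of _ l]) blast
qed

lemma vector_polynomial:
  fixes l :: "nat \<Rightarrow> real^'d::finite \<Rightarrow> real" and a :: "nat \<Rightarrow> real^'m::finite"
  assumes "\<And>j. j < n \<Longrightarrow> l j \<in> Pk k"
  defines "P \<equiv> (\<lambda>x. \<Sum>j<n. l j x *\<^sub>R a j)"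
  shows "(\<lambda>x. P x $ i) \<in> Pk k"
    and "continuous_on S P"
    and "\<exists>P'. (\<forall>x. (P has_derivative P' x) (at x)) \<and> (\<forall>v. continuous_on UNIV (\<lambda>x. P' x v))"
proof -
  have "(\<lambda>x. \<Sum>j<n. a j $ i * l j x) \<in> Pk k" unfolding Pk_fspan by (rule fspan_sum) (use assms(1) in \<open>simp add: Pk_fspan\<close>)
  then show "(\<lambda>x. P x $ i) \<in> Pk k" by (simp add: P_def mult.commute)
  have "\<exists>p'. (\<forall>x. (l j has_derivative p' x) (at x)) \<and> (\<forall>v. continuous_on UNIV (\<lambda>x. p' x v))" if "j < n" for j
    by (rule real_polynomial_function_derivative[OF real_polynomial_function_Pk[OF assms(1)[OF that]]])
  then have "\<forall>j. \<exists>p'. j < n \<longrightarrow> (\<forall>x. (l j has_derivative p' x) (at x)) \<and> (\<forall>v. continuous_on UNIV (\<lambda>x. p' x v))" by blast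
  from choice[OF this] obtain l' where l': "\<And>j x. j < n \<Longrightarrow> (l j has_derivative l' j x) (at x)"
      "\<And>j v. j < n \<Longrightarrow> continuous_on UNIV (\<lambda>x. l' j x v)" by blast
  have "(P has_derivative (\<lambda>v. \<Sum>j<n. l' j x v *\<^sub>R a j)) (at x)" for x
    unfolding P_def by (intro has_derivative_sum has_derivative_scaleR_left l') auto
  moreover have "continuous_on UNIV (\<lambda>x. \<Sum>j<n. l' j x v *\<^sub>R a j)" for v
    by (intro continuous_on_sum continuous_on_scaleR continuous_on_const l'(2)) auto
  ultimately show ex: "\<exists>P'. (\<forall>x. (P has_derivative P' x) (at x)) \<and> (\<forall>v. continuous_on UNIV (\<lambda>x. P' x v))"
    by (intro exI[of _ "\<lambda>x v. \<Sum>j<n. l' j x v *\<^sub>R a j"]) blast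
  then show "continuous_on S P" by (meson continuous_at_imp_continuous_on has_derivative_continuous)
qed

context convex_body
begin

text \<open>Dominated convergence of the difference quotients. Near the range at time \<open>t\<close> the entropy is Lipschitz, and by the
interpolation formula the state varies at a rate that is bounded uniformly on \<open>K\<close>. The derivative is one-sided where \<open>t\<close>
is an end point of \<open>I\<close>, so the limit is taken along sequences in \<open>I - {t}\<close>.\<close>

lemma has_real_derivative_integral_state:
  fixes U :: "real^'m::finite \<Rightarrow> real" and b :: "real \<Rightarrow> nat \<Rightarrow> real^'m"
  assumes S: "open \<Omega>'" and dU: "\<And>w. w \<in> \<Omega>' \<Longrightarrow> U differentiable (at w)" and cU: "continuous_on \<Omega>' (grad U)"
    and l: "\<And>j. j < n \<Longrightarrow> l j \<in> Pk k"
    and b: "\<And>j. j < n \<Longrightarrow> ((\<lambda>s. b s j) has_vector_derivative b' j) (at t within I)"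
    and u: "\<And>s x. s \<in> I \<Longrightarrow> x \<in> interior K \<Longrightarrow> u s x = (\<Sum>j<n. l j x *\<^sub>R b s j)"
    and t: "t \<in> I" and range: "\<And>x. x \<in> K \<Longrightarrow> (\<Sum>j<n. l j x *\<^sub>R b t j) \<in> \<Omega>'"
  shows "((\<lambda>s. LINT x:K|lebesgue. U (u s x)) has_real_derivative
      (LINT x:K|lebesgue. grad U (\<Sum>j<n. l j x *\<^sub>R b t j) \<bullet> (\<Sum>j<n. l j x *\<^sub>R b' j))) (at t within I)"
proof -
  define P where "P s x = (\<Sum>j<n. l j x *\<^sub>R b s j)" for s x
  define D where "D x = (\<Sum>j<n. l j x *\<^sub>R b' j)" for x
  have cP: "continuous_on X (P s)" for X s unfolding P_def[abs_def] by (rule vector_polynomial(2)) (rule l)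
  have cD: "continuous_on X D" for X unfolding D_def[abs_def] by (rule vector_polynomial(2)) (rule l)
  have PK: "P t x \<in> \<Omega>'" if "x \<in> K" for x using range[OF that] by (simp add: P_def)
  have cU0: "continuous_on \<Omega>' U" using dU by (meson continuous_at_imp_continuous_on differentiable_imp_continuous_within)
  have dP: "((\<lambda>s. P s x) has_vector_derivative D x) (at t within I)" for x
    unfolding P_def D_def by (intro has_vector_derivative_sum bounded_linear.has_vector_derivative[OF bounded_linear_scaleR_right] b) auto
  \<comment> \<open>A compact neighbourhood \<open>N\<close> of the range at time \<open>t\<close>, contained in the set of states; \<open>\<nabla>U\<close> is bounded on it.\<close>
  have cpt: "compact (P t ` K)" by (rule compact_continuous_image[OF cP compact_K])
  have sub: "P t ` K \<subseteq> \<Omega>'" using PK by blast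
  obtain e where e: "0 < e" "(\<Union>w\<in>P t ` K. cball w e) \<subseteq> \<Omega>'"
    using compact_subset_open_imp_cball_epsilon_subset[OF cpt S sub] by metis
  define N where "N = {w + v | w v. w \<in> P t ` K \<and> v \<in> cball 0 e}"
  have N: "compact N" unfolding N_def by (rule compact_sums[OF cpt]) simp
  have N\<Omega>: "N \<subseteq> \<Omega>'"
  proof
    fix z assume "z \<in> N"
    then obtain w v where "w \<in> P t ` K" "norm v \<le> e" "z = w + v" by (auto simp: N_def)
    then have "z \<in> cball w e" by (simp add: dist_norm)
    then show "z \<in> \<Omega>'" using e(2) \<open>w \<in> P t ` K\<close> by blast
  qed
  from compact_imp_bounded[OF compact_continuous_image[OF continuous_on_subset[OF cU N\<Omega>] N]]
  obtain L where L: "\<And>z. z \<in> N \<Longrightarrow> norm (grad U z) \<le> L" by (auto simp: bounded_iff)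
  have lip: "\<bar>U z - U (P t x)\<bar> \<le> L * norm (z - P t x)" if x: "x \<in> K" and z: "z \<in> cball (P t x) e" for x z
  proof -
    have ballN: "cball (P t x) e \<subseteq> N"
    proof
      fix y assume y: "y \<in> cball (P t x) e"
      have "y = P t x + (y - P t x)" "y - P t x \<in> cball 0 e" using y by (auto simp: dist_norm norm_minus_commute)
      moreover have "P t x \<in> P t ` K" using x by (rule imageI)
      ultimately show "y \<in> N" unfolding N_def mem_Collect_eq by (intro exI conjI)
    qed
    have "norm (U z - U (P t x)) \<le> L * norm (z - P t x)"
    proof (rule differentiable_bound[where S = "cball (P t x) e" and f' = "\<lambda>y v. grad U y \<bullet> v"])
      fix y assume y: "y \<in> cball (P t x) e"
      have "y \<in> \<Omega>'" by (rule subsetD[OF N\<Omega> subsetD[OF ballN y]])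
      then show "(U has_derivative (\<lambda>v. grad U y \<bullet> v)) (at y within cball (P t x) e)"
        by (rule has_derivative_at_withinI[OF has_derivative_grad[OF dU]])
      show "onorm (\<lambda>v. grad U y \<bullet> v) \<le> L"
      proof (rule onorm_le)
        fix v
        have "norm (grad U y \<bullet> v) \<le> norm (grad U y) * norm v" using Cauchy_Schwarz_ineq2[of "grad U y" v] by simp
        also have "\<dots> \<le> L * norm v" by (rule mult_right_mono[OF L[OF subsetD[OF ballN y]]]) simp
        finally show "norm (grad U y \<bullet> v) \<le> L * norm v" .
      qed
    qed (use z e(1) in auto)
    then show ?thesis by simp
  qed
  \<comment> \<open>The coefficients \<open>l j\<close> are bounded on \<open>K\<close>, which makes the rate of change uniform in space.\<close>
  have "\<forall>j. \<exists>B. j < n \<longrightarrow> (\<forall>x\<in>K. \<bar>l j x\<bar> \<le> B)"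
  proof
    fix j show "\<exists>B. j < n \<longrightarrow> (\<forall>x\<in>K. \<bar>l j x\<bar> \<le> B)"
    proof (cases "j < n")
      case True
      from compact_imp_bounded[OF compact_continuous_image[OF Pk_continuous[OF l[OF True]] compact_K]]
      show ?thesis by (auto simp: bounded_iff)
    qed simp
  qed
  from choice[OF this] obtain B where B: "\<And>j x. j < n \<Longrightarrow> x \<in> K \<Longrightarrow> \<bar>l j x\<bar> \<le> B j" by blast
  have ev: "\<forall>\<^sub>F s in at t within I. norm (b s j - b t j) \<le> (norm (b' j) + 1) * \<bar>s - t\<bar>" if "j < n" for j
  proof -
    have "((\<lambda>s. (b s j - b t j - (s - t) *\<^sub>R b' j) /\<^sub>R norm (s - t)) \<longlongrightarrow> 0) (at t within I)"
      using b[OF that] by (simp add: has_vector_derivative_def has_derivative_at_within)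
    then have "\<forall>\<^sub>F s in at t within I. norm ((b s j - b t j - (s - t) *\<^sub>R b' j) /\<^sub>R norm (s - t)) < 1"
      by (auto dest!: tendstoD[where e = 1] simp: dist_norm)
    then show ?thesis
    proof (rule eventually_mono[OF eventually_conj[OF _ eventually_at_filter[THEN iffD2, OF always_eventually]]])
      show "\<forall>s. s \<noteq> t \<longrightarrow> s \<in> I \<longrightarrow> s \<noteq> t" by simp
      fix s assume s: "norm ((b s j - b t j - (s - t) *\<^sub>R b' j) /\<^sub>R norm (s - t)) < 1 \<and> s \<noteq> t"
      define X where "X = norm (b s j - b t j - (s - t) *\<^sub>R b' j)"
      have "X / \<bar>s - t\<bar> < 1" using s by (simp add: X_def divide_inverse mult.commute)
      then have "X < \<bar>s - t\<bar>" using s by (simp add: pos_divide_less_eq)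
      then have "norm (b s j - b t j - (s - t) *\<^sub>R b' j) < \<bar>s - t\<bar>" by (simp only: X_def)
      moreover have "norm (b s j - b t j) \<le> norm (b s j - b t j - (s - t) *\<^sub>R b' j) + norm ((s - t) *\<^sub>R b' j)"
        using norm_triangle_ineq[of "b s j - b t j - (s - t) *\<^sub>R b' j" "(s - t) *\<^sub>R b' j"] by simp
      ultimately show "norm (b s j - b t j) \<le> (norm (b' j) + 1) * \<bar>s - t\<bar>"
        by (simp add: distrib_right mult.commute[of "norm (b' j)"])
    qed
  qed
  define G where "G = (\<Sum>j<n. B j * (norm (b' j) + 1))"
  have G: "\<forall>\<^sub>F s in at t within I. \<forall>x\<in>K. norm (P s x - P t x) \<le> G * \<bar>s - t\<bar>"
  proof -
    have "\<forall>\<^sub>F s in at t within I. \<forall>j\<in>{..<n}. norm (b s j - b t j) \<le> (norm (b' j) + 1) * \<bar>s - t\<bar>"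
      by (intro eventually_ball_finite) (use ev in auto)
    then show ?thesis
    proof eventually_elim
      case (elim s)
      show ?case
      proof
        fix x assume x: "x \<in> K"
        have "norm (P s x - P t x) = norm (\<Sum>j<n. l j x *\<^sub>R (b s j - b t j))"
          by (simp add: P_def sum_subtractf scaleR_diff_right)
        also have "\<dots> \<le> (\<Sum>j<n. norm (l j x *\<^sub>R (b s j - b t j)))" by (rule norm_sum)
        also have "\<dots> \<le> (\<Sum>j<n. B j * ((norm (b' j) + 1) * \<bar>s - t\<bar>))"
        proof (rule sum_mono)
          fix j assume j: "j \<in> {..<n}"
          have "\<bar>l j x\<bar> * norm (b s j - b t j) \<le> B j * ((norm (b' j) + 1) * \<bar>s - t\<bar>)"
            by (rule mult_mono) (use B[of j x] x j elim in \<open>auto intro: order_trans[OF abs_ge_zero]\<close>)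
          then show "norm (l j x *\<^sub>R (b s j - b t j)) \<le> B j * ((norm (b' j) + 1) * \<bar>s - t\<bar>)" by simp
        qed
        also have "\<dots> = G * \<bar>s - t\<bar>" by (simp add: G_def sum_distrib_right mult.assoc)
        finally show "norm (P s x - P t x) \<le> G * \<bar>s - t\<bar>" .
      qed
    qed
  qed
  define G' where "G' = \<bar>G\<bar> + 1"
  have near: "\<forall>\<^sub>F s in at t within I. \<forall>x\<in>K. norm (P s x - P t x) \<le> G' * \<bar>s - t\<bar> \<and> P s x \<in> cball (P t x) e"
  proof -
    have "\<forall>\<^sub>F s in at t within I. dist s t < e / G'"
      unfolding eventually_at by (rule exI[of _ "e / G'"]) (use e(1) in \<open>auto simp: G'_def\<close>)
    with G show ?thesis
    proof eventually_elim
      case (elim s)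
      show ?case
      proof
        fix x assume "x \<in> K"
        then have 1: "norm (P s x - P t x) \<le> G * \<bar>s - t\<bar>" using elim by blast
        also have "\<dots> \<le> G' * \<bar>s - t\<bar>" by (rule mult_right_mono) (auto simp: G'_def)
        finally have 2: "norm (P s x - P t x) \<le> G' * \<bar>s - t\<bar>" .
        have "G' * \<bar>s - t\<bar> < e" using elim by (simp add: dist_real_def G'_def pos_less_divide_eq mult.commute)
        then show "norm (P s x - P t x) \<le> G' * \<bar>s - t\<bar> \<and> P s x \<in> cball (P t x) e"
          using 2 by (simp add: dist_norm norm_minus_commute)
      qed
    qed
  qed
  have int_eq: "(LINT x:K|lebesgue. U (u s x)) = (LINT x:K|lebesgue. U (P s x))"
      "set_integrable lebesgue K (\<lambda>x. U (P s x))"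
    if s: "s \<in> I" and Ps: "\<forall>x\<in>K. P s x \<in> \<Omega>'" for s
  proof -
    have c: "continuous_on K (\<lambda>x. U (P s x))" by (rule continuous_on_compose2[OF cU0 cP]) (use Ps in blast)
    show "(LINT x:K|lebesgue. U (u s x)) = (LINT x:K|lebesgue. U (P s x))"
      by (rule integrable_K_cong(3)[OF _ c]) (simp add: u[OF s] P_def)
    show "set_integrable lebesgue K (\<lambda>x. U (P s x))" by (rule integrable_K_cong(2)[OF _ c, of "\<lambda>x. U (P s x)"]) simp
  qed
  have ball_sub: "cball (P t x) e \<subseteq> \<Omega>'" if "x \<in> K" for x using e(2) that by blast
  show ?thesis unfolding has_field_derivative_iff P_def[symmetric] D_def[symmetric] tendsto_at_iff_sequentially
  proof (intro allI impI)
    fix X assume X: "\<forall>i. X i \<in> I - {t}" "X \<longlonglongrightarrow> t"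
    have XF: "filterlim X (at t within I) sequentially"
      using X by (auto simp: filterlim_at intro!: always_eventually)
    have evX: "\<forall>\<^sub>F i in sequentially. \<forall>x\<in>K. norm (P (X i) x - P t x) \<le> G' * \<bar>X i - t\<bar> \<and> P (X i) x \<in> cball (P t x) e"
      by (rule eventually_compose_filterlim[OF near XF])
    define q where "q i x = indicator K x * ((U (P (X i) x) - U (P t x)) / (X i - t))" for i x
    obtain i0 where i0: "\<And>i x. i0 \<le> i \<Longrightarrow> x \<in> K \<Longrightarrow> norm (P (X i) x - P t x) \<le> G' * \<bar>X i - t\<bar> \<and> P (X i) x \<in> cball (P t x) e"
      using evX unfolding eventually_sequentially by blast
    have quot: "((LINT x:K|lebesgue. U (u (X i) x)) - (LINT x:K|lebesgue. U (u t x))) / (X i - t) = integral\<^sup>L lebesgue (q i)"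
      and qm: "q i \<in> borel_measurable lebesgue" if "i0 \<le> i" for i
    proof -
      have PX: "\<forall>x\<in>K. P (X i) x \<in> \<Omega>'" using i0[OF that] ball_sub by blast
      have Xi: "X i \<in> I" "X i \<noteq> t" using X(1) by auto
      note A = int_eq[OF Xi(1) PX]
      have A0: "(LINT x:K|lebesgue. U (u t x)) = (LINT x:K|lebesgue. U (P t x))" "set_integrable lebesgue K (\<lambda>x. U (P t x))"
        using int_eq[OF t] PK by blast+
      have "q i = (\<lambda>x. (indicator K x *\<^sub>R (U (P (X i) x) - U (P t x))) / (X i - t))" by (auto simp: q_def fun_eq_iff)
      moreover have "(LINT x:K|lebesgue. U (P (X i) x) - U (P t x)) = (LINT x:K|lebesgue. U (P (X i) x)) - (LINT x:K|lebesgue. U (P t x))"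
        by (rule set_integral_diff(2)[OF A(2) A0(2)])
      moreover have sd: "set_integrable lebesgue K (\<lambda>x. U (P (X i) x) - U (P t x))" by (rule set_integral_diff(1)[OF A(2) A0(2)])
      ultimately show "((LINT x:K|lebesgue. U (u (X i) x)) - (LINT x:K|lebesgue. U (u t x))) / (X i - t) = integral\<^sup>L lebesgue (q i)"
        unfolding A(1) A0(1) by (simp add: set_lebesgue_integral_def)
      show "q i \<in> borel_measurable lebesgue"
        using borel_measurable_integrable[OF sd[unfolded set_integrable_def]] unfolding q_def[abs_def] by simp
    qed
    have "(\<lambda>i. integral\<^sup>L lebesgue (q (i + i0))) \<longlonglongrightarrow> integral\<^sup>L lebesgue (\<lambda>x. indicator K x * (grad U (P t x) \<bullet> D x))"
    proof (rule integral_dominated_convergence[where w = "\<lambda>x. indicator K x * (\<bar>L\<bar> * G')"])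
      have "continuous_on K (\<lambda>x. grad U (P t x) \<bullet> D x)"
        by (intro continuous_intros continuous_on_compose2[OF cU cP] cD) (use PK in blast)
      from borel_measurable_integrable[OF integrable_K_cong(2)[OF _ this, of "\<lambda>x. grad U (P t x) \<bullet> D x", unfolded set_integrable_def]]
      show "(\<lambda>x. indicator K x * (grad U (P t x) \<bullet> D x)) \<in> borel_measurable lebesgue" by simp
      show "\<And>i. q (i + i0) \<in> borel_measurable lebesgue" by (rule qm) simp
      show "integrable lebesgue (\<lambda>x. indicator K x * (\<bar>L\<bar> * G'))"
        using integrable_K_cong(2)[of "\<lambda>x. \<bar>L\<bar> * G'" "\<lambda>x. \<bar>L\<bar> * G'"] by (simp add: set_integrable_def)
      show "AE x in lebesgue. norm (q (i + i0) x) \<le> indicator K x * (\<bar>L\<bar> * G')" for i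
      proof (rule AE_I2)
        fix x
        show "norm (q (i + i0) x) \<le> indicator K x * (\<bar>L\<bar> * G')"
        proof (cases "x \<in> K")
          case True
          have Xi: "0 < \<bar>X (i + i0) - t\<bar>" using X(1) by simp
          have "\<bar>U (P (X (i + i0)) x) - U (P t x)\<bar> \<le> L * norm (P (X (i + i0)) x - P t x)"
            using lip[OF True] i0[OF _ True] by simp
          also have "\<dots> \<le> \<bar>L\<bar> * (G' * \<bar>X (i + i0) - t\<bar>)"
            by (rule mult_mono) (use i0[OF _ True] in auto)
          finally have "\<bar>U (P (X (i + i0)) x) - U (P t x)\<bar> / \<bar>X (i + i0) - t\<bar> \<le> \<bar>L\<bar> * G'"
            using Xi by (simp add: pos_divide_le_eq mult.assoc)
          then show ?thesis using True by (simp add: q_def)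
        qed (simp add: q_def)
      qed
      show "AE x in lebesgue. (\<lambda>i. q (i + i0) x) \<longlonglongrightarrow> indicator K x * (grad U (P t x) \<bullet> D x)"
      proof (rule AE_I2)
        fix x
        show "(\<lambda>i. q (i + i0) x) \<longlonglongrightarrow> indicator K x * (grad U (P t x) \<bullet> D x)"
        proof (cases "x \<in> K")
          case True
          have "((\<lambda>s. U (P s x)) has_derivative (\<lambda>h. grad U (P t x) \<bullet> (h *\<^sub>R D x))) (at t within I)"
            by (rule has_derivative_compose[OF dP[unfolded has_vector_derivative_def] has_derivative_grad[OF dU[OF PK[OF True]]]])
          moreover have "(\<lambda>h. grad U (P t x) \<bullet> (h *\<^sub>R D x)) = (*) (grad U (P t x) \<bullet> D x)"
            by (simp add: fun_eq_iff mult.commute)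
          ultimately have "((\<lambda>s. U (P s x)) has_real_derivative (grad U (P t x) \<bullet> D x)) (at t within I)"
            by (simp add: has_field_derivative_def)
          then have "((\<lambda>s. (U (P s x) - U (P t x)) / (s - t)) \<longlongrightarrow> grad U (P t x) \<bullet> D x) (at t within I)"
            by (simp add: has_field_derivative_iff)
          from filterlim_compose[OF this XF]
          have "(\<lambda>i. (U (P (X i) x) - U (P t x)) / (X i - t)) \<longlonglongrightarrow> grad U (P t x) \<bullet> D x" .
          from LIMSEQ_ignore_initial_segment[OF this, of i0] show ?thesis using True by (simp add: q_def)
        qed (simp add: q_def)
      qed
    qed
    then have "(\<lambda>i. integral\<^sup>L lebesgue (q i)) \<longlonglongrightarrow> integral\<^sup>L lebesgue (\<lambda>x. indicator K x * (grad U (P t x) \<bullet> D x))"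
      by (rule LIMSEQ_offset)
    then have "(\<lambda>i. ((LINT x:K|lebesgue. U (u (X i) x)) - (LINT x:K|lebesgue. U (u t x))) / (X i - t))
        \<longlonglongrightarrow> integral\<^sup>L lebesgue (\<lambda>x. indicator K x * (grad U (P t x) \<bullet> D x))"
      by (rule Lim_transform_eventually) (use quot in \<open>auto intro!: eventually_sequentiallyI[of i0]\<close>)
    then show "((\<lambda>s. ((LINT x:K|lebesgue. U (u s x)) - (LINT x:K|lebesgue. U (u t x))) / (s - t)) \<circ> X)
        \<longlonglongrightarrow> (LINT x:K|lebesgue. grad U (P t x) \<bullet> D x)"
      by (simp add: o_def set_lebesgue_integral_def)
  qed
qed

section \<open>The local entropy inequality\<close>

text \<open>The entropy balance on one element at a fixed time, with \<open>P\<close> the polynomial that the state agrees with on the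
interior, \<open>D\<close> the polynomial time derivative and \<open>\<beta>\<close> the damping coefficient. The scheme tested with the projected entropy
variables is rewritten in terms of the entropy variables themselves; the two resulting errors \<open>err\<close> and
\<open>\<integral> H \<bullet> w\<close> add up to at most \<open>c M V R\<close>, which is the lower bound \<open>dampQ\<close> of the damping.\<close>

lemma element_entropy_inequality:
  fixes P :: "real^'d \<Rightarrow> real^'m::finite" and u :: "real^'d \<Rightarrow> real^'m"
  assumes U: "strict_entropy \<Omega>' U"
    and smooth: "\<And>i. Ck_on 1 \<Omega>' (f i)"
    and F: "\<And>i w. w \<in> \<Omega>' \<Longrightarrow> F i differentiable (at w) \<and> grad (F i) w = grad U w v* jacobian (f i) (at w)"
    and stable: "entropy_stable_flux \<Omega>' f U F fhat"
    and uP: "\<And>x. x \<in> interior K \<Longrightarrow> u x = P x"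
    and Pk: "\<And>j. (\<lambda>x. P x $ j) \<in> Pk k" and Dk: "\<And>j. (\<lambda>x. D x $ j) \<in> Pk k"
    and cP: "continuous_on UNIV P" and cD: "continuous_on UNIV D"
    and dP: "\<And>x. (P has_derivative P' x) (at x)" "\<And>v. continuous_on UNIV (\<lambda>x. P' x v)"
    and hull: "state_hull K u \<subseteq> \<Omega>'"
    and C: "0 < c"
    and est1: "\<And>x. x \<in> frontier K \<Longrightarrow> norm (pi_h k K (\<lambda>y. grad U (u y) - grad U (int_trace K u x)) x)
           \<le> c / volume K * third_deriv_max U K u * cell_variance K u"
    and est2: "\<bar>LINT x:K|lebesgue. grad U (u x) \<bullet> (flux_div f u x - pi_h k K (flux_div f u) x)\<bar>
        \<le> c / sqrt (volume K) * third_deriv_max U K u * proj_defect k f K u * cell_variance K u"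
    and ext: "AE x in surface_measure. x \<in> frontier K \<longrightarrow> uext x \<in> \<Omega>'"
    and H: "\<And>x. H x = - fhat (int_trace K u x) (uext x) (outward_normal K x) + normal_flux f (int_trace K u x) (outward_normal K x)"
    and Hint: "set_integrable surface_measure (frontier K) H"
    and Fint: "set_integrable surface_measure (frontier K)
       (\<lambda>x. numerical_entropy_flux f U F fhat (int_trace K u x) (uext x) (outward_normal K x))"
    and damp: "\<beta> = c * (third_deriv_max U K u / (INF w\<in>state_hull K u. \<bar>min_eigenvalue (hessian U w)\<bar>))
       * (1 / sqrt (volume K) * proj_defect k f K u + 1 / volume K * (LINT x:frontier K|surface_measure. norm (H x)))"
    and scheme: "\<And>w. (\<And>j. (\<lambda>x. w x $ j) \<in> Pk k) \<Longrightarrow> continuous_on UNIV w \<Longrightarrow>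
       (LINT x:K|lebesgue. D x \<bullet> w x)
         = - (\<Sum>i\<in>UNIV. LINT x:K|lebesgue. partial_deriv i (\<lambda>y. f i (P y)) x \<bullet> w x)
           + (LINT x:frontier K|surface_measure. H x \<bullet> w x)
           - \<beta> * (LINT x:K|lebesgue. (P x - cell_average K u) \<bullet> w x)"
  shows "(LINT x:K|lebesgue. grad U (P x) \<bullet> D x) + (LINT x:frontier K|surface_measure.
       numerical_entropy_flux f U F fhat (int_trace K u x) (uext x) (outward_normal K x)) \<le> 0"
proof -
  interpret U: strict_entropy \<Omega>' U by (rule U)
  define S where "S = state_hull K u"
  define M where "M = third_deriv_max U K u"
  define V where "V = cell_variance K u"
  define pd where "pd = proj_defect k f K u"
  define \<mu> where "\<mu> = (INF w\<in>S. \<bar>min_eigenvalue (hessian U w)\<bar>)"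
  define Hn where "Hn = (LINT x:frontier K|surface_measure. norm (H x))"
  define Fh where "Fh x = numerical_entropy_flux f U F fhat (int_trace K u x) (uext x) (outward_normal K x)" for x
  define pi where "pi = pi_h k K (\<lambda>y. grad U (u y))"
  define G where "G x = (\<Sum>i\<in>UNIV. partial_deriv i (\<lambda>y. f i (P y)) x)" for x
  have tr: "int_trace K u x = P x" if "x \<in> K" for x by (rule int_trace_eq[OF uP cP that])
  have cPX: "continuous_on X P" for X using cP by (rule continuous_on_subset) simp
  have S: "compact S" "convex S" "P ` K \<subseteq> S" "S \<subseteq> \<Omega>'" "S \<noteq> {}"
  proof -
    have "int_trace K u ` K = P ` K" using tr by (rule image_cong[OF refl])
    then have Seq: "S = convex hull (P ` K)" by (simp add: S_def state_hull_def)
    show "compact S" unfolding Seq by (intro compact_convex_hull compact_continuous_image cPX compact_K)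
    show "convex S" "P ` K \<subseteq> S" unfolding Seq by (simp_all add: hull_subset)
    show "S \<subseteq> \<Omega>'" using hull by (simp add: S_def)
    show "S \<noteq> {}" unfolding Seq using interior_K interior_subset by auto
  qed
  have PK: "P ` K \<subseteq> \<Omega>'" using S by blast
  have \<mu>0: "0 < \<mu>" unfolding \<mu>_def by (rule U.inf_min_eigenvalue(1)[OF S(1,5,4)])
  have M0: "0 \<le> M" unfolding M_def third_deriv_max_def S_def[symmetric] by (rule U.third_deriv_nonneg[OF S(1,5,4)])
  have vol: "0 < volume K" by (rule volume_pos)
  have gUP: "continuous_on K (\<lambda>x. grad U (P x))"
    by (rule continuous_on_compose2[OF U.continuous_grad cPX PK])
  have gac: "almost_continuous (\<lambda>y. grad U (u y) $ j)" for j
    unfolding almost_continuous_def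
    by (rule exI[of _ "\<lambda>y. grad U (P y) $ j"]) (use uP in \<open>auto intro!: continuous_intros gUP\<close>)
  have pik: "(\<lambda>x. pi x $ j) \<in> Pk k" for j
    using L2_proj(1)[OF gac] by (simp add: pi_def pi_h_def)
  have cpi: "continuous_on X pi" for X
  proof -
    have "continuous_on X (\<lambda>x. \<chi> j. pi x $ j)" by (intro continuous_on_vec_lambda Pk_continuous[OF pik])
    then show ?thesis by simp
  qed
  note ed = entropy_flux_divergence[OF U.open_states smooth F U.continuous_grad dP PK]
  have cG: "continuous_on K G" unfolding G_def[abs_def] by (intro continuous_on_sum ed(1))
  have fdG: "flux_div f u x = G x" if x: "x \<in> interior K" for x
    unfolding flux_div_def G_def
  proof (rule sum.cong[OF refl])
    fix i show "partial_deriv i (\<lambda>y. f i (u y)) x = partial_deriv i (\<lambda>y. f i (P y)) x"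
      by (rule partial_deriv_cong[OF open_interior x]) (simp add: uP)
  qed
  have fac: "almost_continuous (\<lambda>y. flux_div f u y $ j)" for j
    unfolding almost_continuous_def
    by (rule exI[of _ "\<lambda>y. G y $ j"]) (use fdG in \<open>auto intro!: continuous_intros cG\<close>)
  have int: "set_integrable lebesgue K h" if "continuous_on K h" for h :: "real^'d \<Rightarrow> real"
    by (rule integrable_K_cong(2)[OF _ that, of h]) simp
  \<comment> \<open>Against polynomials the entropy variables may be replaced by their projection.\<close>
  have pg: "(LINT x:K|lebesgue. grad U (P x) \<bullet> q x) = (LINT x:K|lebesgue. pi x \<bullet> q x)"
    if q: "\<And>j. (\<lambda>x. q x $ j) \<in> Pk k" for q
  proof -
    have "continuous_on K (\<lambda>x. \<chi> j. q x $ j)" by (intro continuous_on_vec_lambda Pk_continuous[OF q])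
    then have cq: "continuous_on K q" by simp
    have "(LINT x:K|lebesgue. grad U (u x) \<bullet> q x) = (LINT x:K|lebesgue. grad U (P x) \<bullet> q x)"
      by (rule integrable_K_cong(3)) (simp_all add: uP continuous_on_inner[OF gUP cq])
    then show ?thesis using pi_h_orthogonal[of "\<lambda>y. grad U (u y)" q k, OF gac q] by (simp add: pi_def)
  qed
  define err where "err = (LINT x:K|lebesgue. grad U (u x) \<bullet> (flux_div f u x - pi_h k K (flux_div f u) x))"
  \<comment> \<open>The projection is moved from \<open>\<nabla>U(u)\<close> to the flux divergence, at the expense of \<open>err\<close>.\<close>
  have Gpi: "(LINT x:K|lebesgue. G x \<bullet> pi x) = (LINT x:K|lebesgue. grad U (P x) \<bullet> G x) - err"
  proof -
    let ?PG = "pi_h k K (flux_div f u)"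
    have PGk: "(\<lambda>x. ?PG x $ j) \<in> Pk k" for j using L2_proj(1)[OF fac] by (simp add: pi_h_def)
    have "continuous_on K (\<lambda>x. \<chi> j. ?PG x $ j)" by (intro continuous_on_vec_lambda Pk_continuous[OF PGk])
    then have cPG: "continuous_on K ?PG" by simp
    have "(LINT x:K|lebesgue. G x \<bullet> pi x) = (LINT x:K|lebesgue. flux_div f u x \<bullet> pi x)"
      by (rule integrable_K_cong(3)[symmetric]) (simp_all add: fdG continuous_on_inner[OF cG cpi])
    also have "\<dots> = (LINT x:K|lebesgue. ?PG x \<bullet> pi x)" by (rule pi_h_orthogonal[OF fac pik])
    also have "\<dots> = (LINT x:K|lebesgue. grad U (P x) \<bullet> ?PG x)" unfolding pg[OF PGk] by (simp add: inner_commute)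
    also have "\<dots> = (LINT x:K|lebesgue. grad U (P x) \<bullet> G x) - err"
    proof -
      have "err = (LINT x:K|lebesgue. grad U (P x) \<bullet> G x - grad U (P x) \<bullet> ?PG x)"
        unfolding err_def
        by (rule integrable_K_cong(3)) (simp_all add: uP fdG inner_diff_right continuous_on_diff continuous_on_inner gUP cG cPG)
      also have "\<dots> = (LINT x:K|lebesgue. grad U (P x) \<bullet> G x) - (LINT x:K|lebesgue. grad U (P x) \<bullet> ?PG x)"
        by (rule set_integral_diff(2)) (intro int continuous_on_inner gUP cG cPG)+
      finally show ?thesis by simp
    qed
    finally show ?thesis .
  qed
  define E where "E = (LINT x:K|lebesgue. grad U (P x) \<bullet> D x)"
  define Q where "Q = (LINT x:K|lebesgue. (P x - cell_average K u) \<bullet> pi x)"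
  define T where "T = (LINT x:frontier K|surface_measure. H x \<bullet> pi x)"
  have Epi: "E = (LINT x:K|lebesgue. D x \<bullet> pi x)" unfolding E_def pg[OF Dk] by (simp add: inner_commute)
  have sumG: "(\<Sum>i\<in>UNIV. LINT x:K|lebesgue. partial_deriv i (\<lambda>y. f i (P y)) x \<bullet> pi x) = (LINT x:K|lebesgue. G x \<bullet> pi x)"
  proof -
    have "set_integrable lebesgue K (\<lambda>x. partial_deriv i (\<lambda>y. f i (P y)) x \<bullet> pi x)" for i
      by (intro int continuous_on_inner ed(1) cpi)
    then show ?thesis unfolding G_def set_lebesgue_integral_def set_integrable_def inner_sum_left scaleR_sum_right
      by (intro Bochner_Integration.integral_sum[symmetric]) auto
  qed
  have bal: "E = - ((LINT x:K|lebesgue. grad U (P x) \<bullet> G x) - err) + T - \<beta> * Q"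
    unfolding Epi scheme[OF pik cpi] sumG Gpi T_def Q_def ..
  have avg: "cell_average K u = cell_average K P" by (rule cell_average_cong[OF uP cPX])
  have V_eq: "V = (LINT x:K|lebesgue. (norm (P x - cell_average K P))\<^sup>2)"
    unfolding V_def cell_variance_def avg
    by (rule integrable_K_cong(3)) (auto simp: uP intro!: continuous_intros cPX)
  have "Q = (LINT x:K|lebesgue. grad U (P x) \<bullet> (P x - cell_average K P))"
  proof -
    have "(\<lambda>x. (P x - cell_average K P) $ j) \<in> Pk k" for j
    proof -
      have "(\<lambda>x. P x $ j + (-1) * (cell_average K P $ j)) \<in> Pk k"
        using fspan_combine[of "\<lambda>x. P x $ j" _ monomial "\<lambda>_. cell_average K P $ j"] Pk Pk_const unfolding Pk_fspan by blast
      then show ?thesis by simp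
    qed
    from pg[OF this] show ?thesis by (simp add: Q_def avg inner_commute)
  qed
  then have Qge: "\<mu> * V \<le> Q" unfolding V_eq \<mu>_def using damping_coercive[OF U cPX S(1-4)] by simp
  have V0: "0 \<le> V" unfolding V_def cell_variance_def set_lebesgue_integral_def by (rule Bochner_Integration.integral_nonneg) simp
  have pd0: "0 \<le> pd" unfolding pd_def proj_defect_def set_lebesgue_integral_def
    by (intro real_sqrt_ge_zero Bochner_Integration.integral_nonneg) simp
  have Hn0: "0 \<le> Hn" unfolding Hn_def set_lebesgue_integral_def by (rule Bochner_Integration.integral_nonneg) simp
  define R where "R = 1 / sqrt (volume K) * pd + 1 / volume K * Hn"
  have R0: "0 \<le> R" unfolding R_def using pd0 Hn0 vol by simp
  have \<beta>: "\<beta> = c * (M / \<mu>) * R" by (simp add: damp R_def M_def \<mu>_def S_def pd_def Hn_def)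
  have \<beta>0: "0 \<le> \<beta>" unfolding \<beta> using C M0 \<mu>0 R0 by simp
  have "\<beta> * (\<mu> * V) \<le> \<beta> * Q" by (rule mult_left_mono[OF Qge \<beta>0])
  \<comment> \<open>The factor \<open>1 / \<mu>\<close> in the damping coefficient cancels the constant of uniform convexity.\<close>
  then have dampQ: "c * M * V * R \<le> \<beta> * Q" unfolding \<beta> using \<mu>0 by (simp add: field_simps)
  \<comment> \<open>The projection error of the entropy variables, which the first estimate bounds at the boundary: subtracting the
    constant vector \<open>\<nabla>U(u(x))\<close> commutes with the projection.\<close>
  define w where "w x = pi x - grad U (P x)" for x
  have frK: "x \<in> K" if "x \<in> frontier K" for x using that frontier_subset_K by blast
  have cfr: "continuous_on (frontier K) (\<lambda>x. grad U (P x))" by (rule continuous_on_subset[OF gUP frontier_subset_K])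
  have iHg: "set_integrable surface_measure (frontier K) (\<lambda>x. H x \<bullet> grad U (P x))"
    by (rule set_integrable_inner_continuous[OF compact_frontier_K Hint cfr])
  have iHw: "set_integrable surface_measure (frontier K) (\<lambda>x. H x \<bullet> w x)"
    by (rule set_integrable_inner_continuous[OF compact_frontier_K Hint]) (auto simp: w_def intro!: continuous_intros cpi cfr)
  have Tsplit: "T = (LINT x:frontier K|surface_measure. H x \<bullet> grad U (P x)) + (LINT x:frontier K|surface_measure. H x \<bullet> w x)"
    unfolding T_def set_integral_add(2)[OF iHg iHw, symmetric] by (simp add: w_def inner_diff_right)
  have wb: "norm (w x) \<le> c / volume K * M * V" if x: "x \<in> frontier K" for x
  proof -
    have "pi_h k K (\<lambda>y. grad U (u y) - grad U (int_trace K u x)) x = w x"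
    proof -
      have "L2_proj k K (\<lambda>y. (grad U (u y) - grad U (P x)) $ j) x = pi x $ j - grad U (P x) $ j" for j
        using L2_proj_diff_const[OF gac[of j]] by (simp add: pi_def pi_h_def)
      then show ?thesis by (simp add: pi_h_def[of k K "\<lambda>y. grad U (u y) - grad U (P x)"] tr[OF frK[OF x]] w_def vec_eq_iff)
    qed
    then show ?thesis using est1[OF x] by (simp add: M_def V_def)
  qed
  have Hw: "(LINT x:frontier K|surface_measure. H x \<bullet> w x) \<le> c / volume K * M * V * Hn"
  proof -
    have nH: "set_integrable surface_measure (frontier K) (\<lambda>x. norm (H x))"
    proof -
      have "integrable surface_measure (\<lambda>x. norm (indicator (frontier K) x *\<^sub>R H x))"
        using Hint unfolding set_integrable_def by (rule integrable_norm)
      then show ?thesis by (simp add: set_integrable_def)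
    qed
    have "(LINT x:frontier K|surface_measure. H x \<bullet> w x) \<le> (LINT x:frontier K|surface_measure. c / volume K * M * V * norm (H x))"
    proof (rule set_integral_mono[OF iHw])
      show "set_integrable surface_measure (frontier K) (\<lambda>x. c / volume K * M * V * norm (H x))"
        by (rule set_integrable_mult_right) (rule nH)
      fix x assume x: "x \<in> frontier K"
      have "H x \<bullet> w x \<le> norm (H x) * norm (w x)" by (rule norm_cauchy_schwarz)
      also have "\<dots> \<le> norm (H x) * (c / volume K * M * V)" by (rule mult_left_mono[OF wb[OF x]]) simp
      finally show "H x \<bullet> w x \<le> c / volume K * M * V * norm (H x)" by (simp only: mult.commute)
    qed
    also have "\<dots> = c / volume K * M * V * Hn" unfolding Hn_def by (rule set_integral_mult_right)
    finally show ?thesis .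
  qed
  have bdry: "(LINT x:frontier K|surface_measure. H x \<bullet> grad U (P x)) + (LINT x:frontier K|surface_measure. Fh x)
      \<le> (LINT x:K|lebesgue. grad U (P x) \<bullet> G x)"
  proof -
    have iF: "set_integrable surface_measure (frontier K) Fh" using Fint by (simp add: Fh_def[abs_def])
    have iN: "set_integrable surface_measure (frontier K) (\<lambda>x. \<Sum>i\<in>UNIV. outward_normal K x $ i * F i (P x))"
      using ed(2) unfolding set_integrable_def scaleR_sum_right by (intro Bochner_Integration.integrable_sum) auto
    have "(LINT x:frontier K|surface_measure. H x \<bullet> grad U (P x)) + (LINT x:frontier K|surface_measure. Fh x)
        = (LINT x:frontier K|surface_measure. H x \<bullet> grad U (P x) + Fh x)"
      by (rule set_integral_add(2)[OF iHg iF, symmetric])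
    also have "\<dots> \<le> (LINT x:frontier K|surface_measure. \<Sum>i\<in>UNIV. outward_normal K x $ i * F i (P x))"
    proof (rule set_integral_mono_AE[OF set_integral_add(1)[OF iHg iF] iN])
      show "AE x\<in>frontier K in surface_measure. H x \<bullet> grad U (P x) + Fh x \<le> (\<Sum>i\<in>UNIV. outward_normal K x $ i * F i (P x))"
        using ext
      proof eventually_elim
        case (elim x)
        show ?case
        proof
          assume x: "x \<in> frontier K"
          have n: "norm (outward_normal K x) = 1" using unit_normal_outward_normal[OF x] by (simp add: unit_normal_def)
          have a: "P x \<in> \<Omega>'" using frK[OF x] PK by blast
          show "H x \<bullet> grad U (P x) + Fh x \<le> (\<Sum>i\<in>UNIV. outward_normal K x $ i * F i (P x))"
            using boundary_entropy_dissipation[OF stable a _ n, of "uext x"] elim x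
            unfolding H Fh_def tr[OF frK[OF x]] by blast
        qed
      qed
    qed
    also have "\<dots> = (LINT x:K|lebesgue. grad U (P x) \<bullet> G x)" unfolding G_def by (rule ed(3)[symmetric])
    finally show ?thesis .
  qed
  have errb: "err \<le> c / sqrt (volume K) * M * pd * V"
    using est2 by (simp add: err_def M_def pd_def V_def abs_le_iff)
  have total: "c / sqrt (volume K) * M * pd * V + c / volume K * M * V * Hn = c * M * V * R"
    by (simp add: R_def distrib_left mult_ac)
  have "E + (LINT x:frontier K|surface_measure. Fh x) \<le> 0"
    using bal Tsplit Hw bdry errb total dampQ by linarith
  then show ?thesis by (simp add: E_def Fh_def)
qed

end

theorem theorem5p3:
  fixes \<Omega> :: "(real^'d::finite) set" and T :: "(real^'d) set set"
    and \<Omega>' :: "(real^'m::finite) set"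
    and f :: "'d \<Rightarrow> real^'m \<Rightarrow> real^'m"
    and U :: "real^'m \<Rightarrow> real" and F :: "'d \<Rightarrow> real^'m \<Rightarrow> real"
    and fhat :: "real^'m \<Rightarrow> real^'m \<Rightarrow> real^'d \<Rightarrow> real^'m"
    and C :: "nat \<Rightarrow> nat \<Rightarrow> nat \<Rightarrow> real \<Rightarrow> real" and k :: nat
  assumes mesh: "convex_mesh \<Omega> T"
    and degree: "k \<ge> 1"
    and open_states: "open \<Omega>'"
    and smooth_flux: "\<And>i r. Ck_on r \<Omega>' (f i)"
    and entropy: "convex_entropy \<Omega>' f U F"
    and estimates: "estimate_constant C k \<Omega> T \<Omega>' f U"
    and stable: "entropy_stable_flux \<Omega>' f U F fhat"
  shows "(\<forall>(I :: real set) (g :: real \<Rightarrow> (real^'d) set \<Rightarrow> real^'d \<Rightarrow> real^'m)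
            (u :: real \<Rightarrow> real^'d \<Rightarrow> real^'m).
           is_interval I \<and> interior I \<noteq> {} \<and>
           scheme_solution C k \<Omega> T \<Omega>' f U fhat g I u \<and>
           (\<forall>K\<in>T. \<forall>t\<in>I. set_integrable surface_measure (frontier K)
              (\<lambda>x. numerical_entropy_flux f U F fhat
                 (int_trace K (u t) x) (ext_trace \<Omega> T (g t) K (u t) x) (outward_normal K x)))
           \<longrightarrow>
           (\<forall>K\<in>T. \<forall>t\<in>I. \<exists>D.
              ((\<lambda>s. LINT x:K|lebesgue. U (u s x)) has_real_derivative D) (at t within I) \<and>
              D + (LINT x:frontier K|surface_measure.
                     numerical_entropy_flux f U F fhat
                       (int_trace K (u t) x) (ext_trace \<Omega> T (g t) K (u t) x) (outward_normal K x))
              \<le> 0))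
       \<and> (\<forall>a\<in>\<Omega>'. \<forall>n. norm n = 1 \<longrightarrow>
            numerical_entropy_flux f U F fhat a a n = (\<Sum>i\<in>UNIV. n $ i * F i a))
       \<and> (\<forall>a\<in>\<Omega>'. \<forall>b\<in>\<Omega>'. \<forall>n. norm n = 1 \<longrightarrow>
            numerical_entropy_flux f U F fhat b a (- n) = - numerical_entropy_flux f U F fhat a b n)"
proof (intro conjI ballI allI impI)
  show "numerical_entropy_flux f U F fhat a a n = (\<Sum>i\<in>UNIV. n $ i * F i a)" if "a \<in> \<Omega>'" "norm n = 1" for a n
    by (rule numerical_entropy_flux_consistent[OF stable that])
  show "numerical_entropy_flux f U F fhat b a (- n) = - numerical_entropy_flux f U F fhat a b n"
    if "a \<in> \<Omega>'" "b \<in> \<Omega>'" "norm n = 1" for a b n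
    by (rule numerical_entropy_flux_conservative[OF stable that])
next
  fix I :: "real set" and g :: "real \<Rightarrow> (real^'d) set \<Rightarrow> real^'d \<Rightarrow> real^'m" and u :: "real \<Rightarrow> real^'d \<Rightarrow> real^'m"
    and K and t
  assume asm: "is_interval I \<and> interior I \<noteq> {} \<and> scheme_solution C k \<Omega> T \<Omega>' f U fhat g I u \<and>
           (\<forall>K\<in>T. \<forall>t\<in>I. set_integrable surface_measure (frontier K)
              (\<lambda>x. numerical_entropy_flux f U F fhat
                 (int_trace K (u t) x) (ext_trace \<Omega> T (g t) K (u t) x) (outward_normal K x)))"
    and K: "K \<in> T" and t: "t \<in> I"
  have bot: "at t within I \<noteq> bot" using at_within_interval_nontrivial asm t by blast
  have sol: "\<And>s. s \<in> I \<Longrightarrow> u s \<in> dg_space k \<Omega> T"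
    "\<And>x. x \<in> interior K \<Longrightarrow> (\<lambda>s. u s x) differentiable (at t within I)"
    "state_hull K (u t) \<subseteq> \<Omega>'"
    "AE x in surface_measure. x \<in> frontier K \<longrightarrow> ext_trace \<Omega> T (g t) K (u t) x \<in> \<Omega>'"
    "set_integrable surface_measure (frontier K) (H_jump \<Omega> T f fhat (g t) K (u t))"
    "\<And>v. v \<in> dg_space k \<Omega> T \<Longrightarrow>
             (LINT x:K|lebesgue. vector_derivative (\<lambda>s. u s x) (at t within I) \<bullet> v x)
             = - (\<Sum>i\<in>UNIV. LINT x:K|lebesgue. partial_deriv i (\<lambda>y. f i (u t y)) x \<bullet> v x)
               + (LINT x:frontier K|surface_measure.
                    H_jump \<Omega> T f fhat (g t) K (u t) x \<bullet> int_trace K v x)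
               - damping_coeff C k \<Omega> T f U fhat (g t) K (u t)
                 * (LINT x:K|lebesgue. (u t x - cell_average K (u t)) \<bullet> v x)"
  proof -
    have "scheme_solution C k \<Omega> T \<Omega>' f U fhat g I u" using asm by (elim conjE)
    note ss = this[unfolded scheme_solution_def]
    show "\<And>s. s \<in> I \<Longrightarrow> u s \<in> dg_space k \<Omega> T" by (rule conjunct1[OF bspec[OF ss]])
    note sK = bspec[OF conjunct2[OF bspec[OF ss t]] K]
    show "\<And>x. x \<in> interior K \<Longrightarrow> (\<lambda>s. u s x) differentiable (at t within I)"
      by (rule bspec[OF conjunct1[OF sK]])
    show "state_hull K (u t) \<subseteq> \<Omega>'" by (rule conjunct1[OF conjunct2[OF sK]])
    show "AE x in surface_measure. x \<in> frontier K \<longrightarrow> ext_trace \<Omega> T (g t) K (u t) x \<in> \<Omega>'"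
      by (rule conjunct1[OF conjunct2[OF conjunct2[OF sK]]])
    show "set_integrable surface_measure (frontier K) (H_jump \<Omega> T f fhat (g t) K (u t))"
      by (rule conjunct1[OF conjunct2[OF conjunct2[OF conjunct2[OF sK]]]])
    show "\<And>v. v \<in> dg_space k \<Omega> T \<Longrightarrow>
             (LINT x:K|lebesgue. vector_derivative (\<lambda>s. u s x) (at t within I) \<bullet> v x)
             = - (\<Sum>i\<in>UNIV. LINT x:K|lebesgue. partial_deriv i (\<lambda>y. f i (u t y)) x \<bullet> v x)
               + (LINT x:frontier K|surface_measure.
                    H_jump \<Omega> T f fhat (g t) K (u t) x \<bullet> int_trace K v x)
               - damping_coeff C k \<Omega> T f U fhat (g t) K (u t)
                 * (LINT x:K|lebesgue. (u t x - cell_average K (u t)) \<bullet> v x)"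
      by (rule bspec[OF conjunct2[OF conjunct2[OF conjunct2[OF conjunct2[OF sK]]]]])
  qed
  have Fint: "set_integrable surface_measure (frontier K)
              (\<lambda>x. numerical_entropy_flux f U F fhat
                 (int_trace K (u t) x) (ext_trace \<Omega> T (g t) K (u t) x) (outward_normal K x))"
  proof -
    from asm have "\<forall>K\<in>T. \<forall>t\<in>I. set_integrable surface_measure (frontier K)
              (\<lambda>x. numerical_entropy_flux f U F fhat
                 (int_trace K (u t) x) (ext_trace \<Omega> T (g t) K (u t) x) (outward_normal K x))" by (elim conjE)
    from bspec[OF bspec[OF this K] t] show ?thesis .
  qed
  interpret convex_body K using mesh K by unfold_locales (auto simp: convex_mesh_def)
  have SU: "strict_entropy \<Omega>' U" using entropy open_states by unfold_locales (auto simp: convex_entropy_def)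
  then interpret strict_entropy \<Omega>' U .
  have F: "F i differentiable (at w) \<and> grad (F i) w = grad U w v* jacobian (f i) (at w)" if "w \<in> \<Omega>'" for i w
    using entropy that by (simp add: convex_entropy_def)
  \<comment> \<open>All states are expanded in the same polynomials \<open>l j\<close>, with time-dependent coefficients \<open>b s j\<close>; in particular the
    time derivative is the polynomial \<open>D\<close>.\<close>
  have "\<exists>(n::nat) y l. (\<forall>j<n. y j \<in> interior K \<and> l j \<in> Pk k) \<and>
    (\<forall>v :: real^'d \<Rightarrow> real^'m. (\<forall>i. \<exists>p\<in>Pk k. \<forall>x\<in>interior K. v x $ i = p x) \<longrightarrow>
       (\<forall>x\<in>interior K. v x = (\<Sum>j<n. l j x *\<^sub>R v (y j))))" by (rule vector_interpolation)
  then obtain n :: nat and y and l :: "nat \<Rightarrow> real^'d \<Rightarrow> real" where nyl0: "\<forall>j<n. y j \<in> interior K \<and> l j \<in> Pk k"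
    "\<forall>v :: real^'d \<Rightarrow> real^'m. (\<forall>i. \<exists>p\<in>Pk k. \<forall>x\<in>interior K. v x $ i = p x) \<longrightarrow>
       (\<forall>x\<in>interior K. v x = (\<Sum>j<n. l j x *\<^sub>R v (y j)))"
    by (elim exE conjE)
  have nyl: "y j \<in> interior K" "l j \<in> Pk k" if "j < n" for j using nyl0(1) that by simp_all
  define b where "b s j = u s (y j)" for s j
  define b' where "b' j = vector_derivative (\<lambda>s. u s (y j)) (at t within I)" for j
  define P where "P x = (\<Sum>j<n. l j x *\<^sub>R b t j)" for x
  define D where "D x = (\<Sum>j<n. l j x *\<^sub>R b' j)" for x
  have uexp: "u s x = (\<Sum>j<n. l j x *\<^sub>R b s j)" if "s \<in> I" "x \<in> interior K" for s x
  proof -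
    have "\<forall>i. \<exists>p\<in>Pk k. \<forall>x\<in>interior K. u s x $ i = p x" using sol(1)[OF that(1)] K unfolding dg_space_def by simp
    then show ?thesis unfolding b_def using nyl0(2) that(2) by blast
  qed
  have db: "((\<lambda>s. b s j) has_vector_derivative b' j) (at t within I)" if "j < n" for j
    using sol(2)[OF nyl(1)[OF that]] unfolding b_def b'_def vector_derivative_works .
  have polyP: "(\<lambda>x. P x $ i) \<in> Pk k" "continuous_on X P"
    "\<exists>P'. (\<forall>x. (P has_derivative P' x) (at x)) \<and> (\<forall>v. continuous_on UNIV (\<lambda>x. P' x v))" for i X
    unfolding P_def[abs_def]
    by (rule vector_polynomial(1), rule nyl(2), assumption, rule vector_polynomial(2), rule nyl(2), assumption,
        rule vector_polynomial(3), rule nyl(2), assumption)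
  have polyD: "(\<lambda>x. D x $ i) \<in> Pk k" "continuous_on X D" for i X
    unfolding D_def[abs_def]
    by (rule vector_polynomial(1), rule nyl(2), assumption, rule vector_polynomial(2), rule nyl(2), assumption)
  have uP: "u t x = P x" if "x \<in> interior K" for x using uexp[OF t that] by (simp add: P_def)
  have ut: "vector_derivative (\<lambda>s. u s x) (at t within I) = D x" if x: "x \<in> interior K" for x
  proof (rule vector_derivative_within[OF bot])
    have "((\<lambda>s. \<Sum>j<n. l j x *\<^sub>R b s j) has_vector_derivative D x) (at t within I)"
      unfolding D_def by (intro has_vector_derivative_sum bounded_linear.has_vector_derivative[OF bounded_linear_scaleR_right] db) auto
    then show "((\<lambda>s. u s x) has_vector_derivative D x) (at t within I)"
      by (rule has_vector_derivative_transform[OF t, rotated]) (simp add: uexp x)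
  qed
  obtain P' where P': "\<And>x. (P has_derivative P' x) (at x)" "\<And>v. continuous_on UNIV (\<lambda>x. P' x v)"
    using polyP(3) by blast
  have tr: "int_trace K (u t) x = P x" if "x \<in> K" for x by (rule int_trace_eq[OF uP polyP(2) that])
  have PK: "P x \<in> \<Omega>'" if "x \<in> K" for x
  proof -
    have "int_trace K (u t) x \<in> state_hull K (u t)" unfolding state_hull_def by (rule hull_inc) (use that in blast)
    then show ?thesis using sol(3) tr[OF that] by auto
  qed
  have smooth1: "Ck_on 1 \<Omega>' (f i)" for i by (rule smooth_flux)
  have deriv: "((\<lambda>s. LINT x:K|lebesgue. U (u s x)) has_real_derivative (LINT x:K|lebesgue. grad U (P x) \<bullet> D x)) (at t within I)"
    unfolding P_def D_def
    by (rule has_real_derivative_integral_state[OF open_states regularity(1) continuous_grad nyl(2) db uexp t])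
      (use PK in \<open>simp_all add: P_def\<close>)
  let ?c = "C k CARD('m) CARD('d) (shape_ratio K)"
  have c0: "0 < ?c" using estimates K by (simp add: estimate_constant_def)
  have est: "\<forall>x\<in>frontier K.
           norm (pi_h k K (\<lambda>y. grad U (u t y) - grad U (int_trace K (u t) x)) x)
           \<le> ?c / volume K * third_deriv_max U K (u t) * cell_variance K (u t)"
      "\<bar>LINT x:K|lebesgue. grad U (u t x) \<bullet> (flux_div f (u t) x - pi_h k K (flux_div f (u t)) x)\<bar>
        \<le> ?c / sqrt (volume K) * third_deriv_max U K (u t) * proj_defect k f K (u t) * cell_variance K (u t)"
  proof -
    note e = bspec[OF bspec[OF conjunct2[OF estimates[unfolded estimate_constant_def]] K] sol(1)[OF t], THEN mp, OF sol(3)]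
    show "\<forall>x\<in>frontier K.
           norm (pi_h k K (\<lambda>y. grad U (u t y) - grad U (int_trace K (u t) x)) x)
           \<le> ?c / volume K * third_deriv_max U K (u t) * cell_variance K (u t)" by (rule conjunct1[OF e])
    show "\<bar>LINT x:K|lebesgue. grad U (u t x) \<bullet> (flux_div f (u t) x - pi_h k K (flux_div f (u t)) x)\<bar>
        \<le> ?c / sqrt (volume K) * third_deriv_max U K (u t) * proj_defect k f K (u t) * cell_variance K (u t)"
      by (rule conjunct2[OF e])
  qed
  \<comment> \<open>Each term of the scheme depends only on the values in the interior of \<open>K\<close>, or on their limits at the boundary.\<close>
  have scheme: "(LINT x:K|lebesgue. D x \<bullet> w x)
         = - (\<Sum>i\<in>UNIV. LINT x:K|lebesgue. partial_deriv i (\<lambda>y. f i (P y)) x \<bullet> w x)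
           + (LINT x:frontier K|surface_measure. H_jump \<Omega> T f fhat (g t) K (u t) x \<bullet> w x)
           - damping_coeff C k \<Omega> T f U fhat (g t) K (u t) * (LINT x:K|lebesgue. (P x - cell_average K (u t)) \<bullet> w x)"
    if wk: "\<And>j. (\<lambda>x. w x $ j) \<in> Pk k" and cw: "continuous_on UNIV w" for w :: "real^'d \<Rightarrow> real^'m"
  proof -
    define v where "v x = (if x \<in> interior K then w x else 0)" for x
    have v: "v \<in> dg_space k \<Omega> T" unfolding v_def[abs_def] by (rule dg_space_element[OF mesh K wk])
    have vw: "v x = w x" if "x \<in> interior K" for x using that by (simp add: v_def)
    have cwK: "continuous_on K w" by (rule continuous_on_subset[OF cw]) simp
    have cPK: "continuous_on K P" "continuous_on K D" by (rule polyP(2), rule polyD(2))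
    have 1: "(LINT x:K|lebesgue. vector_derivative (\<lambda>s. u s x) (at t within I) \<bullet> v x) = (LINT x:K|lebesgue. D x \<bullet> w x)"
      by (rule integrable_K_cong(3)) (simp_all add: ut vw continuous_on_inner[OF cPK(2) cwK])
    have 2: "(LINT x:K|lebesgue. partial_deriv i (\<lambda>y. f i (u t y)) x \<bullet> v x) = (LINT x:K|lebesgue. partial_deriv i (\<lambda>y. f i (P y)) x \<bullet> w x)" for i
    proof (rule integrable_K_cong(3))
      fix x assume x: "x \<in> interior K"
      have "partial_deriv i (\<lambda>y. f i (u t y)) x = partial_deriv i (\<lambda>y. f i (P y)) x"
        by (rule partial_deriv_cong[OF open_interior x]) (simp add: uP)
      then show "partial_deriv i (\<lambda>y. f i (u t y)) x \<bullet> v x = partial_deriv i (\<lambda>y. f i (P y)) x \<bullet> w x" by (simp add: vw[OF x])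
    next
      have "P ` K \<subseteq> \<Omega>'" using PK by blast
      from entropy_flux_divergence(1)[OF open_states smooth1 F continuous_grad P' this]
      show "continuous_on K (\<lambda>x. partial_deriv i (\<lambda>y. f i (P y)) x \<bullet> w x)" by (rule continuous_on_inner[OF _ cwK])
    qed
    have 3: "(LINT x:K|lebesgue. (u t x - cell_average K (u t)) \<bullet> v x) = (LINT x:K|lebesgue. (P x - cell_average K (u t)) \<bullet> w x)"
      by (rule integrable_K_cong(3)) (auto simp: uP vw intro!: continuous_intros cPK cwK)
    have 4: "(LINT x:frontier K|surface_measure. H_jump \<Omega> T f fhat (g t) K (u t) x \<bullet> int_trace K v x)
        = (LINT x:frontier K|surface_measure. H_jump \<Omega> T f fhat (g t) K (u t) x \<bullet> w x)"
    proof -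
      have "int_trace K v x = w x" if "x \<in> frontier K" for x
        by (rule int_trace_eq[OF vw cw]) (use that frontier_subset_K in auto)
      then have "indicator (frontier K) x *\<^sub>R (H_jump \<Omega> T f fhat (g t) K (u t) x \<bullet> int_trace K v x)
          = indicator (frontier K) x *\<^sub>R (H_jump \<Omega> T f fhat (g t) K (u t) x \<bullet> w x)" for x
        by (auto simp: indicator_def)
      then show ?thesis unfolding set_lebesgue_integral_def by (intro Bochner_Integration.integral_cong refl)
    qed
    show ?thesis using sol(6)[OF v] unfolding 1 2 3 4 .
  qed
  have "(LINT x:K|lebesgue. grad U (P x) \<bullet> D x) + (LINT x:frontier K|surface_measure.
       numerical_entropy_flux f U F fhat (int_trace K (u t) x) (ext_trace \<Omega> T (g t) K (u t) x) (outward_normal K x)) \<le> 0"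
  proof (rule element_entropy_inequality[where c = ?c and k = k and P' = P' and \<Omega>' = \<Omega>'
        and H = "H_jump \<Omega> T f fhat (g t) K (u t)" and \<beta> = "damping_coeff C k \<Omega> T f U fhat (g t) K (u t)"])
    show "strict_entropy \<Omega>' U" by (rule SU)
    show "Ck_on 1 \<Omega>' (f i)" for i by (rule smooth1)
    show "F i differentiable (at w) \<and> grad (F i) w = grad U w v* jacobian (f i) (at w)" if "w \<in> \<Omega>'" for i w
      by (rule F[OF that])
    show "entropy_stable_flux \<Omega>' f U F fhat" by (rule stable)
    show "u t x = P x" if "x \<in> interior K" for x by (rule uP[OF that])
    show "(\<lambda>x. P x $ j) \<in> Pk k" "(\<lambda>x. D x $ j) \<in> Pk k" for j by (rule polyP(1), rule polyD(1))
    show "continuous_on UNIV P" "continuous_on UNIV D" by (rule polyP(2), rule polyD(2))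
    show "(P has_derivative P' x) (at x)" for x by (rule P'(1))
    show "continuous_on UNIV (\<lambda>x. P' x v)" for v by (rule P'(2))
    show "state_hull K (u t) \<subseteq> \<Omega>'" by (rule sol(3))
    show "0 < ?c" by (rule c0)
    show "norm (pi_h k K (\<lambda>y. grad U (u t y) - grad U (int_trace K (u t) x)) x)
           \<le> ?c / volume K * third_deriv_max U K (u t) * cell_variance K (u t)" if "x \<in> frontier K" for x
      by (rule bspec[OF est(1) that])
    show "\<bar>LINT x:K|lebesgue. grad U (u t x) \<bullet> (flux_div f (u t) x - pi_h k K (flux_div f (u t)) x)\<bar>
        \<le> ?c / sqrt (volume K) * third_deriv_max U K (u t) * proj_defect k f K (u t) * cell_variance K (u t)"
      by (rule est(2))
    show "AE x in surface_measure. x \<in> frontier K \<longrightarrow> ext_trace \<Omega> T (g t) K (u t) x \<in> \<Omega>'" by (rule sol(4))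
    show "set_integrable surface_measure (frontier K) (H_jump \<Omega> T f fhat (g t) K (u t))" by (rule sol(5))
  qed (fact Fint | rule scheme, assumption+ | simp only: H_jump_def damping_coeff_def)+
  with deriv show "\<exists>D. ((\<lambda>s. LINT x:K|lebesgue. U (u s x)) has_real_derivative D) (at t within I) \<and>
              D + (LINT x:frontier K|surface_measure.
                     numerical_entropy_flux f U F fhat
                       (int_trace K (u t) x) (ext_trace \<Omega> T (g t) K (u t) x) (outward_normal K x)) \<le> 0"
    by blast
qed

end
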